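(* Let either (a) $m\ge3$, $\Gamma_1,\dots,\Gamma_m$ be non-trivial finite groups with symmetric sets of generators $S_1,\dots,S_m$, $\Gamma=\Gamma_1*\cdots*\Gamma_m$, $S=S_1\cup\dots\cup S_m$, and $p\in\mathbb C[\Gamma]$ have support $S$ with $p=p^*$; or (b) $m=2$, $\Gamma=\Gamma_1*\Gamma_2$ with $\Gamma_1,\Gamma_2$ finite groups, $|\Gamma_1|\ge3$, $|\Gamma_2|\ge2$, $S_i=\Gamma_i\setminus\{e\}$, and $p=p_1\mathbf 1_{S_1}+p_2\mathbf 1_{S_2}$ with $p_1,p_2>0$. Let $I_0$ be a compact interval with non-empty interior on which conditions (AC) and (R4) hold for $P=\lambda(p)$. Let $(\rho_N)$ be a sequence of permutation representations $\rho_N:\Gamma\to S_N$ converging in distribution to $\lambda$. Let $I$ be a closed interval (of positive length) contained in the interior of $I_0$, let $(\varphi_\alpha)_{\alpha\in[N]}$ be, for each $N$, an orthonormal eigenbasis of $P_N=\rho_N(p)$, and let $T\subset\Gamma$ be finite. Then for sequences of $T$-local matrices $K_N\in M_N(\mathbb C)$ with $\|K_N\|_{1,\infty}\le1$, quantum ergodicity (QE) and quantum mixing (QM) hold in $I$ provided that one of the following conditions holds: (i) $(K_N)$ is asymptotically uncorrelated; (ii) $(K_N(t.x,x))_{x\in[N]}\in H_N^\perp$ for all $t\in T$, where $H_N\subset\mathbb C^N$ is a certain sequence of vector subspaces with $\dim(H_N)=o(N)$ (that is: there exists such a sequence $(H_N)$, not depending on $(K_N)$, for which the conclusion holds for all such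 $(K_N)$).
   Context: Algebra. $e$ is the unit of $\Gamma$; $|g|$ is the word length of $g\in\Gamma$ for a fixed finite generating set. $\mathbb C[\Gamma]$ is the group algebra of finite sums $p=\sum_g p_g g$, with $p^*=\sum_g\bar p_g g^{-1}$; $\mathbf 1_A=\sum_{g\in A}g$. $\lambda$ is the left regular representation on $\ell^2(\Gamma)$, $\lambda(g)\delta_v=\delta_{gv}$. A permutation representation is a homomorphism $\rho_N:\Gamma\to S_N$; $g.x=\rho_N(g)(x)$ for $x\in[N]=\{1,\dots,N\}$, and $\rho_N(g)$ is identified with the matrix $\rho_N(g)(x,y)=\mathbf 1(x=g.y)$. For a representation $\rho$, $\rho(p)=\sum_g p_g\rho(g)$. Sequences $(\rho_N)$ are indexed by an infinite set of integers $N\to\infty$. $(\rho_N)$ converges in distribution to $\lambda$ if $\frac1N\mathrm{Tr}(\rho_N(g))\to0$ for all $g\in\Gamma\setminus\{e\}$. Scalar products are $\langle f,h\rangle=\sum_x\overline{f(x)}h(x)$. With $R^z=(P-z\,\mathrm{Id})^{-1}$, $\Im R^z=(R^z-(R^z)^* )/(2i)$ and $Q(g,h)=\langle\delta_g,Q\delta_h\rangle$: (AC) on $I_0$: there is $C_0\ge1$ with $C_0^{-1}\le(\Im R^z)(e,e)\le C_0$ for all $z=E+i\eta$, $E\in I_0$, $0<\eta\le1$. (R4) on $I_0$: for some $C_1'>2C_1+1$, $\displaystyle\lim_{\eta\to0}\sup_{\lambda_0\in I_0}\sum_{g\in\Gamma}\eta^2|(\Im R^{\lambda_0+i\eta})(e,g)|^4|g|^{C_1'}=0$.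 Here $C_1$ is a rapid decay exponent of $\Gamma$: a constant $C_1>0$ for which there are $C>0$ and a finite generating set $S'$ such that $\|\lambda(q)\|_{\rm op}\le C(\mathrm{diam}_{S'}(q))^{C_1}(\sum_g|q_g|^2)^{1/2}$ for all $q\in\mathbb C[\Gamma]$, where $\mathrm{diam}_{S'}(q)$ is the maximum of $1$ and the diameter of the support of $q$ in $\mathrm{Cay}(\Gamma,S')$ (edges from $g$ to $sg$, $s\in S'$); such a constant exists for these free products (known fact). Observables. $\|K\|_{1,\infty}=\max_{x,y}|K(x,y)|$. $K_N\in M_N(\mathbb C)$ is $T$-local if $K_N(x,y)=0$ unless $x=g.y$ for some $g\in T$. Its average is $\langle K_N\rangle=\rho_N(k_N)$, $k_N=\sum_{g\in T}k_{N,g}\,g$, $k_{N,g}=\frac1N\sum_{x=1}^N K_N(g.x,x)$. A sequence $a_N\in\mathbb C^N$ is asymptotically uncorrelated if $\lim_{|g|\to\infty}\sigma(g)=0$, where $\sigma(g)=\limsup_{N\to\infty}\bigl|\frac1N\sum_{x\in[N]}\overline{(a_N(x)-\langle a_N\rangle)}(a_N(g.x)-\langle a_N\rangle)\bigr|$ and $\langle a_N\rangle=\frac1N\sum_x a_N(x)$. $(K_N)$ is asymptotically uncorrelated if for every $t\in T$ the sequence $a_N(x)=K_N(t.x,x)$ is. Let $\lambda_\alpha$ be the eigenvalue of $\varphi_\alpha$, $\Lambda_J=\{\alpha:\lambda_\alpha\in J\}$ and $J_E^\eta=[E-\eta,E+\eta]$; averages over an empty index set are $0$. (QE) in $I$: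 $\displaystyle\lim_{N\to\infty}\frac1{|\Lambda_I|}\sum_{\alpha\in\Lambda_I}|\langle\varphi_\alpha,K_N\varphi_\alpha\rangle-\langle\varphi_\alpha,\langle K_N\rangle\varphi_\alpha\rangle|^2=0$. (QM) in $I$: $\displaystyle\lim_{\eta\to0}\limsup_{N\to\infty}\sup_{E_1,E_2}\frac1{|\Lambda_{J_{E_1}^\eta}|}\sum_{\alpha\in\Lambda_{J_{E_1}^\eta}}\sum_{\beta\in\Lambda_{J_{E_2}^\eta}}|\langle\varphi_\beta,K_N\varphi_\alpha\rangle-\langle\varphi_\beta,\langle K_N\rangle\varphi_\alpha\rangle|^2=0$, the supremum being over $E_1,E_2$ in the interior of $I$. *)

theory Defs
  imports
    "HOL-Analysis.Analysis"
    "HOL-Algebra.Sym_Groups"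
    "HOL-Library.Function_Algebras"
    "HOL-Library.Landau_Symbols"
begin

section \<open>Free products of groups\<close>

text \<open>Elements are reduced words: lists of letters \<open>(i, g)\<close> with \<open>g\<close> a non-unit of the
  \<open>i\<close>-th factor, adjacent letters belonging to different factors. The product is concatenation
  followed by reduction.\<close>

definition reduced_words :: "'i set \<Rightarrow> ('i \<Rightarrow> 'a monoid) \<Rightarrow> ('i \<times> 'a) list set" where
  "reduced_words I G =
     {w. (\<forall>(i, g) \<in> set w. i \<in> I \<and> g \<in> carrier (G i) \<and> g \<noteq> \<one>\<^bsub>G i\<^esub>) \<and> distinct_adj (map fst w)}"

fun prepend_letter :: "('i \<Rightarrow> 'a monoid) \<Rightarrow> 'i \<times> 'a \<Rightarrow> ('i \<times> 'a) list \<Rightarrow> ('i \<times> 'a) list" where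
  "prepend_letter G (i, g) [] = [(i, g)]"
| "prepend_letter G (i, g) ((j, h) # w) =
     (if i = j
      then (if g \<otimes>\<^bsub>G i\<^esub> h = \<one>\<^bsub>G i\<^esub> then w else (i, g \<otimes>\<^bsub>G i\<^esub> h) # w)
      else (i, g) # (j, h) # w)"

definition free_product :: "'i set \<Rightarrow> ('i \<Rightarrow> 'a monoid) \<Rightarrow> ('i \<times> 'a) list monoid" where
  "free_product I G =
     \<lparr>carrier = reduced_words I G, mult = (\<lambda>u v. foldr (prepend_letter G) u v), one = []\<rparr>"

definition factor_embedding :: "('i \<Rightarrow> 'a monoid) \<Rightarrow> 'i \<Rightarrow> 'a \<Rightarrow> ('i \<times> 'a) list" where
  "factor_embedding G i g = (if g = \<one>\<^bsub>G i\<^esub> then [] else [(i, g)])"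

context
  fixes I :: "'i set" and G :: "'i \<Rightarrow> 'a monoid"
  assumes grp: "\<And>i. i \<in> I \<Longrightarrow> group (G i)"
begin

lemma reduced_words_Cons:
  "(i, g) # w \<in> reduced_words I G \<longleftrightarrow>
     i \<in> I \<and> g \<in> carrier (G i) \<and> g \<noteq> \<one>\<^bsub>G i\<^esub> \<and> w \<in> reduced_words I G \<and> (w = [] \<or> fst (hd w) \<noteq> i)"
  by (cases w) (auto simp: reduced_words_def)

lemma prepend_letter_closed:
  assumes "i \<in> I" "g \<in> carrier (G i)" "g \<noteq> \<one>\<^bsub>G i\<^esub>" "w \<in> reduced_words I G"
  shows "prepend_letter G (i, g) w \<in> reduced_words I G"
proof (cases w)
  case Nil
  then show ?thesis using assms by (simp add: reduced_words_Cons)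
next
  case (Cons a w')
  obtain j h where a: "a = (j, h)" by (cases a)
  interpret group "G i" using grp assms(1) by blast
  show ?thesis
  proof (cases "j = i")
    case True
    show ?thesis using assms unfolding Cons a True by (auto simp: reduced_words_Cons)
  next
    case False
    then show ?thesis using assms unfolding Cons a by (auto simp: reduced_words_Cons)
  qed
qed

lemma prepend_letter_cancel:
  assumes "i \<in> I" "g \<in> carrier (G i)" "h \<in> carrier (G i)" "h \<noteq> \<one>\<^bsub>G i\<^esub>" "g \<otimes>\<^bsub>G i\<^esub> h = \<one>\<^bsub>G i\<^esub>"
    and "w \<in> reduced_words I G"
  shows "prepend_letter G (i, g) (prepend_letter G (i, h) w) = w"
proof -
  interpret group "G i" using grp assms(1) by blast
  have gh: "g = inv\<^bsub>G i\<^esub> h" using assms by (simp add: inv_equality)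
  show ?thesis
  proof (cases w)
    case Nil
    then show ?thesis using assms by simp
  next
    case (Cons a w')
    obtain j k where a: "a = (j, k)" by (cases a)
    show ?thesis
    proof (cases "j = i")
      case False
      then show ?thesis using assms unfolding Cons a by simp
    next
      case True
      have k: "k \<in> carrier (G i)" "k \<noteq> \<one>\<^bsub>G i\<^esub>" and w': "w' = [] \<or> fst (hd w') \<noteq> i"
        using assms(6) unfolding Cons a True by (auto simp: reduced_words_Cons)
      show ?thesis
      proof (cases "h \<otimes>\<^bsub>G i\<^esub> k = \<one>\<^bsub>G i\<^esub>")
        case hk: True
        have "k = g" unfolding gh using hk assms k by (metis inv_comm inv_equality)
        then show ?thesis unfolding Cons a True using hk w' by (cases w') auto
      next
        case hk: False
        have "g \<otimes>\<^bsub>G i\<^esub> (h \<otimes>\<^bsub>G i\<^esub> k) = k"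
          using assms k by (simp add: m_assoc[symmetric])
        then show ?thesis unfolding Cons a True using hk k by simp
      qed
    qed
  qed
qed

lemma prepend_letter_merge:
  assumes "i \<in> I" "g \<in> carrier (G i)" "h \<in> carrier (G i)" "g \<noteq> \<one>\<^bsub>G i\<^esub>" "h \<noteq> \<one>\<^bsub>G i\<^esub>"
    and "g \<otimes>\<^bsub>G i\<^esub> h \<noteq> \<one>\<^bsub>G i\<^esub>" and "w \<in> reduced_words I G"
  shows "prepend_letter G (i, g) (prepend_letter G (i, h) w) = prepend_letter G (i, g \<otimes>\<^bsub>G i\<^esub> h) w"
proof -
  interpret group "G i" using grp assms(1) by blast
  show ?thesis
  proof (cases w)
    case Nil
    then show ?thesis using assms by simp
  next
    case (Cons a w')
    obtain j k where a: "a = (j, k)" by (cases a)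
    show ?thesis
    proof (cases "j = i")
      case False
      then show ?thesis using assms unfolding Cons a by simp
    next
      case True
      have k: "k \<in> carrier (G i)" "k \<noteq> \<one>\<^bsub>G i\<^esub>" and w': "w' = [] \<or> fst (hd w') \<noteq> i"
        using assms(7) unfolding Cons a True by (auto simp: reduced_words_Cons)
      have assoc: "g \<otimes>\<^bsub>G i\<^esub> h \<otimes>\<^bsub>G i\<^esub> k = g \<otimes>\<^bsub>G i\<^esub> (h \<otimes>\<^bsub>G i\<^esub> k)"
        using assms k by (simp add: m_assoc)
      show ?thesis
      proof (cases "h \<otimes>\<^bsub>G i\<^esub> k = \<one>\<^bsub>G i\<^esub>")
        case hk: True
        then show ?thesis unfolding Cons a True using assoc w' assms by (cases w') auto
      next
        case hk: False
        then show ?thesis unfolding Cons a True using assoc by simp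
      qed
    qed
  qed
qed

lemma foldr_prepend_closed:
  assumes "u \<in> reduced_words I G" "v \<in> reduced_words I G"
  shows "foldr (prepend_letter G) u v \<in> reduced_words I G"
  using assms(1)
proof (induction u)
  case Nil
  then show ?case using assms(2) by simp
next
  case (Cons a u)
  then show ?case by (cases a) (auto simp: reduced_words_Cons prepend_letter_closed)
qed

lemma foldr_prepend_letter:
  assumes "i \<in> I" "g \<in> carrier (G i)" "g \<noteq> \<one>\<^bsub>G i\<^esub>" "v \<in> reduced_words I G" "w \<in> reduced_words I G"
  shows "foldr (prepend_letter G) (prepend_letter G (i, g) v) w =
         prepend_letter G (i, g) (foldr (prepend_letter G) v w)"
proof (cases v)
  case Nil
  then show ?thesis by simp
next
  case (Cons a v')
  obtain j h where a: "a = (j, h)" by (cases a)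
  show ?thesis
  proof (cases "j = i")
    case False
    then show ?thesis unfolding Cons a by simp
  next
    case True
    have *: "h \<in> carrier (G i)" "h \<noteq> \<one>\<^bsub>G i\<^esub>" "foldr (prepend_letter G) v' w \<in> reduced_words I G"
      using assms unfolding Cons a True by (auto simp: reduced_words_Cons foldr_prepend_closed)
    show ?thesis
      unfolding Cons a True
      using assms * by (auto simp: prepend_letter_cancel prepend_letter_merge)
  qed
qed

lemma free_product_group: "group (free_product I G)"
proof (rule groupI)
  fix x y z
  assume "x \<in> carrier (free_product I G)" "y \<in> carrier (free_product I G)"
    "z \<in> carrier (free_product I G)"
  then have xyz: "x \<in> reduced_words I G" "y \<in> reduced_words I G" "z \<in> reduced_words I G"
    by (auto simp: free_product_def)
  have "foldr (prepend_letter G) (foldr (prepend_letter G) x y) z =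
        foldr (prepend_letter G) x (foldr (prepend_letter G) y z)"
    using xyz(1)
  proof (induction x)
    case Nil
    then show ?case by simp
  next
    case (Cons a x)
    then show ?case
      using xyz by (cases a) (auto simp: reduced_words_Cons foldr_prepend_letter foldr_prepend_closed)
  qed
  then show "x \<otimes>\<^bsub>free_product I G\<^esub> y \<otimes>\<^bsub>free_product I G\<^esub> z =
      x \<otimes>\<^bsub>free_product I G\<^esub> (y \<otimes>\<^bsub>free_product I G\<^esub> z)"
    by (simp add: free_product_def)
next
  fix x assume "x \<in> carrier (free_product I G)"
  then have x: "x \<in> reduced_words I G" by (simp add: free_product_def)
  define y where "y = rev (map (\<lambda>(i, g). (i, inv\<^bsub>G i\<^esub> g)) x)"
  have fst_y: "map fst y = rev (map fst x)"
    unfolding y_def by (simp add: rev_map comp_def case_prod_unfold)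
  have "y \<in> reduced_words I G"
  proof -
    have "i \<in> I \<and> g \<in> carrier (G i) \<and> g \<noteq> \<one>\<^bsub>G i\<^esub>" if y: "(i, g) \<in> set y" for i g
    proof -
      obtain h where h: "(i, h) \<in> set x" "g = inv\<^bsub>G i\<^esub> h" using y unfolding y_def by auto
      then have i: "i \<in> I" "h \<in> carrier (G i)" "h \<noteq> \<one>\<^bsub>G i\<^esub>" using x by (auto simp: reduced_words_def)
      interpret group "G i" using grp i by blast
      show ?thesis using i h by simp
    qed
    moreover have "distinct_adj (map fst y)" using x unfolding fst_y by (simp add: reduced_words_def)
    ultimately show ?thesis unfolding reduced_words_def by auto
  qed
  moreover have "foldr (prepend_letter G) y x = []"
    using x unfolding y_def
  proof (induction x)
    case Nil
    then show ?case by simp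
  next
    case (Cons a x)
    obtain i g where a: "a = (i, g)" by (cases a)
    have i: "i \<in> I" "g \<in> carrier (G i)" "x \<in> reduced_words I G" using Cons.prems by (auto simp: a reduced_words_Cons)
    interpret group "G i" using grp i by blast
    show ?case using Cons.IH i by (simp add: a)
  qed
  ultimately show "\<exists>y\<in>carrier (free_product I G). y \<otimes>\<^bsub>free_product I G\<^esub> x = \<one>\<^bsub>free_product I G\<^esub>"
    by (auto simp: free_product_def)
qed (auto simp: free_product_def foldr_prepend_closed, auto simp: reduced_words_def)

lemma factor_embedding_hom:
  assumes "i \<in> I"
  shows "factor_embedding G i \<in> hom (G i) (free_product I G)"
proof -
  interpret group "G i" using grp assms by blast
  show ?thesis
    using assms by (auto simp: hom_def factor_embedding_def free_product_def reduced_words_def)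
qed

end


section \<open>Word lengths and the Cayley graph\<close>

definition finite_generating_set :: "('g, 'b) monoid_scheme \<Rightarrow> 'g set \<Rightarrow> bool" where
  "finite_generating_set G F \<longleftrightarrow> finite F \<and> F \<subseteq> carrier G \<and> generate G F = carrier G"

definition word_length :: "('g, 'b) monoid_scheme \<Rightarrow> 'g set \<Rightarrow> 'g \<Rightarrow> nat" where
  "word_length G F g =
     (LEAST n. \<exists>ws. length ws = n \<and> set ws \<subseteq> F \<union> m_inv G ` F \<and> foldr (mult G) ws \<one>\<^bsub>G\<^esub> = g)"

text \<open>The edges join \<open>g\<close> to \<open>s g\<close> and are undirected.\<close>

definition cayley_edges :: "('g, 'b) monoid_scheme \<Rightarrow> 'g set \<Rightarrow> 'g rel" where
  "cayley_edges G F =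
     {(g, s \<otimes>\<^bsub>G\<^esub> g) | g s. g \<in> carrier G \<and> s \<in> F} \<union> {(s \<otimes>\<^bsub>G\<^esub> g, g) | g s. g \<in> carrier G \<and> s \<in> F}"

definition cayley_dist :: "('g, 'b) monoid_scheme \<Rightarrow> 'g set \<Rightarrow> 'g \<Rightarrow> 'g \<Rightarrow> nat" where
  "cayley_dist G F g h = (LEAST n. (g, h) \<in> cayley_edges G F ^^ n)"


section \<open>The group algebra\<close>

definition supp :: "('g \<Rightarrow> complex) \<Rightarrow> 'g set" where
  "supp q = {g. q g \<noteq> 0}"

definition group_algebra :: "('g, 'b) monoid_scheme \<Rightarrow> ('g \<Rightarrow> complex) set" where
  "group_algebra G = {q. finite (supp q) \<and> supp q \<subseteq> carrier G}"

definition star :: "('g, 'b) monoid_scheme \<Rightarrow> ('g \<Rightarrow> complex) \<Rightarrow> 'g \<Rightarrow> complex" where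
  "star G q = (\<lambda>g. if g \<in> carrier G then cnj (q (inv\<^bsub>G\<^esub> g)) else 0)"

definition support_diam :: "('g, 'b) monoid_scheme \<Rightarrow> 'g set \<Rightarrow> ('g \<Rightarrow> complex) \<Rightarrow> nat" where
  "support_diam G F q = Max (insert 1 {cayley_dist G F g h | g h. g \<in> supp q \<and> h \<in> supp q})"


section \<open>The left regular representation\<close>

text \<open>\<open>\<ell>\<^sup>2(\<Gamma>)\<close> is realised as a set of functions vanishing outside the carrier.\<close>

definition ell2 :: "('g, 'b) monoid_scheme \<Rightarrow> ('g \<Rightarrow> complex) set" where
  "ell2 G = {u. (\<forall>x. x \<notin> carrier G \<longrightarrow> u x = 0) \<and> (\<lambda>x. (cmod (u x))\<^sup>2) summable_on carrier G}"

definition ell2_inner :: "('g, 'b) monoid_scheme \<Rightarrow> ('g \<Rightarrow> complex) \<Rightarrow> ('g \<Rightarrow> complex) \<Rightarrow> complex" where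
  "ell2_inner G u v = (\<Sum>\<^sub>\<infinity>x\<in>carrier G. cnj (u x) * v x)"

definition ell2_norm :: "('g, 'b) monoid_scheme \<Rightarrow> ('g \<Rightarrow> complex) \<Rightarrow> real" where
  "ell2_norm G u = sqrt (\<Sum>\<^sub>\<infinity>x\<in>carrier G. (cmod (u x))\<^sup>2)"

definition ell2_opnorm :: "('g, 'b) monoid_scheme \<Rightarrow> (('g \<Rightarrow> complex) \<Rightarrow> 'g \<Rightarrow> complex) \<Rightarrow> real" where
  "ell2_opnorm G A = (SUP u \<in> {u \<in> ell2 G. ell2_norm G u \<le> 1}. ell2_norm G (A u))"

definition ell2_delta :: "'g \<Rightarrow> 'g \<Rightarrow> complex" where
  "ell2_delta v = (\<lambda>x. if x = v then 1 else 0)"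

definition left_translation :: "('g, 'b) monoid_scheme \<Rightarrow> 'g \<Rightarrow> ('g \<Rightarrow> complex) \<Rightarrow> 'g \<Rightarrow> complex" where
  "left_translation G g u = (\<lambda>x. if x \<in> carrier G then u (inv\<^bsub>G\<^esub> g \<otimes>\<^bsub>G\<^esub> x) else 0)"

lemma left_translation_delta:
  assumes "group G" "g \<in> carrier G" "v \<in> carrier G"
  shows "left_translation G g (ell2_delta v) = ell2_delta (g \<otimes>\<^bsub>G\<^esub> v)"
proof -
  interpret group G by fact
  show ?thesis
    using assms by (auto simp: left_translation_def ell2_delta_def fun_eq_iff m_assoc[symmetric]
      inv_solve_left')
qed

definition left_regular ::
    "('g, 'b) monoid_scheme \<Rightarrow> ('g \<Rightarrow> complex) \<Rightarrow> ('g \<Rightarrow> complex) \<Rightarrow> 'g \<Rightarrow> complex" where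
  "left_regular G q u = (\<lambda>x. \<Sum>g\<in>supp q. q g * left_translation G g u x)"

definition resolvent ::
    "('g, 'b) monoid_scheme \<Rightarrow> ('g \<Rightarrow> complex) \<Rightarrow> complex \<Rightarrow> ('g \<Rightarrow> complex) \<Rightarrow> 'g \<Rightarrow> complex" where
  "resolvent G p z = the_inv_into (ell2 G) (\<lambda>u x. left_regular G p u x - z * u x)"

text \<open>The kernel \<open>\<langle>\<delta>\<^sub>g, Im R \<delta>\<^sub>h\<rangle>\<close> of \<open>Im R = (R - R\<^sup>*) / 2i\<close>, where
  \<open>\<langle>\<delta>\<^sub>g, R\<^sup>* \<delta>\<^sub>h\<rangle> = \<langle>R \<delta>\<^sub>g, \<delta>\<^sub>h\<rangle>\<close>.\<close>

definition Im_resolvent ::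
    "('g, 'b) monoid_scheme \<Rightarrow> ('g \<Rightarrow> complex) \<Rightarrow> complex \<Rightarrow> 'g \<Rightarrow> 'g \<Rightarrow> complex" where
  "Im_resolvent G p z g h =
     (ell2_inner G (ell2_delta g) (resolvent G p z (ell2_delta h))
      - ell2_inner G (resolvent G p z (ell2_delta g)) (ell2_delta h)) / (2 * \<i>)"

text \<open>The diagonal entries of \<open>Im R\<close> are real; \<open>Re\<close> only changes the type.\<close>

definition cond_AC :: "('g, 'b) monoid_scheme \<Rightarrow> ('g \<Rightarrow> complex) \<Rightarrow> real set \<Rightarrow> bool" where
  "cond_AC G p I\<^sub>0 \<longleftrightarrow>
     (\<exists>C\<^sub>0\<ge>1. \<forall>E\<in>I\<^sub>0. \<forall>\<eta>. 0 < \<eta> \<and> \<eta> \<le> 1 \<longrightarrow>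
        inverse C\<^sub>0 \<le> Re (Im_resolvent G p (Complex E \<eta>) \<one>\<^bsub>G\<^esub> \<one>\<^bsub>G\<^esub>) \<and>
        Re (Im_resolvent G p (Complex E \<eta>) \<one>\<^bsub>G\<^esub> \<one>\<^bsub>G\<^esub>) \<le> C\<^sub>0)"

definition rapid_decay_exponent :: "('g, 'b) monoid_scheme \<Rightarrow> real \<Rightarrow> bool" where
  "rapid_decay_exponent G C\<^sub>1 \<longleftrightarrow> C\<^sub>1 > 0 \<and>
     (\<exists>C>0. \<exists>F. finite_generating_set G F \<and>
        (\<forall>q\<in>group_algebra G.
           ell2_opnorm G (left_regular G q)
             \<le> C * real (support_diam G F q) powr C\<^sub>1 * sqrt (\<Sum>g\<in>supp q. (cmod (q g))\<^sup>2)))"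

text \<open>Sum and supremum are taken in \<open>[0,\<infinity>]\<close>. The argument \<open>F\<close> is the generating set that
  defines the word length.\<close>

definition cond_R4 ::
    "('g, 'b) monoid_scheme \<Rightarrow> 'g set \<Rightarrow> ('g \<Rightarrow> complex) \<Rightarrow> real set \<Rightarrow> bool" where
  "cond_R4 G F p I\<^sub>0 \<longleftrightarrow>
     (\<exists>C\<^sub>1 C\<^sub>1'. rapid_decay_exponent G C\<^sub>1 \<and> C\<^sub>1' > 2 * C\<^sub>1 + 1 \<and>
        ((\<lambda>\<eta>. SUP E\<in>I\<^sub>0. \<Sum>\<^sub>\<infinity>g\<in>carrier G.
            ennreal (\<eta>\<^sup>2 * cmod (Im_resolvent G p (Complex E \<eta>) \<one>\<^bsub>G\<^esub> g) ^ 4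
                     * real (word_length G F g) powr C\<^sub>1'))
          \<longlongrightarrow> 0) (at_right 0))"


section \<open>Finite-dimensional linear algebra\<close>

text \<open>Vectors in \<open>\<complex>\<^sup>N\<close> and \<open>N \<times> N\<close> matrices are functions on \<open>nat\<close>, of which only the values at
  indices in \<open>{1..N}\<close> are used.\<close>

definition cinner :: "nat \<Rightarrow> (nat \<Rightarrow> complex) \<Rightarrow> (nat \<Rightarrow> complex) \<Rightarrow> complex" where
  "cinner N f h = (\<Sum>x\<in>{1..N}. cnj (f x) * h x)"

definition mat_vec :: "nat \<Rightarrow> (nat \<Rightarrow> nat \<Rightarrow> complex) \<Rightarrow> (nat \<Rightarrow> complex) \<Rightarrow> nat \<Rightarrow> complex" where
  "mat_vec N M v = (\<lambda>x. \<Sum>y\<in>{1..N}. M x y * v y)"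

definition mat_trace :: "nat \<Rightarrow> (nat \<Rightarrow> nat \<Rightarrow> complex) \<Rightarrow> complex" where
  "mat_trace N M = (\<Sum>x\<in>{1..N}. M x x)"

definition mat_norm_1_inf :: "nat \<Rightarrow> (nat \<Rightarrow> nat \<Rightarrow> complex) \<Rightarrow> real" where
  "mat_norm_1_inf N K = Max {cmod (K x y) | x y. x \<in> {1..N} \<and> y \<in> {1..N}}"

definition vec_scale :: "complex \<Rightarrow> (nat \<Rightarrow> complex) \<Rightarrow> nat \<Rightarrow> complex" where
  "vec_scale c v = (\<lambda>x. c * v x)"

lemma vector_space_vec_scale: "vector_space vec_scale"
  by unfold_locales (auto simp: vec_scale_def fun_eq_iff algebra_simps)

text \<open>For subspaces, \<open>\<complex>\<^sup>N\<close> is identified with the functions vanishing outside \<open>{1..N}\<close>.\<close>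

definition is_subspace :: "nat \<Rightarrow> (nat \<Rightarrow> complex) set \<Rightarrow> bool" where
  "is_subspace N H \<longleftrightarrow> module.subspace vec_scale H \<and> (\<forall>v\<in>H. \<forall>x. x \<notin> {1..N} \<longrightarrow> v x = 0)"

definition vec_dim :: "(nat \<Rightarrow> complex) set \<Rightarrow> nat" where
  "vec_dim = vector_space.dim vec_scale"

definition orthonormal_eigenbasis ::
    "nat \<Rightarrow> (nat \<Rightarrow> nat \<Rightarrow> complex) \<Rightarrow> (nat \<Rightarrow> nat \<Rightarrow> complex) \<Rightarrow> (nat \<Rightarrow> real) \<Rightarrow> bool" where
  "orthonormal_eigenbasis N M \<phi> ev \<longleftrightarrow>
     (\<forall>\<alpha>\<in>{1..N}. \<forall>\<beta>\<in>{1..N}. cinner N (\<phi> \<alpha>) (\<phi> \<beta>) = (if \<alpha> = \<beta> then 1 else 0)) \<and>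
     (\<forall>\<alpha>\<in>{1..N}. \<forall>x\<in>{1..N}. mat_vec N M (\<phi> \<alpha>) x = complex_of_real (ev \<alpha>) * \<phi> \<alpha> x)"


section \<open>Permutation representations\<close>

text \<open>A sequence indexed by a set \<open>\<N>\<close> of integers is a function on \<open>nat\<close> used on \<open>\<N>\<close> only;
  limits are taken along the following filter.\<close>

definition along :: "nat set \<Rightarrow> nat filter" where
  "along \<N> = inf sequentially (principal \<N>)"

definition perm_mat :: "(nat \<Rightarrow> nat) \<Rightarrow> nat \<Rightarrow> nat \<Rightarrow> complex" where
  "perm_mat \<pi> x y = (if x = \<pi> y then 1 else 0)"

definition rep_mat :: "('g \<Rightarrow> nat \<Rightarrow> nat) \<Rightarrow> ('g \<Rightarrow> complex) \<Rightarrow> nat \<Rightarrow> nat \<Rightarrow> complex" where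
  "rep_mat \<rho> q x y = (\<Sum>g\<in>supp q. q g * perm_mat (\<rho> g) x y)"

definition converges_in_distribution ::
    "('g, 'b) monoid_scheme \<Rightarrow> nat set \<Rightarrow> (nat \<Rightarrow> 'g \<Rightarrow> nat \<Rightarrow> nat) \<Rightarrow> bool" where
  "converges_in_distribution G \<N> \<rho> \<longleftrightarrow>
     (\<forall>g\<in>carrier G - {\<one>\<^bsub>G\<^esub>}. ((\<lambda>N. mat_trace N (perm_mat (\<rho> N g)) / of_nat N) \<longlongrightarrow> 0) (along \<N>))"


section \<open>Observables\<close>

definition T_local ::
    "nat \<Rightarrow> ('g \<Rightarrow> nat \<Rightarrow> nat) \<Rightarrow> 'g set \<Rightarrow> (nat \<Rightarrow> nat \<Rightarrow> complex) \<Rightarrow> bool" where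
  "T_local N \<rho> T K \<longleftrightarrow>
     (\<forall>x\<in>{1..N}. \<forall>y\<in>{1..N}. (\<nexists>g. g \<in> T \<and> x = \<rho> g y) \<longrightarrow> K x y = 0)"

definition avg_coeff ::
    "nat \<Rightarrow> ('g \<Rightarrow> nat \<Rightarrow> nat) \<Rightarrow> 'g set \<Rightarrow> (nat \<Rightarrow> nat \<Rightarrow> complex) \<Rightarrow> 'g \<Rightarrow> complex" where
  "avg_coeff N \<rho> T K = (\<lambda>g. if g \<in> T then (\<Sum>x\<in>{1..N}. K (\<rho> g x) x) / of_nat N else 0)"

definition avg_mat ::
    "nat \<Rightarrow> ('g \<Rightarrow> nat \<Rightarrow> nat) \<Rightarrow> 'g set \<Rightarrow> (nat \<Rightarrow> nat \<Rightarrow> complex) \<Rightarrow> nat \<Rightarrow> nat \<Rightarrow> complex" where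
  "avg_mat N \<rho> T K = rep_mat \<rho> (avg_coeff N \<rho> T K)"

definition vec_mean :: "nat \<Rightarrow> (nat \<Rightarrow> complex) \<Rightarrow> complex" where
  "vec_mean N a = (\<Sum>x\<in>{1..N}. a x) / of_nat N"

definition correlation ::
    "nat set \<Rightarrow> (nat \<Rightarrow> 'g \<Rightarrow> nat \<Rightarrow> nat) \<Rightarrow> (nat \<Rightarrow> nat \<Rightarrow> complex) \<Rightarrow> 'g \<Rightarrow> ennreal" where
  "correlation \<N> \<rho> a g =
     Limsup (along \<N>) (\<lambda>N. ennreal (cmod
       ((\<Sum>x\<in>{1..N}. cnj (a N x - vec_mean N (a N)) * (a N (\<rho> N g x) - vec_mean N (a N))) / of_nat N)))"

text \<open>The filter expresses \<open>|g| \<rightarrow> \<infinity>\<close> in the group.\<close>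

definition asymptotically_uncorrelated ::
    "('g, 'b) monoid_scheme \<Rightarrow> 'g set \<Rightarrow> nat set \<Rightarrow> (nat \<Rightarrow> 'g \<Rightarrow> nat \<Rightarrow> nat) \<Rightarrow>
     (nat \<Rightarrow> nat \<Rightarrow> complex) \<Rightarrow> bool" where
  "asymptotically_uncorrelated G F \<N> \<rho> a \<longleftrightarrow>
     (correlation \<N> \<rho> a \<longlongrightarrow> 0) (inf (filtercomap (word_length G F) at_top) (principal (carrier G)))"

definition asymptotically_uncorrelated_mat ::
    "('g, 'b) monoid_scheme \<Rightarrow> 'g set \<Rightarrow> nat set \<Rightarrow> (nat \<Rightarrow> 'g \<Rightarrow> nat \<Rightarrow> nat) \<Rightarrow> 'g set \<Rightarrow>
     (nat \<Rightarrow> nat \<Rightarrow> nat \<Rightarrow> complex) \<Rightarrow> bool" where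
  "asymptotically_uncorrelated_mat G F \<N> \<rho> T K \<longleftrightarrow>
     (\<forall>t\<in>T. asymptotically_uncorrelated G F \<N> \<rho> (\<lambda>N x. K N (\<rho> N t x) x))"


section \<open>Quantum ergodicity and quantum mixing\<close>

text \<open>In the following, \<open>\<phi> N \<alpha>\<close> is the \<open>\<alpha>\<close>-th eigenvector and \<open>ev N \<alpha>\<close> its eigenvalue; \<open>K N\<close> is
  the observable and \<open>A N\<close> its average. Empty averages are \<open>0 / 0 = 0\<close>.\<close>

definition spectral_window :: "nat \<Rightarrow> (nat \<Rightarrow> real) \<Rightarrow> real set \<Rightarrow> nat set" where
  "spectral_window N ev J = {\<alpha>\<in>{1..N}. ev \<alpha> \<in> J}"

definition deviation ::
    "nat \<Rightarrow> (nat \<Rightarrow> nat \<Rightarrow> complex) \<Rightarrow> (nat \<Rightarrow> nat \<Rightarrow> complex) \<Rightarrow> (nat \<Rightarrow> complex) \<Rightarrow> (nat \<Rightarrow> complex) \<Rightarrow> real"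
  where
  "deviation N K A f h = (cmod (cinner N f (mat_vec N K h) - cinner N f (mat_vec N A h)))\<^sup>2"

definition quantum_ergodic ::
    "nat set \<Rightarrow> (nat \<Rightarrow> nat \<Rightarrow> nat \<Rightarrow> complex) \<Rightarrow> (nat \<Rightarrow> nat \<Rightarrow> real) \<Rightarrow> real set \<Rightarrow>
     (nat \<Rightarrow> nat \<Rightarrow> nat \<Rightarrow> complex) \<Rightarrow> (nat \<Rightarrow> nat \<Rightarrow> nat \<Rightarrow> complex) \<Rightarrow> bool" where
  "quantum_ergodic \<N> \<phi> ev I K A \<longleftrightarrow>
     ((\<lambda>N. (\<Sum>\<alpha>\<in>spectral_window N (ev N) I. deviation N (K N) (A N) (\<phi> N \<alpha>) (\<phi> N \<alpha>))
           / real (card (spectral_window N (ev N) I))) \<longlongrightarrow> 0) (along \<N>)"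

definition quantum_mixing ::
    "nat set \<Rightarrow> (nat \<Rightarrow> nat \<Rightarrow> nat \<Rightarrow> complex) \<Rightarrow> (nat \<Rightarrow> nat \<Rightarrow> real) \<Rightarrow> real set \<Rightarrow>
     (nat \<Rightarrow> nat \<Rightarrow> nat \<Rightarrow> complex) \<Rightarrow> (nat \<Rightarrow> nat \<Rightarrow> nat \<Rightarrow> complex) \<Rightarrow> bool" where
  "quantum_mixing \<N> \<phi> ev I K A \<longleftrightarrow>
     ((\<lambda>\<eta>. Limsup (along \<N>) (\<lambda>N. SUP (E\<^sub>1, E\<^sub>2) \<in> interior I \<times> interior I. ennreal
         ((\<Sum>\<alpha>\<in>spectral_window N (ev N) {E\<^sub>1 - \<eta>..E\<^sub>1 + \<eta>}.
            \<Sum>\<beta>\<in>spectral_window N (ev N) {E\<^sub>2 - \<eta>..E\<^sub>2 + \<eta>}.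
              deviation N (K N) (A N) (\<phi> N \<beta>) (\<phi> N \<alpha>))
          / real (card (spectral_window N (ev N) {E\<^sub>1 - \<eta>..E\<^sub>1 + \<eta>})))))
       \<longlongrightarrow> 0) (at_right 0)"

definition QE_and_QM ::
    "nat set \<Rightarrow> (nat \<Rightarrow> 'g \<Rightarrow> nat \<Rightarrow> nat) \<Rightarrow> 'g set \<Rightarrow> (nat \<Rightarrow> nat \<Rightarrow> nat \<Rightarrow> complex) \<Rightarrow>
     (nat \<Rightarrow> nat \<Rightarrow> real) \<Rightarrow> real set \<Rightarrow> (nat \<Rightarrow> nat \<Rightarrow> nat \<Rightarrow> complex) \<Rightarrow> bool" where
  "QE_and_QM \<N> \<rho> T \<phi> ev I K \<longleftrightarrow>
     quantum_ergodic \<N> \<phi> ev I K (\<lambda>N. avg_mat N (\<rho> N) T (K N)) \<and>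
     quantum_mixing \<N> \<phi> ev I K (\<lambda>N. avg_mat N (\<rho> N) T (K N))"


section \<open>The two families of free products\<close>

definition symmetric_generators :: "('g, 'b) monoid_scheme \<Rightarrow> 'g set \<Rightarrow> bool" where
  "symmetric_generators G S \<longleftrightarrow>
     S \<subseteq> carrier G \<and> generate G S = carrier G \<and> (\<forall>s\<in>S. inv\<^bsub>G\<^esub> s \<in> S)"

definition setting_a ::
    "nat \<Rightarrow> (nat \<Rightarrow> 'a monoid) \<Rightarrow> (nat \<Rightarrow> 'a set) \<Rightarrow> ((nat \<times> 'a) list \<Rightarrow> complex) \<Rightarrow> bool" where
  "setting_a m G S p \<longleftrightarrow>
     m \<ge> 3 \<and>
     (\<forall>i\<in>{1..m}. group (G i) \<and> finite (carrier (G i)) \<and> carrier (G i) \<noteq> {\<one>\<^bsub>G i\<^esub>} \<and>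
                 symmetric_generators (G i) (S i)) \<and>
     p \<in> group_algebra (free_product {1..m} G) \<and>
     supp p = (\<Union>i\<in>{1..m}. factor_embedding G i ` S i) \<and>
     p = star (free_product {1..m} G) p"

definition setting_b ::
    "nat \<Rightarrow> (nat \<Rightarrow> 'a monoid) \<Rightarrow> (nat \<Rightarrow> 'a set) \<Rightarrow> ((nat \<times> 'a) list \<Rightarrow> complex) \<Rightarrow> bool" where
  "setting_b m G S p \<longleftrightarrow>
     m = 2 \<and>
     (\<forall>i\<in>{1..2}. group (G i) \<and> finite (carrier (G i)) \<and> S i = carrier (G i) - {\<one>\<^bsub>G i\<^esub>}) \<and>
     card (carrier (G 1)) \<ge> 3 \<and> card (carrier (G 2)) \<ge> 2 \<and>
     (\<exists>p\<^sub>1 p\<^sub>2 :: real. p\<^sub>1 > 0 \<and> p\<^sub>2 > 0 \<and>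
        p = (\<lambda>g. of_real p\<^sub>1 * indicator (factor_embedding G 1 ` S 1) g
               + of_real p\<^sub>2 * indicator (factor_embedding G 2 ` S 2) g))"

end

theory Submission
  imports Defs
begin

text \<open>Let \<open>P = \<lambda>(p)\<close>, \<open>P\<^sub>N = \<rho>\<^sub>N(p)\<close> and \<open>A\<^sub>E = Im (P - E - i\<eta>)\<^sup>-\<^sup>1\<close>. After subtraction of its average an
  observable is a sum over \<open>t \<in> T\<close> of products \<open>\<rho>\<^sub>N(t) D\<^sub>a\<close> with \<open>D\<^sub>a\<close> the diagonal matrix of the function
  \<open>a(x) = K\<^sub>N(t.x, x)\<close>, centred, up to a bounded matrix with \<open>o(N)\<close> non-zero entries. Since the indicator of a window of
  half-width \<open>\<eta>\<close> is at most \<open>2\<eta>\<close> times the Poisson kernel, the sum of the squared matrix elements over two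
  windows is at most \<open>4\<eta>\<^sup>2 Tr(A\<^sub>2 \<rho>\<^sub>N(t) D\<^sub>a A\<^sub>1 D\<^sub>a\<^sup>* \<rho>\<^sub>N(t)\<^sup>*)\<close>, with \<open>A\<^sub>i\<close> evaluated at \<open>P\<^sub>N\<close>. It has to be
  \<open>o(\<eta>) N\<close>, as the windows contain at least \<open>c \<eta> N\<close> eigenvalues: by (AC), the normalised traces of the
  Poisson kernels converge to quantities bounded above and below
  (\<open>poisson_asymptotic\<close>, \<open>window_count\<close>).

  The passage between \<open>P\<^sub>N\<close> and \<open>P\<close> uses one explicit polynomial approximation of the Poisson kernel:
  \<open>((P - E)\<^sup>2 + \<eta>\<^sup>2)\<^sup>-\<^sup>1\<close> is expanded in a Neumann series around the scalar \<open>c + \<eta>\<^sup>2\<close>, where \<open>c\<close> bounds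
  \<open>(P - E)\<^sup>2\<close>. Its partial sums lie in the group algebra, converge in \<open>\<ell>\<^sup>2(\<Gamma>)\<close> to the Green function
  (\<open>green_limit\<close>, \<open>green_function\<close>) and act on the eigenvectors of \<open>P\<^sub>N\<close> by geometric sums
  (\<open>rep_green\<close>). Convergence in distribution evaluates the trace: only the terms of the form
  \<open>\<langle>a, \<rho>\<^sub>N(k) a\<rangle>\<close> survive, and the trace becomes \<open>\<langle>a, \<rho>\<^sub>N(w) a\<rangle> + o(N)\<close> for a self-adjoint \<open>w\<close> in the group
  algebra with \<open>|w(k)| \<le> |A\<^sub>2(e, t k t\<^sup>-\<^sup>1)| |A\<^sub>1(e, k)|\<close> (\<open>energy_symbol_exists\<close>).

  It remains to see that \<open>\<langle>a, \<rho>\<^sub>N(w) a\<rangle> = o(1/\<eta>) N\<close>. The entries of \<open>A\<close> are bounded and the sum of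
  their squares is \<open>O(1/\<eta>)\<close> by the resolvent identity, so the sum of \<open>|w|\<close> is \<open>O(1/\<eta>)\<close>. For uncorrelated observables the long
  \<open>k\<close> have a small correlation and the short ones contribute \<open>O(1)\<close> (\<open>uncorrelated_energy\<close>). In the
  second case (R4) and rapid decay give \<open>\<parallel>\<lambda>(w)\<parallel> = o(1/\<eta>)\<close> (\<open>opnorm_small\<close>). Convergence in distribution
  does not bound the norm of \<open>\<rho>\<^sub>N(w)\<close>, but it bounds its moments, so that \<open>\<rho>\<^sub>N(w)\<close> exceeds \<open>2 \<parallel>\<lambda>(w)\<parallel>\<close>
  only on \<open>o(N)\<close> directions (\<open>few_bad_directions\<close>). These directions, for finitely many
  energies at each of countably many scales, span the exceptional spaces
  (\<open>exceptional_subspaces\<close>).\<close>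

section \<open>Square-summable functions on a group\<close>

context group
begin

text \<open>The product of the group algebra is the left regular representation applied to a finitely
  supported function, so a single operation serves as both.\<close>

abbreviation conv (infixr "\<star>" 75) where "q \<star> u \<equiv> left_regular G q u"
abbreviation nrm ("\<parallel>_\<parallel>") where "\<parallel>u\<parallel> \<equiv> ell2_norm G u"
abbreviation inn ("\<langle>_, _\<rangle>") where "\<langle>u, v\<rangle> \<equiv> ell2_inner G u v"

lemma ell2_outside: "u \<in> ell2 G \<Longrightarrow> x \<notin> carrier G \<Longrightarrow> u x = 0"
  by (auto simp: ell2_def)

lemma ell2_L2_set_le:
  assumes "u \<in> ell2 G" "finite A" "A \<subseteq> carrier G"
  shows "L2_set (\<lambda>x. cmod (u x)) A \<le> \<parallel>u\<parallel>"
  unfolding L2_set_def ell2_norm_def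
  using assms by (intro real_sqrt_le_mono finite_sum_le_infsum) (auto simp: ell2_def)

text \<open>Bounds by finite partial sums are stable under pointwise limits; this is how limits of elements of
  the group algebra are placed in \<open>\<ell>\<^sup>2\<close> below.\<close>

lemma ell2_boundI:
  assumes "\<And>x. x \<notin> carrier G \<Longrightarrow> u x = 0"
    and bd: "\<And>A. finite A \<Longrightarrow> A \<subseteq> carrier G \<Longrightarrow> L2_set (\<lambda>x. cmod (u x)) A \<le> B"
  shows "u \<in> ell2 G" "\<parallel>u\<parallel> \<le> B"
proof -
  have B: "B \<ge> 0" using bd[of "{}"] by simp
  have le: "(\<Sum>x\<in>A. (cmod (u x))\<^sup>2) \<le> B\<^sup>2" if "finite A" "A \<subseteq> carrier G" for A
    using bd[OF that] unfolding L2_set_def by (rule sqrt_le_D)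
  have sm: "(\<lambda>x. (cmod (u x))\<^sup>2) summable_on carrier G"
    by (rule nonneg_bdd_above_summable_on) (auto intro!: bdd_aboveI2[where M="B\<^sup>2"] le)
  show "u \<in> ell2 G" using sm assms(1) by (auto simp: ell2_def)
  have "(\<Sum>\<^sub>\<infinity>x\<in>carrier G. (cmod (u x))\<^sup>2) \<le> B\<^sup>2"
    by (rule infsum_le_finite_sums[OF sm le])
  then show "\<parallel>u\<parallel> \<le> B" unfolding ell2_norm_def using B by (simp add: real_le_lsqrt infsum_nonneg)
qed

lemma ell2_norm_nonneg [simp]: "\<parallel>u\<parallel> \<ge> 0"
  by (simp add: ell2_norm_def infsum_nonneg)

lemma ell2_norm_square: "(\<parallel>u\<parallel>)\<^sup>2 = (\<Sum>\<^sub>\<infinity>x\<in>carrier G. (cmod (u x))\<^sup>2)"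
  by (simp add: ell2_norm_def infsum_nonneg)

lemma ell2_pointwise: "u \<in> ell2 G \<Longrightarrow> cmod (u x) \<le> \<parallel>u\<parallel>"
  using ell2_L2_set_le[of u "{x}"] ell2_outside[of u x] by (cases "x \<in> carrier G") (auto simp: L2_set_def)

lemma ell2_scale:
  assumes "u \<in> ell2 G"
  shows "(\<lambda>x. c * u x) \<in> ell2 G" "\<parallel>\<lambda>x. c * u x\<parallel> = cmod c * \<parallel>u\<parallel>"
proof -
  show "(\<lambda>x. c * u x) \<in> ell2 G"
    using assms by (auto simp: ell2_def norm_mult power_mult_distrib intro: summable_on_cmult_right)
  have "(\<parallel>\<lambda>x. c * u x\<parallel>)\<^sup>2 = (cmod c * \<parallel>u\<parallel>)\<^sup>2"
    unfolding ell2_norm_square power_mult_distrib norm_mult by (rule infsum_cmult_right')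
  then show "\<parallel>\<lambda>x. c * u x\<parallel> = cmod c * \<parallel>u\<parallel>"
    by (simp add: power2_eq_iff_nonneg)
qed

lemma ell2_add:
  assumes "u \<in> ell2 G" "v \<in> ell2 G"
  shows "(\<lambda>x. u x + v x) \<in> ell2 G" "\<parallel>\<lambda>x. u x + v x\<parallel> \<le> \<parallel>u\<parallel> + \<parallel>v\<parallel>"
proof -
  have "L2_set (\<lambda>x. cmod (u x + v x)) A \<le> \<parallel>u\<parallel> + \<parallel>v\<parallel>" if A: "finite A" "A \<subseteq> carrier G" for A
  proof -
    have "L2_set (\<lambda>x. cmod (u x + v x)) A \<le> L2_set (\<lambda>x. cmod (u x) + cmod (v x)) A"
      by (intro L2_set_mono norm_triangle_ineq) auto
    also have "\<dots> \<le> L2_set (\<lambda>x. cmod (u x)) A + L2_set (\<lambda>x. cmod (v x)) A"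
      by (rule L2_set_triangle_ineq)
    finally show ?thesis using ell2_L2_set_le[OF assms(1) A] ell2_L2_set_le[OF assms(2) A] by linarith
  qed
  then show "(\<lambda>x. u x + v x) \<in> ell2 G" "\<parallel>\<lambda>x. u x + v x\<parallel> \<le> \<parallel>u\<parallel> + \<parallel>v\<parallel>"
    using ell2_boundI[of "\<lambda>x. u x + v x" "\<parallel>u\<parallel> + \<parallel>v\<parallel>"] assms by (auto simp: ell2_outside)
qed

lemma ell2_diff:
  assumes "u \<in> ell2 G" "v \<in> ell2 G"
  shows "(\<lambda>x. u x - v x) \<in> ell2 G" "\<parallel>\<lambda>x. u x - v x\<parallel> \<le> \<parallel>u\<parallel> + \<parallel>v\<parallel>"
  using ell2_add[OF assms(1) ell2_scale(1)[OF assms(2), of "-1"]] ell2_scale(2)[OF assms(2), of "-1"]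
  by auto

lemma ell2_zero [simp]: "(\<lambda>x. 0) \<in> ell2 G" "\<parallel>\<lambda>x. 0\<parallel> = 0"
  by (auto simp: ell2_def ell2_norm_def)

lemma ell2_sum:
  assumes "finite J" "\<And>j. j \<in> J \<Longrightarrow> f j \<in> ell2 G"
  shows "(\<lambda>x. \<Sum>j\<in>J. f j x) \<in> ell2 G" "\<parallel>\<lambda>x. \<Sum>j\<in>J. f j x\<parallel> \<le> (\<Sum>j\<in>J. \<parallel>f j\<parallel>)"
proof -
  have "(\<lambda>x. \<Sum>j\<in>J. f j x) \<in> ell2 G \<and> \<parallel>\<lambda>x. \<Sum>j\<in>J. f j x\<parallel> \<le> (\<Sum>j\<in>J. \<parallel>f j\<parallel>)"
    using assms
  proof (induction J)
    case (insert j J)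
    then show ?case using ell2_add[of "f j" "\<lambda>x. \<Sum>j\<in>J. f j x"] by fastforce
  qed simp
  then show "(\<lambda>x. \<Sum>j\<in>J. f j x) \<in> ell2 G" "\<parallel>\<lambda>x. \<Sum>j\<in>J. f j x\<parallel> \<le> (\<Sum>j\<in>J. \<parallel>f j\<parallel>)" by auto
qed

lemma ell2_prod_bound:
  assumes "u \<in> ell2 G" "v \<in> ell2 G" "finite A" "A \<subseteq> carrier G"
  shows "(\<Sum>x\<in>A. cmod (u x * v x)) \<le> \<parallel>u\<parallel> * \<parallel>v\<parallel>"
proof -
  have "(\<Sum>x\<in>A. cmod (u x * v x)) \<le> L2_set (\<lambda>x. cmod (u x)) A * L2_set (\<lambda>x. cmod (v x)) A"
    using L2_set_mult_ineq[of "\<lambda>x. cmod (u x)" "\<lambda>x. cmod (v x)" A] by (simp add: norm_mult)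
  also have "\<dots> \<le> \<parallel>u\<parallel> * \<parallel>v\<parallel>"
    by (intro mult_mono ell2_L2_set_le assms) auto
  finally show ?thesis .
qed

lemma inner_abs_summable:
  assumes "u \<in> ell2 G" "v \<in> ell2 G"
  shows "(\<lambda>x. norm (cnj (u x) * v x)) summable_on carrier G"
  by (rule nonneg_bdd_above_summable_on)
    (auto intro!: bdd_aboveI2[where M="\<parallel>u\<parallel> * \<parallel>v\<parallel>"] simp: norm_mult ell2_prod_bound[OF assms, unfolded norm_mult])

lemmas inner_summable = abs_summable_summable[OF inner_abs_summable]

lemma inner_Cauchy_Schwarz:
  assumes "u \<in> ell2 G" "v \<in> ell2 G"
  shows "cmod \<langle>u, v\<rangle> \<le> \<parallel>u\<parallel> * \<parallel>v\<parallel>"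
proof -
  have "cmod \<langle>u, v\<rangle> \<le> (\<Sum>\<^sub>\<infinity>x\<in>carrier G. cmod (cnj (u x) * v x))"
    unfolding ell2_inner_def by (rule norm_infsum_bound[OF inner_abs_summable[OF assms]])
  also have "\<dots> \<le> \<parallel>u\<parallel> * \<parallel>v\<parallel>"
    by (rule infsum_le_finite_sums[OF inner_abs_summable[OF assms]])
      (use ell2_prod_bound[OF assms] in \<open>simp add: norm_mult\<close>)
  finally show ?thesis .
qed

lemma inner_add_right:
  "u \<in> ell2 G \<Longrightarrow> v \<in> ell2 G \<Longrightarrow> w \<in> ell2 G \<Longrightarrow> \<langle>u, \<lambda>x. v x + w x\<rangle> = \<langle>u, v\<rangle> + \<langle>u, w\<rangle>"
  unfolding ell2_inner_def by (simp add: distrib_left infsum_add inner_summable)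

lemma inner_scale_right: "\<langle>u, \<lambda>x. c * v x\<rangle> = c * \<langle>u, v\<rangle>"
  unfolding ell2_inner_def by (simp add: mult.left_commute[of _ c] infsum_cmult_right')

lemma inner_commute: "\<langle>v, u\<rangle> = cnj \<langle>u, v\<rangle>"
  unfolding ell2_inner_def infsum_cnj[symmetric] by (simp add: mult.commute)

lemma inner_add_left:
  "u \<in> ell2 G \<Longrightarrow> v \<in> ell2 G \<Longrightarrow> w \<in> ell2 G \<Longrightarrow> \<langle>\<lambda>x. v x + w x, u\<rangle> = \<langle>v, u\<rangle> + \<langle>w, u\<rangle>"
  using inner_add_right[of u v w] by (metis complex_cnj_add inner_commute)

lemma inner_scale_left: "\<langle>\<lambda>x. c * v x, u\<rangle> = cnj c * \<langle>v, u\<rangle>"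
  by (metis complex_cnj_mult inner_commute inner_scale_right)

lemma inner_diff_right:
  "u \<in> ell2 G \<Longrightarrow> v \<in> ell2 G \<Longrightarrow> w \<in> ell2 G \<Longrightarrow> \<langle>u, \<lambda>x. v x - w x\<rangle> = \<langle>u, v\<rangle> - \<langle>u, w\<rangle>"
  using inner_add_right[of u v "\<lambda>x. (-1) * w x"] ell2_scale(1)[of w "-1"] inner_scale_right[of u "-1" w] by simp

lemma inner_diff_left:
  "u \<in> ell2 G \<Longrightarrow> v \<in> ell2 G \<Longrightarrow> w \<in> ell2 G \<Longrightarrow> \<langle>\<lambda>x. v x - w x, u\<rangle> = \<langle>v, u\<rangle> - \<langle>w, u\<rangle>"
  using inner_diff_right[of u v w] by (metis complex_cnj_diff inner_commute)

lemma inner_sum_right: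
  assumes "finite J" "u \<in> ell2 G" "\<And>j. j \<in> J \<Longrightarrow> f j \<in> ell2 G"
  shows "\<langle>u, \<lambda>x. \<Sum>j\<in>J. f j x\<rangle> = (\<Sum>j\<in>J. \<langle>u, f j\<rangle>)"
  using assms
proof (induction J)
  case empty then show ?case by (simp add: ell2_inner_def)
next
  case (insert j J)
  then show ?case using inner_add_right[of u "f j" "\<lambda>x. \<Sum>j\<in>J. f j x"] ell2_sum(1)[of J f] by simp
qed

lemma inner_self:
  assumes "u \<in> ell2 G"
  shows "\<langle>u, u\<rangle> = of_real ((\<parallel>u\<parallel>)\<^sup>2)"
proof -
  have "\<langle>u, u\<rangle> = (\<Sum>\<^sub>\<infinity>x\<in>carrier G. complex_of_real ((cmod (u x))\<^sup>2))"
    unfolding ell2_inner_def complex_norm_square by (simp add: mult.commute)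
  also have "\<dots> = of_real (\<Sum>\<^sub>\<infinity>x\<in>carrier G. (cmod (u x))\<^sup>2)"
    by (rule infsumI, subst has_sum_of_real_iff) (use assms in \<open>auto simp: ell2_def intro: has_sum_infsum\<close>)
  finally show ?thesis by (simp add: ell2_norm_square)
qed

lemma ell2_norm_eq_0: "u \<in> ell2 G \<Longrightarrow> \<parallel>u\<parallel> = 0 \<Longrightarrow> u = (\<lambda>x. 0)"
  using ell2_pointwise[of u] by fastforce

lemma ell2_norm_diff_square:
  assumes "u \<in> ell2 G" "v \<in> ell2 G"
  shows "(\<parallel>\<lambda>x. u x - v x\<parallel>)\<^sup>2 = (\<parallel>u\<parallel>)\<^sup>2 - 2 * Re \<langle>u, v\<rangle> + (\<parallel>v\<parallel>)\<^sup>2"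
proof -
  have "\<langle>\<lambda>x. u x - v x, \<lambda>x. u x - v x\<rangle> = \<langle>u, u\<rangle> - \<langle>u, v\<rangle> - \<langle>v, u\<rangle> + \<langle>v, v\<rangle>"
    using assms by (simp add: inner_diff_left inner_diff_right ell2_diff)
  then have "Re \<langle>\<lambda>x. u x - v x, \<lambda>x. u x - v x\<rangle> = Re (\<langle>u, u\<rangle> - \<langle>u, v\<rangle> - cnj \<langle>u, v\<rangle> + \<langle>v, v\<rangle>)"
    by (simp add: inner_commute[of v u])
  then show ?thesis using assms by (simp add: inner_self ell2_diff)
qed

lemma ell2_sum_square_finite:
  assumes "finite A" "A \<subseteq> carrier G" "\<And>x. x \<notin> A \<Longrightarrow> u x = 0"
  shows "u \<in> ell2 G" "\<parallel>u\<parallel> = sqrt (\<Sum>x\<in>A. (cmod (u x))\<^sup>2)"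
proof -
  have "(\<lambda>x. (cmod (u x))\<^sup>2) summable_on carrier G \<longleftrightarrow> (\<lambda>x. (cmod (u x))\<^sup>2) summable_on A"
    by (rule summable_on_cong_neutral) (use assms in auto)
  then show "u \<in> ell2 G" using assms by (auto simp: ell2_def)
  have "(\<Sum>\<^sub>\<infinity>x\<in>carrier G. (cmod (u x))\<^sup>2) = (\<Sum>\<^sub>\<infinity>x\<in>A. (cmod (u x))\<^sup>2)"
    by (rule infsum_cong_neutral) (use assms in auto)
  then show "\<parallel>u\<parallel> = sqrt (\<Sum>x\<in>A. (cmod (u x))\<^sup>2)" using assms by (simp add: ell2_norm_def)
qed

lemma delta_ell2: "h \<in> carrier G \<Longrightarrow> ell2_delta h \<in> ell2 G"
  by (rule ell2_sum_square_finite[of "{h}"]) (auto simp: ell2_delta_def)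

lemma delta_norm: "h \<in> carrier G \<Longrightarrow> \<parallel>ell2_delta h\<parallel> = 1"
  by (subst ell2_sum_square_finite[of "{h}"]) (auto simp: ell2_delta_def)

lemma inner_delta_left: "h \<in> carrier G \<Longrightarrow> \<langle>ell2_delta h, u\<rangle> = u h"
proof -
  assume h: "h \<in> carrier G"
  have "\<langle>ell2_delta h, u\<rangle> = (\<Sum>\<^sub>\<infinity>x\<in>{h}. cnj (ell2_delta h x) * u x)"
    unfolding ell2_inner_def by (rule infsum_cong_neutral) (use h in \<open>auto simp: ell2_delta_def\<close>)
  then show ?thesis by (simp add: ell2_delta_def)
qed

lemma inner_delta_right: "h \<in> carrier G \<Longrightarrow> \<langle>u, ell2_delta h\<rangle> = cnj (u h)"
  by (metis inner_commute inner_delta_left)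

subsection \<open>Translations\<close>

lemma left_mult_bij: "g \<in> carrier G \<Longrightarrow> bij_betw (\<lambda>x. g \<otimes> x) (carrier G) (carrier G)"
  by (rule bij_betw_byWitness[where f'="\<lambda>x. inv g \<otimes> x"]) (auto simp: m_assoc[symmetric])

lemma right_mult_bij: "g \<in> carrier G \<Longrightarrow> bij_betw (\<lambda>x. x \<otimes> g) (carrier G) (carrier G)"
  by (rule bij_betw_byWitness[where f'="\<lambda>x. x \<otimes> inv g"]) (auto simp: m_assoc)

lemma left_translation_ell2:
  assumes "g \<in> carrier G" "u \<in> ell2 G"
  shows "left_translation G g u \<in> ell2 G" "\<parallel>left_translation G g u\<parallel> = \<parallel>u\<parallel>"
proof -
  have b: "bij_betw (\<lambda>x. inv g \<otimes> x) (carrier G) (carrier G)" using assms left_mult_bij by simp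
  have "(\<lambda>x. (cmod (u (inv g \<otimes> x)))\<^sup>2) summable_on carrier G"
    using summable_on_reindex_bij_betw[OF b, of "\<lambda>x. (cmod (u x))\<^sup>2"] assms(2) by (simp add: ell2_def)
  then show "left_translation G g u \<in> ell2 G"
    by (auto simp: ell2_def left_translation_def cong: summable_on_cong)
  show "\<parallel>left_translation G g u\<parallel> = \<parallel>u\<parallel>"
    unfolding ell2_norm_def using infsum_reindex_bij_betw[OF b, of "\<lambda>x. (cmod (u x))\<^sup>2"]
    by (simp add: left_translation_def cong: infsum_cong)
qed

lemma left_translation_adjoint:
  assumes "g \<in> carrier G"
  shows "\<langle>left_translation G g u, v\<rangle> = \<langle>u, left_translation G (inv g) v\<rangle>"
proof -
  have "\<langle>left_translation G g u, v\<rangle> =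
      (\<Sum>\<^sub>\<infinity>x\<in>carrier G. cnj (u (inv g \<otimes> x)) * v (g \<otimes> (inv g \<otimes> x)))"
    unfolding ell2_inner_def by (rule infsum_cong) (use assms in \<open>simp add: left_translation_def m_assoc[symmetric]\<close>)
  also have "\<dots> = (\<Sum>\<^sub>\<infinity>x\<in>carrier G. cnj (u x) * v (g \<otimes> x))"
    using left_mult_bij[of "inv g"] assms
    by (intro infsum_reindex_bij_betw[where g="\<lambda>x. inv g \<otimes> x" and f="\<lambda>x. cnj (u x) * v (g \<otimes> x)"]) auto
  also have "\<dots> = \<langle>u, left_translation G (inv g) v\<rangle>"
    unfolding ell2_inner_def by (rule infsum_cong) (use assms in \<open>simp add: left_translation_def\<close>)
  finally show ?thesis .
qed

definition right_translation where
  "right_translation h u = (\<lambda>x. if x \<in> carrier G then u (x \<otimes> inv h) else 0)"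

lemma right_translation_ell2:
  assumes "h \<in> carrier G" "u \<in> ell2 G"
  shows "right_translation h u \<in> ell2 G" "\<parallel>right_translation h u\<parallel> = \<parallel>u\<parallel>"
proof -
  have b: "bij_betw (\<lambda>x. x \<otimes> inv h) (carrier G) (carrier G)" using assms right_mult_bij by simp
  have "(\<lambda>x. (cmod (u (x \<otimes> inv h)))\<^sup>2) summable_on carrier G"
    using summable_on_reindex_bij_betw[OF b, of "\<lambda>x. (cmod (u x))\<^sup>2"] assms(2) by (simp add: ell2_def)
  then show "right_translation h u \<in> ell2 G"
    by (auto simp: ell2_def right_translation_def cong: summable_on_cong)
  show "\<parallel>right_translation h u\<parallel> = \<parallel>u\<parallel>"
    unfolding ell2_norm_def using infsum_reindex_bij_betw[OF b, of "\<lambda>x. (cmod (u x))\<^sup>2"]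
    by (simp add: right_translation_def cong: infsum_cong)
qed

lemma right_translation_delta:
  "h \<in> carrier G \<Longrightarrow> right_translation h (ell2_delta \<one>) = ell2_delta h"
  using inv_equality[of _ "inv h"] by (fastforce simp: right_translation_def ell2_delta_def fun_eq_iff)

lemma right_translation_conv:
  assumes "h \<in> carrier G" "supp q \<subseteq> carrier G"
  shows "q \<star> right_translation h u = right_translation h (q \<star> u)"
proof
  fix x
  show "(q \<star> right_translation h u) x = right_translation h (q \<star> u) x"
    unfolding left_regular_def right_translation_def left_translation_def
    using assms by (auto intro!: sum.cong simp: m_assoc subset_iff)
qed

end

section \<open>The group algebra acting on square-summable functions\<close>

context group
begin

abbreviation GA where "GA \<equiv> group_algebra G"

lemma GA_D:
  assumes "q \<in> GA"
  shows "finite (supp q)" "supp q \<subseteq> carrier G" "x \<notin> carrier G \<Longrightarrow> q x = 0"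
  using assms unfolding group_algebra_def supp_def by blast+

lemma GA_I: "finite A \<Longrightarrow> A \<subseteq> carrier G \<Longrightarrow> (\<And>x. x \<notin> A \<Longrightarrow> q x = 0) \<Longrightarrow> q \<in> GA"
proof -
  assume A: "finite A" "A \<subseteq> carrier G" "\<And>x. x \<notin> A \<Longrightarrow> q x = 0"
  have "supp q \<subseteq> A" using A(3) by (auto simp: supp_def)
  then have "finite (supp q)" "supp q \<subseteq> carrier G"
    using A(1,2) by (blast intro: finite_subset)+
  then show "q \<in> GA" by (simp add: group_algebra_def)
qed

lemma GA_ell2:
  assumes "q \<in> GA"
  shows "q \<in> ell2 G" "\<parallel>q\<parallel> = sqrt (\<Sum>x\<in>supp q. (cmod (q x))\<^sup>2)"
proof -
  have *: "x \<notin> supp q \<Longrightarrow> q x = 0" for x by (simp add: supp_def)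
  show "q \<in> ell2 G" "\<parallel>q\<parallel> = sqrt (\<Sum>x\<in>supp q. (cmod (q x))\<^sup>2)"
    by (rule ell2_sum_square_finite[OF GA_D(1,2)[OF assms] *], assumption)+
qed

lemma conv_sum:
  assumes "finite A" "supp q \<subseteq> A"
  shows "(q \<star> u) x = (\<Sum>g\<in>A. q g * left_translation G g u x)"
  unfolding left_regular_def using assms by (intro sum.mono_neutral_left) (simp_all add: supp_def)

lemma conv_outside: "x \<notin> carrier G \<Longrightarrow> (q \<star> u) x = 0"
  by (simp add: left_regular_def left_translation_def)

lemma conv_ell2:
  assumes "q \<in> GA" "u \<in> ell2 G"
  shows "q \<star> u \<in> ell2 G" "\<parallel>q \<star> u\<parallel> \<le> (\<Sum>g\<in>supp q. cmod (q g)) * \<parallel>u\<parallel>"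
proof -
  have eq: "q \<star> u = (\<lambda>x. \<Sum>g\<in>supp q. (\<lambda>x. q g * left_translation G g u x) x)"
    by (simp add: left_regular_def fun_eq_iff)
  have t: "left_translation G g u \<in> ell2 G" "\<parallel>left_translation G g u\<parallel> = \<parallel>u\<parallel>" if "g \<in> supp q" for g
    using left_translation_ell2[of g u] GA_D(2)[OF assms(1)] assms(2) that by auto
  show "q \<star> u \<in> ell2 G" unfolding eq
    using GA_D(1)[OF assms(1)] t by (intro ell2_sum ell2_scale) auto
  have "\<parallel>q \<star> u\<parallel> \<le> (\<Sum>g\<in>supp q. \<parallel>\<lambda>x. q g * left_translation G g u x\<parallel>)" unfolding eq
    using GA_D(1)[OF assms(1)] t by (intro ell2_sum ell2_scale) auto
  also have "\<dots> = (\<Sum>g\<in>supp q. cmod (q g)) * \<parallel>u\<parallel>"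
    using t by (simp add: ell2_scale sum_distrib_right)
  finally show "\<parallel>q \<star> u\<parallel> \<le> (\<Sum>g\<in>supp q. cmod (q g)) * \<parallel>u\<parallel>" .
qed

lemma conv_add_right: "q \<star> (\<lambda>x. u x + v x) = (\<lambda>x. (q \<star> u) x + (q \<star> v) x)"
proof
  fix x
  show "(q \<star> (\<lambda>x. u x + v x)) x = (q \<star> u) x + (q \<star> v) x"
    unfolding left_regular_def sum.distrib[symmetric]
    by (rule sum.cong) (simp_all add: left_translation_def distrib_left)
qed

lemma conv_scale_right: "q \<star> (\<lambda>x. c * u x) = (\<lambda>x. c * (q \<star> u) x)"
proof
  fix x
  show "(q \<star> (\<lambda>x. c * u x)) x = c * (q \<star> u) x"
    unfolding left_regular_def sum_distrib_left
    by (rule sum.cong) (simp_all add: left_translation_def)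
qed

lemma conv_diff_right: "q \<star> (\<lambda>x. u x - v x) = (\<lambda>x. (q \<star> u) x - (q \<star> v) x)"
proof
  fix x
  show "(q \<star> (\<lambda>x. u x - v x)) x = (q \<star> u) x - (q \<star> v) x"
    unfolding left_regular_def sum_subtractf[symmetric]
    by (rule sum.cong) (simp_all add: left_translation_def right_diff_distrib)
qed

lemma conv_add_left:
  assumes "q \<in> GA" "r \<in> GA"
  shows "(\<lambda>x. q x + r x) \<star> u = (\<lambda>x. (q \<star> u) x + (r \<star> u) x)"
proof
  fix x
  let ?A = "supp q \<union> supp r"
  have A: "finite ?A" "supp (\<lambda>x. q x + r x) \<subseteq> ?A" "supp q \<subseteq> ?A" "supp r \<subseteq> ?A"
    using GA_D(1,2)[OF assms(1)] GA_D(1,2)[OF assms(2)] by (auto simp: supp_def)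
  show "((\<lambda>x. q x + r x) \<star> u) x = (q \<star> u) x + (r \<star> u) x"
    unfolding conv_sum[OF A(1,2)] conv_sum[OF A(1,3)] conv_sum[OF A(1,4)]
    by (simp add: distrib_right sum.distrib)
qed

lemma supp_scale: "supp (\<lambda>x. c * q x) \<subseteq> supp q"
  by (auto simp: supp_def)

lemma conv_scale_left:
  assumes "q \<in> GA"
  shows "(\<lambda>x. c * q x) \<star> u = (\<lambda>x. c * (q \<star> u) x)"
  unfolding conv_sum[OF GA_D(1)[OF assms] supp_scale, abs_def] fun_eq_iff left_regular_def
  by (simp add: sum_distrib_left mult.assoc)

lemma GA_closed:
  assumes "q \<in> GA" "r \<in> GA"
  shows "(\<lambda>x. q x + r x) \<in> GA" "(\<lambda>x. q x - r x) \<in> GA" "(\<lambda>x. c * q x) \<in> GA"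
  using GA_D(1,2)[OF assms(1)] GA_D(1,2)[OF assms(2)]
  by (auto intro!: GA_I[of "supp q \<union> supp r"] simp: supp_def)

lemma GA_zero: "(\<lambda>x. 0) \<in> GA"
  by (auto simp: group_algebra_def supp_def)

lemma GA_sum: "finite J \<Longrightarrow> (\<And>j. j \<in> J \<Longrightarrow> f j \<in> GA) \<Longrightarrow> (\<lambda>x. \<Sum>j\<in>J. f j x) \<in> GA"
  by (induction J rule: finite_induct) (auto simp: GA_zero GA_closed)

lemma GA_delta: "h \<in> carrier G \<Longrightarrow> ell2_delta h \<in> GA"
  by (rule GA_I[of "{h}"]) (auto simp: ell2_delta_def)

lemma left_translation_GA:
  assumes "q \<in> GA" "g \<in> carrier G"
  shows "left_translation G g q \<in> GA"
proof (rule GA_I)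
  show "finite ((\<lambda>x. g \<otimes> x) ` supp q)" "(\<lambda>x. g \<otimes> x) ` supp q \<subseteq> carrier G"
    using GA_D(1,2)[OF assms(1)] assms(2) by auto
  fix x assume x: "x \<notin> (\<lambda>x. g \<otimes> x) ` supp q"
  show "left_translation G g q x = 0"
  proof (rule ccontr)
    assume "left_translation G g q x \<noteq> 0"
    then have "x \<in> carrier G" "inv g \<otimes> x \<in> supp q" by (auto simp: left_translation_def supp_def split: if_splits)
    then have "g \<otimes> (inv g \<otimes> x) \<in> (\<lambda>x. g \<otimes> x) ` supp q" by blast
    then show False using x \<open>x \<in> carrier G\<close> assms(2) by (simp add: m_assoc[symmetric])
  qed
qed

lemma conv_GA:
  assumes "q \<in> GA" "r \<in> GA"
  shows "q \<star> r \<in> GA"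
proof -
  have eq: "q \<star> r = (\<lambda>x. \<Sum>g\<in>supp q. (\<lambda>x. q g * left_translation G g r x) x)"
    by (simp add: left_regular_def fun_eq_iff)
  show ?thesis unfolding eq
    using GA_D(1,2)[OF assms(1)] assms(2) by (intro GA_sum GA_closed left_translation_GA) auto
qed

lemma conv_delta_right:
  assumes "q \<in> GA"
  shows "q \<star> ell2_delta \<one> = q"
proof
  fix x
  show "(q \<star> ell2_delta \<one>) x = q x"
  proof (cases "x \<in> carrier G")
    case True
    have "left_translation G g (ell2_delta \<one>) x = (if g = x then 1 else 0)" if "g \<in> supp q" for g
    proof -
      have g: "g \<in> carrier G" using GA_D(2)[OF assms] that by blast
      have "left_translation G g (ell2_delta \<one>) = ell2_delta (g \<otimes> \<one>)"
        by (rule left_translation_delta) (use g is_group in auto)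
      then show ?thesis using g by (auto simp: ell2_delta_def)
    qed
    then have "(q \<star> ell2_delta \<one>) x = (\<Sum>g\<in>supp q. if g = x then q g else 0)"
      unfolding left_regular_def by (intro sum.cong) auto
    then show ?thesis using GA_D(1)[OF assms] by (auto simp: supp_def)
  next
    case False
    then show ?thesis using GA_D(3)[OF assms] conv_outside by simp
  qed
qed

lemma conv_left_translation:
  assumes "r \<in> GA" "g \<in> carrier G"
  shows "left_translation G g r \<star> u = left_translation G g (r \<star> u)"
proof
  fix x
  let ?f = "\<lambda>x. g \<otimes> x"
  have r: "finite (supp r)" "supp r \<subseteq> carrier G" using GA_D(1,2)[OF assms(1)] by auto
  have sub: "supp (left_translation G g r) \<subseteq> ?f ` supp r"
  proof
    fix x assume "x \<in> supp (left_translation G g r)"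
    then have "x \<in> carrier G" "inv g \<otimes> x \<in> supp r" by (auto simp: left_translation_def supp_def split: if_splits)
    moreover from this have "x = g \<otimes> (inv g \<otimes> x)" using assms by (simp add: m_assoc[symmetric])
    ultimately show "x \<in> ?f ` supp r" by blast
  qed
  have inj: "inj_on ?f (supp r)" using r assms by (auto simp: inj_on_def subset_iff)
  show "(left_translation G g r \<star> u) x = left_translation G g (r \<star> u) x"
  proof (cases "x \<in> carrier G")
    case True
    have "(left_translation G g r \<star> u) x =
        (\<Sum>h\<in>supp r. left_translation G g r (g \<otimes> h) * left_translation G (g \<otimes> h) u x)"
      using r by (subst conv_sum[OF _ sub]) (simp_all add: sum.reindex[OF inj])
    also have "\<dots> = (\<Sum>h\<in>supp r. r h * left_translation G h u (inv g \<otimes> x))"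
    proof (rule sum.cong[OF refl])
      fix h assume "h \<in> supp r"
      then have h: "h \<in> carrier G" using r by auto
      have e1: "inv g \<otimes> (g \<otimes> h) = h" using h assms by (simp add: m_assoc[symmetric])
      have e2: "inv (g \<otimes> h) \<otimes> x = inv h \<otimes> (inv g \<otimes> x)"
        using h assms True by (simp add: inv_mult_group m_assoc)
      show "left_translation G g r (g \<otimes> h) * left_translation G (g \<otimes> h) u x =
          r h * left_translation G h u (inv g \<otimes> x)"
        unfolding left_translation_def using h assms True e1 e2 by simp
    qed
    also have "\<dots> = left_translation G g (r \<star> u) x"
      using True by (simp add: left_regular_def left_translation_def)
    finally show ?thesis .
  next
    case False
    then show ?thesis by (simp add: conv_outside left_translation_def)
  qed
qed

lemma conv_sum_left:
  assumes "finite J" "\<And>j. j \<in> J \<Longrightarrow> f j \<in> GA"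
  shows "(\<lambda>x. \<Sum>j\<in>J. f j x) \<star> u = (\<lambda>x. \<Sum>j\<in>J. (f j \<star> u) x)"
  using assms
proof (induction J rule: finite_induct)
  case empty
  then show ?case by (simp add: left_regular_def supp_def)
next
  case (insert j J)
  then show ?case using conv_add_left[of "f j" "\<lambda>x. \<Sum>j\<in>J. f j x" u] GA_sum[of J f] by simp
qed

lemma conv_assoc:
  assumes "q \<in> GA" "r \<in> GA"
  shows "(q \<star> r) \<star> u = q \<star> (r \<star> u)"
proof -
  have eq: "q \<star> r = (\<lambda>x. \<Sum>g\<in>supp q. (\<lambda>x. q g * left_translation G g r x) x)"
    by (simp add: left_regular_def fun_eq_iff)
  have t: "left_translation G g r \<in> GA" "g \<in> carrier G" if "g \<in> supp q" for g
    using GA_D(2)[OF assms(1)] that left_translation_GA[OF assms(2)] by auto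
  have "(q \<star> r) \<star> u = (\<lambda>x. \<Sum>g\<in>supp q. ((\<lambda>x. q g * left_translation G g r x) \<star> u) x)"
    unfolding eq using GA_D(1)[OF assms(1)] t by (intro conv_sum_left GA_closed) auto
  also have "\<dots> = (\<lambda>x. \<Sum>g\<in>supp q. q g * left_translation G g (r \<star> u) x)"
    using t assms by (intro ext sum.cong) (auto simp: conv_scale_left conv_left_translation)
  finally show ?thesis by (simp add: left_regular_def fun_eq_iff)
qed

lemma star_supp:
  assumes "q \<in> GA"
  shows "supp (star G q) = m_inv G ` supp q"
proof -
  have "x \<in> m_inv G ` supp q" if "x \<in> carrier G" "q (inv x) \<noteq> 0" for x
    using that by (metis (mono_tags, lifting) image_eqI inv_inv mem_Collect_eq supp_def)
  then show ?thesis using GA_D(2)[OF assms] by (auto simp: supp_def star_def subset_iff)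
qed

lemma star_GA:
  assumes "q \<in> GA"
  shows "star G q \<in> GA"
proof -
  have "finite (m_inv G ` supp q)" "m_inv G ` supp q \<subseteq> carrier G"
    using GA_D(1,2)[OF assms] by auto
  then show ?thesis unfolding group_algebra_def by (simp add: star_supp[OF assms])
qed

lemma conv_adjoint:
  assumes "q \<in> GA" "u \<in> ell2 G" "v \<in> ell2 G"
  shows "\<langle>q \<star> u, v\<rangle> = \<langle>u, star G q \<star> v\<rangle>"
proof -
  have q: "finite (supp q)" "supp q \<subseteq> carrier G" using GA_D(1,2)[OF assms(1)] by auto
  have t: "left_translation G g u \<in> ell2 G" "left_translation G (inv g) v \<in> ell2 G" if "g \<in> supp q" for g
    using left_translation_ell2 q that assms by auto
  have eq: "q \<star> u = (\<lambda>x. \<Sum>g\<in>supp q. (\<lambda>x. q g * left_translation G g u x) x)"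
    by (simp add: left_regular_def fun_eq_iff)
  have inj: "inj_on (m_inv G) (supp q)" using q(2) inv_inj inj_on_subset by blast
  have eq2: "star G q \<star> v = (\<lambda>x. \<Sum>g\<in>supp q. (\<lambda>x. cnj (q g) * left_translation G (inv g) v x) x)"
    unfolding left_regular_def star_supp[OF assms(1)] sum.reindex[OF inj]
    using q by (auto simp: fun_eq_iff star_def intro!: sum.cong)
  have "\<langle>v, q \<star> u\<rangle> = (\<Sum>g\<in>supp q. \<langle>v, \<lambda>x. q g * left_translation G g u x\<rangle>)"
    unfolding eq using q assms t by (intro inner_sum_right) (auto intro: ell2_scale)
  then have "\<langle>q \<star> u, v\<rangle> = (\<Sum>g\<in>supp q. cnj (q g) * \<langle>left_translation G g u, v\<rangle>)"
    by (subst inner_commute) (simp add: inner_scale_right inner_commute[of v])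
  also have "\<dots> = (\<Sum>g\<in>supp q. \<langle>u, \<lambda>x. cnj (q g) * left_translation G (inv g) v x\<rangle>)"
    using q by (intro sum.cong) (auto simp: left_translation_adjoint inner_scale_right subset_iff)
  also have "\<dots> = \<langle>u, star G q \<star> v\<rangle>"
    unfolding eq2 using q assms t by (intro inner_sum_right[symmetric]) (auto intro: ell2_scale)
  finally show ?thesis .
qed

lemma conv_self_adjoint:
  assumes "q \<in> GA" "q = star G q" "u \<in> ell2 G" "v \<in> ell2 G"
  shows "\<langle>q \<star> u, v\<rangle> = \<langle>u, q \<star> v\<rangle>"
  using conv_adjoint[of q u v] assms by simp

text \<open>The supremum that defines the operator norm is one of a bounded set, because of the \<open>\<ell>\<^sup>1\<close> bound for
  convolutions.\<close>

lemma opnorm_bound: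
  assumes "q \<in> GA" "u \<in> ell2 G"
  shows "\<parallel>q \<star> u\<parallel> \<le> ell2_opnorm G (left_regular G q) * \<parallel>u\<parallel>"
proof (cases "\<parallel>u\<parallel> = 0")
  case True
  then have "\<parallel>q \<star> u\<parallel> \<le> 0" using conv_ell2(2)[OF assms] by simp
  then show ?thesis using True by simp
next
  case False
  then have pos: "\<parallel>u\<parallel> > 0" by (simp add: less_le)
  define w where "w = (\<lambda>x. of_real (1 / \<parallel>u\<parallel>) * u x)"
  have w: "w \<in> ell2 G" "\<parallel>w\<parallel> = 1" 
    unfolding w_def using ell2_scale(1)[OF assms(2), of "of_real (1 / \<parallel>u\<parallel>)"] ell2_scale(2)[OF assms(2), of "of_real (1 / \<parallel>u\<parallel>)"] pos
    by (auto simp: norm_divide)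
  have "\<parallel>q \<star> w\<parallel> \<le> ell2_opnorm G (left_regular G q)"
    unfolding ell2_opnorm_def
  proof (rule cSUP_upper)
    show "w \<in> {u \<in> ell2 G. \<parallel>u\<parallel> \<le> 1}" using w by simp
    show "bdd_above ((\<lambda>u. \<parallel>q \<star> u\<parallel>) ` {u \<in> ell2 G. \<parallel>u\<parallel> \<le> 1})"
    proof (rule bdd_aboveI2)
      fix u assume "u \<in> {u \<in> ell2 G. \<parallel>u\<parallel> \<le> 1}"
      then show "\<parallel>q \<star> u\<parallel> \<le> (\<Sum>g\<in>supp q. cmod (q g)) * 1"
        using order_trans[OF conv_ell2(2)[OF assms(1), of u] mult_left_mono[of "\<parallel>u\<parallel>" 1]]
        by (simp add: sum_nonneg)
    qed
  qed
  moreover have "\<parallel>q \<star> w\<parallel> = \<parallel>q \<star> u\<parallel> / \<parallel>u\<parallel>"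
    unfolding w_def conv_scale_right ell2_scale(2)[OF conv_ell2(1)[OF assms]] using pos by (simp add: norm_divide)
  ultimately show ?thesis using pos by (simp add: field_simps)
qed

lemma opnorm_le:
  assumes "B \<ge> 0" "\<And>u. u \<in> ell2 G \<Longrightarrow> \<parallel>q \<star> u\<parallel> \<le> B * \<parallel>u\<parallel>"
  shows "ell2_opnorm G (left_regular G q) \<le> B"
  unfolding ell2_opnorm_def
proof (rule cSUP_least)
  have "(\<lambda>x. 0) \<in> {u \<in> ell2 G. \<parallel>u\<parallel> \<le> 1}" by simp
  then show "{u \<in> ell2 G. \<parallel>u\<parallel> \<le> 1} \<noteq> {}" by blast
  fix u assume "u \<in> {u \<in> ell2 G. \<parallel>u\<parallel> \<le> 1}"
  then have u: "u \<in> ell2 G" "\<parallel>u\<parallel> \<le> 1" by auto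
  have "\<parallel>q \<star> u\<parallel> \<le> B * 1" by (rule order_trans[OF assms(2)[OF u(1)] mult_left_mono[OF u(2) assms(1)]])
  then show "\<parallel>q \<star> u\<parallel> \<le> B" by simp
qed

lemma opnorm_nonneg:
  assumes "q \<in> GA"
  shows "ell2_opnorm G (left_regular G q) \<ge> 0"
proof -
  have "0 \<le> \<parallel>q \<star> ell2_delta \<one>\<parallel>" by (rule ell2_norm_nonneg)
  also have "\<dots> \<le> ell2_opnorm G (left_regular G q) * \<parallel>ell2_delta \<one>\<parallel>"
    by (rule opnorm_bound[OF assms delta_ell2]) simp
  finally show ?thesis by (simp add: delta_norm)
qed

end

section \<open>The Green function as a limit of elements of the group algebra\<close>

context group
begin

text \<open>The operators \<open>P - E\<close> and \<open>(P - E)\<^sup>2 + \<eta>\<^sup>2\<close>, and an upper bound for \<open>(P - E)\<^sup>2\<close>.\<close>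

definition shifted where
  "shifted p E u = (\<lambda>x. (p \<star> u) x - complex_of_real E * u x)"

definition shifted_sq where
  "shifted_sq p E \<eta> u = (\<lambda>x. shifted p E (shifted p E u) x + complex_of_real (\<eta>\<^sup>2) * u x)"

definition shift_bound :: "('a \<Rightarrow> complex) \<Rightarrow> real \<Rightarrow> real" where
  "shift_bound p E = ((\<Sum>g\<in>supp p. cmod (p g)) + \<bar>E\<bar>)\<^sup>2"

text \<open>Richardson's iteration for \<open>((P - E)\<^sup>2 + \<eta>\<^sup>2) v = \<delta>\<^sub>e\<close>; its \<open>n\<close>-th step is the \<open>n\<close>-th partial sum of the
  Neumann series around the scalar \<open>c + \<eta>\<^sup>2\<close>, where \<open>c\<close> is \<open>shift_bound p E\<close>.\<close>

fun green_approx where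
  "green_approx p E \<eta> 0 = (\<lambda>x. 0)"
| "green_approx p E \<eta> (Suc n) = (\<lambda>x. green_approx p E \<eta> n x
     + complex_of_real (1 / (shift_bound p E + \<eta>\<^sup>2)) *
       (ell2_delta \<one> x - shifted_sq p E \<eta> (green_approx p E \<eta> n) x))"

lemma shift_bound_nonneg: "shift_bound p E \<ge> 0"
  by (simp add: shift_bound_def)

lemma shifted_lin:
  "shifted p E (\<lambda>x. u x + v x) = (\<lambda>x. shifted p E u x + shifted p E v x)"
  "shifted p E (\<lambda>x. u x - v x) = (\<lambda>x. shifted p E u x - shifted p E v x)"
  "shifted p E (\<lambda>x. c * u x) = (\<lambda>x. c * shifted p E u x)"
  unfolding shifted_def conv_add_right conv_diff_right conv_scale_right
  by (simp_all add: algebra_simps)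

lemma shifted_sq_lin:
  "shifted_sq p E \<eta> (\<lambda>x. u x + v x) = (\<lambda>x. shifted_sq p E \<eta> u x + shifted_sq p E \<eta> v x)"
  "shifted_sq p E \<eta> (\<lambda>x. u x - v x) = (\<lambda>x. shifted_sq p E \<eta> u x - shifted_sq p E \<eta> v x)"
  "shifted_sq p E \<eta> (\<lambda>x. c * u x) = (\<lambda>x. c * shifted_sq p E \<eta> u x)"
  unfolding shifted_sq_def shifted_lin by (simp_all add: algebra_simps)

lemma shifted_GA: "p \<in> GA \<Longrightarrow> q \<in> GA \<Longrightarrow> shifted p E q \<in> GA"
  unfolding shifted_def by (intro GA_closed conv_GA)

lemma shifted_sq_GA: "p \<in> GA \<Longrightarrow> q \<in> GA \<Longrightarrow> shifted_sq p E \<eta> q \<in> GA"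
  unfolding shifted_sq_def by (intro GA_closed shifted_GA)

lemma green_approx_GA: "p \<in> GA \<Longrightarrow> green_approx p E \<eta> n \<in> GA"
  by (induction n) (auto simp del: of_real_divide intro!: GA_zero GA_closed shifted_sq_GA GA_delta)

lemma shifted_ell2:
  assumes "p \<in> GA" "u \<in> ell2 G"
  shows "shifted p E u \<in> ell2 G" "(\<parallel>shifted p E u\<parallel>)\<^sup>2 \<le> shift_bound p E * (\<parallel>u\<parallel>)\<^sup>2"
proof -
  note c = conv_ell2[OF assms] ell2_scale[OF assms(2), of "complex_of_real E"]
  show "shifted p E u \<in> ell2 G" unfolding shifted_def by (intro ell2_diff c)
  have "\<parallel>shifted p E u\<parallel> \<le> \<parallel>p \<star> u\<parallel> + \<bar>E\<bar> * \<parallel>u\<parallel>"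
    unfolding shifted_def using ell2_diff(2)[OF c(1,3)] c(4) by simp
  also have "\<dots> \<le> ((\<Sum>g\<in>supp p. cmod (p g)) + \<bar>E\<bar>) * \<parallel>u\<parallel>"
    using c(2) by (simp add: algebra_simps)
  finally have "(\<parallel>shifted p E u\<parallel>)\<^sup>2 \<le> (((\<Sum>g\<in>supp p. cmod (p g)) + \<bar>E\<bar>) * \<parallel>u\<parallel>)\<^sup>2"
    by (intro power_mono) auto
  then show "(\<parallel>shifted p E u\<parallel>)\<^sup>2 \<le> shift_bound p E * (\<parallel>u\<parallel>)\<^sup>2"
    by (simp add: shift_bound_def power_mult_distrib)
qed

lemma shifted_sq_ell2: "p \<in> GA \<Longrightarrow> u \<in> ell2 G \<Longrightarrow> shifted_sq p E \<eta> u \<in> ell2 G"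
  unfolding shifted_sq_def by (intro ell2_add ell2_scale shifted_ell2)

lemma shifted_self_adjoint:
  assumes "p \<in> GA" "p = star G p" "u \<in> ell2 G" "v \<in> ell2 G"
  shows "\<langle>shifted p E u, v\<rangle> = \<langle>u, shifted p E v\<rangle>"
  unfolding shifted_def using assms
  by (simp add: inner_diff_left inner_diff_right conv_ell2 ell2_scale inner_scale_left inner_scale_right
    conv_self_adjoint[OF assms])

text \<open>On the spectrum the operator multiplies by \<open>c - \<lambda>\<^sup>2\<close> with \<open>0 \<le> \<lambda>\<^sup>2 \<le> c\<close>; the proof replaces
  the spectral theorem by the expansion of the square.\<close>

lemma shifted_contraction:
  assumes p: "p \<in> GA" "p = star G p" and u: "u \<in> ell2 G"
  shows "\<parallel>\<lambda>x. complex_of_real (shift_bound p E) * u x - shifted p E (shifted p E u) x\<parallel>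
    \<le> shift_bound p E * \<parallel>u\<parallel>"
proof -
  let ?c = "shift_bound p E" and ?X = "shifted p E"
  have X: "?X u \<in> ell2 G" "?X (?X u) \<in> ell2 G" using shifted_ell2(1) p u by auto
  have "\<langle>u, ?X (?X u)\<rangle> = \<langle>?X u, ?X u\<rangle>" using shifted_self_adjoint[OF p u X(1)] by simp
  then have i: "Re \<langle>u, ?X (?X u)\<rangle> = (\<parallel>?X u\<parallel>)\<^sup>2" by (simp add: inner_self X)
  have "(\<parallel>\<lambda>x. complex_of_real ?c * u x - ?X (?X u) x\<parallel>)\<^sup>2
      = ?c\<^sup>2 * (\<parallel>u\<parallel>)\<^sup>2 - 2 * (?c * (\<parallel>?X u\<parallel>)\<^sup>2) + (\<parallel>?X (?X u)\<parallel>)\<^sup>2"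
    using ell2_norm_diff_square[OF ell2_scale(1)[OF u] X(2), of "of_real ?c"] shift_bound_nonneg[of p E]
    by (simp add: ell2_scale[OF u] inner_scale_left i power_mult_distrib)
  also have "\<dots> \<le> ?c\<^sup>2 * (\<parallel>u\<parallel>)\<^sup>2"
    using shifted_ell2(2)[OF p(1) X(1), of E] shift_bound_nonneg[of p E] 
    by (smt (verit) mult_nonneg_nonneg zero_le_power2)
  finally have "(\<parallel>\<lambda>x. complex_of_real ?c * u x - ?X (?X u) x\<parallel>)\<^sup>2 \<le> (?c * \<parallel>u\<parallel>)\<^sup>2"
    by (simp add: power_mult_distrib)
  then show ?thesis by (rule power2_le_imp_le) (simp add: shift_bound_nonneg)
qed

lemma shifted_sq_norm:
  assumes p: "p \<in> GA" and u: "u \<in> ell2 G"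
  shows "\<parallel>shifted_sq p E \<eta> u\<parallel> \<le> (shift_bound p E + \<eta>\<^sup>2) * \<parallel>u\<parallel>"
proof -
  let ?c = "shift_bound p E" and ?X = "shifted p E"
  have X: "?X u \<in> ell2 G" "?X (?X u) \<in> ell2 G" using shifted_ell2(1) p u by auto
  have "(\<parallel>?X (?X u)\<parallel>)\<^sup>2 \<le> ?c * (?c * (\<parallel>u\<parallel>)\<^sup>2)"
    using shifted_ell2(2)[OF p X(1), of E] mult_left_mono[OF shifted_ell2(2)[OF p u, of E] shift_bound_nonneg[of p E]]
    by linarith
  then have "(\<parallel>?X (?X u)\<parallel>)\<^sup>2 \<le> (?c * \<parallel>u\<parallel>)\<^sup>2" by (simp add: power2_eq_square mult_ac)
  then have "\<parallel>?X (?X u)\<parallel> \<le> ?c * \<parallel>u\<parallel>" by (rule power2_le_imp_le) (simp add: shift_bound_nonneg)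
  moreover have "\<parallel>shifted_sq p E \<eta> u\<parallel> \<le> \<parallel>?X (?X u)\<parallel> + \<eta>\<^sup>2 * \<parallel>u\<parallel>"
    using ell2_add(2)[OF X(2) ell2_scale(1)[OF u, of "complex_of_real (\<eta>\<^sup>2)"]] ell2_scale(2)[OF u, of "complex_of_real (\<eta>\<^sup>2)"]
    unfolding shifted_sq_def by (simp add: norm_power)
  ultimately show ?thesis by (simp add: algebra_simps)
qed

definition green_residual where
  "green_residual p E \<eta> n = (\<lambda>x. ell2_delta \<one> x - shifted_sq p E \<eta> (green_approx p E \<eta> n) x)"

text \<open>One step of the iteration multiplies the residual by \<open>(c - (P - E)\<^sup>2) / (c + \<eta>\<^sup>2)\<close>.\<close>

lemma green_residual:
  assumes p: "p \<in> GA" "p = star G p" and \<eta>: "\<eta> > 0"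
  shows "green_residual p E \<eta> n \<in> ell2 G"
    "\<parallel>green_residual p E \<eta> n\<parallel> \<le> (shift_bound p E / (shift_bound p E + \<eta>\<^sup>2)) ^ n"
proof -
  let ?c = "shift_bound p E" and ?s = "shift_bound p E + \<eta>\<^sup>2" and ?r = "green_residual p E \<eta>"
  have c: "?c \<ge> 0" "?s > 0" using shift_bound_nonneg[of p E] \<eta> by (auto simp: add_nonneg_pos)
  have r: "?r n \<in> ell2 G" for n
    unfolding green_residual_def
    by (intro ell2_diff delta_ell2 shifted_sq_ell2 p GA_ell2 green_approx_GA) simp
  show "?r n \<in> ell2 G" by (rule r)
  show "\<parallel>?r n\<parallel> \<le> (?c / ?s) ^ n"
  proof (induction n)
    case 0
    have "shifted_sq p E \<eta> (\<lambda>x. 0) = (\<lambda>x. 0)"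
      using shifted_sq_lin(3)[of p E \<eta> 0 "\<lambda>x. 0"] by simp
    then show ?case by (simp add: green_residual_def delta_norm)
  next
    case (Suc n)
    have "green_approx p E \<eta> (Suc n) = (\<lambda>x. green_approx p E \<eta> n x + of_real (1 / ?s) * ?r n x)"
      by (simp add: green_residual_def)
    then have "shifted_sq p E \<eta> (green_approx p E \<eta> (Suc n)) =
        (\<lambda>x. shifted_sq p E \<eta> (green_approx p E \<eta> n) x + of_real (1 / ?s) * shifted_sq p E \<eta> (?r n) x)"
      by (simp only: shifted_sq_lin)
    then have "?r (Suc n) x = ?r n x - of_real (1 / ?s) * shifted_sq p E \<eta> (?r n) x" for x
      using fun_cong[OF green_residual_def[of p E \<eta> "Suc n"], of x] fun_cong[OF green_residual_def[of p E \<eta> n], of x]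
      by (simp only: diff_diff_eq)
    then have "?r (Suc n) = (\<lambda>x. ?r n x - of_real (1 / ?s) * shifted_sq p E \<eta> (?r n) x)" by blast
    also have "\<dots> = (\<lambda>x. of_real (1 / ?s) * (of_real ?c * ?r n x - shifted p E (shifted p E (?r n)) x))"
    proof
      fix x
      have "complex_of_real ?s \<noteq> 0" using c by (metis less_irrefl of_real_eq_0_iff)
      then show "?r n x - of_real (1 / ?s) * shifted_sq p E \<eta> (?r n) x =
          of_real (1 / ?s) * (of_real ?c * ?r n x - shifted p E (shifted p E (?r n)) x)"
        unfolding shifted_sq_def of_real_divide by (simp add: field_simps)
    qed
    moreover have cs: "cmod (complex_of_real (1 / ?s)) = 1 / ?s" using c by (simp only: norm_of_real) simp
    ultimately have "\<parallel>?r (Suc n)\<parallel> = (1 / ?s) * \<parallel>\<lambda>x. of_real ?c * ?r n x - shifted p E (shifted p E (?r n)) x\<parallel>"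
      using ell2_scale(2)[OF ell2_diff(1)[OF ell2_scale(1)[OF r[of n]] shifted_ell2(1)[OF p(1) shifted_ell2(1)[OF p(1) r[of n]]]], of "of_real (1 / ?s)" "of_real ?c" E E]
      by (simp only: cs)
    also have "\<dots> \<le> (1 / ?s) * (?c * (?c / ?s) ^ n)"
      using c shifted_contraction[OF p r[of n], of E] Suc
      by (intro mult_left_mono) (auto intro: order_trans mult_left_mono)
    finally show ?case using c by (simp add: field_simps)
  qed
qed

lemma green_ratio:
  assumes "\<eta> > 0"
  shows "0 \<le> shift_bound p E / (shift_bound p E + \<eta>\<^sup>2)" "shift_bound p E / (shift_bound p E + \<eta>\<^sup>2) < 1"
    "(shift_bound p E + \<eta>\<^sup>2) * (1 - shift_bound p E / (shift_bound p E + \<eta>\<^sup>2)) = \<eta>\<^sup>2"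
proof -
  have "shift_bound p E + \<eta>\<^sup>2 > 0" using shift_bound_nonneg[of p E] assms by (simp add: add_nonneg_pos)
  then show "0 \<le> shift_bound p E / (shift_bound p E + \<eta>\<^sup>2)" "shift_bound p E / (shift_bound p E + \<eta>\<^sup>2) < 1"
    "(shift_bound p E + \<eta>\<^sup>2) * (1 - shift_bound p E / (shift_bound p E + \<eta>\<^sup>2)) = \<eta>\<^sup>2"
    using shift_bound_nonneg[of p E] assms by (auto simp: field_simps)
qed

text \<open>Summing the geometric series of the residuals gives the solution of
  \<open>((P - E)\<^sup>2 + \<eta>\<^sup>2) v = \<delta>\<^sub>e\<close>.\<close>

lemma green_limit:
  assumes p: "p \<in> GA" "p = star G p" and \<eta>: "\<eta> > 0"
  obtains v where "v \<in> ell2 G" "shifted_sq p E \<eta> v = ell2_delta \<one>"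
    "(\<lambda>n. \<parallel>\<lambda>x. v x - green_approx p E \<eta> n x\<parallel>) \<longlonglongrightarrow> 0"
proof -
  let ?s = "shift_bound p E + \<eta>\<^sup>2" and ?r = "green_residual p E \<eta>" and ?v = "green_approx p E \<eta>"
  define t where "t = shift_bound p E / ?s"
  have t: "0 \<le> t" "t < 1" "?s * (1 - t) = \<eta>\<^sup>2" using green_ratio[OF \<eta>, of p E] unfolding t_def by auto
  have s: "?s > 0" using shift_bound_nonneg[of p E] \<eta> by (simp add: add_nonneg_pos)
  have cs: "cmod (complex_of_real (1 / ?s)) = 1 / ?s" using s by (simp only: norm_of_real) simp
  note r = green_residual[OF p \<eta>, of E, folded t_def]
  have step: "?v (Suc n) x - ?v n x = of_real (1 / ?s) * ?r n x" for n x
    by (simp add: green_residual_def)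
  \<comment> \<open>The increments are the residuals divided by \<open>s\<close>, hence a geometric series of sum \<open>1 / \<eta>\<^sup>2\<close>.\<close>
  have gap: "\<parallel>\<lambda>x. ?v (n + m) x - ?v n x\<parallel> \<le> (\<Sum>k<m. t ^ (n + k) / ?s)" for n m
  proof (induction m)
    case (Suc m)
    have a: "(\<lambda>x. ?v (n + m) x - ?v n x) \<in> ell2 G"
      by (intro ell2_diff GA_ell2 green_approx_GA p)
    have b: "(\<lambda>x. of_real (1 / ?s) * ?r (n + m) x) \<in> ell2 G" by (intro ell2_scale r)
    have "(\<lambda>x. ?v (n + Suc m) x - ?v n x) = (\<lambda>x. (?v (n + m) x - ?v n x) + of_real (1 / ?s) * ?r (n + m) x)"
      unfolding step[symmetric] by (simp del: green_approx.simps)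
    then have "\<parallel>\<lambda>x. ?v (n + Suc m) x - ?v n x\<parallel> \<le> \<parallel>\<lambda>x. ?v (n + m) x - ?v n x\<parallel> + \<parallel>\<lambda>x. of_real (1 / ?s) * ?r (n + m) x\<parallel>"
      using ell2_add(2)[OF a b] by simp
    also have "\<parallel>\<lambda>x. of_real (1 / ?s) * ?r (n + m) x\<parallel> = \<parallel>?r (n + m)\<parallel> / ?s"
      using ell2_scale(2)[OF r(1), of "of_real (1 / ?s)" "n + m"] by (simp only: cs) simp
    also have "\<dots> \<le> t ^ (n + m) / ?s" using r(2)[of "n + m"] s by (simp add: divide_right_mono)
    finally show ?case using Suc by simp
  qed simp
  have gap2: "\<parallel>\<lambda>x. ?v (n + m) x - ?v n x\<parallel> \<le> t ^ n / \<eta>\<^sup>2" for n m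
  proof -
    have "(\<Sum>k<m. t ^ (n + k) / ?s) = t ^ n / ?s * (\<Sum>k<m. t ^ k)"
      by (simp add: power_add sum_distrib_left sum_divide_distrib[symmetric])
    also have "\<dots> \<le> t ^ n / ?s * (1 / (1 - t))"
      using t s sum_gp_strict[of t m] by (intro mult_left_mono) (auto simp: divide_right_mono)
    also have "\<dots> = t ^ n / \<eta>\<^sup>2" using t(3) by simp
    finally show ?thesis using gap[of n m] by simp
  qed
  have sm: "summable (\<lambda>n. of_real (1 / ?s) * ?r n x)" for x
  proof (rule summable_comparison_test')
    show "summable (\<lambda>n. t ^ n / ?s)" using t by (intro summable_divide summable_geometric) simp
    fix n :: nat
    have "cmod (?r n x) \<le> t ^ n" using ell2_pointwise[OF r(1), of n x] r(2)[of n] by linarith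
    then show "norm (of_real (1 / ?s) * ?r n x) \<le> t ^ n / ?s"
      unfolding norm_mult cs using s by (simp add: divide_right_mono)
  qed
  define v where "v = (\<lambda>x. \<Sum>n. of_real (1 / ?s) * ?r n x)"
  have part: "?v n x = (\<Sum>k<n. of_real (1 / ?s) * ?r k x)" for n x
    by (induction n) (simp_all add: green_residual_def)
  have lim: "(\<lambda>n. ?v n x) \<longlonglongrightarrow> v x" for x
    unfolding part v_def using summable_LIMSEQ[OF sm] .
  have lim': "(\<lambda>m. ?v (n + m) x) \<longlonglongrightarrow> v x" for n x
    using LIMSEQ_ignore_initial_segment[OF lim[of x], of n] by (simp only: add.commute)
  have zero: "?v n x = 0" if "x \<notin> carrier G" for n x
    using GA_D(3)[OF green_approx_GA[OF p(1)] that] .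
  have v0: "v x = 0" if "x \<notin> carrier G" for x
    using lim[of x] zero[OF that] LIMSEQ_unique[OF _ tendsto_const] by (simp add: LIMSEQ_const_iff)
  \<comment> \<open>The partial sums converge pointwise only, so the norm bound passes to the limit on finite sets.\<close>
  have fatou: "(\<lambda>x. v x - ?v n x) \<in> ell2 G \<and> \<parallel>\<lambda>x. v x - ?v n x\<parallel> \<le> t ^ n / \<eta>\<^sup>2" for n
  proof -
    have "L2_set (\<lambda>x. cmod (v x - ?v n x)) A \<le> t ^ n / \<eta>\<^sup>2" if A: "finite A" "A \<subseteq> carrier G" for A
    proof (rule LIMSEQ_le_const2)
      show "(\<lambda>m. L2_set (\<lambda>x. cmod (?v (n + m) x - ?v n x)) A) \<longlonglongrightarrow> L2_set (\<lambda>x. cmod (v x - ?v n x)) A"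
        unfolding L2_set_def
        by (intro tendsto_real_sqrt tendsto_sum tendsto_power tendsto_norm tendsto_diff tendsto_const lim')
      show "\<exists>N. \<forall>m\<ge>N. L2_set (\<lambda>x. cmod (?v (n + m) x - ?v n x)) A \<le> t ^ n / \<eta>\<^sup>2"
        using ell2_L2_set_le[OF ell2_diff(1)[OF GA_ell2(1) GA_ell2(1)] A] green_approx_GA[OF p(1)] gap2[of n]
        by (meson order_trans)
    qed
    then show ?thesis using ell2_boundI[of "\<lambda>x. v x - ?v n x" "t ^ n / \<eta>\<^sup>2"] v0 zero by simp
  qed
  have v: "v \<in> ell2 G" using fatou[of 0] by simp
  have tn: "(\<lambda>n. t ^ n / \<eta>\<^sup>2) \<longlonglongrightarrow> 0"
    using tendsto_divide_zero[OF LIMSEQ_realpow_zero] t by blast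
  have conv: "(\<lambda>n. \<parallel>\<lambda>x. v x - ?v n x\<parallel>) \<longlonglongrightarrow> 0"
    by (rule tendsto_sandwich[OF _ _ tendsto_const tn]) (use fatou in auto)
  let ?d = "\<lambda>x. ell2_delta \<one> x - shifted_sq p E \<eta> v x"
  have d: "?d \<in> ell2 G" by (intro ell2_diff delta_ell2 shifted_sq_ell2 p v) simp
  have "\<parallel>?d\<parallel> \<le> t ^ n + ?s * (t ^ n / \<eta>\<^sup>2)" for n
  proof -
    have "?d = (\<lambda>x. ?r n x - shifted_sq p E \<eta> (\<lambda>x. v x - ?v n x) x)"
      unfolding shifted_sq_lin green_residual_def by simp
    then have "\<parallel>?d\<parallel> \<le> \<parallel>?r n\<parallel> + \<parallel>shifted_sq p E \<eta> (\<lambda>x. v x - ?v n x)\<parallel>"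
      using ell2_diff(2)[OF r(1) shifted_sq_ell2[OF p(1)]] fatou[of n] by simp
    also have "\<dots> \<le> t ^ n + ?s * \<parallel>\<lambda>x. v x - ?v n x\<parallel>"
      using r(2)[of n] shifted_sq_norm[OF p(1) conjunct1[OF fatou[of n]], of E \<eta>] by simp
    also have "\<dots> \<le> t ^ n + ?s * (t ^ n / \<eta>\<^sup>2)"
      using fatou[of n] s by (simp add: mult_left_mono del: times_divide_eq_right)
    finally show ?thesis .
  qed
  moreover have "(\<lambda>n. t ^ n + ?s * (t ^ n / \<eta>\<^sup>2)) \<longlonglongrightarrow> 0 + ?s * 0"
    using t by (intro tendsto_add tendsto_mult tn tendsto_const LIMSEQ_realpow_zero) auto
  ultimately have "\<parallel>?d\<parallel> \<le> 0"
    using LIMSEQ_le_const[of "\<lambda>n. t ^ n + ?s * (t ^ n / \<eta>\<^sup>2)" 0 "\<parallel>?d\<parallel>"] by auto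
  then have "\<parallel>?d\<parallel> = 0" using ell2_norm_nonneg[of ?d] by linarith
  then have "?d = (\<lambda>x. 0)" using ell2_norm_eq_0[OF d] by blast
  then have "shifted_sq p E \<eta> v = ell2_delta \<one>" by (simp add: fun_eq_iff)
  then show ?thesis using that v conv by blast
qed

text \<open>The operator \<open>P - E + i\<eta>\<close>, the second factor of \<open>(P - E)\<^sup>2 + \<eta>\<^sup>2 = (P - z) (P - E + i\<eta>)\<close>.\<close>

definition half_shifted where
  "half_shifted p E \<eta> u = (\<lambda>x. shifted p E u x + (\<i> * complex_of_real \<eta>) * u x)"

lemma half_shifted_ell2: "p \<in> GA \<Longrightarrow> u \<in> ell2 G \<Longrightarrow> half_shifted p E \<eta> u \<in> ell2 G"
  unfolding half_shifted_def by (intro ell2_add ell2_scale shifted_ell2)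

lemma half_shifted_inner:
  assumes p: "p \<in> GA" "p = star G p" and u: "u \<in> ell2 G" and v: "v \<in> ell2 G"
  shows "\<langle>half_shifted p E \<eta> u, half_shifted p E \<eta> v\<rangle> = \<langle>u, shifted_sq p E \<eta> v\<rangle>"
proof -
  let ?X = "shifted p E"
  have X: "?X u \<in> ell2 G" "?X v \<in> ell2 G" "?X (?X v) \<in> ell2 G" using shifted_ell2(1) p u v by auto
  note sc = ell2_scale(1)
  have "\<langle>half_shifted p E \<eta> u, half_shifted p E \<eta> v\<rangle> =
      \<langle>?X u, ?X v\<rangle> + \<i> * \<eta> * \<langle>?X u, v\<rangle> + (cnj (\<i> * \<eta>) * \<langle>u, ?X v\<rangle> + cnj (\<i> * \<eta>) * (\<i> * \<eta>) * \<langle>u, v\<rangle>)"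
    unfolding half_shifted_def using X u v
    by (simp add: inner_add_left inner_add_right ell2_add sc inner_scale_left inner_scale_right algebra_simps)
  also have "\<langle>?X u, v\<rangle> = \<langle>u, ?X v\<rangle>" using shifted_self_adjoint[OF p u v] .
  also have "\<langle>?X u, ?X v\<rangle> = \<langle>u, ?X (?X v)\<rangle>" using shifted_self_adjoint[OF p u X(2)] .
  finally have "\<langle>half_shifted p E \<eta> u, half_shifted p E \<eta> v\<rangle> = \<langle>u, ?X (?X v)\<rangle> + \<eta>\<^sup>2 * \<langle>u, v\<rangle>"
    by (simp add: power2_eq_square algebra_simps)
  also have "\<dots> = \<langle>u, shifted_sq p E \<eta> v\<rangle>"
    unfolding shifted_sq_def using X u v by (simp add: inner_add_right sc inner_scale_right)
  finally show ?thesis .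
qed

lemma shifted_right_translation:
  assumes "p \<in> GA" "h \<in> carrier G"
  shows "shifted p E (right_translation h u) = right_translation h (shifted p E u)"
  unfolding shifted_def right_translation_conv[OF assms(2) GA_D(2)[OF assms(1)]]
  by (auto simp: right_translation_def)

lemma half_shifted_right_translation:
  assumes "p \<in> GA" "h \<in> carrier G"
  shows "half_shifted p E \<eta> (right_translation h u) = right_translation h (half_shifted p E \<eta> u)"
  unfolding half_shifted_def shifted_right_translation[OF assms] by (auto simp: right_translation_def)

lemma shifted_sq_right_translation:
  assumes "p \<in> GA" "h \<in> carrier G"
  shows "shifted_sq p E \<eta> (right_translation h u) = right_translation h (shifted_sq p E \<eta> u)"
  unfolding shifted_sq_def shifted_right_translation[OF assms] by (auto simp: right_translation_def)

text \<open>A self-adjoint operator has no eigenvalue off the real axis.\<close>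

lemma resolvent_inj:
  assumes p: "p \<in> GA" "p = star G p" and \<eta>: "\<eta> > 0"
  shows "inj_on (\<lambda>u x. (p \<star> u) x - Complex E \<eta> * u x) (ell2 G)"
proof (rule inj_onI)
  fix a b assume a: "a \<in> ell2 G" and b: "b \<in> ell2 G"
    and eq: "(\<lambda>x. (p \<star> a) x - Complex E \<eta> * a x) = (\<lambda>x. (p \<star> b) x - Complex E \<eta> * b x)"
  define d where "d = (\<lambda>x. a x - b x)"
  have d: "d \<in> ell2 G" unfolding d_def using a b by (rule ell2_diff)
  have "shifted p E d x = (\<i> * of_real \<eta>) * d x" for x
    using fun_cong[OF eq, of x] unfolding shifted_def d_def conv_diff_right Complex_eq
    by (simp add: algebra_simps)
  then have X: "shifted p E d = (\<lambda>x. (\<i> * of_real \<eta>) * d x)" by blast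
  have "cnj (\<i> * of_real \<eta>) * \<langle>d, d\<rangle> = (\<i> * of_real \<eta>) * \<langle>d, d\<rangle>"
    using shifted_self_adjoint[OF p d d, of E] unfolding X inner_scale_left inner_scale_right .
  then have "\<langle>d, d\<rangle> = 0" using \<eta> by simp
  then have "\<parallel>d\<parallel> = 0" by (simp add: inner_self d)
  then have "d = (\<lambda>x. 0)" using ell2_norm_eq_0[OF d] by simp
  then show "a = b" unfolding d_def by (simp add: fun_eq_iff)
qed

text \<open>What the rest of the development uses of the solution of \<open>((P - E)\<^sup>2 + \<eta>\<^sup>2) v = \<delta>\<^sub>e\<close>: \<open>\<eta> v\<close> is, up to
  conjugation, the row of the unit in \<open>Im R\<close>, and it is a limit of elements of the group algebra.\<close>

definition green_like where
  "green_like p E \<eta> v \<longleftrightarrow> v \<in> ell2 G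
     \<and> (\<lambda>n. \<parallel>\<lambda>x. v x - green_approx p E \<eta> n x\<parallel>) \<longlonglongrightarrow> 0
     \<and> (\<forall>h\<in>carrier G. Im_resolvent G p (Complex E \<eta>) \<one> h = of_real \<eta> * cnj (v h)
          \<and> v (inv h) = cnj (v h) \<and> cmod (v h) \<le> Re (v \<one>))
     \<and> \<eta>\<^sup>2 * (\<parallel>v\<parallel>)\<^sup>2 \<le> Re (v \<one>)"

text \<open>If \<open>v\<^sub>h\<close> is the right translate of the solution \<open>v\<close>, then \<open>u\<^sub>h = (P - E + i\<eta>) v\<^sub>h\<close> solves
  \<open>(P - z) u\<^sub>h = \<delta>\<^sub>h\<close>, and the resolvent identity gives \<open>Im R(e, h) = \<eta> \<langle>u\<^sub>e, u\<^sub>h\<rangle> = \<eta> \<langle>v, \<delta>\<^sub>h\<rangle>\<close>. The symmetry and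
  the bounds are read off from these scalar products.\<close>

lemma green_function:
  assumes p: "p \<in> GA" "p = star G p" and \<eta>: "\<eta> > 0"
  shows "\<exists>v. green_like p E \<eta> v"
proof -
  obtain v where v: "v \<in> ell2 G" "shifted_sq p E \<eta> v = ell2_delta \<one>"
    and lim: "(\<lambda>n. \<parallel>\<lambda>x. v x - green_approx p E \<eta> n x\<parallel>) \<longlonglongrightarrow> 0"
    using green_limit[OF p \<eta>] by blast
  define w where "w = half_shifted p E \<eta> v"
  define R where "R = (\<lambda>h. right_translation h w)"
  have w: "w \<in> ell2 G" unfolding w_def by (rule half_shifted_ell2[OF p(1) v(1)])
  have R: "R h \<in> ell2 G" "\<parallel>R h\<parallel> = \<parallel>w\<parallel>" if "h \<in> carrier G" for h
    unfolding R_def using right_translation_ell2[OF that w] by auto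
  have R1: "R \<one> = w" using ell2_outside[OF w] unfolding R_def by (auto simp: right_translation_def)
  have Rh: "R h = half_shifted p E \<eta> (right_translation h v)" if "h \<in> carrier G" for h
    unfolding R_def w_def by (simp add: half_shifted_right_translation[OF p(1) that])
  have solve: "(p \<star> R h) x - Complex E \<eta> * R h x = ell2_delta h x" if h: "h \<in> carrier G" for h x
  proof -
    have "(p \<star> R h) x - Complex E \<eta> * R h x = shifted p E (R h) x - (\<i> * of_real \<eta>) * R h x"
      by (simp add: shifted_def Complex_eq algebra_simps)
    also have "\<dots> = shifted_sq p E \<eta> (right_translation h v) x"
      unfolding Rh[OF h] half_shifted_def shifted_lin shifted_sq_def
      by (simp add: algebra_simps power2_eq_square)
    also have "\<dots> = ell2_delta h x"
      unfolding shifted_sq_right_translation[OF p(1) h] v(2) right_translation_delta[OF h] ..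
    finally show ?thesis .
  qed
  have res: "resolvent G p (Complex E \<eta>) (ell2_delta h) = R h" if h: "h \<in> carrier G" for h
    unfolding resolvent_def
    by (rule the_inv_into_f_eq[OF resolvent_inj[OF p \<eta>]]) (use solve[OF h] R[OF h] in auto)
  have inner_R: "\<langle>R g, R h\<rangle> = cnj (v (h \<otimes> inv g))" if g: "g \<in> carrier G" and h: "h \<in> carrier G" for g h
  proof -
    have "\<langle>R g, R h\<rangle> = \<langle>right_translation g v, shifted_sq p E \<eta> (right_translation h v)\<rangle>"
      unfolding Rh[OF g] Rh[OF h]
      by (rule half_shifted_inner[OF p]) (use right_translation_ell2 g h v in auto)
    also have "\<dots> = \<langle>right_translation g v, ell2_delta h\<rangle>"
      unfolding shifted_sq_right_translation[OF p(1) h] v(2) right_translation_delta[OF h] ..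
    also have "\<dots> = cnj (v (h \<otimes> inv g))"
      using h by (simp add: inner_delta_right right_translation_def)
    finally show ?thesis .
  qed
  have sym: "v (inv h) = cnj (v h)" if h: "h \<in> carrier G" for h
    using inner_R[of h \<one>] inner_R[of \<one> h] inner_commute[of "R h" "R \<one>"] h by simp
  have w_sq: "Re (v \<one>) = (\<parallel>w\<parallel>)\<^sup>2"
    using inner_R[of \<one> \<one>] R1 inner_self[OF w] by (metis complex_cnj_cnj complex_cnj_complex_of_real inv_one one_closed r_one Re_complex_of_real)
  have Im: "Im_resolvent G p (Complex E \<eta>) \<one> h = of_real \<eta> * cnj (v h)" if h: "h \<in> carrier G" for h
  proof -
    have X: "shifted p E (R g) = (\<lambda>x. ell2_delta g x + (\<i> * of_real \<eta>) * R g x)" if "g \<in> carrier G" for g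
      using solve[OF that] by (auto simp: shifted_def Complex_eq algebra_simps fun_eq_iff)
    have "\<langle>shifted p E (R \<one>), R h\<rangle> = \<langle>R \<one>, shifted p E (R h)\<rangle>"
      by (rule shifted_self_adjoint[OF p]) (use R h in auto)
    then have "\<langle>ell2_delta \<one>, R h\<rangle> + cnj (\<i> * of_real \<eta>) * \<langle>R \<one>, R h\<rangle>
        = \<langle>R \<one>, ell2_delta h\<rangle> + (\<i> * of_real \<eta>) * \<langle>R \<one>, R h\<rangle>"
      unfolding X[OF h] X[OF one_closed]
      using R h by (simp add: inner_add_left inner_add_right inner_scale_left inner_scale_right delta_ell2 ell2_scale)
    then have "\<langle>ell2_delta \<one>, R h\<rangle> - \<langle>R \<one>, ell2_delta h\<rangle> = (2 * \<i>) * (of_real \<eta> * \<langle>R \<one>, R h\<rangle>)"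
      by (simp add: algebra_simps)
    then show ?thesis
      unfolding Im_resolvent_def res[OF h] res[OF one_closed] using inner_R[of \<one> h] h by simp
  qed
  have bnd: "cmod (v h) \<le> Re (v \<one>)" if h: "h \<in> carrier G" for h
  proof -
    have "cmod (v h) = cmod \<langle>R \<one>, R h\<rangle>" using inner_R[of \<one> h] h by simp
    also have "\<dots> \<le> \<parallel>R \<one>\<parallel> * \<parallel>R h\<parallel>" by (rule inner_Cauchy_Schwarz) (use R h in auto)
    also have "\<dots> = Re (v \<one>)" using R[OF h] R[OF one_closed] by (simp add: w_sq power2_eq_square)
    finally show ?thesis .
  qed
  have "\<eta>\<^sup>2 * (\<parallel>v\<parallel>)\<^sup>2 \<le> Re (v \<one>)"
  proof -
    have X: "shifted p E v \<in> ell2 G" using shifted_ell2(1)[OF p(1) v(1)] .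
    have "\<langle>v, shifted_sq p E \<eta> v\<rangle> = \<langle>shifted p E v, shifted p E v\<rangle> + \<eta>\<^sup>2 * \<langle>v, v\<rangle>"
      unfolding shifted_sq_def shifted_self_adjoint[OF p v(1) X]
      using v shifted_ell2(1)[OF p(1) X] by (simp add: inner_add_right ell2_scale inner_scale_right)
    then have "Re (v \<one>) = (\<parallel>shifted p E v\<parallel>)\<^sup>2 + \<eta>\<^sup>2 * (\<parallel>v\<parallel>)\<^sup>2"
      unfolding v(2) inner_delta_right[OF one_closed]
      using arg_cong[of "cnj (v \<one>)" _ Re] by (metis (no_types, lifting) X inner_self v(1) Re_complex_of_real cnj.simps(1) of_real_add of_real_mult)
    then show ?thesis by simp
  qed
  then have "green_like p E \<eta> v" unfolding green_like_def using v(1) lim Im sym bnd by simp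
  then show ?thesis by blast
qed

end

section \<open>Orthonormal families in finite dimension\<close>

definition vec_sq :: "nat \<Rightarrow> (nat \<Rightarrow> complex) \<Rightarrow> real" where
  "vec_sq N a = (\<Sum>x\<in>{1..N}. (cmod (a x))\<^sup>2)"

definition frobenius_sq :: "nat \<Rightarrow> (nat \<Rightarrow> nat \<Rightarrow> complex) \<Rightarrow> real" where
  "frobenius_sq N M = (\<Sum>x\<in>{1..N}. vec_sq N (M x))"

definition orthonormal_family where
  "orthonormal_family N J v \<longleftrightarrow> finite J \<and> (\<forall>i\<in>J. \<forall>j\<in>J. cinner N (v i) (v j) = (if i = j then 1 else 0))"

lemma vec_sq_nonneg [simp]: "vec_sq N a \<ge> 0"
  by (simp add: vec_sq_def sum_nonneg)

lemma vec_sq_eq_0: "vec_sq N a = 0 \<longleftrightarrow> (\<forall>x\<in>{1..N}. a x = 0)"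
  unfolding vec_sq_def by (subst sum_nonneg_eq_0_iff) auto

lemma cinner_self: "cinner N a a = of_real (vec_sq N a)"
  unfolding cinner_def vec_sq_def of_real_sum
  by (rule sum.cong, simp, subst complex_norm_square, rule mult.commute)

lemma cinner_commute: "cinner N b a = cnj (cinner N a b)"
  by (simp add: cinner_def mult.commute)

lemma cinner_diff_right: "cinner N a (\<lambda>x. b x - c x) = cinner N a b - cinner N a c"
  by (simp add: cinner_def right_diff_distrib sum_subtractf)

lemma cinner_scale_right: "cinner N a (\<lambda>x. k * b x) = k * cinner N a b"
  by (simp add: cinner_def sum_distrib_left mult.left_commute)

lemma cinner_sum_right: "cinner N a (\<lambda>x. \<Sum>j\<in>J. f j x) = (\<Sum>j\<in>J. cinner N a (f j))"
  unfolding cinner_def sum_distrib_left by (rule sum.swap)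

lemma Cauchy_Schwarz_cinner: "(cmod (cinner N a b))\<^sup>2 \<le> vec_sq N a * vec_sq N b"
proof -
  have "cmod (cinner N a b) \<le> (\<Sum>x\<in>{1..N}. \<bar>cmod (a x)\<bar> * \<bar>cmod (b x)\<bar>)"
    unfolding cinner_def by (rule order_trans[OF norm_sum]) (simp add: norm_mult)
  also have "\<dots> \<le> sqrt (vec_sq N a) * sqrt (vec_sq N b)"
    unfolding vec_sq_def using L2_set_mult_ineq[of "\<lambda>x. cmod (a x)" "\<lambda>x. cmod (b x)" "{1..N}"]
    unfolding L2_set_def by simp
  finally have "(cmod (cinner N a b))\<^sup>2 \<le> (sqrt (vec_sq N a) * sqrt (vec_sq N b))\<^sup>2"
    by (rule power_mono) simp
  then show ?thesis by (simp add: power_mult_distrib)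
qed

lemma Bessel_identity:
  assumes "orthonormal_family N J v"
  shows "vec_sq N (\<lambda>x. b x - (\<Sum>j\<in>J. cinner N (v j) b * v j x)) = vec_sq N b - (\<Sum>j\<in>J. (cmod (cinner N (v j) b))\<^sup>2)"
proof -
  have J: "finite J" and on: "\<And>i j. i \<in> J \<Longrightarrow> j \<in> J \<Longrightarrow> cinner N (v i) (v j) = (if i = j then 1 else 0)"
    using assms by (auto simp: orthonormal_family_def)
  define w where "w = (\<lambda>x. b x - (\<Sum>j\<in>J. cinner N (v j) b * v j x))"
  have expand: "cinner N a w = cinner N a b - (\<Sum>j\<in>J. cinner N (v j) b * cinner N a (v j))" for a
    unfolding w_def cinner_diff_right cinner_sum_right cinner_scale_right ..
  have orth: "cinner N (v k) w = 0" if "k \<in> J" for k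
  proof -
    have "(\<Sum>j\<in>J. cinner N (v j) b * cinner N (v k) (v j)) = (\<Sum>j\<in>J. if j = k then cinner N (v j) b else 0)"
      by (rule sum.cong) (use on that in auto)
    then show ?thesis unfolding expand using J that by simp
  qed
  have "cinner N w w = cinner N w b"
    unfolding expand[of w] using orth by (simp add: cinner_commute[of N w "v _"])
  also have "\<dots> = cnj (cinner N b w)" by (rule cinner_commute)
  also have "\<dots> = cinner N b b - (\<Sum>j\<in>J. of_real ((cmod (cinner N (v j) b))\<^sup>2))"
    unfolding expand[of b] complex_norm_square by (simp add: cinner_commute[of N b] cinner_self mult.commute)
  finally have "complex_of_real (vec_sq N w) = of_real (vec_sq N b - (\<Sum>j\<in>J. (cmod (cinner N (v j) b))\<^sup>2))"
    by (simp add: cinner_self)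
  then show ?thesis unfolding w_def of_real_eq_iff .
qed

lemma Bessel:
  assumes "orthonormal_family N J v"
  shows "(\<Sum>j\<in>J. (cmod (cinner N (v j) b))\<^sup>2) \<le> vec_sq N b"
  using Bessel_identity[OF assms, of b] vec_sq_nonneg[of N "\<lambda>x. b x - (\<Sum>j\<in>J. cinner N (v j) b * v j x)"]
  by linarith

lemma cinner_unit_vector: "x \<in> {1..N} \<Longrightarrow> cinner N a (\<lambda>y. if y = x then 1 else 0) = cnj (a x)"
  by (simp add: cinner_def if_distrib cong: if_cong)

lemma vec_sq_unit_vector: "x \<in> {1..N} \<Longrightarrow> vec_sq N (\<lambda>y. if y = x then 1 else 0) = 1"
  unfolding vec_sq_def by (simp add: if_distrib[of cmod] if_distrib[of "\<lambda>x. x\<^sup>2"] cong: if_cong)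

lemma vec_sq_orthonormal: "orthonormal_family N J v \<Longrightarrow> j \<in> J \<Longrightarrow> vec_sq N (v j) = 1"
  using cinner_self[of N "v j"] by (auto simp: orthonormal_family_def)

lemma sum_orthonormal: "orthonormal_family N J v \<Longrightarrow> (\<Sum>x\<in>{1..N}. \<Sum>j\<in>J. (cmod (v j x))\<^sup>2) = card J"
  using vec_sq_orthonormal[of N J v] unfolding vec_sq_def by (subst sum.swap) simp

lemma sum_orthonormal_at_point:
  assumes "orthonormal_family N J v" "x \<in> {1..N}"
  shows "(\<Sum>j\<in>J. (cmod (v j x))\<^sup>2) \<le> 1"
  using Bessel[OF assms(1), of "\<lambda>y. if y = x then 1 else 0"]
  by (simp only: cinner_unit_vector[OF assms(2)] vec_sq_unit_vector[OF assms(2)] complex_mod_cnj)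

lemma card_orthonormal_le: 
  assumes "orthonormal_family N J v"
  shows "card J \<le> N"
proof -
  have "real (card J) \<le> (\<Sum>x\<in>{1..N}. 1)"
    unfolding sum_orthonormal[OF assms, symmetric]
    by (rule sum_mono) (rule sum_orthonormal_at_point[OF assms])
  then show ?thesis by simp
qed

text \<open>The Bessel inequalities for the \<open>N\<close> unit vectors sum up to an equality, so each of them is one.\<close>

lemma orthonormal_complete:
  assumes on: "orthonormal_family N J v" and "card J = N" and x: "x \<in> {1..N}" and y: "y \<in> {1..N}"
  shows "(\<Sum>j\<in>J. v j x * cnj (v j y)) = (if x = y then 1 else 0)"
proof -
  let ?d = "\<lambda>z. if z = y then (1::complex) else 0"
  have "(\<Sum>z\<in>{1..N}. 1 - (\<Sum>j\<in>J. (cmod (v j z))\<^sup>2)) = 0"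
    using sum_orthonormal[OF on] assms(2) by (simp add: sum_subtractf)
  then have "1 - (\<Sum>j\<in>J. (cmod (v j y))\<^sup>2) = 0"
    using sum_orthonormal_at_point[OF on] y
    by (subst (asm) sum_nonneg_eq_0_iff) auto
  then have "vec_sq N ?d - (\<Sum>j\<in>J. (cmod (cinner N (v j) ?d))\<^sup>2) = 0"
    by (simp only: cinner_unit_vector[OF y] vec_sq_unit_vector[OF y] complex_mod_cnj)
  then have "vec_sq N (\<lambda>z. ?d z - (\<Sum>j\<in>J. cinner N (v j) ?d * v j z)) = 0"
    by (subst Bessel_identity[OF on])
  then have "?d x - (\<Sum>j\<in>J. cinner N (v j) ?d * v j x) = 0"
    using x unfolding vec_sq_eq_0 by blast
  then show ?thesis unfolding cinner_unit_vector[OF y] by (simp add: mult.commute[of "cnj _"])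
qed

lemma Parseval:
  assumes on: "orthonormal_family N J v" and card: "card J = N"
  shows "(\<Sum>j\<in>J. (cmod (cinner N (v j) b))\<^sup>2) = vec_sq N b"
proof -
  have "(\<Sum>j\<in>J. cinner N (v j) b * v j x) = b x" if x: "x \<in> {1..N}" for x
  proof -
    have "(\<Sum>j\<in>J. cinner N (v j) b * v j x) = (\<Sum>j\<in>J. \<Sum>y\<in>{1..N}. b y * (v j x * cnj (v j y)))"
      unfolding cinner_def sum_distrib_right by (intro sum.cong refl) (simp add: mult_ac)
    also have "\<dots> = (\<Sum>y\<in>{1..N}. b y * (\<Sum>j\<in>J. v j x * cnj (v j y)))"
      by (subst sum.swap) (simp add: sum_distrib_left)
    also have "\<dots> = (\<Sum>y\<in>{1..N}. if x = y then b y else 0)"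
      by (rule sum.cong) (simp_all add: orthonormal_complete[OF on card x])
    finally show ?thesis using x by simp
  qed
  then have "vec_sq N (\<lambda>x. b x - (\<Sum>j\<in>J. cinner N (v j) b * v j x)) = 0"
    unfolding vec_sq_eq_0 by simp
  then show ?thesis unfolding Bessel_identity[OF on] by simp
qed

lemma mat_vec_cinner: "mat_vec N M a x = cinner N (\<lambda>y. cnj (M x y)) a"
  by (simp add: mat_vec_def cinner_def)

lemma vec_sq_cnj: "vec_sq N (\<lambda>y. cnj (a y)) = vec_sq N a"
  by (simp add: vec_sq_def)

lemma frobenius_Bessel:
  assumes "orthonormal_family N J v"
  shows "(\<Sum>j\<in>J. vec_sq N (mat_vec N M (v j))) \<le> frobenius_sq N M"
proof -
  have "(\<Sum>j\<in>J. vec_sq N (mat_vec N M (v j))) = (\<Sum>x\<in>{1..N}. \<Sum>j\<in>J. (cmod (cinner N (v j) (\<lambda>y. cnj (M x y))))\<^sup>2)"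
    unfolding vec_sq_def mat_vec_cinner
    by (subst sum.swap) (simp add: cinner_commute[of N "\<lambda>y. cnj (M _ y)"])
  also have "\<dots> \<le> frobenius_sq N M"
    unfolding frobenius_sq_def by (rule sum_mono, subst vec_sq_cnj[symmetric]) (rule Bessel[OF assms])
  finally show ?thesis .
qed

lemma frobenius_Parseval:
  assumes "orthonormal_family N J v" "card J = N"
  shows "(\<Sum>i\<in>J. \<Sum>j\<in>J. (cmod (cinner N (v j) (mat_vec N M (v i))))\<^sup>2) = frobenius_sq N M"
proof -
  have "(\<Sum>i\<in>J. \<Sum>j\<in>J. (cmod (cinner N (v j) (mat_vec N M (v i))))\<^sup>2) = (\<Sum>i\<in>J. vec_sq N (mat_vec N M (v i)))"
    unfolding Parseval[OF assms] ..
  also have "\<dots> = (\<Sum>x\<in>{1..N}. \<Sum>j\<in>J. (cmod (cinner N (v j) (\<lambda>y. cnj (M x y))))\<^sup>2)"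
    unfolding vec_sq_def mat_vec_cinner
    by (subst sum.swap) (simp add: cinner_commute[of N "\<lambda>y. cnj (M _ y)"])
  also have "\<dots> = frobenius_sq N M"
    unfolding frobenius_sq_def Parseval[OF assms] vec_sq_cnj ..
  finally show ?thesis .
qed

text \<open>A maximal orthonormal family of vectors that \<open>M\<close> stretches by more than the square root of
  \<open>c\<close> does the work of a spectral subspace of \<open>M\<^sup>*M\<close>.\<close>

lemma few_stretched_directions:
  assumes c: "c > 0"
  obtains V where "finite V" "\<And>v x. v \<in> V \<Longrightarrow> x \<notin> {1..N} \<Longrightarrow> v x = 0" "c * real (card V) \<le> frobenius_sq N M"
    "\<And>a. (\<And>v. v \<in> V \<Longrightarrow> cinner N v a = 0) \<Longrightarrow> vec_sq N (mat_vec N M a) \<le> c * vec_sq N a"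
proof -
  define good where "good V \<longleftrightarrow> orthonormal_family N V (\<lambda>v. v) \<and> (\<forall>v\<in>V. \<forall>x. x \<notin> {1..N} \<longrightarrow> v x = 0)
      \<and> (\<forall>v\<in>V. c \<le> vec_sq N (mat_vec N M v))" for V
  have "good {}" by (simp add: good_def orthonormal_family_def)
  moreover have "\<forall>V. good V \<longrightarrow> card V < Suc N"
    using card_orthonormal_le unfolding good_def by (metis less_Suc_eq_le)
  ultimately obtain V where V: "good V" and max: "\<And>W. good W \<Longrightarrow> card W \<le> card V"
    using ex_has_greatest_nat[of good "{}" card "Suc N"] by blast
  have on: "orthonormal_family N V (\<lambda>v. v)" and fin: "finite V" using V by (auto simp: good_def orthonormal_family_def)
  show ?thesis
  proof
    show "finite V" by fact
    show "v x = 0" if "v \<in> V" "x \<notin> {1..N}" for v x using V that by (auto simp: good_def)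
    have "c * real (card V) = (\<Sum>v\<in>V. c)" by simp
    also have "\<dots> \<le> (\<Sum>v\<in>V. vec_sq N (mat_vec N M v))"
      by (rule sum_mono) (use V in \<open>auto simp: good_def\<close>)
    also have "\<dots> \<le> frobenius_sq N M" by (rule frobenius_Bessel[OF on])
    finally show "c * real (card V) \<le> frobenius_sq N M" .
    fix a assume orth: "\<And>v. v \<in> V \<Longrightarrow> cinner N v a = 0"
    show "vec_sq N (mat_vec N M a) \<le> c * vec_sq N a"
    proof (rule ccontr)
      assume less: "\<not> vec_sq N (mat_vec N M a) \<le> c * vec_sq N a"
      have "vec_sq N a \<noteq> 0"
      proof
        assume "vec_sq N a = 0"
        then have "vec_sq N (mat_vec N M a) = 0" unfolding vec_sq_eq_0 by (simp add: mat_vec_def)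
        then show False using less \<open>vec_sq N a = 0\<close> by simp
      qed
      then have pos: "vec_sq N a > 0" using vec_sq_nonneg[of N a] by linarith
      define k where "k = complex_of_real (1 / sqrt (vec_sq N a))"
      have k: "(cmod k)\<^sup>2 = 1 / vec_sq N a" unfolding k_def norm_of_real using pos by (simp add: power_divide)
      define b where "b = (\<lambda>x. if x \<in> {1..N} then k * a x else 0)"
      have "cinner N v b = k * cinner N v a" for v
        unfolding b_def cinner_def sum_distrib_left by (rule sum.cong) auto
      then have vb: "cinner N v b = 0" "cinner N b v = 0" if "v \<in> V" for v
        using orth[OF that] cinner_commute[of N b v] by auto
      have "vec_sq N b = (cmod k)\<^sup>2 * vec_sq N a"
        unfolding b_def vec_sq_def sum_distrib_left by (rule sum.cong) (auto simp: norm_mult power_mult_distrib)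
      then have bb: "cinner N b b = 1" using k pos by (simp add: cinner_self)
      have "mat_vec N M b = (\<lambda>x. k * mat_vec N M a x)"
        unfolding mat_vec_def b_def sum_distrib_left by (intro ext sum.cong) auto
      then have "vec_sq N (mat_vec N M b) = (cmod k)\<^sup>2 * vec_sq N (mat_vec N M a)"
        by (simp add: vec_sq_def norm_mult power_mult_distrib sum_distrib_left)
      then have large: "c \<le> vec_sq N (mat_vec N M b)" 
      proof -
        assume "vec_sq N (mat_vec N M b) = (cmod k)\<^sup>2 * vec_sq N (mat_vec N M a)"
        then have "vec_sq N (mat_vec N M a) = vec_sq N a * vec_sq N (mat_vec N M b)" using pos k by simp
        then have "vec_sq N a * c < vec_sq N a * vec_sq N (mat_vec N M b)" using less by (simp add: mult.commute)
        then show "c \<le> vec_sq N (mat_vec N M b)" using pos by simp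
      qed
      have "b \<notin> V" using vb bb by force
      have "orthonormal_family N (insert b V) (\<lambda>v. v)"
        using on vb bb unfolding orthonormal_family_def by auto
      then have "good (insert b V)" using V large unfolding good_def by (auto simp: b_def)
      then have "card (insert b V) \<le> card V" by (rule max)
      then show False using fin \<open>b \<notin> V\<close> by simp
    qed
  qed
qed

lemma spectral_expansion:
  assumes on: "orthonormal_family N J v" and card: "card J = N"
    and ev: "\<And>j x. j \<in> J \<Longrightarrow> x \<in> {1..N} \<Longrightarrow> mat_vec N Q (v j) x = q j * v j x"
    and x: "x \<in> {1..N}" and y: "y \<in> {1..N}"
  shows "Q x y = (\<Sum>j\<in>J. q j * v j x * cnj (v j y))"
proof -
  have "(\<Sum>j\<in>J. q j * v j x * cnj (v j y)) = (\<Sum>j\<in>J. \<Sum>z\<in>{1..N}. Q x z * (v j z * cnj (v j y)))"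
  proof (rule sum.cong[OF refl])
    fix j assume "j \<in> J"
    then have "q j * v j x * cnj (v j y) = mat_vec N Q (v j) x * cnj (v j y)" using ev x by simp
    then show "q j * v j x * cnj (v j y) = (\<Sum>z\<in>{1..N}. Q x z * (v j z * cnj (v j y)))"
      by (simp add: mat_vec_def sum_distrib_right mult.assoc)
  qed
  also have "\<dots> = (\<Sum>z\<in>{1..N}. Q x z * (\<Sum>j\<in>J. v j z * cnj (v j y)))"
    by (subst sum.swap) (simp add: sum_distrib_left)
  also have "\<dots> = (\<Sum>z\<in>{1..N}. if z = y then Q x z else 0)"
    by (rule sum.cong) (simp_all add: orthonormal_complete[OF on card _ y])
  finally show ?thesis using y by simp
qed

text \<open>The left-hand side is the trace of \<open>Q\<^sub>2 B Q\<^sub>1 B\<^sup>*\<close>, computed in the eigenbasis, for the product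
  \<open>B\<close> of a permutation matrix with a diagonal one.\<close>

lemma weighted_matrix_elements:
  fixes v :: "'j \<Rightarrow> nat \<Rightarrow> complex" and q\<^sub>1 q\<^sub>2 :: "'j \<Rightarrow> real"
  assumes on: "orthonormal_family N J v" and card: "card J = N"
    and ev1: "\<And>j x. j \<in> J \<Longrightarrow> x \<in> {1..N} \<Longrightarrow> mat_vec N Q\<^sub>1 (v j) x = of_real (q\<^sub>1 j) * v j x"
    and ev2: "\<And>j x. j \<in> J \<Longrightarrow> x \<in> {1..N} \<Longrightarrow> mat_vec N Q\<^sub>2 (v j) x = of_real (q\<^sub>2 j) * v j x"
    and \<pi>: "\<And>x. x \<in> {1..N} \<Longrightarrow> \<pi> x \<in> {1..N}"
  shows "complex_of_real (\<Sum>i\<in>J. \<Sum>j\<in>J. q\<^sub>1 i * q\<^sub>2 j * (cmod (\<Sum>y\<in>{1..N}. cnj (v j (\<pi> y)) * a y * v i y))\<^sup>2)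
    = (\<Sum>y\<in>{1..N}. \<Sum>y'\<in>{1..N}. a y * cnj (a y') * Q\<^sub>1 y y' * Q\<^sub>2 (\<pi> y') (\<pi> y))"
proof -
  let ?R = "{1..N}"
  \<comment> \<open>The square is a double sum, in which the spectral expansions of \<open>Q\<^sub>1\<close> and \<open>Q\<^sub>2\<close> are recognised.\<close>
  have sq: "of_real (q\<^sub>1 i * q\<^sub>2 j * (cmod (\<Sum>y\<in>?R. cnj (v j (\<pi> y)) * a y * v i y))\<^sup>2) =
      (\<Sum>y\<in>?R. \<Sum>y'\<in>?R. a y * cnj (a y') * (of_real (q\<^sub>1 i) * v i y * cnj (v i y')) *
        (of_real (q\<^sub>2 j) * v j (\<pi> y') * cnj (v j (\<pi> y))))" for i j
  proof -
    let ?f = "\<lambda>y. cnj (v j (\<pi> y)) * a y * v i y"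
    have "of_real (q\<^sub>1 i * q\<^sub>2 j * (cmod (\<Sum>y\<in>?R. ?f y))\<^sup>2) =
        of_real (q\<^sub>1 i * q\<^sub>2 j) * ((\<Sum>y\<in>?R. ?f y) * cnj (\<Sum>y\<in>?R. ?f y))"
      by (simp only: of_real_mult complex_norm_square)
    also have "(\<Sum>y\<in>?R. ?f y) * cnj (\<Sum>y\<in>?R. ?f y) = (\<Sum>y\<in>?R. \<Sum>y'\<in>?R. ?f y * cnj (?f y'))"
      by (simp only: cnj_sum sum_product)
    finally have "of_real (q\<^sub>1 i * q\<^sub>2 j * (cmod (\<Sum>y\<in>?R. ?f y))\<^sup>2) =
        (\<Sum>y\<in>?R. \<Sum>y'\<in>?R. of_real (q\<^sub>1 i * q\<^sub>2 j) * (?f y * cnj (?f y')))"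
      by (simp only: sum_distrib_left)
    then show ?thesis
      by (simp add: mult_ac)
  qed
  have "complex_of_real (\<Sum>i\<in>J. \<Sum>j\<in>J. q\<^sub>1 i * q\<^sub>2 j * (cmod (\<Sum>y\<in>?R. cnj (v j (\<pi> y)) * a y * v i y))\<^sup>2)
    = (\<Sum>i\<in>J. \<Sum>j\<in>J. \<Sum>y\<in>?R. \<Sum>y'\<in>?R. a y * cnj (a y') * (of_real (q\<^sub>1 i) * v i y * cnj (v i y')) *
        (of_real (q\<^sub>2 j) * v j (\<pi> y') * cnj (v j (\<pi> y))))"
    unfolding of_real_sum sq ..
  also have "\<dots> = (\<Sum>y\<in>?R. \<Sum>y'\<in>?R. \<Sum>i\<in>J. \<Sum>j\<in>J. a y * cnj (a y') * (of_real (q\<^sub>1 i) * v i y * cnj (v i y')) *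
        (of_real (q\<^sub>2 j) * v j (\<pi> y') * cnj (v j (\<pi> y))))"
  proof -
    have sw: "(\<Sum>i\<in>J. \<Sum>j\<in>J. \<Sum>y\<in>?R. \<Sum>y'\<in>?R. F i j y y') = (\<Sum>y\<in>?R. \<Sum>y'\<in>?R. \<Sum>i\<in>J. \<Sum>j\<in>J. F i j y y')"
      for F :: "'j \<Rightarrow> 'j \<Rightarrow> nat \<Rightarrow> nat \<Rightarrow> complex"
    proof -
      have "(\<Sum>i\<in>J. \<Sum>j\<in>J. \<Sum>y\<in>?R. \<Sum>y'\<in>?R. F i j y y') = (\<Sum>i\<in>J. \<Sum>y\<in>?R. \<Sum>j\<in>J. \<Sum>y'\<in>?R. F i j y y')"
        by (intro sum.cong refl sum.swap)
      also have "\<dots> = (\<Sum>y\<in>?R. \<Sum>i\<in>J. \<Sum>j\<in>J. \<Sum>y'\<in>?R. F i j y y')" by (rule sum.swap)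
      also have "\<dots> = (\<Sum>y\<in>?R. \<Sum>i\<in>J. \<Sum>y'\<in>?R. \<Sum>j\<in>J. F i j y y')"
        by (intro sum.cong refl sum.swap)
      also have "\<dots> = (\<Sum>y\<in>?R. \<Sum>y'\<in>?R. \<Sum>i\<in>J. \<Sum>j\<in>J. F i j y y')"
        by (intro sum.cong refl sum.swap)
      finally show ?thesis .
    qed
    show ?thesis by (rule sw)
  qed
  also have "\<dots> = (\<Sum>y\<in>?R. \<Sum>y'\<in>?R. a y * cnj (a y') * Q\<^sub>1 y y' * Q\<^sub>2 (\<pi> y') (\<pi> y))"
  proof (intro sum.cong refl)
    fix y y' assume y: "y \<in> ?R" "y' \<in> ?R"
    show "(\<Sum>i\<in>J. \<Sum>j\<in>J. a y * cnj (a y') * (of_real (q\<^sub>1 i) * v i y * cnj (v i y')) *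
        (of_real (q\<^sub>2 j) * v j (\<pi> y') * cnj (v j (\<pi> y)))) = a y * cnj (a y') * Q\<^sub>1 y y' * Q\<^sub>2 (\<pi> y') (\<pi> y)"
      unfolding spectral_expansion[OF on card ev1 y, simplified] spectral_expansion[OF on card ev2 \<pi>[OF y(2)] \<pi>[OF y(1)], simplified]
      by (simp only: sum_distrib_left sum_distrib_right mult.assoc, rule sum.swap)
  qed
  finally show ?thesis .
qed

lemma eigenbasis_orthonormal:
  assumes "orthonormal_eigenbasis N M \<phi> ev"
  shows "orthonormal_family N {1..N} \<phi>"
  using assms by (simp add: orthonormal_eigenbasis_def orthonormal_family_def)

section \<open>Permutation representations of the group algebra\<close>

locale permutation_rep = group G for G (structure) +
  fixes N :: nat and \<rho> :: "'a \<Rightarrow> nat \<Rightarrow> nat"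
  assumes hom: "\<rho> \<in> hom G (sym_group N)"
begin

lemma rep_permutes: "g \<in> carrier G \<Longrightarrow> \<rho> g permutes {1..N}"
  using hom by (auto simp: hom_def sym_group_def)

lemma rep_in: "g \<in> carrier G \<Longrightarrow> x \<in> {1..N} \<Longrightarrow> \<rho> g x \<in> {1..N}"
  using permutes_in_image[OF rep_permutes] by blast

lemma rep_inj: "g \<in> carrier G \<Longrightarrow> \<rho> g x = \<rho> g y \<longleftrightarrow> x = y"
  using permutes_inj[OF rep_permutes] by (auto simp: inj_def)

lemma rep_mult: "g \<in> carrier G \<Longrightarrow> h \<in> carrier G \<Longrightarrow> \<rho> (g \<otimes> h) x = \<rho> g (\<rho> h x)"
  using hom by (simp add: hom_def sym_group_def)

lemma rep_one: "\<rho> \<one> x = x"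
  using rep_mult[of \<one> \<one> x] rep_inj[of \<one> "\<rho> \<one> x" x] by simp

lemma rep_inv: "g \<in> carrier G \<Longrightarrow> \<rho> (inv g) (\<rho> g x) = x" "g \<in> carrier G \<Longrightarrow> \<rho> g (\<rho> (inv g) x) = x"
  using rep_mult[of "inv g" g x] rep_mult[of g "inv g" x] by (simp_all add: rep_one)

lemma rep_eq_iff: "g \<in> carrier G \<Longrightarrow> x = \<rho> g y \<longleftrightarrow> y = \<rho> (inv g) x"
  using rep_inv by metis

lemma rep_bij: "g \<in> carrier G \<Longrightarrow> bij_betw (\<rho> g) {1..N} {1..N}"
  using permutes_imp_bij[OF rep_permutes] .

definition fixed_count :: "'a \<Rightarrow> real" where
  "fixed_count g = (\<Sum>x\<in>{1..N}. if \<rho> g x = x then 1 else 0)"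

lemma fixed_count_nonneg: "fixed_count g \<ge> 0"
  unfolding fixed_count_def by (rule sum_nonneg) simp

lemma trace_perm_mat: "mat_trace N (perm_mat (\<rho> g)) = of_real (fixed_count g)"
  unfolding mat_trace_def perm_mat_def fixed_count_def of_real_sum by (intro sum.cong) auto

lemma rep_apply:
  assumes "finite A" "supp q \<subseteq> A" "A \<subseteq> carrier G" "x \<in> {1..N}"
  shows "mat_vec N (rep_mat \<rho> q) a x = (\<Sum>g\<in>A. q g * a (\<rho> (inv g) x))"
proof -
  have "mat_vec N (rep_mat \<rho> q) a x = (\<Sum>y\<in>{1..N}. \<Sum>g\<in>supp q. q g * (if y = \<rho> (inv g) x then a y else 0))"
    unfolding mat_vec_def rep_mat_def sum_distrib_right
  proof (intro sum.cong refl)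
    fix y g assume "g \<in> supp q"
    then have "g \<in> carrier G" using assms by auto
    then show "q g * perm_mat (\<rho> g) x y * a y = q g * (if y = \<rho> (inv g) x then a y else 0)"
      using rep_eq_iff[of g x y] by (simp add: perm_mat_def)
  qed
  also have "\<dots> = (\<Sum>g\<in>supp q. q g * (\<Sum>y\<in>{1..N}. if y = \<rho> (inv g) x then a y else 0))"
    unfolding sum_distrib_left by (rule sum.swap)
  also have "\<dots> = (\<Sum>g\<in>supp q. q g * a (\<rho> (inv g) x))"
  proof (intro sum.cong refl)
    fix g assume "g \<in> supp q"
    then have "\<rho> (inv g) x \<in> {1..N}" using assms by (intro rep_in) auto
    then show "q g * (\<Sum>y\<in>{1..N}. if y = \<rho> (inv g) x then a y else 0) = q g * a (\<rho> (inv g) x)" by simp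
  qed
  also have "\<dots> = (\<Sum>g\<in>A. q g * a (\<rho> (inv g) x))"
    by (rule sum.mono_neutral_left) (use assms in \<open>auto simp: supp_def\<close>)
  finally show ?thesis .
qed

lemmas rep_apply_supp = rep_apply[OF GA_D(1) order_refl GA_D(2)]

lemma mat_vec_cong: "(\<And>x. x \<in> {1..N} \<Longrightarrow> a x = b x) \<Longrightarrow> mat_vec N M a = mat_vec N M b"
  unfolding mat_vec_def by (intro ext sum.cong) auto

lemma rep_diff:
  assumes "q \<in> GA" "r \<in> GA" "x \<in> {1..N}"
  shows "mat_vec N (rep_mat \<rho> (\<lambda>g. q g - r g)) a x = mat_vec N (rep_mat \<rho> q) a x - mat_vec N (rep_mat \<rho> r) a x"
proof -
  let ?A = "supp q \<union> supp r"
  have A: "finite ?A" "supp q \<subseteq> ?A" "supp r \<subseteq> ?A" "?A \<subseteq> carrier G" "supp (\<lambda>g. q g - r g) \<subseteq> ?A"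
    using GA_D(1,2)[OF assms(1)] GA_D(1,2)[OF assms(2)] by (auto simp: supp_def)
  show ?thesis
    unfolding rep_apply[OF A(1,2,4) assms(3)] rep_apply[OF A(1,3,4) assms(3)] rep_apply[OF A(1,5,4) assms(3)]
    by (simp add: left_diff_distrib sum_subtractf)
qed

lemma rep_add:
  assumes "q \<in> GA" "r \<in> GA" "x \<in> {1..N}"
  shows "mat_vec N (rep_mat \<rho> (\<lambda>g. q g + r g)) a x = mat_vec N (rep_mat \<rho> q) a x + mat_vec N (rep_mat \<rho> r) a x"
proof -
  let ?A = "supp q \<union> supp r"
  have A: "finite ?A" "supp q \<subseteq> ?A" "supp r \<subseteq> ?A" "?A \<subseteq> carrier G" "supp (\<lambda>g. q g + r g) \<subseteq> ?A"
    using GA_D(1,2)[OF assms(1)] GA_D(1,2)[OF assms(2)] by (auto simp: supp_def)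
  show ?thesis
    unfolding rep_apply[OF A(1,2,4) assms(3)] rep_apply[OF A(1,3,4) assms(3)] rep_apply[OF A(1,5,4) assms(3)]
    by (simp add: distrib_right sum.distrib)
qed

lemma rep_scale:
  assumes "q \<in> GA" "x \<in> {1..N}"
  shows "mat_vec N (rep_mat \<rho> (\<lambda>g. c * q g)) a x = c * mat_vec N (rep_mat \<rho> q) a x"
  unfolding rep_apply[OF GA_D(1)[OF assms(1)] order_refl GA_D(2)[OF assms(1)] assms(2)]
    rep_apply[OF GA_D(1)[OF assms(1)] supp_scale GA_D(2)[OF assms(1)] assms(2)]
  by (simp add: sum_distrib_left mult.assoc)

lemma rep_sum:
  assumes "finite J" "\<And>j. j \<in> J \<Longrightarrow> f j \<in> GA" "x \<in> {1..N}"
  shows "mat_vec N (rep_mat \<rho> (\<lambda>g. \<Sum>j\<in>J. f j g)) a x = (\<Sum>j\<in>J. mat_vec N (rep_mat \<rho> (f j)) a x)"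
  using assms(1,2)
proof (induction J rule: finite_induct)
  case empty
  then show ?case by (simp add: rep_mat_def supp_def mat_vec_def)
next
  case (insert j J)
  then show ?case using rep_add[of "f j" "\<lambda>x. \<Sum>j\<in>J. f j x", OF _ _ assms(3)] GA_sum[of J f] by simp
qed

lemma rep_delta:
  assumes "x \<in> {1..N}"
  shows "mat_vec N (rep_mat \<rho> (ell2_delta \<one>)) a x = a x"
  using rep_apply[of "{\<one>}" "ell2_delta \<one>" x a] assms
  by (simp add: rep_one ell2_delta_def supp_def)

lemma rep_left_translation:
  assumes r: "r \<in> GA" and g: "g \<in> carrier G" and x: "x \<in> {1..N}"
  shows "mat_vec N (rep_mat \<rho> (left_translation G g r)) a x = mat_vec N (rep_mat \<rho> r) a (\<rho> (inv g) x)"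
proof -
  let ?f = "\<lambda>x. g \<otimes> x"
  have s: "finite (supp r)" "supp r \<subseteq> carrier G" using GA_D[OF r] by auto
  have sub: "supp (left_translation G g r) \<subseteq> ?f ` supp r"
  proof
    fix x assume "x \<in> supp (left_translation G g r)"
    then have "x \<in> carrier G" "inv g \<otimes> x \<in> supp r" by (auto simp: left_translation_def supp_def split: if_splits)
    moreover from this have "x = g \<otimes> (inv g \<otimes> x)" using g by (simp add: m_assoc[symmetric])
    ultimately show "x \<in> ?f ` supp r" by blast
  qed
  have inj: "inj_on ?f (supp r)" using s g by (auto simp: inj_on_def subset_iff)
  have im: "finite (?f ` supp r)" "?f ` supp r \<subseteq> carrier G" using s g by auto
  have "mat_vec N (rep_mat \<rho> (left_translation G g r)) a x =
      (\<Sum>h\<in>supp r. left_translation G g r (g \<otimes> h) * a (\<rho> (inv (g \<otimes> h)) x))"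
    unfolding rep_apply[OF im(1) sub im(2) x] sum.reindex[OF inj] by simp
  also have "\<dots> = (\<Sum>h\<in>supp r. r h * a (\<rho> (inv h) (\<rho> (inv g) x)))"
  proof (rule sum.cong[OF refl])
    fix h assume "h \<in> supp r"
    then have h: "h \<in> carrier G" using s by auto
    have "inv g \<otimes> (g \<otimes> h) = h" using h g by (simp add: m_assoc[symmetric])
    moreover have "\<rho> (inv (g \<otimes> h)) x = \<rho> (inv h) (\<rho> (inv g) x)"
      using h g by (simp add: inv_mult_group rep_mult)
    ultimately show "left_translation G g r (g \<otimes> h) * a (\<rho> (inv (g \<otimes> h)) x) = r h * a (\<rho> (inv h) (\<rho> (inv g) x))"
      unfolding left_translation_def using h g by simp
  qed
  also have "\<dots> = mat_vec N (rep_mat \<rho> r) a (\<rho> (inv g) x)"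
    using rep_apply_supp[OF r r rep_in] g x by simp
  finally show ?thesis .
qed

lemma rep_conv:
  assumes q: "q \<in> GA" and r: "r \<in> GA" and x: "x \<in> {1..N}"
  shows "mat_vec N (rep_mat \<rho> (q \<star> r)) a x = mat_vec N (rep_mat \<rho> q) (mat_vec N (rep_mat \<rho> r) a) x"
proof -
  have eq: "q \<star> r = (\<lambda>x. \<Sum>g\<in>supp q. (\<lambda>x. q g * left_translation G g r x) x)"
    by (simp add: left_regular_def fun_eq_iff)
  have t: "left_translation G g r \<in> GA" "g \<in> carrier G" if "g \<in> supp q" for g
    using GA_D(2)[OF q] that left_translation_GA[OF r] by auto
  have "mat_vec N (rep_mat \<rho> (q \<star> r)) a x =
      (\<Sum>g\<in>supp q. mat_vec N (rep_mat \<rho> (\<lambda>x. q g * left_translation G g r x)) a x)"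
    unfolding eq using GA_D(1)[OF q] t by (intro rep_sum GA_closed x) auto
  also have "\<dots> = (\<Sum>g\<in>supp q. q g * mat_vec N (rep_mat \<rho> r) a (\<rho> (inv g) x))"
  proof (intro sum.cong refl)
    fix g assume g: "g \<in> supp q"
    show "mat_vec N (rep_mat \<rho> (\<lambda>x. q g * left_translation G g r x)) a x = q g * mat_vec N (rep_mat \<rho> r) a (\<rho> (inv g) x)"
      unfolding rep_scale[OF t(1)[OF g] x] rep_left_translation[OF r t(2)[OF g] x] ..
  qed
  also have "\<dots> = mat_vec N (rep_mat \<rho> q) (mat_vec N (rep_mat \<rho> r) a) x"
    by (simp add: rep_apply_supp[OF q q x])
  finally show ?thesis .
qed

lemma cinner_rep:
  assumes "w \<in> GA"
  shows "cinner N a (mat_vec N (rep_mat \<rho> w) b) = (\<Sum>k\<in>supp w. w k * (\<Sum>y\<in>{1..N}. cnj (a (\<rho> k y)) * b y))"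
proof -
  have "cinner N a (mat_vec N (rep_mat \<rho> w) b) = (\<Sum>x\<in>{1..N}. \<Sum>k\<in>supp w. w k * (cnj (a x) * b (\<rho> (inv k) x)))"
    unfolding cinner_def by (intro sum.cong refl) (simp add: rep_apply_supp[OF assms assms] sum_distrib_left mult.left_commute)
  also have "\<dots> = (\<Sum>k\<in>supp w. w k * (\<Sum>x\<in>{1..N}. cnj (a x) * b (\<rho> (inv k) x)))"
    by (subst sum.swap) (simp add: sum_distrib_left)
  also have "\<dots> = (\<Sum>k\<in>supp w. w k * (\<Sum>y\<in>{1..N}. cnj (a (\<rho> k y)) * b y))"
  proof (intro sum.cong refl)
    fix k assume "k \<in> supp w"
    then have k: "k \<in> carrier G" using GA_D(2)[OF assms] by auto
    show "w k * (\<Sum>x\<in>{1..N}. cnj (a x) * b (\<rho> (inv k) x)) = w k * (\<Sum>y\<in>{1..N}. cnj (a (\<rho> k y)) * b y)"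
      using sum.reindex_bij_betw[OF rep_bij[OF k], of "\<lambda>x. cnj (a x) * b (\<rho> (inv k) x)"]
      by (simp add: rep_inv k)
  qed
  finally show ?thesis .
qed

lemma rep_adjoint:
  assumes "w \<in> GA"
  shows "cinner N (mat_vec N (rep_mat \<rho> w) a) b = cinner N a (mat_vec N (rep_mat \<rho> (star G w)) b)"
proof -
  have inj: "inj_on (m_inv G) (supp w)" using GA_D(2)[OF assms] inv_inj inj_on_subset by blast
  have "cinner N (mat_vec N (rep_mat \<rho> w) a) b = cnj (\<Sum>k\<in>supp w. w k * (\<Sum>y\<in>{1..N}. cnj (b (\<rho> k y)) * a y))"
    unfolding cinner_rep[OF assms, symmetric] by (rule cinner_commute)
  also have "\<dots> = (\<Sum>k\<in>supp w. cnj (w k) * (\<Sum>y\<in>{1..N}. cnj (a y) * b (\<rho> k y)))"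
    by (simp add: mult.commute[of "b _"])
  also have "\<dots> = (\<Sum>k\<in>supp w. cnj (w k) * (\<Sum>y\<in>{1..N}. cnj (a (\<rho> (inv k) y)) * b y))"
  proof (intro sum.cong refl)
    fix k assume "k \<in> supp w"
    then have k: "k \<in> carrier G" using GA_D(2)[OF assms] by auto
    show "cnj (w k) * (\<Sum>y\<in>{1..N}. cnj (a y) * b (\<rho> k y)) = cnj (w k) * (\<Sum>y\<in>{1..N}. cnj (a (\<rho> (inv k) y)) * b y)"
      using sum.reindex_bij_betw[OF rep_bij[OF k], of "\<lambda>y. cnj (a (\<rho> (inv k) y)) * b y"]
      by (simp add: rep_inv k)
  qed
  also have "\<dots> = (\<Sum>k\<in>supp (star G w). star G w k * (\<Sum>y\<in>{1..N}. cnj (a (\<rho> k y)) * b y))"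
    unfolding star_supp[OF assms] sum.reindex[OF inj]
    by (intro sum.cong refl) (use GA_D(2)[OF assms] in \<open>auto simp: star_def\<close>)
  also have "\<dots> = cinner N a (mat_vec N (rep_mat \<rho> (star G w)) b)"
    unfolding cinner_rep[OF star_GA[OF assms]] ..
  finally show ?thesis .
qed

lemma coincidence_count:
  assumes "g \<in> carrier G" "h \<in> carrier G"
  shows "(\<Sum>y\<in>{1..N}. if \<rho> g y = \<rho> h y then 1 else 0) = fixed_count (inv h \<otimes> g)"
  unfolding fixed_count_def
proof (intro sum.cong refl)
  fix y
  have "\<rho> g y = \<rho> h y \<longleftrightarrow> \<rho> (inv h \<otimes> g) y = y"
    using assms rep_inv rep_mult[of "inv h" g y] by (metis inv_closed)
  then show "(if \<rho> g y = \<rho> h y then 1 else 0) = (if \<rho> (inv h \<otimes> g) y = y then 1 else (0::real))" by simp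
qed

text \<open>Expanding the square leaves a double sum over \<open>g, h\<close>; the diagonal is \<open>N \<parallel>q\<parallel>\<^sup>2\<close>, and two different
  elements coincide at a point only if \<open>h\<^sup>-\<^sup>1 g\<close> fixes it.\<close>

lemma frobenius_rep_le:
  assumes q: "q \<in> GA" and \<delta>: "\<delta> \<ge> 0" and few: "\<And>g h. g \<in> supp q \<Longrightarrow> h \<in> supp q \<Longrightarrow> g \<noteq> h \<Longrightarrow> fixed_count (inv h \<otimes> g) \<le> \<delta>"
  shows "frobenius_sq N (rep_mat \<rho> q) \<le> real N * (\<parallel>q\<parallel>)\<^sup>2 + \<delta> * (\<Sum>g\<in>supp q. cmod (q g))\<^sup>2"
proof -
  let ?A = "supp q" and ?R = "{1..N}"
  have A: "finite ?A" "?A \<subseteq> carrier G" using GA_D[OF q] by auto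
  define c where "c = (\<lambda>g h. \<Sum>y\<in>?R. if \<rho> g y = \<rho> h y then 1 else (0::real))"
  have P: "(cmod (rep_mat \<rho> q x y))\<^sup>2 = Re (\<Sum>g\<in>?A. \<Sum>h\<in>?A. q g * cnj (q h) * of_real ((if x = \<rho> g y then 1 else 0) * (if x = \<rho> h y then 1 else 0)))" for x y
  proof -
    have "complex_of_real ((cmod (rep_mat \<rho> q x y))\<^sup>2) =
      (\<Sum>g\<in>?A. \<Sum>h\<in>?A. (q g * perm_mat (\<rho> g) x y) * cnj (q h * perm_mat (\<rho> h) x y))"
      unfolding complex_norm_square rep_mat_def cnj_sum sum_product ..
    also have "\<dots> = (\<Sum>g\<in>?A. \<Sum>h\<in>?A. q g * cnj (q h) * of_real ((if x = \<rho> g y then 1 else 0) * (if x = \<rho> h y then 1 else 0)))"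
      by (intro sum.cong refl) (simp add: perm_mat_def)
    finally show ?thesis by (metis Re_complex_of_real)
  qed
  have "frobenius_sq N (rep_mat \<rho> q) = Re (\<Sum>x\<in>?R. \<Sum>y\<in>?R. \<Sum>g\<in>?A. \<Sum>h\<in>?A.
      q g * cnj (q h) * of_real ((if x = \<rho> g y then 1 else 0) * (if x = \<rho> h y then 1 else 0)))"
    unfolding frobenius_sq_def vec_sq_def P by simp
  also have "(\<Sum>x\<in>?R. \<Sum>y\<in>?R. \<Sum>g\<in>?A. \<Sum>h\<in>?A.
      q g * cnj (q h) * of_real ((if x = \<rho> g y then 1 else 0) * (if x = \<rho> h y then 1 else 0))) =
      (\<Sum>g\<in>?A. \<Sum>h\<in>?A. \<Sum>x\<in>?R. \<Sum>y\<in>?R. q g * cnj (q h) * of_real ((if x = \<rho> g y then 1 else 0) * (if x = \<rho> h y then 1 else 0)))"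
  proof -
    have "(\<Sum>x\<in>?R. \<Sum>y\<in>?R. \<Sum>g\<in>?A. \<Sum>h\<in>?A. F x y g h) = (\<Sum>g\<in>?A. \<Sum>h\<in>?A. \<Sum>x\<in>?R. \<Sum>y\<in>?R. F x y g h)"
      for F :: "nat \<Rightarrow> nat \<Rightarrow> 'a \<Rightarrow> 'a \<Rightarrow> complex"
    proof -
      have "(\<Sum>x\<in>?R. \<Sum>y\<in>?R. \<Sum>g\<in>?A. \<Sum>h\<in>?A. F x y g h) = (\<Sum>x\<in>?R. \<Sum>g\<in>?A. \<Sum>y\<in>?R. \<Sum>h\<in>?A. F x y g h)"
        by (intro sum.cong refl sum.swap)
      also have "\<dots> = (\<Sum>g\<in>?A. \<Sum>x\<in>?R. \<Sum>y\<in>?R. \<Sum>h\<in>?A. F x y g h)" by (rule sum.swap)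
      also have "\<dots> = (\<Sum>g\<in>?A. \<Sum>x\<in>?R. \<Sum>h\<in>?A. \<Sum>y\<in>?R. F x y g h)"
        by (intro sum.cong refl sum.swap)
      also have "\<dots> = (\<Sum>g\<in>?A. \<Sum>h\<in>?A. \<Sum>x\<in>?R. \<Sum>y\<in>?R. F x y g h)"
        by (intro sum.cong refl sum.swap)
      finally show ?thesis .
    qed
    then show ?thesis .
  qed
  also have "\<dots> = (\<Sum>g\<in>?A. \<Sum>h\<in>?A. q g * cnj (q h) * of_real (c g h))"
  proof (intro sum.cong refl)
    fix g h assume gh: "g \<in> ?A" "h \<in> ?A"
    have "(\<Sum>x\<in>?R. \<Sum>y\<in>?R. (if x = \<rho> g y then 1 else 0) * (if x = \<rho> h y then 1 else (0::real))) = c g h"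
      unfolding c_def
    proof (subst sum.swap, intro sum.cong refl)
      fix y assume "y \<in> ?R"
      then have "\<rho> g y \<in> ?R" using rep_in gh A by blast
      have "(\<Sum>x\<in>?R. (if x = \<rho> g y then 1 else 0) * (if x = \<rho> h y then 1 else (0::real))) =
        (\<Sum>x\<in>?R. if x = \<rho> g y then (if \<rho> g y = \<rho> h y then 1 else 0) else 0)"
        by (intro sum.cong) auto
      then show "(\<Sum>x\<in>?R. (if x = \<rho> g y then 1 else 0) * (if x = \<rho> h y then 1 else (0::real))) = (if \<rho> g y = \<rho> h y then 1 else 0)"
        using \<open>\<rho> g y \<in> ?R\<close> by simp
    qed
    then show "(\<Sum>x\<in>?R. \<Sum>y\<in>?R. q g * cnj (q h) * of_real ((if x = \<rho> g y then 1 else 0) * (if x = \<rho> h y then 1 else 0))) =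
        q g * cnj (q h) * of_real (c g h)"
      by (simp only: sum_distrib_left[symmetric] of_real_sum[symmetric])
  qed
  also have "Re \<dots> \<le> (\<Sum>g\<in>?A. \<Sum>h\<in>?A. (if h = g then real N * (cmod (q g))\<^sup>2 else 0) + \<delta> * (cmod (q g) * cmod (q h)))"
    unfolding Re_sum
  proof (intro sum_mono)
    fix g h assume gh: "g \<in> ?A" "h \<in> ?A"
    have c0: "c g h \<ge> 0" unfolding c_def by (rule sum_nonneg) simp
    show "Re (q g * cnj (q h) * of_real (c g h)) \<le> (if h = g then real N * (cmod (q g))\<^sup>2 else 0) + \<delta> * (cmod (q g) * cmod (q h))"
    proof (cases "h = g")
      case True
      have "q g * cnj (q g) * of_real (c g g) = complex_of_real ((cmod (q g))\<^sup>2 * real N)"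
        unfolding of_real_mult complex_norm_square by (simp add: c_def)
      then show ?thesis using True \<delta> by (simp add: mult.commute)
    next
      case False
      have "Re (q g * cnj (q h) * of_real (c g h)) \<le> cmod (q g * cnj (q h) * of_real (c g h))" by (rule complex_Re_le_cmod)
      also have "\<dots> = cmod (q g) * cmod (q h) * c g h" using c0 by (simp add: norm_mult)
      also have "\<dots> \<le> cmod (q g) * cmod (q h) * \<delta>"

      proof (rule mult_left_mono)
        have "g \<in> carrier G" "h \<in> carrier G" using gh A by auto
        then have "c g h = fixed_count (inv h \<otimes> g)" unfolding c_def by (rule coincidence_count)
        then show "c g h \<le> \<delta>" using few[OF gh] False by simp
      qed simp
      finally show ?thesis using False by (simp add: mult_ac)
    qed
  qed
  also have "\<dots> = real N * (\<parallel>q\<parallel>)\<^sup>2 + \<delta> * (\<Sum>g\<in>supp q. cmod (q g))\<^sup>2"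
  proof -
    have "(\<Sum>g\<in>?A. \<Sum>h\<in>?A. if h = g then real N * (cmod (q g))\<^sup>2 else 0) = real N * (\<parallel>q\<parallel>)\<^sup>2"
      using A by (simp add: sum_distrib_left GA_ell2[OF q] sum_nonneg)
    moreover have "(\<Sum>g\<in>?A. \<Sum>h\<in>?A. \<delta> * (cmod (q g) * cmod (q h))) = \<delta> * (\<Sum>g\<in>?A. cmod (q g))\<^sup>2"
      unfolding power2_eq_square sum_product by (simp only: sum_distrib_left)
    ultimately show ?thesis by (simp only: sum.distrib)
  qed
  finally show ?thesis .
qed

end

section \<open>Green functions and traces in permutation representations\<close>

context group
begin

text \<open>The value at \<open>l\<close> of the polynomial in \<open>P\<close> that \<open>green_approx\<close> stands for: a geometric sum.\<close>

definition green_eigenvalue where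
  "green_eigenvalue p E \<eta> n l =
     (1 - ((shift_bound p E - (l - E)\<^sup>2) / (shift_bound p E + \<eta>\<^sup>2)) ^ n) / ((l - E)\<^sup>2 + \<eta>\<^sup>2)"

lemma green_eigenvalue_bounds:
  assumes \<eta>: "\<eta> > 0" and l: "\<bar>l\<bar> \<le> (\<Sum>g\<in>supp p. cmod (p g))"
  shows "0 \<le> green_eigenvalue p E \<eta> n l"
    "green_eigenvalue p E \<eta> n l \<le> 1 / ((l - E)\<^sup>2 + \<eta>\<^sup>2)"
    "(1 - (shift_bound p E / (shift_bound p E + \<eta>\<^sup>2)) ^ n) / ((l - E)\<^sup>2 + \<eta>\<^sup>2) \<le> green_eigenvalue p E \<eta> n l"
proof -
  let ?c = "shift_bound p E" and ?d = "(l - E)\<^sup>2 + \<eta>\<^sup>2"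
  let ?t = "(?c - (l - E)\<^sup>2) / (?c + \<eta>\<^sup>2)"
  have s: "?c + \<eta>\<^sup>2 > 0" using shift_bound_nonneg[of p E] \<eta> by (simp add: add_nonneg_pos)
  have d: "?d > 0" using \<eta> by (simp add: add_nonneg_pos)
  have "\<bar>l - E\<bar> \<le> (\<Sum>g\<in>supp p. cmod (p g)) + \<bar>E\<bar>" using l by linarith
  then have "(l - E)\<^sup>2 \<le> ?c"
    unfolding shift_bound_def by (metis abs_ge_zero power2_abs power_mono)
  then have t: "0 \<le> ?t" "?t \<le> ?c / (?c + \<eta>\<^sup>2)" using s by (auto intro: divide_right_mono)
  have "?c / (?c + \<eta>\<^sup>2) \<le> 1" using s by simp
  then have pw: "0 \<le> ?t ^ n" "?t ^ n \<le> 1" "?t ^ n \<le> (?c / (?c + \<eta>\<^sup>2)) ^ n"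
    using t by (auto intro: power_le_one power_mono)
  show "0 \<le> green_eigenvalue p E \<eta> n l" "green_eigenvalue p E \<eta> n l \<le> 1 / ?d"
    "(1 - (?c / (?c + \<eta>\<^sup>2)) ^ n) / ?d \<le> green_eigenvalue p E \<eta> n l"
    unfolding green_eigenvalue_def using pw d by (auto intro: divide_right_mono)
qed

end

context permutation_rep
begin

lemma rep_shifted:
  assumes p: "p \<in> GA" and q: "q \<in> GA"
    and eig: "\<And>x. x \<in> {1..N} \<Longrightarrow> mat_vec N (rep_mat \<rho> p) \<phi> x = of_real l * \<phi> x"
    and val: "\<And>x. x \<in> {1..N} \<Longrightarrow> mat_vec N (rep_mat \<rho> q) \<phi> x = of_real f * \<phi> x"
    and x: "x \<in> {1..N}"
  shows "mat_vec N (rep_mat \<rho> (shifted p E q)) \<phi> x = of_real ((l - E) * f) * \<phi> x"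
proof -
  have sc: "mat_vec N M (\<lambda>x. c * a x) y = c * mat_vec N M a y" for M c a y
    by (simp add: mat_vec_def sum_distrib_left mult.left_commute)
  have "mat_vec N (rep_mat \<rho> p) (mat_vec N (rep_mat \<rho> q) \<phi>) = mat_vec N (rep_mat \<rho> p) (\<lambda>x. of_real f * \<phi> x)"
    by (rule mat_vec_cong) (rule val)
  then show ?thesis
    unfolding shifted_def rep_diff[OF conv_GA[OF p q] GA_closed(3)[OF q q] x] rep_conv[OF p q x] rep_scale[OF q x]
    by (simp add: sc eig[OF x] val[OF x] algebra_simps)
qed

lemma rep_green:
  assumes p: "p \<in> GA" and \<eta>: "\<eta> > 0"
    and eig: "\<And>x. x \<in> {1..N} \<Longrightarrow> mat_vec N (rep_mat \<rho> p) \<phi> x = of_real l * \<phi> x"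
    and x: "x \<in> {1..N}"
  shows "mat_vec N (rep_mat \<rho> (green_approx p E \<eta> n)) \<phi> x = of_real (green_eigenvalue p E \<eta> n l) * \<phi> x"
  using x
proof (induction n arbitrary: x)
  case 0
  then show ?case by (simp add: green_eigenvalue_def mat_vec_def rep_mat_def supp_def)
next
  case (Suc n)
  let ?q = "green_approx p E \<eta> n" and ?f = "green_eigenvalue p E \<eta> n l"
  let ?s = "shift_bound p E + \<eta>\<^sup>2" and ?d = "(l - E)\<^sup>2 + \<eta>\<^sup>2"
  define t where "t = (shift_bound p E - (l - E)\<^sup>2) / ?s"
  have s: "?s > 0" using shift_bound_nonneg[of p E] \<eta> by (simp add: add_nonneg_pos)
  have d: "?d > 0" using \<eta> by (simp add: add_nonneg_pos)
  note q = green_approx_GA[OF p, of E \<eta> n]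
  have X: "mat_vec N (rep_mat \<rho> (shifted p E ?q)) \<phi> x = of_real ((l - E) * ?f) * \<phi> x" if "x \<in> {1..N}" for x
    by (rule rep_shifted[OF p q eig Suc.IH that])
  have XX: "mat_vec N (rep_mat \<rho> (shifted p E (shifted p E ?q))) \<phi> x = of_real ((l - E) * ((l - E) * ?f)) * \<phi> x"
    by (rule rep_shifted[OF p shifted_GA[OF p q] eig X Suc.prems])
  have L: "mat_vec N (rep_mat \<rho> (shifted_sq p E \<eta> ?q)) \<phi> x = of_real (?d * ?f) * \<phi> x"
    unfolding shifted_sq_def rep_add[OF shifted_GA[OF p shifted_GA[OF p q]] GA_closed(3)[OF q q] Suc.prems]
      XX rep_scale[OF q Suc.prems] Suc.IH[OF Suc.prems]
    by (simp add: algebra_simps power2_eq_square)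
  have dGA: "(\<lambda>x. ell2_delta \<one> x - shifted_sq p E \<eta> ?q x) \<in> GA"
    by (intro GA_closed GA_delta shifted_sq_GA p q) simp
  have "mat_vec N (rep_mat \<rho> (green_approx p E \<eta> (Suc n))) \<phi> x
      = of_real ?f * \<phi> x + of_real (1 / ?s) * (\<phi> x - of_real (?d * ?f) * \<phi> x)"
    unfolding green_approx.simps rep_add[OF q GA_closed(3)[OF dGA dGA] Suc.prems] rep_scale[OF dGA Suc.prems]
      rep_diff[OF GA_delta[OF one_closed] shifted_sq_GA[OF p q] Suc.prems] L rep_delta[OF Suc.prems] Suc.IH[OF Suc.prems] ..
  also have "\<dots> = of_real (?f + 1 / ?s * (1 - ?d * ?f)) * \<phi> x"
    by (simp add: algebra_simps)
  also have "?f + 1 / ?s * (1 - ?d * ?f) = green_eigenvalue p E \<eta> (Suc n) l"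
  proof -
    have df: "?d * ?f = 1 - t ^ n" unfolding green_eigenvalue_def t_def times_divide_eq_right
      by (rule nonzero_mult_div_cancel_left) (use d in linarith)
    have ds: "?d = ?s * (1 - t)" unfolding t_def using s by (simp add: field_simps)
    have "?d * (?f + 1 / ?s * (1 - ?d * ?f)) = ?d * ?f + ?d / ?s * (1 - ?d * ?f)"
      by (simp add: distrib_left)
    also have "\<dots> = 1 - t ^ n + (1 - t) * t ^ n"
      unfolding df using ds s by simp
    also have "\<dots> = 1 - t ^ Suc n" by (simp add: algebra_simps)
    finally have "?d * (?f + 1 / ?s * (1 - ?d * ?f)) = 1 - t ^ Suc n" .
    then show ?thesis unfolding green_eigenvalue_def t_def[symmetric] using d
      by (metis less_irrefl nonzero_mult_div_cancel_left)
  qed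
  finally show ?case .
qed

text \<open>The eigenvalue equation is evaluated at a point where the eigenvector has maximal modulus.\<close>

lemma eigenvalue_bound:
  assumes p: "p \<in> GA" and eig: "\<And>x. x \<in> {1..N} \<Longrightarrow> mat_vec N (rep_mat \<rho> p) \<phi> x = of_real l * \<phi> x"
    and nz: "vec_sq N \<phi> \<noteq> 0"
  shows "\<bar>l\<bar> \<le> (\<Sum>g\<in>supp p. cmod (p g))"
proof -
  obtain z where z: "z \<in> {1..N}" "\<phi> z \<noteq> 0" using nz vec_sq_eq_0 by blast
  define m where "m = Max ((\<lambda>x. cmod (\<phi> x)) ` {1..N})"
  have le: "cmod (\<phi> x) \<le> m" if "x \<in> {1..N}" for x unfolding m_def using that by (intro Max_ge) auto
  have "m \<in> (\<lambda>x. cmod (\<phi> x)) ` {1..N}" unfolding m_def by (rule Max_in) (use z in auto)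
  then obtain x where x: "x \<in> {1..N}" "m = cmod (\<phi> x)" by blast
  have m: "m > 0" using le[OF z(1)] z(2) by (metis less_le_trans zero_less_norm_iff)
  have "\<bar>l\<bar> * m = cmod (mat_vec N (rep_mat \<rho> p) \<phi> x)" by (simp add: eig[OF x(1)] x(2) norm_mult)
  also have "\<dots> \<le> (\<Sum>g\<in>supp p. cmod (p g) * m)"
    unfolding rep_apply_supp[OF p p x(1)]
  proof (rule order_trans[OF norm_sum sum_mono])
    fix g assume "g \<in> supp p"
    then have "\<rho> (inv g) x \<in> {1..N}" using GA_D(2)[OF p] x by (intro rep_in) auto
    then show "cmod (p g * \<phi> (\<rho> (inv g) x)) \<le> cmod (p g) * m" using le by (simp add: norm_mult mult_left_mono)
  qed
  finally have "\<bar>l\<bar> * m \<le> (\<Sum>g\<in>supp p. cmod (p g)) * m" by (simp add: sum_distrib_right)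
  then show ?thesis using m by simp
qed

lemma trace_rep: "mat_trace N (rep_mat \<rho> q) = (\<Sum>g\<in>supp q. q g * of_real (fixed_count g))"
  unfolding trace_perm_mat[symmetric] mat_trace_def rep_mat_def
  by (subst sum.swap) (simp add: sum_distrib_left)

lemma trace_eigenvalues:
  assumes on: "orthonormal_family N J v" and card: "card J = N"
    and ev: "\<And>j x. j \<in> J \<Longrightarrow> x \<in> {1..N} \<Longrightarrow> mat_vec N Q (v j) x = q j * v j x"
  shows "mat_trace N Q = (\<Sum>j\<in>J. q j)"
proof -
  have "mat_trace N Q = (\<Sum>x\<in>{1..N}. \<Sum>j\<in>J. q j * (cnj (v j x) * v j x))"
    unfolding mat_trace_def using spectral_expansion[OF on card ev] by (intro sum.cong) (simp_all add: mult_ac)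
  also have "\<dots> = (\<Sum>j\<in>J. q j * cinner N (v j) (v j))"
    unfolding cinner_def by (subst sum.swap) (simp add: sum_distrib_left)
  also have "\<dots> = (\<Sum>j\<in>J. q j)"
    by (rule sum.cong) (use on in \<open>auto simp: orthonormal_family_def\<close>)
  finally show ?thesis .
qed

text \<open>Only the pairs with \<open>h = k\<^sup>-\<^sup>1\<close> contribute; any other pair needs a fixed point of
  \<open>h k \<noteq> e\<close>.\<close>

lemma trace_of_product:
  assumes q1: "q\<^sub>1 \<in> GA" and q2: "q\<^sub>2 \<in> GA" and t: "t \<in> carrier G" and \<delta>: "\<delta> \<ge> 0"
    and few: "\<And>k h. k \<in> (\<lambda>g. inv t \<otimes> g \<otimes> t) ` supp q\<^sub>2 \<Longrightarrow> h \<in> supp q\<^sub>1 \<Longrightarrow> h \<otimes> k \<noteq> \<one> \<Longrightarrow> fixed_count (h \<otimes> k) \<le> \<delta>"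
    and B: "\<And>x. x \<in> {1..N} \<Longrightarrow> cmod (a x) \<le> B"
  shows "cmod ((\<Sum>y\<in>{1..N}. \<Sum>y'\<in>{1..N}. a y * cnj (a y') * rep_mat \<rho> q\<^sub>1 y y' * rep_mat \<rho> q\<^sub>2 (\<rho> t y') (\<rho> t y))
      - (\<Sum>k\<in>(\<lambda>g. inv t \<otimes> g \<otimes> t) ` supp q\<^sub>2. q\<^sub>2 (t \<otimes> k \<otimes> inv t) * q\<^sub>1 (inv k) * (\<Sum>y\<in>{1..N}. cnj (a (\<rho> k y)) * a y)))
    \<le> \<delta> * (B\<^sup>2 * (\<Sum>g\<in>supp q\<^sub>1. cmod (q\<^sub>1 g)) * (\<Sum>g\<in>supp q\<^sub>2. cmod (q\<^sub>2 g)))"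
proof -
  let ?R = "{1..N}" and ?f = "\<lambda>g. inv t \<otimes> g \<otimes> t" and ?S = "supp q\<^sub>1"
  let ?K = "?f ` supp q\<^sub>2"
  define r where "r = (\<lambda>k. q\<^sub>2 (t \<otimes> k \<otimes> inv t))"
  define corr where "corr = (\<lambda>k. \<Sum>y\<in>?R. cnj (a (\<rho> k y)) * a y)"
  define part where "part = (\<lambda>h k. \<Sum>y\<in>?R. if \<rho> (h \<otimes> k) y = y then a y * cnj (a (\<rho> k y)) else 0)"
  have s1: "finite ?S" "?S \<subseteq> carrier G" using GA_D[OF q1] by auto
  have s2: "finite (supp q\<^sub>2)" "supp q\<^sub>2 \<subseteq> carrier G" using GA_D[OF q2] by auto
  have K: "finite ?K" "?K \<subseteq> carrier G" using s2 t by auto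
  have fK: "t \<otimes> ?f g \<otimes> inv t = g" if "g \<in> carrier G" for g
  proof -
    have "t \<otimes> (inv t \<otimes> (g \<otimes> t)) = g \<otimes> t" using that t by (simp add: m_assoc[symmetric])
    then show ?thesis using that t by (simp add: m_assoc)
  qed
  have inj: "inj_on ?f (supp q\<^sub>2)"
    by (rule inj_on_inverseI[where g="\<lambda>k. t \<otimes> k \<otimes> inv t"]) (use fK s2 in auto)
  have r_sum: "(\<Sum>k\<in>?K. cmod (r k)) = (\<Sum>g\<in>supp q\<^sub>2. cmod (q\<^sub>2 g))"
    unfolding sum.reindex[OF inj] r_def using fK s2 by (intro sum.cong) auto
  have Q2: "rep_mat \<rho> q\<^sub>2 (\<rho> t y') (\<rho> t y) = (\<Sum>k\<in>?K. r k * (if y' = \<rho> k y then 1 else 0))" for y y'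
    unfolding sum.reindex[OF inj] rep_mat_def
  proof (intro sum.cong refl, unfold o_def)
    fix g assume "g \<in> supp q\<^sub>2"
    then have g: "g \<in> carrier G" using s2 by auto
    have "\<rho> t y' = \<rho> g (\<rho> t y) \<longleftrightarrow> y' = \<rho> (inv t \<otimes> g \<otimes> t) y"
      using g t by (simp add: rep_mult) (metis rep_inv)
    then show "q\<^sub>2 g * perm_mat (\<rho> g) (\<rho> t y') (\<rho> t y) = r (?f g) * (if y' = \<rho> (?f g) y then 1 else 0)"
      unfolding perm_mat_def r_def fK[OF g] by simp
  qed
  have "(\<Sum>y\<in>?R. \<Sum>y'\<in>?R. a y * cnj (a y') * rep_mat \<rho> q\<^sub>1 y y' * rep_mat \<rho> q\<^sub>2 (\<rho> t y') (\<rho> t y)) =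
      (\<Sum>y\<in>?R. \<Sum>k\<in>?K. r k * (a y * cnj (a (\<rho> k y)) * rep_mat \<rho> q\<^sub>1 y (\<rho> k y)))"
  proof (intro sum.cong refl)
    fix y assume y: "y \<in> ?R"
    have "(\<Sum>y'\<in>?R. a y * cnj (a y') * rep_mat \<rho> q\<^sub>1 y y' * rep_mat \<rho> q\<^sub>2 (\<rho> t y') (\<rho> t y)) =
        (\<Sum>y'\<in>?R. \<Sum>k\<in>?K. if y' = \<rho> k y then r k * (a y * cnj (a y') * rep_mat \<rho> q\<^sub>1 y y') else 0)"
      unfolding Q2 sum_distrib_left by (intro sum.cong) auto
    also have "\<dots> = (\<Sum>k\<in>?K. \<Sum>y'\<in>?R. if y' = \<rho> k y then r k * (a y * cnj (a y') * rep_mat \<rho> q\<^sub>1 y y') else 0)"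
      by (rule sum.swap)
    also have "\<dots> = (\<Sum>k\<in>?K. r k * (a y * cnj (a (\<rho> k y)) * rep_mat \<rho> q\<^sub>1 y (\<rho> k y)))"
    proof (intro sum.cong refl)
      fix k assume "k \<in> ?K"
      then have "\<rho> k y \<in> ?R" using rep_in K y by blast
      then show "(\<Sum>y'\<in>?R. if y' = \<rho> k y then r k * (a y * cnj (a y') * rep_mat \<rho> q\<^sub>1 y y') else 0) =
          r k * (a y * cnj (a (\<rho> k y)) * rep_mat \<rho> q\<^sub>1 y (\<rho> k y))"
        by simp
    qed
    finally show "(\<Sum>y'\<in>?R. a y * cnj (a y') * rep_mat \<rho> q\<^sub>1 y y' * rep_mat \<rho> q\<^sub>2 (\<rho> t y') (\<rho> t y)) =
        (\<Sum>k\<in>?K. r k * (a y * cnj (a (\<rho> k y)) * rep_mat \<rho> q\<^sub>1 y (\<rho> k y)))" .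
  qed
  also have "\<dots> = (\<Sum>k\<in>?K. \<Sum>h\<in>?S. r k * q\<^sub>1 h * part h k)"
  proof (subst sum.swap, intro sum.cong refl)
    fix k assume k: "k \<in> ?K"
    have "(\<Sum>y\<in>?R. r k * (a y * cnj (a (\<rho> k y)) * rep_mat \<rho> q\<^sub>1 y (\<rho> k y))) =
        (\<Sum>y\<in>?R. \<Sum>h\<in>?S. r k * q\<^sub>1 h * (if \<rho> (h \<otimes> k) y = y then a y * cnj (a (\<rho> k y)) else 0))"
      unfolding rep_mat_def sum_distrib_left
    proof (intro sum.cong refl)
      fix y h assume "h \<in> ?S"
      then have "h \<in> carrier G" "k \<in> carrier G" using s1 K k by auto
      then have "\<rho> (h \<otimes> k) y = \<rho> h (\<rho> k y)" by (rule rep_mult)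
      then show "r k * (a y * cnj (a (\<rho> k y)) * (q\<^sub>1 h * perm_mat (\<rho> h) y (\<rho> k y))) =
          r k * q\<^sub>1 h * (if \<rho> (h \<otimes> k) y = y then a y * cnj (a (\<rho> k y)) else 0)"
        unfolding perm_mat_def by auto
    qed
    also have "\<dots> = (\<Sum>h\<in>?S. r k * q\<^sub>1 h * part h k)"
      unfolding part_def sum_distrib_left by (rule sum.swap)
    finally show "(\<Sum>y\<in>?R. r k * (a y * cnj (a (\<rho> k y)) * rep_mat \<rho> q\<^sub>1 y (\<rho> k y))) = (\<Sum>h\<in>?S. r k * q\<^sub>1 h * part h k)" .
  qed
  finally have T: "(\<Sum>y\<in>?R. \<Sum>y'\<in>?R. a y * cnj (a y') * rep_mat \<rho> q\<^sub>1 y y' * rep_mat \<rho> q\<^sub>2 (\<rho> t y') (\<rho> t y)) =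
      (\<Sum>k\<in>?K. \<Sum>h\<in>?S. r k * q\<^sub>1 h * part h k)" .
  have main: "r k * q\<^sub>1 (inv k) * corr k = (\<Sum>h\<in>?S. if h = inv k then r k * q\<^sub>1 h * part h k else 0)" if k: "k \<in> ?K" for k
  proof -
    have kc: "k \<in> carrier G" using k K by auto
    have "part (inv k) k = corr k"
      unfolding part_def corr_def using kc by (intro sum.cong) (simp_all add: rep_one mult.commute)
    then have "(\<Sum>h\<in>?S. if h = inv k then r k * q\<^sub>1 h * part h k else 0) = (if inv k \<in> ?S then r k * q\<^sub>1 (inv k) * corr k else 0)"
      using s1 by simp
    then show ?thesis by (auto simp: supp_def)
  qed
  have diff: "(\<Sum>k\<in>?K. \<Sum>h\<in>?S. r k * q\<^sub>1 h * part h k) - (\<Sum>k\<in>?K. r k * q\<^sub>1 (inv k) * corr k) =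
      (\<Sum>k\<in>?K. \<Sum>h\<in>?S. if h = inv k then 0 else r k * q\<^sub>1 h * part h k)"
    unfolding sum_subtractf[symmetric]
  proof (intro sum.cong refl)
    fix k assume "k \<in> ?K"
    show "(\<Sum>h\<in>?S. r k * q\<^sub>1 h * part h k) - r k * q\<^sub>1 (inv k) * corr k = (\<Sum>h\<in>?S. if h = inv k then 0 else r k * q\<^sub>1 h * part h k)"
      unfolding main[OF \<open>k \<in> ?K\<close>] sum_subtractf[symmetric] by (intro sum.cong) auto
  qed
  have "cmod (\<Sum>k\<in>?K. \<Sum>h\<in>?S. if h = inv k then 0 else r k * q\<^sub>1 h * part h k) \<le>
      (\<Sum>k\<in>?K. \<Sum>h\<in>?S. cmod (r k) * cmod (q\<^sub>1 h) * (\<delta> * B\<^sup>2))"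
  proof (intro order_trans[OF norm_sum sum_mono])
    fix k h assume k: "k \<in> ?K" and h: "h \<in> ?S"
    show "cmod (if h = inv k then 0 else r k * q\<^sub>1 h * part h k) \<le> cmod (r k) * cmod (q\<^sub>1 h) * (\<delta> * B\<^sup>2)"
    proof (cases "h = inv k")
      case True
      then show ?thesis using \<delta> by simp
    next
      case False
      have hk: "h \<in> carrier G" "k \<in> carrier G" using h k s1 K by auto
      have "h \<otimes> k \<noteq> \<one>" using False inv_equality[of h k] hk by blast
      then have fc: "fixed_count (h \<otimes> k) \<le> \<delta>" using few[OF k h] by blast
      have "cmod (part h k) \<le> (\<Sum>y\<in>?R. (if \<rho> (h \<otimes> k) y = y then 1 else 0) * B\<^sup>2)"
        unfolding part_def
      proof (rule order_trans[OF norm_sum sum_mono])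
        fix y assume y: "y \<in> ?R"
        have "cmod (a y) * cmod (a (\<rho> k y)) \<le> B * B"
          using B[OF y] B[OF rep_in[OF hk(2) y]] by (intro mult_mono) (auto intro: order_trans[OF norm_ge_zero])
        then show "cmod (if \<rho> (h \<otimes> k) y = y then a y * cnj (a (\<rho> k y)) else 0) \<le> (if \<rho> (h \<otimes> k) y = y then 1 else 0) * B\<^sup>2"
          by (simp add: norm_mult power2_eq_square)
      qed
      also have "\<dots> = fixed_count (h \<otimes> k) * B\<^sup>2" by (simp add: fixed_count_def sum_distrib_right)
      also have "\<dots> \<le> \<delta> * B\<^sup>2" using fc by (simp add: mult_right_mono)
      finally show ?thesis using False by (simp add: norm_mult mult_left_mono mult.assoc)
    qed
  qed
  also have "\<dots> = \<delta> * (B\<^sup>2 * (\<Sum>g\<in>?S. cmod (q\<^sub>1 g)) * (\<Sum>g\<in>supp q\<^sub>2. cmod (q\<^sub>2 g)))"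
  proof -
    have "(\<Sum>k\<in>?K. \<Sum>h\<in>?S. cmod (r k) * cmod (q\<^sub>1 h) * (\<delta> * B\<^sup>2)) = (\<Sum>k\<in>?K. cmod (r k)) * (\<Sum>h\<in>?S. cmod (q\<^sub>1 h)) * (\<delta> * B\<^sup>2)"
      unfolding sum_product by (simp only: sum_distrib_right)
    then show ?thesis unfolding r_sum by (simp add: mult_ac)
  qed
  finally have "cmod (\<Sum>k\<in>?K. \<Sum>h\<in>?S. if h = inv k then 0 else r k * q\<^sub>1 h * part h k) \<le>
      \<delta> * (B\<^sup>2 * (\<Sum>g\<in>?S. cmod (q\<^sub>1 g)) * (\<Sum>g\<in>supp q\<^sub>2. cmod (q\<^sub>2 g)))" .
  from this[folded diff] show ?thesis
    unfolding T r_def corr_def .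
qed

end

section \<open>Sequences of representations converging in distribution\<close>

lemma eventually_along: "eventually P (along \<N>) \<longleftrightarrow> (\<forall>\<^sub>F N in sequentially. N \<in> \<N> \<longrightarrow> P N)"
  unfolding along_def by (rule eventually_inf_principal)

lemma eventually_along_mem: "\<forall>\<^sub>F N in along \<N>. N \<in> \<N>"
  unfolding eventually_along by simp

locale spectral_sequence = group G for G (structure) +
  fixes p :: "'a \<Rightarrow> complex" and \<N> :: "nat set" and \<rho> :: "nat \<Rightarrow> 'a \<Rightarrow> nat \<Rightarrow> nat"
    and \<phi> :: "nat \<Rightarrow> nat \<Rightarrow> nat \<Rightarrow> complex" and ev :: "nat \<Rightarrow> nat \<Rightarrow> real"
  assumes p_GA: "p \<in> GA" and p_star: "p = star G p"
    and N_pos: "0 \<notin> \<N>"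
    and hom: "\<And>N. N \<in> \<N> \<Longrightarrow> \<rho> N \<in> hom G (sym_group N)"
    and in_distribution: "converges_in_distribution G \<N> \<rho>"
    and eigenbasis: "\<And>N. N \<in> \<N> \<Longrightarrow> orthonormal_eigenbasis N (rep_mat (\<rho> N) p) (\<phi> N) (ev N)"
begin

lemma rep: "N \<in> \<N> \<Longrightarrow> permutation_rep G N (\<rho> N)"
  by unfold_locales (rule hom)

abbreviation fixed where "fixed N g \<equiv> permutation_rep.fixed_count N (\<rho> N) g"

lemma fixed_small:
  assumes "finite A" "A \<subseteq> carrier G" "\<one> \<notin> A" "\<epsilon> > 0"
  shows "\<forall>\<^sub>F N in along \<N>. \<forall>g\<in>A. fixed N g \<le> \<epsilon> * real N"
proof (rule eventually_ball_finite[OF assms(1)], rule ballI)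
  fix g assume "g \<in> A"
  then have g: "g \<in> carrier G - {\<one>}" using assms by auto
  have t: "((\<lambda>N. mat_trace N (perm_mat (\<rho> N g)) / of_nat N) \<longlongrightarrow> 0) (along \<N>)"
    using in_distribution g unfolding converges_in_distribution_def by blast
  have "\<forall>\<^sub>F N in along \<N>. cmod (mat_trace N (perm_mat (\<rho> N g)) / of_nat N) < \<epsilon>"
    using tendstoD[OF t assms(4)] by (simp only: dist_norm diff_zero)
  then show "\<forall>\<^sub>F N in along \<N>. fixed N g \<le> \<epsilon> * real N"
    using eventually_along_mem
  proof eventually_elim
    case (elim N)
    interpret permutation_rep G N "\<rho> N" using rep elim by blast
    have "N > 0" using elim N_pos by (metis gr0I)
    then show ?case using elim(1) fixed_count_nonneg[of g]
      by (simp add: trace_perm_mat norm_divide field_simps)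
  qed
qed

lemma frobenius_asymptotic:
  assumes q: "q \<in> GA" and \<epsilon>: "\<epsilon> > 0"
  shows "\<forall>\<^sub>F N in along \<N>. frobenius_sq N (rep_mat (\<rho> N) q) \<le> ((\<parallel>q\<parallel>)\<^sup>2 + \<epsilon>) * real N"
proof -
  define L where "L = (\<Sum>g\<in>supp q. cmod (q g))\<^sup>2 + 1"
  have L: "L > 0" unfolding L_def by (simp add: add_nonneg_pos)
  define A where "A = (\<lambda>(g, h). inv h \<otimes> g) ` (supp q \<times> supp q) - {\<one>}"
  have s: "finite (supp q)" "supp q \<subseteq> carrier G" using GA_D[OF q] by auto
  have A: "finite A" "A \<subseteq> carrier G" "\<one> \<notin> A" unfolding A_def using s by auto
  have mem: "inv h \<otimes> g \<in> A" if "g \<in> supp q" "h \<in> supp q" "g \<noteq> h" for g h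
  proof -
    have "g \<in> carrier G" "h \<in> carrier G" using that s by auto
    then have "inv h \<otimes> g \<noteq> \<one>" using that(3) by (metis inv_equality inv_inv inv_closed)
    then show ?thesis unfolding A_def using that by force
  qed
  show ?thesis
    using fixed_small[OF A divide_pos_pos[OF \<epsilon> L]] eventually_along_mem
  proof eventually_elim
    case (elim N)
    interpret permutation_rep G N "\<rho> N" using rep elim by blast
    have "frobenius_sq N (rep_mat (\<rho> N) q) \<le> real N * (\<parallel>q\<parallel>)\<^sup>2 + \<epsilon> / L * real N * (\<Sum>g\<in>supp q. cmod (q g))\<^sup>2"
      by (rule frobenius_rep_le[OF q]) (use elim mem L \<epsilon> in auto)
    also have "\<dots> \<le> real N * (\<parallel>q\<parallel>)\<^sup>2 + \<epsilon> / L * real N * L"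
      using L \<epsilon> by (intro add_left_mono mult_left_mono) (auto simp: L_def)
    also have "\<dots> = ((\<parallel>q\<parallel>)\<^sup>2 + \<epsilon>) * real N" using L by (simp add: algebra_simps)
    finally show ?case .
  qed
qed

lemma trace_asymptotic:
  assumes q: "q \<in> GA" and \<epsilon>: "\<epsilon> > 0"
  shows "\<forall>\<^sub>F N in along \<N>. cmod (mat_trace N (rep_mat (\<rho> N) q) - of_nat N * q \<one>) \<le> \<epsilon> * real N"
proof -
  define L where "L = (\<Sum>g\<in>supp q. cmod (q g)) + 1"
  have L: "L > 0" unfolding L_def by (simp add: add_nonneg_pos sum_nonneg)
  have s: "finite (supp q)" "supp q \<subseteq> carrier G" using GA_D[OF q] by auto
  have A: "finite (supp q - {\<one>})" "supp q - {\<one>} \<subseteq> carrier G" "\<one> \<notin> supp q - {\<one>}" using s by auto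
  show ?thesis
    using fixed_small[OF A divide_pos_pos[OF \<epsilon> L]] eventually_along_mem
  proof eventually_elim
    case (elim N)
    interpret permutation_rep G N "\<rho> N" using rep elim by blast
    have f1: "fixed_count \<one> = real N" by (simp add: fixed_count_def rep_one)
    have "of_nat N * q \<one> = (\<Sum>g\<in>supp q. if g = \<one> then q g * of_real (fixed_count g) else 0)"
      using s by (simp add: f1 supp_def)
    then have "mat_trace N (rep_mat (\<rho> N) q) - of_nat N * q \<one> =
        (\<Sum>g\<in>supp q. q g * of_real (fixed_count g) - (if g = \<one> then q g * of_real (fixed_count g) else 0))"
      unfolding trace_rep by (simp add: sum_subtractf)
    also have "cmod \<dots> \<le> (\<Sum>g\<in>supp q. cmod (q g) * (\<epsilon> / L * real N))"
    proof (rule order_trans[OF norm_sum sum_mono])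
      fix g assume g: "g \<in> supp q"
      show "cmod (q g * of_real (fixed_count g) - (if g = \<one> then q g * of_real (fixed_count g) else 0))
        \<le> cmod (q g) * (\<epsilon> / L * real N)"
      proof (cases "g = \<one>")
        case True
        then show ?thesis using L \<epsilon> by simp
      next
        case False
        have f: "fixed_count g \<le> \<epsilon> / L * real N" using elim(1) g False by blast
        have "cmod (q g * of_real (fixed_count g)) = cmod (q g) * fixed_count g"
          using fixed_count_nonneg[of g] by (simp add: norm_mult)
        also have "\<dots> \<le> cmod (q g) * (\<epsilon> / L * real N)" by (rule mult_left_mono[OF f norm_ge_zero])
        finally show ?thesis unfolding if_not_P[OF False] diff_zero .
      qed
    qed
    also have "\<dots> = (L - 1) * (\<epsilon> / L * real N)"
      unfolding sum_distrib_right[symmetric] by (simp add: L_def)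
    also have "\<dots> \<le> L * (\<epsilon> / L * real N)" using L \<epsilon> by (intro mult_right_mono) auto
    also have "\<dots> = \<epsilon> * real N" using L by simp
    finally show ?case .
  qed
qed

lemma eigenvector:
  assumes "N \<in> \<N>" "j \<in> {1..N}" "x \<in> {1..N}"
  shows "mat_vec N (rep_mat (\<rho> N) p) (\<phi> N j) x = of_real (ev N j) * \<phi> N j x"
  using eigenbasis[OF assms(1)] assms(2,3) by (simp add: orthonormal_eigenbasis_def)

lemmas basis = eigenbasis_orthonormal[OF eigenbasis]

lemma ev_bound:
  assumes "N \<in> \<N>" "j \<in> {1..N}"
  shows "\<bar>ev N j\<bar> \<le> (\<Sum>g\<in>supp p. cmod (p g))"
proof -
  interpret permutation_rep G N "\<rho> N" using rep assms by blast
  show ?thesis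
    by (rule eigenvalue_bound[OF p_GA eigenvector[OF assms]]) (use vec_sq_orthonormal[OF basis] assms in auto)
qed

subsection \<open>Counting eigenvalues in short windows\<close>

text \<open>The sum of the Poisson kernels of width \<open>\<eta>\<close>, divided by \<open>\<eta>\<close>.\<close>

definition poisson_sum where
  "poisson_sum N E \<eta> = (\<Sum>j\<in>{1..N}. 1 / ((ev N j - E)\<^sup>2 + \<eta>\<^sup>2))"

lemma trace_green:
  assumes N: "N \<in> \<N>" and \<eta>: "\<eta> > 0"
  shows "mat_trace N (rep_mat (\<rho> N) (green_approx p E \<eta> n)) = of_real (\<Sum>j\<in>{1..N}. green_eigenvalue p E \<eta> n (ev N j))"
proof -
  interpret permutation_rep G N "\<rho> N" using rep N by blast
  show ?thesis unfolding of_real_sum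
    by (rule trace_eigenvalues[OF basis[OF N]]) (auto intro!: rep_green p_GA \<eta> eigenvector N simp del: atLeastAtMost_iff)
qed

lemma green_small_ratio:
  assumes "\<eta> > 0"
  shows "\<forall>\<^sub>F n in sequentially. (shift_bound p E / (shift_bound p E + \<eta>\<^sup>2)) ^ n \<le> 1 / 2"
proof -
  have "(\<lambda>n. (shift_bound p E / (shift_bound p E + \<eta>\<^sup>2)) ^ n) \<longlonglongrightarrow> 0"
    using green_ratio[OF assms, of p E] by (intro LIMSEQ_realpow_zero) auto
  then have "\<forall>\<^sub>F n in sequentially. (shift_bound p E / (shift_bound p E + \<eta>\<^sup>2)) ^ n < 1 / 2"
    by (rule order_tendstoD) simp
  then show ?thesis by (rule eventually_mono) simp
qed

text \<open>The Poisson kernel lies between one and two times its polynomial approximation, whose trace is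
  \<open>N\<close> times the value of the approximate Green function at the unit, up to \<open>o(N)\<close>.\<close>

lemma poisson_asymptotic:
  assumes C: "C > 0" and \<eta>: "\<eta> > 0"
    and AC: "inverse C \<le> Re (Im_resolvent G p (Complex E \<eta>) \<one> \<one>)" "Re (Im_resolvent G p (Complex E \<eta>) \<one> \<one>) \<le> C"
  shows "\<forall>\<^sub>F N in along \<N>. real N / (2 * C) \<le> \<eta> * poisson_sum N E \<eta> \<and> \<eta> * poisson_sum N E \<eta> \<le> 3 * C * real N"
proof -
  obtain v where gr: "green_like p E \<eta> v" using green_function[OF p_GA p_star \<eta>] by blast
  then have v: "v \<in> ell2 G" and lim: "(\<lambda>n. \<parallel>\<lambda>x. v x - green_approx p E \<eta> n x\<parallel>) \<longlonglongrightarrow> 0"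
    and Im: "Im_resolvent G p (Complex E \<eta>) \<one> \<one> = of_real \<eta> * cnj (v \<one>)"
    unfolding green_like_def by auto
  define m where "m = Re (v \<one>)"
  have m: "inverse C \<le> \<eta> * m" "\<eta> * m \<le> C" using AC Im by (simp_all add: m_def)
  have "0 < inverse C" using C by simp
  then have "0 < \<eta> * m" using m by linarith
  then have m0: "m > 0" using \<eta> by (simp add: zero_less_mult_iff)
  then have m4: "m / 4 > 0" by simp
  have "\<forall>\<^sub>F n in sequentially. \<parallel>\<lambda>x. v x - green_approx p E \<eta> n x\<parallel> < m / 4"
    by (rule order_tendstoD(2)[OF lim]) (use m0 in simp)
  then have "\<forall>\<^sub>F n in sequentially. \<parallel>\<lambda>x. v x - green_approx p E \<eta> n x\<parallel> < m / 4 \<and>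
      (shift_bound p E / (shift_bound p E + \<eta>\<^sup>2)) ^ n \<le> 1 / 2"
    using green_small_ratio[OF \<eta>, of E] by eventually_elim simp
  then obtain n where n: "\<parallel>\<lambda>x. v x - green_approx p E \<eta> n x\<parallel> < m / 4"
      "(shift_bound p E / (shift_bound p E + \<eta>\<^sup>2)) ^ n \<le> 1 / 2"
    using eventually_happens'[OF sequentially_bot] by blast
  let ?q = "green_approx p E \<eta> n"
  have q: "?q \<in> GA" by (rule green_approx_GA[OF p_GA])
  have "cmod (v \<one> - ?q \<one>) < m / 4"
    using ell2_pointwise[OF ell2_diff(1)[OF v GA_ell2(1)[OF q]], of \<one>] n by linarith
  then have qm: "\<bar>m - Re (?q \<one>)\<bar> < m / 4"
    using abs_Re_le_cmod[of "v \<one> - ?q \<one>"] unfolding m_def by simp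
  show ?thesis
    using trace_asymptotic[OF q m4] eventually_along_mem
  proof eventually_elim
    case (elim N)
    let ?f = "green_eigenvalue p E \<eta> n"
    define S where "S = (\<Sum>j\<in>{1..N}. ?f (ev N j))"
    define X where "X = real N * m"
    define Y where "Y = real N * Re (?q \<one>)"
    have "\<bar>S - Y\<bar> \<le> cmod (mat_trace N (rep_mat (\<rho> N) ?q) - of_nat N * ?q \<one>)"
      using abs_Re_le_cmod[of "mat_trace N (rep_mat (\<rho> N) ?q) - of_nat N * ?q \<one>"]
      unfolding trace_green[OF elim(2) \<eta>] S_def[symmetric] Y_def by simp
    also have "\<dots> \<le> X / 4" using elim(1) unfolding X_def by (simp add: mult.commute)
    finally have SY: "\<bar>S - Y\<bar> \<le> X / 4" .
    have "X - Y = real N * (m - Re (?q \<one>))" unfolding X_def Y_def by (rule right_diff_distrib[symmetric])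
    then have "\<bar>X - Y\<bar> = real N * \<bar>m - Re (?q \<one>)\<bar>" by (simp only: abs_mult abs_of_nat)
    also have "\<dots> \<le> real N * (m / 4)" by (rule mult_left_mono) (use qm in auto)
    finally have "\<bar>X - Y\<bar> \<le> X / 4" unfolding X_def by simp
    then have S: "X / 2 \<le> S" "S \<le> 3 / 2 * X" using SY by linarith+
    have pos: "(ev N j - E)\<^sup>2 + \<eta>\<^sup>2 > 0" for j using \<eta> by (simp add: add_nonneg_pos)
    have b: "?f (ev N j) \<le> 1 / ((ev N j - E)\<^sup>2 + \<eta>\<^sup>2)" "1 / ((ev N j - E)\<^sup>2 + \<eta>\<^sup>2) \<le> 2 * ?f (ev N j)"
      if j: "j \<in> {1..N}" for j
    proof -
      note g = green_eigenvalue_bounds[OF \<eta> ev_bound[OF elim(2) j], of E n]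
      show "?f (ev N j) \<le> 1 / ((ev N j - E)\<^sup>2 + \<eta>\<^sup>2)" by (rule g(2))
      have "(1 / 2) / ((ev N j - E)\<^sup>2 + \<eta>\<^sup>2) \<le> (1 - (shift_bound p E / (shift_bound p E + \<eta>\<^sup>2)) ^ n) / ((ev N j - E)\<^sup>2 + \<eta>\<^sup>2)"
        by (rule divide_right_mono) (use n pos[of j] in auto)
      moreover have "1 / ((ev N j - E)\<^sup>2 + \<eta>\<^sup>2) = 2 * ((1 / 2) / ((ev N j - E)\<^sup>2 + \<eta>\<^sup>2))"
        unfolding times_divide_eq_right by simp
      ultimately show "1 / ((ev N j - E)\<^sup>2 + \<eta>\<^sup>2) \<le> 2 * ?f (ev N j)" using g(3) by linarith
    qed
    have "S \<le> poisson_sum N E \<eta>" unfolding S_def poisson_sum_def by (rule sum_mono) (rule b(1))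
    moreover have "poisson_sum N E \<eta> \<le> 2 * S" unfolding S_def poisson_sum_def sum_distrib_left by (rule sum_mono) (rule b(2))
    ultimately have P: "X / 2 \<le> poisson_sum N E \<eta>" "poisson_sum N E \<eta> \<le> 3 * X" using S by linarith+
    have "real N / (2 * C) = inverse C * (real N / 2)" by (simp add: field_simps)
    also have "\<dots> \<le> (\<eta> * m) * (real N / 2)" by (rule mult_right_mono[OF m(1)]) simp
    also have "\<dots> \<le> \<eta> * poisson_sum N E \<eta>" 
    proof -
      have "\<eta> * (X / 2) \<le> \<eta> * poisson_sum N E \<eta>" using P(1) \<eta> by (intro mult_left_mono) auto
      then show ?thesis unfolding X_def by (simp add: mult_ac)
    qed
    finally have lo: "real N / (2 * C) \<le> \<eta> * poisson_sum N E \<eta>" .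
    have "\<eta> * poisson_sum N E \<eta> \<le> \<eta> * (3 * X)" using P(2) \<eta> by (intro mult_left_mono) auto
    also have "\<dots> = (\<eta> * m) * (3 * real N)" unfolding X_def by simp
    also have "\<dots> \<le> C * (3 * real N)" by (rule mult_right_mono[OF m(2)]) simp
    also have "\<dots> = 3 * C * real N" by simp
    finally show ?case using lo by blast
  qed
qed

text \<open>The Poisson kernel of width \<open>\<eta>' = \<eta> / (24 C\<^sup>2)\<close> is compared with that of width \<open>\<eta>\<close>: outside the
  window it is at most \<open>2 \<eta>' / \<eta>\<close> times the latter, so the eigenvalues outside contribute at most half
  of the lower bound for the sum, and those inside, at most \<open>1 / \<eta>'\<close> each, the rest.\<close>

lemma window_count_at:
  assumes C: "C \<ge> 1" and \<eta>: "0 < \<eta>" "\<eta> \<le> 1"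
    and AC: "\<And>\<eta>. 0 < \<eta> \<Longrightarrow> \<eta> \<le> 1 \<Longrightarrow> inverse C \<le> Re (Im_resolvent G p (Complex E \<eta>) \<one> \<one>)"
      "\<And>\<eta>. 0 < \<eta> \<Longrightarrow> \<eta> \<le> 1 \<Longrightarrow> Re (Im_resolvent G p (Complex E \<eta>) \<one> \<one>) \<le> C"
  shows "\<forall>\<^sub>F N in along \<N>. \<eta> / (96 * C ^ 3) * real N \<le> real (card (spectral_window N (ev N) {E - \<eta>..E + \<eta>}))"
proof -
  define \<eta>' where "\<eta>' = \<eta> / (24 * C\<^sup>2)"
  have C2: "C\<^sup>2 \<ge> 1" using C by simp
  have \<eta>': "0 < \<eta>'" "\<eta>' \<le> \<eta>" "\<eta>' \<le> 1"
  proof -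
    show "0 < \<eta>'" unfolding \<eta>'_def using \<eta> C by simp
    have "\<eta> * 1 \<le> \<eta> * (24 * C\<^sup>2)" using \<eta> C2 by (intro mult_left_mono) auto
    then show "\<eta>' \<le> \<eta>" unfolding \<eta>'_def using C by (simp add: divide_le_eq)
    then show "\<eta>' \<le> 1" using \<eta> by simp
  qed
  have C0: "C > 0" using C by simp
  show ?thesis
    using poisson_asymptotic[OF C0 \<eta>(1) AC(1)[OF \<eta>] AC(2)[OF \<eta>]]
      poisson_asymptotic[OF C0 \<eta>'(1) AC(1)[OF \<eta>'(1,3)] AC(2)[OF \<eta>'(1,3)]]
  proof eventually_elim
    case (elim N)
    let ?W = "spectral_window N (ev N) {E - \<eta>..E + \<eta>}"
    have W: "?W \<subseteq> {1..N}" by (auto simp: spectral_window_def)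
    have "poisson_sum N E \<eta>' \<le> (\<Sum>j\<in>{1..N}. (if j \<in> ?W then 1 / \<eta>'\<^sup>2 else 0) + 2 / ((ev N j - E)\<^sup>2 + \<eta>\<^sup>2))"
      unfolding poisson_sum_def
    proof (rule sum_mono)
      fix j assume j: "j \<in> {1..N}"
      have pos: "(ev N j - E)\<^sup>2 + \<eta>\<^sup>2 > 0" using \<eta> by (simp add: add_nonneg_pos)
      show "1 / ((ev N j - E)\<^sup>2 + \<eta>'\<^sup>2) \<le> (if j \<in> ?W then 1 / \<eta>'\<^sup>2 else 0) + 2 / ((ev N j - E)\<^sup>2 + \<eta>\<^sup>2)"
      proof (cases "j \<in> ?W")
        case True
        have "1 / ((ev N j - E)\<^sup>2 + \<eta>'\<^sup>2) \<le> 1 / \<eta>'\<^sup>2" using \<eta>' by (intro divide_left_mono) (auto simp: add_nonneg_pos)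
        moreover have "2 / ((ev N j - E)\<^sup>2 + \<eta>\<^sup>2) \<ge> 0" using pos by simp
        ultimately show ?thesis unfolding if_P[OF True] by linarith
      next
        case False
        then have "\<bar>ev N j - E\<bar> \<ge> \<eta>" using j by (auto simp: spectral_window_def)
        then have sq: "(ev N j - E)\<^sup>2 \<ge> \<eta>\<^sup>2" using \<eta> by (metis abs_le_square_iff abs_of_pos)
        have e2: "\<eta>\<^sup>2 > 0" using \<eta> by simp
        have "1 / ((ev N j - E)\<^sup>2 + \<eta>'\<^sup>2) \<le> 1 / (((ev N j - E)\<^sup>2 + \<eta>\<^sup>2) / 2)"
        proof (rule divide_left_mono)
          have e3: "\<eta>'\<^sup>2 > 0" using \<eta>' by simp
          have aux: "(x + y) / 2 \<le> x + z" if "y \<le> x" "0 < z" for x y z :: real using that by simp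
          show "((ev N j - E)\<^sup>2 + \<eta>\<^sup>2) / 2 \<le> (ev N j - E)\<^sup>2 + \<eta>'\<^sup>2" by (rule aux[OF sq e3])
          show "0 < ((ev N j - E)\<^sup>2 + \<eta>'\<^sup>2) * (((ev N j - E)\<^sup>2 + \<eta>\<^sup>2) / 2)"
            by (intro mult_pos_pos add_nonneg_pos divide_pos_pos) (use e2 e3 in auto)
        qed simp
        then show ?thesis using False by simp
      qed
    qed
    also have "\<dots> = real (card ?W) / \<eta>'\<^sup>2 + 2 * poisson_sum N E \<eta>"
      using W by (simp add: sum.distrib poisson_sum_def sum_distrib_left sum.If_cases Int_absorb1)
    finally have "\<eta>' * poisson_sum N E \<eta>' \<le> \<eta>' * (real (card ?W) / \<eta>'\<^sup>2 + 2 * poisson_sum N E \<eta>)"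
      using \<eta>' by (intro mult_left_mono) auto
    also have "\<dots> = real (card ?W) / \<eta>' + 2 * \<eta>' / \<eta> * (\<eta> * poisson_sum N E \<eta>)"
      using \<eta> \<eta>' by (simp add: field_simps power2_eq_square)
    also have "\<dots> \<le> real (card ?W) / \<eta>' + 2 * \<eta>' / \<eta> * (3 * C * real N)"
      using elim \<eta> \<eta>' by (intro add_left_mono mult_left_mono) auto
    also have "2 * \<eta>' / \<eta> * (3 * C * real N) = real N / (4 * C)"
      unfolding \<eta>'_def using \<eta> C by (simp add: field_simps power2_eq_square)
    finally have "real N / (2 * C) - real N / (4 * C) \<le> real (card ?W) / \<eta>'" using elim by linarith
    then have "\<eta>' * (real N / (4 * C)) \<le> real (card ?W)"
      using \<eta>' C by (simp add: field_simps)
    also have "\<eta>' * (real N / (4 * C)) = \<eta> / (96 * C ^ 3) * real N"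
      unfolding \<eta>'_def using C by (simp add: field_simps power2_eq_square power3_eq_cube)
    finally show ?case .
  qed
qed

end

definition net :: "real \<Rightarrow> real \<Rightarrow> nat \<Rightarrow> real set" where
  "net a b k = (\<lambda>j. a + real j * ((b - a) / real (Suc k))) ` {0..Suc k}"

lemma net_finite: "finite (net a b k)" "card (net a b k) \<le> k + 2"
  unfolding net_def using card_image_le[of "{0..Suc k}" "\<lambda>j. a + real j * ((b - a) / real (Suc k))"] by auto

lemma net_subset:
  assumes "a \<le> b"
  shows "net a b k \<subseteq> {a..b}"
proof
  fix x assume "x \<in> net a b k"
  then obtain j where j: "j \<le> Suc k" "x = a + real j * ((b - a) / real (Suc k))" unfolding net_def by auto
  have "real j * ((b - a) / real (Suc k)) \<le> real (Suc k) * ((b - a) / real (Suc k))"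
    using j assms by (intro mult_right_mono) auto
  also have "\<dots> = b - a" by (simp del: of_nat_Suc)
  finally show "x \<in> {a..b}" using j assms by simp
qed

lemma net_covers:
  assumes "a < b" "E \<in> {a..b}"
  obtains E' where "E' \<in> net a b k" "\<bar>E - E'\<bar> \<le> (b - a) / real (Suc k)"
proof -
  define d where "d = (b - a) / real (Suc k)"
  have d: "d > 0" unfolding d_def using assms by simp
  define j where "j = nat \<lfloor>(E - a) / d\<rfloor>"
  have q: "0 \<le> (E - a) / d" using assms d by simp
  have "(E - a) / d \<le> (b - a) / d" using assms d by (simp add: divide_right_mono)
  also have "\<dots> = real (Suc k)" unfolding d_def using assms by simp
  finally have "\<lfloor>(E - a) / d\<rfloor> \<le> int (Suc k)" by linarith
  then have "j \<le> Suc k" unfolding j_def by linarith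
  then have "a + real j * d \<in> net a b k" unfolding net_def d_def by auto
  moreover have "real j \<le> (E - a) / d" "(E - a) / d \<le> real j + 1"
    unfolding j_def using q by linarith+
  then have "real j * d \<le> E - a" "E - a \<le> real j * d + d" using d by (auto simp: field_simps)
  then have "\<bar>E - (a + real j * d)\<bar> \<le> (b - a) / real (Suc k)" unfolding d_def[symmetric] by linarith
  ultimately show ?thesis using that by blast
qed

context spectral_sequence
begin

lemma window_mono: "J \<subseteq> J' \<Longrightarrow> spectral_window N e J \<subseteq> spectral_window N e J'"
  by (auto simp: spectral_window_def)

lemma window_finite: "finite (spectral_window N e J)"
  by (simp add: spectral_window_def)

text \<open>A finite net of energies makes the threshold for \<open>N\<close> independent of \<open>E\<close>: the window at \<open>E\<close> contains
  the one of half the width at a nearby point of the net.\<close>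

lemma window_count:
  assumes AC: "cond_AC G p I\<^sub>0" and ab: "a < b" "{a..b} \<subseteq> I\<^sub>0"
  obtains c where "c > 0" "\<And>\<eta>. 0 < \<eta> \<Longrightarrow> \<eta> \<le> 1 \<Longrightarrow>
    \<forall>\<^sub>F N in along \<N>. \<forall>E\<in>{a..b}. c * \<eta> * real N \<le> real (card (spectral_window N (ev N) {E - \<eta>..E + \<eta>}))"
proof -
  obtain C where C: "C \<ge> 1" and AC': "\<forall>E\<in>I\<^sub>0. \<forall>\<eta>. 0 < \<eta> \<and> \<eta> \<le> 1 \<longrightarrow>
      inverse C \<le> Re (Im_resolvent G p (Complex E \<eta>) \<one> \<one>) \<and> Re (Im_resolvent G p (Complex E \<eta>) \<one> \<one>) \<le> C"
    using AC unfolding cond_AC_def by blast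
  define c where "c = 1 / (192 * C ^ 3)"
  show ?thesis
  proof
    show "c > 0" unfolding c_def using C by simp
    fix \<eta> :: real assume \<eta>: "0 < \<eta>" "\<eta> \<le> 1"
    obtain k where k: "(b - a) / real (Suc k) < \<eta> / 2"
    proof -
      obtain k :: nat where "(b - a) / (\<eta> / 2) < real k" using reals_Archimedean2 by blast
      then have "(b - a) / (\<eta> / 2) < real (Suc k)" by simp
      then have "(b - a) / real (Suc k) < \<eta> / 2" using \<eta> by (simp add: field_simps del: of_nat_Suc)
      then show ?thesis using that by blast
    qed
    have half: "0 < \<eta> / 2" "\<eta> / 2 \<le> 1" using \<eta> by auto
    have "\<forall>\<^sub>F N in along \<N>. \<forall>E\<in>net a b k.
        (\<eta> / 2) / (96 * C ^ 3) * real N \<le> real (card (spectral_window N (ev N) {E - \<eta> / 2..E + \<eta> / 2}))"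
    proof (rule eventually_ball_finite[OF net_finite(1)], rule ballI)
      fix E assume "E \<in> net a b k"
      then have "E \<in> I\<^sub>0" using net_subset[of a b k] ab by auto
      then show "\<forall>\<^sub>F N in along \<N>. (\<eta> / 2) / (96 * C ^ 3) * real N \<le> real (card (spectral_window N (ev N) {E - \<eta> / 2..E + \<eta> / 2}))"
        using AC' by (intro window_count_at[OF C half]) auto
    qed
    then show "\<forall>\<^sub>F N in along \<N>. \<forall>E\<in>{a..b}. c * \<eta> * real N \<le> real (card (spectral_window N (ev N) {E - \<eta>..E + \<eta>}))"
    proof (rule eventually_mono, intro ballI)
      fix N E assume N: "\<forall>E\<in>net a b k. (\<eta> / 2) / (96 * C ^ 3) * real N \<le> real (card (spectral_window N (ev N) {E - \<eta> / 2..E + \<eta> / 2}))"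
        and E: "E \<in> {a..b}"
      obtain E' where E': "E' \<in> net a b k" "\<bar>E - E'\<bar> \<le> (b - a) / real (Suc k)" using net_covers[OF ab(1) E] by blast
      then have "E - \<eta> \<le> E' - \<eta> / 2 \<and> E' + \<eta> / 2 \<le> E + \<eta>" using k by linarith
      then have "{E' - \<eta> / 2..E' + \<eta> / 2} \<subseteq> {E - \<eta>..E + \<eta>}" by (simp add: atLeastatMost_subset_iff)
      then have "card (spectral_window N (ev N) {E' - \<eta> / 2..E' + \<eta> / 2}) \<le> card (spectral_window N (ev N) {E - \<eta>..E + \<eta>})"
        by (intro card_mono window_finite window_mono)
      moreover have "c * \<eta> * real N = (\<eta> / 2) / (96 * C ^ 3) * real N" unfolding c_def by simp
      ultimately show "c * \<eta> * real N \<le> real (card (spectral_window N (ev N) {E - \<eta>..E + \<eta>}))"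
        using N E'(1) by force
    qed
  qed
qed

end

section \<open>Matrix elements in spectral windows\<close>

context group
begin

lemma conjugation_inverse: "t \<in> carrier G \<Longrightarrow> k \<in> carrier G \<Longrightarrow> inv (t \<otimes> k \<otimes> inv t) = t \<otimes> inv k \<otimes> inv t"
  by (simp add: inv_mult_group m_assoc)

lemma conjugation_inj: "t \<in> carrier G \<Longrightarrow> inj_on (\<lambda>k. t \<otimes> k \<otimes> inv t) (carrier G)"
  by (rule inj_onI) simp

lemma conjugated_pair_sum:
  assumes "u \<in> ell2 G" "v \<in> ell2 G" "t \<in> carrier G" "finite A" "A \<subseteq> carrier G"
  shows "(\<Sum>k\<in>A. cmod (u (t \<otimes> k \<otimes> inv t)) * cmod (v (inv k))) \<le> \<parallel>u\<parallel> * \<parallel>v\<parallel>"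
proof -
  have r: "L2_set (\<lambda>k. cmod (z (f k))) A \<le> \<parallel>z\<parallel>"
    if z: "z \<in> ell2 G" and f: "inj_on f A" "f ` A \<subseteq> carrier G" for z f
  proof -
    have "L2_set (\<lambda>k. cmod (z (f k))) A = L2_set (\<lambda>k. cmod (z k)) (f ` A)"
      unfolding L2_set_def sum.reindex[OF f(1)] by simp
    then show ?thesis using ell2_L2_set_le[OF z _ f(2)] assms(4) by simp
  qed
  have "(\<Sum>k\<in>A. cmod (u (t \<otimes> k \<otimes> inv t)) * cmod (v (inv k))) \<le>
      L2_set (\<lambda>k. cmod (u (t \<otimes> k \<otimes> inv t))) A * L2_set (\<lambda>k. cmod (v (inv k))) A"
    using L2_set_mult_ineq[of "\<lambda>k. cmod (u (t \<otimes> k \<otimes> inv t))" "\<lambda>k. cmod (v (inv k))" A] by simp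
  also have "\<dots> \<le> \<parallel>u\<parallel> * \<parallel>v\<parallel>"
  proof (intro mult_mono r assms(1,2))
    show "inj_on (\<lambda>k. t \<otimes> k \<otimes> inv t) A" using conjugation_inj[OF assms(3)] assms(5) inj_on_subset by blast
    show "inj_on (m_inv G) A" using inv_inj assms(5) inj_on_subset by blast
  qed (use assms(3,5) in auto)
  finally show ?thesis .
qed

lemma conjugated_pair_tail:
  assumes "u \<in> ell2 G" "v \<in> ell2 G" "t \<in> carrier G" "\<epsilon> > 0"
  shows "\<exists>D. finite D \<and> D \<subseteq> carrier G \<and> (\<forall>k\<in>D. inv k \<in> D) \<and>
    (\<forall>A. finite A \<and> A \<subseteq> carrier G \<and> A \<inter> D = {} \<longrightarrow>
      (\<Sum>k\<in>A. cmod (u (t \<otimes> k \<otimes> inv t)) * cmod (v (inv k))) \<le> \<epsilon>)"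
proof -
  define f where "f = (\<lambda>k. cmod (u (t \<otimes> k \<otimes> inv t)) * cmod (v (inv k)))"
  have f0: "f k \<ge> 0" for k by (simp add: f_def)
  have sm: "f summable_on carrier G"
    by (rule nonneg_bdd_above_summable_on)
      (auto simp: f_def intro!: bdd_aboveI2[where M="\<parallel>u\<parallel> * \<parallel>v\<parallel>"] conjugated_pair_sum assms)
  obtain D where D: "finite D" "D \<subseteq> carrier G" "dist (sum f D) (infsum f (carrier G)) \<le> \<epsilon>"
    using infsum_finite_approximation[OF sm assms(4)] by blast
  have tail: "sum f A \<le> \<epsilon>" if A: "finite A" "A \<subseteq> carrier G" "A \<inter> D = {}" for A
  proof -
    have "sum f A + sum f D = sum f (A \<union> D)" using A D by (simp add: sum.union_disjoint)
    also have "\<dots> \<le> infsum f (carrier G)"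
      by (rule finite_sum_le_infsum[OF sm]) (use A D f0 in auto)
    finally show ?thesis using D(3) by (simp add: dist_real_def)
  qed
  show ?thesis
  proof (intro exI conjI allI impI ballI)
    show "finite (D \<union> m_inv G ` D)" "D \<union> m_inv G ` D \<subseteq> carrier G" using D by auto
    show "inv k \<in> D \<union> m_inv G ` D" if "k \<in> D \<union> m_inv G ` D" for k using that D(2) by auto
    show "(\<Sum>k\<in>A. cmod (u (t \<otimes> k \<otimes> inv t)) * cmod (v (inv k))) \<le> \<epsilon>"
      if "finite A \<and> A \<subseteq> carrier G \<and> A \<inter> (D \<union> m_inv G ` D) = {}" for A
      using tail[of A] that unfolding f_def by blast
  qed
qed

text \<open>The coefficients of the product of two Green functions are approximated in \<open>\<ell>\<^sup>1\<close> by those of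
  elements of the group algebra, although each factor converges only in \<open>\<ell>\<^sup>2\<close>.\<close>

lemma green_product_approx:
  assumes p: "p \<in> GA" and g1: "green_like p E\<^sub>1 \<eta> v\<^sub>1" and g2: "green_like p E\<^sub>2 \<eta> v\<^sub>2" and t: "t \<in> carrier G"
    and \<epsilon>: "\<epsilon> > 0"
  shows "\<exists>D. finite D \<and> D \<subseteq> carrier G \<and> (\<forall>k\<in>D. inv k \<in> D) \<and>
    (\<forall>\<^sub>F n in sequentially. \<forall>A. finite A \<and> A \<subseteq> carrier G \<longrightarrow>
      (\<Sum>k\<in>A. cmod (green_approx p E\<^sub>2 \<eta> n (t \<otimes> k \<otimes> inv t) * green_approx p E\<^sub>1 \<eta> n (inv k)
        - (if k \<in> D then v\<^sub>2 (t \<otimes> k \<otimes> inv t) * v\<^sub>1 (inv k) else 0))) \<le> \<epsilon>)"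
proof -
  have v1: "v\<^sub>1 \<in> ell2 G" and l1: "(\<lambda>n. \<parallel>\<lambda>x. v\<^sub>1 x - green_approx p E\<^sub>1 \<eta> n x\<parallel>) \<longlonglongrightarrow> 0"
    using g1 unfolding green_like_def by auto
  have v2: "v\<^sub>2 \<in> ell2 G" and l2: "(\<lambda>n. \<parallel>\<lambda>x. v\<^sub>2 x - green_approx p E\<^sub>2 \<eta> n x\<parallel>) \<longlonglongrightarrow> 0"
    using g2 unfolding green_like_def by auto
  obtain D where D: "finite D" "D \<subseteq> carrier G" "\<forall>k\<in>D. inv k \<in> D"
    and tail: "\<forall>A. finite A \<and> A \<subseteq> carrier G \<and> A \<inter> D = {} \<longrightarrow>
      (\<Sum>k\<in>A. cmod (v\<^sub>2 (t \<otimes> k \<otimes> inv t)) * cmod (v\<^sub>1 (inv k))) \<le> \<epsilon> / 2"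
    using conjugated_pair_tail[OF v2 v1 t half_gt_zero[OF \<epsilon>]] by blast
  define d1 where "d1 = (\<lambda>n. \<parallel>\<lambda>x. v\<^sub>1 x - green_approx p E\<^sub>1 \<eta> n x\<parallel>)"
  define d2 where "d2 = (\<lambda>n. \<parallel>\<lambda>x. v\<^sub>2 x - green_approx p E\<^sub>2 \<eta> n x\<parallel>)"
  have "(\<lambda>n. d2 n * (\<parallel>v\<^sub>1\<parallel> + d1 n) + \<parallel>v\<^sub>2\<parallel> * d1 n) \<longlonglongrightarrow> 0 * (\<parallel>v\<^sub>1\<parallel> + 0) + \<parallel>v\<^sub>2\<parallel> * 0"
    unfolding d1_def d2_def by (intro tendsto_add tendsto_mult l1 l2 tendsto_const)
  then have "\<forall>\<^sub>F n in sequentially. d2 n * (\<parallel>v\<^sub>1\<parallel> + d1 n) + \<parallel>v\<^sub>2\<parallel> * d1 n < \<epsilon> / 2"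
    by (rule order_tendstoD) (use \<epsilon> in simp)
  then have ev: "\<forall>\<^sub>F n in sequentially. \<forall>A. finite A \<and> A \<subseteq> carrier G \<longrightarrow>
      (\<Sum>k\<in>A. cmod (green_approx p E\<^sub>2 \<eta> n (t \<otimes> k \<otimes> inv t) * green_approx p E\<^sub>1 \<eta> n (inv k)
        - (if k \<in> D then v\<^sub>2 (t \<otimes> k \<otimes> inv t) * v\<^sub>1 (inv k) else 0))) \<le> \<epsilon>"
  proof (rule eventually_mono, intro allI impI)
    fix n A assume n: "d2 n * (\<parallel>v\<^sub>1\<parallel> + d1 n) + \<parallel>v\<^sub>2\<parallel> * d1 n < \<epsilon> / 2" and A: "finite A \<and> A \<subseteq> carrier G"
    let ?q1 = "green_approx p E\<^sub>1 \<eta> n" and ?q2 = "green_approx p E\<^sub>2 \<eta> n"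
    let ?c = "\<lambda>k. t \<otimes> k \<otimes> inv t"
    have q: "?q1 \<in> ell2 G" "?q2 \<in> ell2 G" by (intro GA_ell2 green_approx_GA p)+
    define e1 where "e1 = (\<lambda>x. v\<^sub>1 x - ?q1 x)"
    define e2 where "e2 = (\<lambda>x. v\<^sub>2 x - ?q2 x)"
    have e: "e1 \<in> ell2 G" "e2 \<in> ell2 G" unfolding e1_def e2_def by (intro ell2_diff v1 v2 q)+
    have ne: "\<parallel>e1\<parallel> = d1 n" "\<parallel>e2\<parallel> = d2 n" by (simp_all add: e1_def e2_def d1_def d2_def)
    have "?q1 = (\<lambda>x. v\<^sub>1 x - e1 x)" by (simp add: e1_def)
    then have nq: "\<parallel>?q1\<parallel> \<le> \<parallel>v\<^sub>1\<parallel> + d1 n" using ell2_diff(2)[OF v1 e(1)] ne by simp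
    have tri: "cmod (- x - y + z) \<le> cmod x + cmod y + cmod z" for x y z :: complex
      using norm_triangle_ineq[of "- x - y" z] norm_triangle_ineq4[of "- x" y] by (simp only: norm_minus_cancel)
    have "(\<Sum>k\<in>A. cmod (?q2 (?c k) * ?q1 (inv k) - (if k \<in> D then v\<^sub>2 (?c k) * v\<^sub>1 (inv k) else 0)))
      \<le> (\<Sum>k\<in>A. cmod (e2 (?c k)) * cmod (?q1 (inv k)) + cmod (v\<^sub>2 (?c k)) * cmod (e1 (inv k))
          + (if k \<in> D then 0 else cmod (v\<^sub>2 (?c k)) * cmod (v\<^sub>1 (inv k))))"
    proof (rule sum_mono)
      fix k
      have eq: "?q2 (?c k) * ?q1 (inv k) - (if k \<in> D then v\<^sub>2 (?c k) * v\<^sub>1 (inv k) else 0) =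
          - (e2 (?c k) * ?q1 (inv k)) - v\<^sub>2 (?c k) * e1 (inv k) + (if k \<in> D then 0 else v\<^sub>2 (?c k) * v\<^sub>1 (inv k))"
        by (simp add: e1_def e2_def algebra_simps)
      have "cmod (?q2 (?c k) * ?q1 (inv k) - (if k \<in> D then v\<^sub>2 (?c k) * v\<^sub>1 (inv k) else 0)) \<le>
          cmod (e2 (?c k) * ?q1 (inv k)) + cmod (v\<^sub>2 (?c k) * e1 (inv k))
          + cmod (if k \<in> D then 0 else v\<^sub>2 (?c k) * v\<^sub>1 (inv k))"
        unfolding eq by (rule tri)
      then show "cmod (?q2 (?c k) * ?q1 (inv k) - (if k \<in> D then v\<^sub>2 (?c k) * v\<^sub>1 (inv k) else 0)) \<le>
          cmod (e2 (?c k)) * cmod (?q1 (inv k)) + cmod (v\<^sub>2 (?c k)) * cmod (e1 (inv k))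
          + (if k \<in> D then 0 else cmod (v\<^sub>2 (?c k)) * cmod (v\<^sub>1 (inv k)))"
        by (cases "k \<in> D") (simp_all only: if_True if_False norm_mult norm_zero)
    qed
    also have "\<dots> = (\<Sum>k\<in>A. cmod (e2 (?c k)) * cmod (?q1 (inv k))) + (\<Sum>k\<in>A. cmod (v\<^sub>2 (?c k)) * cmod (e1 (inv k)))
        + (\<Sum>k\<in>A. if k \<in> D then 0 else cmod (v\<^sub>2 (?c k)) * cmod (v\<^sub>1 (inv k)))"
      by (simp only: sum.distrib)
    also have "(\<Sum>k\<in>A. if k \<in> D then 0 else cmod (v\<^sub>2 (?c k)) * cmod (v\<^sub>1 (inv k))) =
        (\<Sum>k\<in>A - D. cmod (v\<^sub>2 (?c k)) * cmod (v\<^sub>1 (inv k)))"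
      using A by (intro sum.mono_neutral_cong_right) auto
    also have "\<dots> \<le> \<epsilon> / 2" by (rule tail[rule_format]) (use A in auto)
    also have "(\<Sum>k\<in>A. cmod (e2 (?c k)) * cmod (?q1 (inv k))) \<le> d2 n * (\<parallel>v\<^sub>1\<parallel> + d1 n)"
      using conjugated_pair_sum[OF e(2) q(1) t conjunct1[OF A] conjunct2[OF A]] mult_left_mono[OF nq ell2_norm_nonneg[of e2]]
      unfolding ne(2) by linarith
    also have "(\<Sum>k\<in>A. cmod (v\<^sub>2 (?c k)) * cmod (e1 (inv k))) \<le> \<parallel>v\<^sub>2\<parallel> * d1 n"
      using conjugated_pair_sum[OF v2 e(1) t conjunct1[OF A] conjunct2[OF A]] unfolding ne(1) .
    finally show "(\<Sum>k\<in>A. cmod (?q2 (?c k) * ?q1 (inv k) - (if k \<in> D then v\<^sub>2 (?c k) * v\<^sub>1 (inv k) else 0))) \<le> \<epsilon>"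
      using n by linarith
  qed
  show ?thesis using D ev by blast
qed

end

context group
begin

definition resolvent_dominated where
  "resolvent_dominated p E\<^sub>1 E\<^sub>2 \<eta> t w \<longleftrightarrow> (\<forall>k\<in>carrier G. cmod (w k) \<le>
     cmod (Im_resolvent G p (Complex E\<^sub>2 \<eta>) \<one> (t \<otimes> k \<otimes> inv t)) * cmod (Im_resolvent G p (Complex E\<^sub>1 \<eta>) \<one> k))"

end

context spectral_sequence
begin

text \<open>The squared matrix elements of \<open>\<rho>\<^sub>N(t) D\<^sub>a\<close> between two windows, \<open>D\<^sub>a\<close> being the diagonal matrix of \<open>a\<close>.\<close>

definition window_energy where
  "window_energy N E\<^sub>1 E\<^sub>2 \<eta> t a =
     (\<Sum>i\<in>spectral_window N (ev N) {E\<^sub>1 - \<eta>..E\<^sub>1 + \<eta>}. \<Sum>j\<in>spectral_window N (ev N) {E\<^sub>2 - \<eta>..E\<^sub>2 + \<eta>}.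
        (cmod (\<Sum>y\<in>{1..N}. cnj (\<phi> N j (\<rho> N t y)) * a y * \<phi> N i y))\<^sup>2)"

lemma green_eigenvalue_window:
  assumes \<eta>: "\<eta> > 0" and n: "(shift_bound p E / (shift_bound p E + \<eta>\<^sup>2)) ^ n \<le> 1 / 2"
    and l: "\<bar>l\<bar> \<le> (\<Sum>g\<in>supp p. cmod (p g))" "l \<in> {E - \<eta>..E + \<eta>}"
  shows "1 \<le> 4 * \<eta>\<^sup>2 * green_eigenvalue p E \<eta> n l"
proof -
  let ?d = "(l - E)\<^sup>2 + \<eta>\<^sup>2"
  have d: "?d > 0" using \<eta> by (simp add: add_nonneg_pos)
  have "\<bar>l - E\<bar> \<le> \<eta>" using l(2) by auto
  then have "(l - E)\<^sup>2 \<le> \<eta>\<^sup>2" using \<eta> by (metis abs_le_square_iff abs_of_pos)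
  then have "?d \<le> 2 * \<eta>\<^sup>2" by simp
  then have "1 \<le> 4 * \<eta>\<^sup>2 * ((1 / 2) / ?d)" using d by (simp add: le_divide_eq)
  also have "\<dots> \<le> 4 * \<eta>\<^sup>2 * ((1 - (shift_bound p E / (shift_bound p E + \<eta>\<^sup>2)) ^ n) / ?d)"
    using n d by (intro mult_left_mono divide_right_mono) auto
  also have "\<dots> \<le> 4 * \<eta>\<^sup>2 * green_eigenvalue p E \<eta> n l"
    by (intro mult_left_mono green_eigenvalue_bounds(3)[OF \<eta> l(1)]) simp
  finally show ?thesis .
qed

text \<open>An element \<open>w\<close> whose quadratic form controls the energy for all bounded functions. As \<open>w\<close> does not
  depend on the function, the exceptional spaces can be chosen before the observable. The summand
  \<open>N\<close> is harmless, being \<open>o(1/\<eta>) N\<close>.\<close>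

definition energy_symbol where
  "energy_symbol E\<^sub>1 E\<^sub>2 \<eta> t w \<longleftrightarrow> w \<in> GA \<and> w = star G w \<and> resolvent_dominated p E\<^sub>1 E\<^sub>2 \<eta> t w
    \<and> (\<forall>\<^sub>F N in along \<N>. \<forall>a. (\<forall>x\<in>{1..N}. cmod (a x) \<le> 2) \<longrightarrow>
          window_energy N E\<^sub>1 E\<^sub>2 \<eta> t a \<le> 16 * \<eta>\<^sup>2 * (cmod (cinner N a (mat_vec N (rep_mat (\<rho> N) w) a)) + real N))"

text \<open>The indicator of the window is at most \<open>4 \<eta>\<^sup>2\<close> times the polynomial approximation of the Green
  function, and the trace that results is the quadratic form of a product of two approximate Green
  functions, up to points fixed by one of finitely many elements other than the unit. Replacing the
  approximations by the Green functions themselves, restricted to a finite set, makes the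
  coefficients entries of \<open>Im R\<close>.\<close>

lemma energy_symbol_exists:
  assumes \<eta>: "\<eta> > 0" and t: "t \<in> carrier G"
  shows "\<exists>w. energy_symbol E\<^sub>1 E\<^sub>2 \<eta> t w"
proof -
  let ?c = "\<lambda>k. t \<otimes> k \<otimes> inv t"
  obtain v1 where g1: "green_like p E\<^sub>1 \<eta> v1" using green_function[OF p_GA p_star \<eta>] by blast
  obtain v2 where g2: "green_like p E\<^sub>2 \<eta> v2" using green_function[OF p_GA p_star \<eta>] by blast
  \<comment> \<open>Both errors below are at most \<open>4 \<epsilon> N\<close>; multiplied by \<open>\<eta>\<^sup>2\<close> they add up to \<open>N\<close>.\<close>
  define \<epsilon> where "\<epsilon> = 1 / (8 * \<eta>\<^sup>2)"
  have \<epsilon>: "\<epsilon> > 0" unfolding \<epsilon>_def using \<eta> by simp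
  obtain D where D: "finite D" "D \<subseteq> carrier G" "\<forall>k\<in>D. inv k \<in> D"
    and appr: "\<forall>\<^sub>F n in sequentially. \<forall>A. finite A \<and> A \<subseteq> carrier G \<longrightarrow>
      (\<Sum>k\<in>A. cmod (green_approx p E\<^sub>2 \<eta> n (?c k) * green_approx p E\<^sub>1 \<eta> n (inv k)
        - (if k \<in> D then v2 (?c k) * v1 (inv k) else 0))) \<le> \<epsilon>"
    using green_product_approx[OF p_GA g1 g2 t \<epsilon>] by blast
  have "\<forall>\<^sub>F n in sequentially. (\<forall>A. finite A \<and> A \<subseteq> carrier G \<longrightarrow>
      (\<Sum>k\<in>A. cmod (green_approx p E\<^sub>2 \<eta> n (?c k) * green_approx p E\<^sub>1 \<eta> n (inv k)
        - (if k \<in> D then v2 (?c k) * v1 (inv k) else 0))) \<le> \<epsilon>)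
      \<and> (shift_bound p E\<^sub>1 / (shift_bound p E\<^sub>1 + \<eta>\<^sup>2)) ^ n \<le> 1 / 2
      \<and> (shift_bound p E\<^sub>2 / (shift_bound p E\<^sub>2 + \<eta>\<^sup>2)) ^ n \<le> 1 / 2"
    by (intro eventually_conj appr green_small_ratio \<eta>)
  then obtain n where n: "\<forall>A. finite A \<and> A \<subseteq> carrier G \<longrightarrow>
      (\<Sum>k\<in>A. cmod (green_approx p E\<^sub>2 \<eta> n (?c k) * green_approx p E\<^sub>1 \<eta> n (inv k)
        - (if k \<in> D then v2 (?c k) * v1 (inv k) else 0))) \<le> \<epsilon>"
      "(shift_bound p E\<^sub>1 / (shift_bound p E\<^sub>1 + \<eta>\<^sup>2)) ^ n \<le> 1 / 2"
      "(shift_bound p E\<^sub>2 / (shift_bound p E\<^sub>2 + \<eta>\<^sup>2)) ^ n \<le> 1 / 2"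
    using eventually_happens'[OF sequentially_bot] by blast
  define q1 where "q1 = green_approx p E\<^sub>1 \<eta> n"
  define q2 where "q2 = green_approx p E\<^sub>2 \<eta> n"
  have q: "q1 \<in> GA" "q2 \<in> GA" unfolding q1_def q2_def by (intro green_approx_GA p_GA)+
  \<comment> \<open>The factor \<open>\<eta>\<^sup>2\<close> turns the two Green functions into entries of \<open>Im R\<close>.\<close>
  define w where "w = (\<lambda>k. if k \<in> D then of_real (\<eta>\<^sup>2) * (v2 (?c k) * v1 (inv k)) else 0)"
  have w_supp: "supp w \<subseteq> D" unfolding w_def supp_def by auto
  have w: "w \<in> GA" by (rule GA_I[OF D(1,2)]) (simp add: w_def)
  have sym1: "v1 (inv h) = cnj (v1 h)" "Im_resolvent G p (Complex E\<^sub>1 \<eta>) \<one> h = of_real \<eta> * cnj (v1 h)"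
    and sym2: "v2 (inv h) = cnj (v2 h)" "Im_resolvent G p (Complex E\<^sub>2 \<eta>) \<one> h = of_real \<eta> * cnj (v2 h)"
    if "h \<in> carrier G" for h
    using g1 g2 that unfolding green_like_def by auto
  have w_star: "w = star G w"
  proof
    fix k
    show "w k = star G w k"
    proof (cases "k \<in> D")
      case True
      have k: "k \<in> carrier G" "inv k \<in> D" "?c k \<in> carrier G" using True D t by auto
      have "v2 (?c (inv k)) = cnj (v2 (?c k))"
        using sym2(1)[OF k(3)] conjugation_inverse[OF t k(1)] by simp
      then show ?thesis using True k sym1(1)[OF k(1)] by (simp add: star_def w_def)
    next
      case False
      then have "k \<in> carrier G \<Longrightarrow> inv k \<notin> D" using D(3) by fastforce
      then show ?thesis using False by (auto simp: star_def w_def)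
    qed
  qed
  have w_bound: "cmod (w k) \<le> cmod (Im_resolvent G p (Complex E\<^sub>2 \<eta>) \<one> (?c k)) * cmod (Im_resolvent G p (Complex E\<^sub>1 \<eta>) \<one> k)"
    if k: "k \<in> carrier G" for k
  proof -
    have "?c k \<in> carrier G" using k t by simp
    then show ?thesis unfolding sym1(2)[OF k] sym2(2)[OF \<open>?c k \<in> carrier G\<close>] w_def
      using \<eta> sym1(1)[OF k] by (simp add: norm_mult power2_eq_square)
  qed
  define K where "K = (\<lambda>g. inv t \<otimes> g \<otimes> t) ` supp q2"
  have s: "finite (supp q1)" "supp q1 \<subseteq> carrier G" "finite (supp q2)" "supp q2 \<subseteq> carrier G"
    using GA_D[OF q(1)] GA_D[OF q(2)] by auto
  have K: "finite K" "K \<subseteq> carrier G" unfolding K_def using s t by auto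
  define A where "A = (\<lambda>(h, k). h \<otimes> k) ` (supp q1 \<times> K) - {\<one>}"
  have A: "finite A" "A \<subseteq> carrier G" "\<one> \<notin> A" unfolding A_def using s K by auto
  define L where "L = (\<Sum>g\<in>supp q1. cmod (q1 g)) * (\<Sum>g\<in>supp q2. cmod (q2 g)) + 1"
  have L: "L \<ge> 1" unfolding L_def by (simp add: sum_nonneg)
  define \<delta>' where "\<delta>' = \<epsilon> / L"
  have \<delta>': "\<delta>' > 0" unfolding \<delta>'_def using \<epsilon> L by simp
  have "\<forall>\<^sub>F N in along \<N>. \<forall>a. (\<forall>x\<in>{1..N}. cmod (a x) \<le> 2) \<longrightarrow>
          window_energy N E\<^sub>1 E\<^sub>2 \<eta> t a \<le> 16 * \<eta>\<^sup>2 * (cmod (cinner N a (mat_vec N (rep_mat (\<rho> N) w) a)) + real N)"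
    using fixed_small[OF A \<delta>'] eventually_along_mem
  proof (eventually_elim, intro allI impI)
    fix N a assume few: "\<forall>g\<in>A. fixed N g \<le> \<delta>' * real N" and N: "N \<in> \<N>" and a: "\<forall>x\<in>{1..N}. cmod (a x) \<le> 2"
    interpret permutation_rep G N "\<rho> N" using rep N by blast
    let ?X = "\<lambda>i j. \<Sum>y\<in>{1..N}. cnj (\<phi> N j (\<rho> N t y)) * a y * \<phi> N i y"
    let ?f1 = "\<lambda>i. green_eigenvalue p E\<^sub>1 \<eta> n (ev N i)" and ?f2 = "\<lambda>j. green_eigenvalue p E\<^sub>2 \<eta> n (ev N j)"
    let ?W1 = "spectral_window N (ev N) {E\<^sub>1 - \<eta>..E\<^sub>1 + \<eta>}" and ?W2 = "spectral_window N (ev N) {E\<^sub>2 - \<eta>..E\<^sub>2 + \<eta>}"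
    define corr where "corr = (\<lambda>k. \<Sum>y\<in>{1..N}. cnj (a (\<rho> N k y)) * a y)"
    define T where "T = (\<Sum>i\<in>{1..N}. \<Sum>j\<in>{1..N}. ?f1 i * ?f2 j * (cmod (?X i j))\<^sup>2)"
    define Q where "Q = cinner N a (mat_vec N (rep_mat (\<rho> N) w) a)"
    have fpos: "?f1 i \<ge> 0" "?f2 i \<ge> 0" if "i \<in> {1..N}" for i
      using green_eigenvalue_bounds(1)[OF \<eta> ev_bound[OF N that]] by auto
    have W: "?W1 \<subseteq> {1..N}" "?W2 \<subseteq> {1..N}" by (auto simp: spectral_window_def)
    have "window_energy N E\<^sub>1 E\<^sub>2 \<eta> t a \<le> (\<Sum>i\<in>?W1. \<Sum>j\<in>?W2. 16 * \<eta> ^ 4 * (?f1 i * ?f2 j * (cmod (?X i j))\<^sup>2))"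
      unfolding window_energy_def
    proof (intro sum_mono)
      fix i j assume i: "i \<in> ?W1" and j: "j \<in> ?W2"
      have "1 \<le> 4 * \<eta>\<^sup>2 * ?f1 i"
        by (rule green_eigenvalue_window[OF \<eta> n(2) ev_bound[OF N]]) (use i in \<open>auto simp: spectral_window_def\<close>)
      moreover have "1 \<le> 4 * \<eta>\<^sup>2 * ?f2 j"
        by (rule green_eigenvalue_window[OF \<eta> n(3) ev_bound[OF N]]) (use j in \<open>auto simp: spectral_window_def\<close>)
      ultimately have "1 * 1 \<le> (4 * \<eta>\<^sup>2 * ?f1 i) * (4 * \<eta>\<^sup>2 * ?f2 j)" by (intro mult_mono) auto
      then have "1 * (cmod (?X i j))\<^sup>2 \<le> ((4 * \<eta>\<^sup>2 * ?f1 i) * (4 * \<eta>\<^sup>2 * ?f2 j)) * (cmod (?X i j))\<^sup>2"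
        by (intro mult_right_mono) auto
      also have "\<dots> = 16 * \<eta> ^ 4 * (?f1 i * ?f2 j * (cmod (?X i j))\<^sup>2)"
        by (simp add: power2_eq_square power4_eq_xxxx)
      finally show "(cmod (?X i j))\<^sup>2 \<le> 16 * \<eta> ^ 4 * (?f1 i * ?f2 j * (cmod (?X i j))\<^sup>2)" by simp
    qed
    also have "\<dots> = 16 * \<eta> ^ 4 * (\<Sum>i\<in>?W1. \<Sum>j\<in>?W2. ?f1 i * ?f2 j * (cmod (?X i j))\<^sup>2)"
      by (simp only: sum_distrib_left)
    also have "\<dots> \<le> 16 * \<eta> ^ 4 * T"
    proof (rule mult_left_mono)
      have "(\<Sum>i\<in>?W1. \<Sum>j\<in>?W2. ?f1 i * ?f2 j * (cmod (?X i j))\<^sup>2) \<le> (\<Sum>i\<in>?W1. \<Sum>j\<in>{1..N}. ?f1 i * ?f2 j * (cmod (?X i j))\<^sup>2)"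
        using W fpos by (intro sum_mono sum_mono2) (auto intro!: mult_nonneg_nonneg)
      also have "\<dots> \<le> T" unfolding T_def
        using W fpos by (intro sum_mono2 sum_nonneg) (auto intro!: mult_nonneg_nonneg)
      finally show "(\<Sum>i\<in>?W1. \<Sum>j\<in>?W2. ?f1 i * ?f2 j * (cmod (?X i j))\<^sup>2) \<le> T" .
    qed (use \<eta> in simp)
    finally have step1: "window_energy N E\<^sub>1 E\<^sub>2 \<eta> t a \<le> 16 * \<eta> ^ 4 * T" .
    have "complex_of_real T = (\<Sum>y\<in>{1..N}. \<Sum>y'\<in>{1..N}. a y * cnj (a y') * rep_mat (\<rho> N) q1 y y' * rep_mat (\<rho> N) q2 (\<rho> N t y') (\<rho> N t y))"
      unfolding T_def
    proof (rule weighted_matrix_elements[OF basis[OF N]])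
      fix j x assume j: "j \<in> {1..N}" and x: "x \<in> {1..N}"
      show "mat_vec N (rep_mat (\<rho> N) q1) (\<phi> N j) x = of_real (?f1 j) * \<phi> N j x"
        unfolding q1_def by (rule rep_green[OF p_GA \<eta> eigenvector[OF N j] x])
      show "mat_vec N (rep_mat (\<rho> N) q2) (\<phi> N j) x = of_real (?f2 j) * \<phi> N j x"
        unfolding q2_def by (rule rep_green[OF p_GA \<eta> eigenvector[OF N j] x])
    qed (use rep_in t in auto)
    moreover have "cmod ((\<Sum>y\<in>{1..N}. \<Sum>y'\<in>{1..N}. a y * cnj (a y') * rep_mat (\<rho> N) q1 y y' * rep_mat (\<rho> N) q2 (\<rho> N t y') (\<rho> N t y))
        - (\<Sum>k\<in>K. q2 (?c k) * q1 (inv k) * corr k))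
      \<le> (\<delta>' * real N) * (2\<^sup>2 * (\<Sum>g\<in>supp q1. cmod (q1 g)) * (\<Sum>g\<in>supp q2. cmod (q2 g)))"
      unfolding K_def corr_def
    proof (rule trace_of_product[OF q t])
      show "0 \<le> \<delta>' * real N" using \<delta>' by simp
      fix k h assume "k \<in> (\<lambda>g. inv t \<otimes> g \<otimes> t) ` supp q2" "h \<in> supp q1" "h \<otimes> k \<noteq> \<one>"
      then have "h \<otimes> k \<in> A" unfolding A_def K_def by force
      then show "fixed_count (h \<otimes> k) \<le> \<delta>' * real N" using few by blast
    qed (use a in auto)
    ultimately have e1: "cmod (complex_of_real T - (\<Sum>k\<in>K. q2 (?c k) * q1 (inv k) * corr k)) \<le> 4 * \<epsilon> * real N"
    proof -
      assume eq: "complex_of_real T = (\<Sum>y\<in>{1..N}. \<Sum>y'\<in>{1..N}. a y * cnj (a y') * rep_mat (\<rho> N) q1 y y' * rep_mat (\<rho> N) q2 (\<rho> N t y') (\<rho> N t y))"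
        and le: "cmod ((\<Sum>y\<in>{1..N}. \<Sum>y'\<in>{1..N}. a y * cnj (a y') * rep_mat (\<rho> N) q1 y y' * rep_mat (\<rho> N) q2 (\<rho> N t y') (\<rho> N t y))
          - (\<Sum>k\<in>K. q2 (?c k) * q1 (inv k) * corr k))
        \<le> (\<delta>' * real N) * (2\<^sup>2 * (\<Sum>g\<in>supp q1. cmod (q1 g)) * (\<Sum>g\<in>supp q2. cmod (q2 g)))"
      have "(\<delta>' * real N) * (2\<^sup>2 * (\<Sum>g\<in>supp q1. cmod (q1 g)) * (\<Sum>g\<in>supp q2. cmod (q2 g))) = 4 * real N * \<delta>' * (L - 1)"
        by (simp add: L_def)
      also have "\<dots> \<le> 4 * real N * \<delta>' * L" using \<delta>' by (intro mult_left_mono) auto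
      also have "\<dots> = 4 * \<epsilon> * real N" unfolding \<delta>'_def using L by simp
      finally show ?thesis using le unfolding eq by linarith
    qed
    have corr_le: "cmod (corr k) \<le> 4 * real N" if k: "k \<in> carrier G" for k
    proof -
      have "cmod (corr k) \<le> (\<Sum>y\<in>{1..N}. 4)"
        unfolding corr_def
      proof (rule order_trans[OF norm_sum sum_mono])
        fix y assume y: "y \<in> {1..N}"
        have "cmod (a (\<rho> N k y)) * cmod (a y) \<le> 2 * 2" using a y rep_in[OF k y] by (intro mult_mono) auto
        then show "cmod (cnj (a (\<rho> N k y)) * a y) \<le> 4" by (simp add: norm_mult)
      qed
      then show ?thesis by simp
    qed
    have Q: "Q = (\<Sum>k\<in>K \<union> D. w k * corr k)"
    proof -
      have "Q = (\<Sum>k\<in>supp w. w k * corr k)" unfolding Q_def corr_def by (rule cinner_rep[OF w])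
      also have "\<dots> = (\<Sum>k\<in>K \<union> D. w k * corr k)"
        using w_supp K D by (intro sum.mono_neutral_left) (auto simp: supp_def)
      finally show ?thesis .
    qed
    have KD: "(\<Sum>k\<in>K. q2 (?c k) * q1 (inv k) * corr k) = (\<Sum>k\<in>K \<union> D. q2 (?c k) * q1 (inv k) * corr k)"
    proof (rule sum.mono_neutral_left)
      show "\<forall>i\<in>K \<union> D - K. q2 (?c i) * q1 (inv i) * corr i = 0"
      proof
        fix k assume k: "k \<in> K \<union> D - K"
        then have kc: "k \<in> carrier G" using D by auto
        have "q2 (?c k) = 0"
        proof (rule ccontr)
          assume "q2 (?c k) \<noteq> 0"
          then have "?c k \<in> supp q2" by (simp add: supp_def)
          moreover have "inv t \<otimes> ?c k \<otimes> t = k"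
          proof -
            have "inv t \<otimes> (t \<otimes> (k \<otimes> (inv t \<otimes> t))) = k" using kc t by (simp add: m_assoc[symmetric])
            then show ?thesis using kc t by (simp add: m_assoc)
          qed
          ultimately have "k \<in> K" unfolding K_def by (metis image_eqI)
          then show False using k by blast
        qed
        then show "q2 (?c k) * q1 (inv k) * corr k = 0" by simp
      qed
    qed (use K D in auto)
    have e2: "cmod (of_real (\<eta>\<^sup>2) * (\<Sum>k\<in>K. q2 (?c k) * q1 (inv k) * corr k) - Q) \<le> \<eta>\<^sup>2 * \<epsilon> * (4 * real N)"
    proof -
      let ?d = "\<lambda>k. q2 (?c k) * q1 (inv k) - (if k \<in> D then v2 (?c k) * v1 (inv k) else 0)"
      have eq: "of_real (\<eta>\<^sup>2) * (\<Sum>k\<in>K. q2 (?c k) * q1 (inv k) * corr k) - Q = (\<Sum>k\<in>K \<union> D. of_real (\<eta>\<^sup>2) * (?d k * corr k))"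
        unfolding KD Q sum_distrib_left sum_subtractf[symmetric]
        by (intro sum.cong refl) (simp add: w_def algebra_simps)
      have "cmod (of_real (\<eta>\<^sup>2) * (\<Sum>k\<in>K. q2 (?c k) * q1 (inv k) * corr k) - Q)
          \<le> (\<Sum>k\<in>K \<union> D. \<eta>\<^sup>2 * (cmod (?d k) * (4 * real N)))"
        unfolding eq
      proof (rule order_trans[OF norm_sum sum_mono])
        fix k assume "k \<in> K \<union> D"
        then have "k \<in> carrier G" using K D by auto
        then have "\<eta>\<^sup>2 * (cmod (?d k) * cmod (corr k)) \<le> \<eta>\<^sup>2 * (cmod (?d k) * (4 * real N))"
          by (intro mult_left_mono corr_le) auto
        then show "cmod (of_real (\<eta>\<^sup>2) * (?d k * corr k)) \<le> \<eta>\<^sup>2 * (cmod (?d k) * (4 * real N))"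
          by (simp only: norm_mult norm_of_real abs_power2)
      qed
      also have "\<dots> = \<eta>\<^sup>2 * ((\<Sum>k\<in>K \<union> D. cmod (?d k)) * (4 * real N))"
        by (simp only: sum_distrib_left sum_distrib_right)
      also have "\<dots> \<le> \<eta>\<^sup>2 * (\<epsilon> * (4 * real N))"
      proof (intro mult_left_mono mult_right_mono)
        show "(\<Sum>k\<in>K \<union> D. cmod (?d k)) \<le> \<epsilon>"
          unfolding q1_def q2_def by (rule n(1)[rule_format]) (use K D in auto)
      qed auto
      finally show ?thesis by (simp only: mult.assoc)
    qed
    define M where "M = (\<Sum>k\<in>K. q2 (?c k) * q1 (inv k) * corr k)"
    have split: "of_real (\<eta>\<^sup>2) * complex_of_real T = Q + (of_real (\<eta>\<^sup>2) * M - Q) + of_real (\<eta>\<^sup>2) * (complex_of_real T - M)"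
      by (simp add: algebra_simps)
    have m1: "\<eta>\<^sup>2 * T \<le> cmod (of_real (\<eta>\<^sup>2) * complex_of_real T)"
      by (metis abs_ge_self norm_of_real of_real_mult)
    have m2: "cmod (of_real (\<eta>\<^sup>2) * complex_of_real T) \<le> cmod Q + cmod (of_real (\<eta>\<^sup>2) * M - Q) + cmod (of_real (\<eta>\<^sup>2) * (complex_of_real T - M))"
      unfolding split by (rule order_trans[OF norm_triangle_ineq add_right_mono[OF norm_triangle_ineq]])
    have m3: "cmod (of_real (\<eta>\<^sup>2) * (complex_of_real T - M)) = \<eta>\<^sup>2 * cmod (complex_of_real T - M)"
      by (simp only: norm_mult norm_of_real abs_power2)
    have m4: "\<eta>\<^sup>2 * cmod (complex_of_real T - M) \<le> \<eta>\<^sup>2 * (4 * \<epsilon> * real N)"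
      using e1 unfolding M_def by (rule mult_left_mono) simp
    have m5: "\<eta>\<^sup>2 * \<epsilon> * (4 * real N) = 1 / 2 * real N" "\<eta>\<^sup>2 * (4 * \<epsilon> * real N) = 1 / 2 * real N"
      unfolding \<epsilon>_def using \<eta> by simp_all
    have "\<eta>\<^sup>2 * T \<le> cmod Q + 1 / 2 * real N + 1 / 2 * real N"
      using m1 m2 m3 m4 m5 e2 unfolding M_def[symmetric] by linarith
    then have "\<eta>\<^sup>2 * T \<le> cmod Q + real N" by simp
    then have "16 * \<eta>\<^sup>2 * (\<eta>\<^sup>2 * T) \<le> 16 * \<eta>\<^sup>2 * (cmod Q + real N)" by (intro mult_left_mono) auto
    then show "window_energy N E\<^sub>1 E\<^sub>2 \<eta> t a \<le> 16 * \<eta>\<^sup>2 * (cmod (cinner N a (mat_vec N (rep_mat (\<rho> N) w) a)) + real N)"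
      using step1 unfolding Q_def[symmetric] by (simp add: power2_eq_square power4_eq_xxxx mult_ac)
  qed
  then show ?thesis using w w_star w_bound unfolding energy_symbol_def resolvent_dominated_def by blast
qed

end

section \<open>Word length and rapid decay\<close>

context group
begin

definition word_of where
  "word_of F n g \<longleftrightarrow> (\<exists>ws. length ws = n \<and> set ws \<subseteq> F \<union> m_inv G ` F \<and> foldr (\<otimes>) ws \<one> = g)"

lemma word_length_alt: "word_length G F g = (LEAST n. word_of F n g)"
  unfolding word_length_def word_of_def ..

lemma letters_closed: "F \<subseteq> carrier G \<Longrightarrow> F \<union> m_inv G ` F \<subseteq> carrier G"
  by auto

lemma foldr_closed: "set ws \<subseteq> carrier G \<Longrightarrow> x \<in> carrier G \<Longrightarrow> foldr (\<otimes>) ws x \<in> carrier G"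
  by (induction ws) auto

lemma foldr_mult: "set ws \<subseteq> carrier G \<Longrightarrow> x \<in> carrier G \<Longrightarrow> foldr (\<otimes>) ws x = foldr (\<otimes>) ws \<one> \<otimes> x"
  by (induction ws) (auto simp: m_assoc foldr_closed)

lemma word_of_mult:
  assumes "F \<subseteq> carrier G" "word_of F m g" "word_of F n h"
  shows "word_of F (m + n) (g \<otimes> h)"
proof -
  obtain us vs where us: "length us = m" "set us \<subseteq> F \<union> m_inv G ` F" "foldr (\<otimes>) us \<one> = g"
    and vs: "length vs = n" "set vs \<subseteq> F \<union> m_inv G ` F" "foldr (\<otimes>) vs \<one> = h"
    using assms(2,3) unfolding word_of_def by blast
  have c: "set us \<subseteq> carrier G" "h \<in> carrier G"
    using us(2) vs letters_closed[OF assms(1)] foldr_closed[of vs \<one>] by auto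
  have "foldr (\<otimes>) (us @ vs) \<one> = g \<otimes> h"
    using foldr_mult[OF c] us(3) vs(3) by simp
  then show ?thesis unfolding word_of_def
    by (intro exI[of _ "us @ vs"]) (use us vs in auto)
qed

lemma word_of_letter:
  assumes "F \<subseteq> carrier G" "s \<in> F \<union> m_inv G ` F"
  shows "word_of F 1 s"
  unfolding word_of_def using assms by (intro exI[of _ "[s]"]) auto

lemma word_of_one: "word_of F 0 \<one>"
  unfolding word_of_def by (intro exI[of _ "[]"]) auto

lemma word_of_inv:
  assumes "F \<subseteq> carrier G" "word_of F n g"
  shows "word_of F n (inv g)"
proof -
  obtain ws where ws: "length ws = n" "set ws \<subseteq> F \<union> m_inv G ` F" "foldr (\<otimes>) ws \<one> = g"
    using assms(2) unfolding word_of_def by blast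
  have "set ws \<subseteq> F \<union> m_inv G ` F \<Longrightarrow> word_of F (length ws) (inv (foldr (\<otimes>) ws \<one>))" for ws
  proof (induction ws)
    case Nil
    then show ?case by (simp add: word_of_one)
  next
    case (Cons s ws)
    have c: "s \<in> carrier G" "foldr (\<otimes>) ws \<one> \<in> carrier G"
      using Cons.prems letters_closed[OF assms(1)] foldr_closed[of ws \<one>] by auto
    have "inv s \<in> F \<union> m_inv G ` F" using Cons.prems assms(1) by auto
    then have "word_of F (length ws + 1) (inv (foldr (\<otimes>) ws \<one>) \<otimes> inv s)"
      using Cons by (intro word_of_mult[OF assms(1)] word_of_letter[OF assms(1)]) auto
    then show ?case using c by (simp add: inv_mult_group)
  qed
  then show ?thesis using ws by blast
qed

lemma word_exists:
  assumes F: "finite_generating_set G F" and g: "g \<in> carrier G"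
  shows "\<exists>n. word_of F n g"
proof -
  have c: "F \<subseteq> carrier G" using F by (simp add: finite_generating_set_def)
  have "g \<in> generate G F" using F g by (simp add: finite_generating_set_def)
  then show ?thesis
  proof (induction rule: generate.induct)
    case one
    then show ?case using word_of_one by blast
  next
    case (incl h)
    then show ?case using word_of_letter[OF c, of h] by blast
  next
    case (inv h)
    then show ?case using word_of_letter[OF c, of "inv h"] by blast
  next
    case (eng h1 h2)
    then show ?case using word_of_mult[OF c] by blast
  qed
qed

lemma word_length_word:
  assumes "finite_generating_set G F" "g \<in> carrier G"
  shows "word_of F (word_length G F g) g"
  unfolding word_length_alt using word_exists[OF assms] by (rule LeastI_ex)

lemma word_length_le: "word_of F n g \<Longrightarrow> word_length G F g \<le> n"
  unfolding word_length_alt by (rule Least_le)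

lemma word_length_mult:
  assumes F: "finite_generating_set G F" and "g \<in> carrier G" "h \<in> carrier G"
  shows "word_length G F (g \<otimes> h) \<le> word_length G F g + word_length G F h"
  using word_length_le[OF word_of_mult[OF _ word_length_word[OF F assms(2)] word_length_word[OF F assms(3)]]] F
  by (simp add: finite_generating_set_def)

lemma word_length_inv:
  assumes F: "finite_generating_set G F" and "g \<in> carrier G"
  shows "word_length G F (inv g) \<le> word_length G F g"
  using word_length_le[OF word_of_inv[OF _ word_length_word[OF F assms(2)]]] F
  by (simp add: finite_generating_set_def)

lemma word_length_one: "word_length G F \<one> = 0"
  using word_length_le[OF word_of_one, of F] by simp

lemma word_length_eq_0:
  assumes F: "finite_generating_set G F" and g: "g \<in> carrier G" and "word_length G F g = 0"
  shows "g = \<one>"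
  using word_length_word[OF F g] assms(3) by (auto simp: word_of_def)

lemma finite_word_ball:
  assumes F: "finite_generating_set G F"
  shows "finite {g \<in> carrier G. word_length G F g \<le> n}"
proof (rule finite_subset)
  let ?L = "F \<union> m_inv G ` F"
  show "finite ((\<lambda>ws. foldr (\<otimes>) ws \<one>) ` {ws. set ws \<subseteq> ?L \<and> length ws \<le> n})"
    using F by (intro finite_imageI finite_lists_length_le) (auto simp: finite_generating_set_def)
  show "{g \<in> carrier G. word_length G F g \<le> n} \<subseteq> (\<lambda>ws. foldr (\<otimes>) ws \<one>) ` {ws. set ws \<subseteq> ?L \<and> length ws \<le> n}"
  proof
    fix g assume g: "g \<in> {g \<in> carrier G. word_length G F g \<le> n}"
    then have "word_of F (word_length G F g) g" using word_length_word[OF F] by blast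
    then obtain ws where "length ws = word_length G F g" "set ws \<subseteq> ?L" "foldr (\<otimes>) ws \<one> = g"
      unfolding word_of_def by blast
    then show "g \<in> (\<lambda>ws. foldr (\<otimes>) ws \<one>) ` {ws. set ws \<subseteq> ?L \<and> length ws \<le> n}" using g by force
  qed
qed

lemma word_length_compare:
  assumes F: "finite_generating_set G F" and F': "finite_generating_set G F'"
  shows "\<exists>\<kappa>. \<forall>g\<in>carrier G. word_length G F' g \<le> \<kappa> * word_length G F g"
proof -
  let ?L = "F \<union> m_inv G ` F"
  define \<kappa> where "\<kappa> = (\<Sum>s\<in>?L. word_length G F' s)"
  have fin: "finite ?L" "?L \<subseteq> carrier G" using F by (auto simp: finite_generating_set_def)
  have "set ws \<subseteq> ?L \<Longrightarrow> word_length G F' (foldr (\<otimes>) ws \<one>) \<le> \<kappa> * length ws" for ws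
  proof (induction ws)
    case Nil
    then show ?case by (simp add: word_length_one)
  next
    case (Cons s ws)
    have s: "s \<in> ?L" "s \<in> carrier G" "foldr (\<otimes>) ws \<one> \<in> carrier G"
      using Cons.prems fin foldr_closed[of ws \<one>] by auto
    have "word_length G F' s \<le> \<kappa>" unfolding \<kappa>_def using fin(1) s(1) by (intro member_le_sum) auto
    then show ?case using word_length_mult[OF F' s(2,3)] Cons by simp
  qed
  then have "word_length G F' g \<le> \<kappa> * word_length G F g" if "g \<in> carrier G" for g
    using word_length_word[OF F that] unfolding word_of_def by metis
  then show ?thesis by blast
qed

lemma cayley_dist_le:
  assumes F: "finite_generating_set G F" and g: "g \<in> carrier G" and h: "h \<in> carrier G"
  shows "cayley_dist G F g h \<le> word_length G F (h \<otimes> inv g)"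
proof -
  have c: "F \<subseteq> carrier G" using F by (simp add: finite_generating_set_def)
  have path: "set ws \<subseteq> F \<union> m_inv G ` F \<Longrightarrow> (g, foldr (\<otimes>) ws \<one> \<otimes> g) \<in> cayley_edges G F ^^ length ws" for ws
  proof (induction ws)
    case Nil
    then show ?case using g by simp
  next
    case (Cons s ws)
    let ?x = "foldr (\<otimes>) ws \<one> \<otimes> g"
    have s: "s \<in> F \<union> m_inv G ` F" "s \<in> carrier G" "foldr (\<otimes>) ws \<one> \<in> carrier G"
      using Cons.prems letters_closed[OF c] foldr_closed[of ws \<one>] by auto
    have x: "?x \<in> carrier G" using s g by simp
    have "(?x, s \<otimes> ?x) \<in> cayley_edges G F"
    proof (cases "s \<in> F")
      case True
      then show ?thesis using x unfolding cayley_edges_def by blast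
    next
      case False
      then obtain f where f: "f \<in> F" "s = inv f" using s(1) by blast
      then have "?x = f \<otimes> (s \<otimes> ?x)" using x c by (auto simp: m_assoc[symmetric])
      moreover have "s \<otimes> ?x \<in> carrier G" using s x by simp
      ultimately show ?thesis using f(1) unfolding cayley_edges_def by blast
    qed
    then show ?case using Cons s g by (auto simp: m_assoc intro: relpow_Suc_I)
  qed
  have hg: "h \<otimes> inv g \<in> carrier G" using g h by simp
  obtain ws where ws: "length ws = word_length G F (h \<otimes> inv g)" "set ws \<subseteq> F \<union> m_inv G ` F"
      "foldr (\<otimes>) ws \<one> = h \<otimes> inv g"
    using word_length_word[OF F hg] unfolding word_of_def by blast
  have "h \<otimes> inv g \<otimes> g = h" using g h by (simp add: m_assoc)
  then have "(g, h) \<in> cayley_edges G F ^^ word_length G F (h \<otimes> inv g)"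
    using path[OF ws(2)] ws(1,3) by simp
  then show ?thesis unfolding cayley_dist_def by (rule Least_le)
qed

text \<open>A change of the generating set costs a constant factor in the lengths, hence in the diameter.\<close>

lemma rapid_decay_ball:
  assumes F: "finite_generating_set G F" and RD: "rapid_decay_exponent G C\<^sub>1"
  shows "\<exists>C>0. \<forall>n\<ge>1. \<forall>q\<in>GA. (\<forall>g\<in>supp q. word_length G F g \<le> n) \<longrightarrow>
    ell2_opnorm G (left_regular G q) \<le> C * real n powr C\<^sub>1 * \<parallel>q\<parallel>"
proof -
  obtain C F' where C: "C > 0" "C\<^sub>1 > 0" and F': "finite_generating_set G F'"
    and bd: "\<forall>q\<in>GA. ell2_opnorm G (left_regular G q)
             \<le> C * real (support_diam G F' q) powr C\<^sub>1 * sqrt (\<Sum>g\<in>supp q. (cmod (q g))\<^sup>2)"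
    using RD unfolding rapid_decay_exponent_def by blast
  obtain \<kappa> where \<kappa>: "\<forall>g\<in>carrier G. word_length G F' g \<le> \<kappa> * word_length G F g"
    using word_length_compare[OF F F'] by blast
  have "ell2_opnorm G (left_regular G q) \<le> C * real (1 + 2 * \<kappa>) powr C\<^sub>1 * real n powr C\<^sub>1 * \<parallel>q\<parallel>"
    if n: "n \<ge> 1" and q: "q \<in> GA" and len: "\<forall>g\<in>supp q. word_length G F g \<le> n" for n q
  proof -
    have s: "finite (supp q)" "supp q \<subseteq> carrier G" using GA_D[OF q] by auto
    let ?S = "{cayley_dist G F' g h | g h. g \<in> supp q \<and> h \<in> supp q}"
    have "?S = (\<lambda>(g, h). cayley_dist G F' g h) ` (supp q \<times> supp q)" by auto
    then have fin: "finite (insert 1 ?S)" using s by simp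
    have "cayley_dist G F' g h \<le> (1 + 2 * \<kappa>) * n" if "g \<in> supp q" "h \<in> supp q" for g h
    proof -
      have gh: "g \<in> carrier G" "h \<in> carrier G" using that s by auto
      have "cayley_dist G F' g h \<le> word_length G F' h + word_length G F' g"
        using cayley_dist_le[OF F' gh] word_length_mult[OF F' gh(2) inv_closed[OF gh(1)]] word_length_inv[OF F' gh(1)]
        by linarith
      also have "\<dots> \<le> \<kappa> * n + \<kappa> * n"
        using \<kappa> gh len that by (intro add_mono) (meson order_trans mult_le_mono2)+
      also have "\<dots> \<le> (1 + 2 * \<kappa>) * n" by (simp add: algebra_simps)
      finally show ?thesis .
    qed
    then have "support_diam G F' q \<le> (1 + 2 * \<kappa>) * n"
      unfolding support_diam_def using n by (subst Max_le_iff[OF fin]) auto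
    then have "real (support_diam G F' q) \<le> real (1 + 2 * \<kappa>) * real n"
      by (metis of_nat_le_iff of_nat_mult)
    then have "real (support_diam G F' q) powr C\<^sub>1 \<le> (real (1 + 2 * \<kappa>) * real n) powr C\<^sub>1"
      using C by (intro powr_mono2) auto
    also have "\<dots> = real (1 + 2 * \<kappa>) powr C\<^sub>1 * real n powr C\<^sub>1" by (simp add: powr_mult)
    finally have d: "real (support_diam G F' q) powr C\<^sub>1 \<le> real (1 + 2 * \<kappa>) powr C\<^sub>1 * real n powr C\<^sub>1" .
    have "ell2_opnorm G (left_regular G q) \<le> C * real (support_diam G F' q) powr C\<^sub>1 * \<parallel>q\<parallel>"
      using bd q GA_ell2(2)[OF q] by simp
    also have "\<dots> \<le> C * (real (1 + 2 * \<kappa>) powr C\<^sub>1 * real n powr C\<^sub>1) * \<parallel>q\<parallel>"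
      using C d by (intro mult_right_mono mult_left_mono) auto
    finally show ?thesis by (simp only: mult.assoc)
  qed
  moreover have "C * real (1 + 2 * \<kappa>) powr C\<^sub>1 > 0" using C by simp
  ultimately show ?thesis by blast
qed

text \<open>Splitting the support into spheres and using the Cauchy-Schwarz inequality over the radii turns
  the rapid decay inequality into a weighted \<open>\<ell>\<^sup>2\<close> bound without a bound on the support; the unit
  has length \<open>0\<close> and weight \<open>0\<close>, so its coefficient appears separately.\<close>

lemma rapid_decay_weighted:
  assumes F: "finite_generating_set G F" and RD: "rapid_decay_exponent G C\<^sub>1" and C1': "C\<^sub>1' > 2 * C\<^sub>1 + 1"
  shows "\<exists>C>0. \<forall>w\<in>GA. ell2_opnorm G (left_regular G w) \<le>
    C * (cmod (w \<one>) + sqrt (\<Sum>k\<in>supp w. (cmod (w k))\<^sup>2 * real (word_length G F k) powr C\<^sub>1'))"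
proof -
  let ?l = "\<lambda>k. word_length G F k"
  obtain C where C: "C > 0" and ball: "\<forall>n\<ge>1. \<forall>q\<in>GA. (\<forall>g\<in>supp q. ?l g \<le> n) \<longrightarrow>
    ell2_opnorm G (left_regular G q) \<le> C * real n powr C\<^sub>1 * \<parallel>q\<parallel>"
    using rapid_decay_ball[OF F RD] by blast
  define z where "z = (\<lambda>n. real n powr (2 * C\<^sub>1 - C\<^sub>1'))"
  have "2 * C\<^sub>1 - C\<^sub>1' < -1" using C1' by simp
  then have zs: "summable z" unfolding z_def using summable_real_powr_iff by blast
  define Z where "Z = sqrt (suminf z)"
  have Z: "Z \<ge> 0" unfolding Z_def using suminf_nonneg[OF zs] by (simp add: z_def)
  have "ell2_opnorm G (left_regular G w) \<le> (C * (1 + Z)) *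
      (cmod (w \<one>) + sqrt (\<Sum>k\<in>supp w. (cmod (w k))\<^sup>2 * real (?l k) powr C\<^sub>1'))" if w: "w \<in> GA" for w
  proof -
    have s: "finite (supp w)" "supp w \<subseteq> carrier G" using GA_D[OF w] by auto
    define M where "M = Max (insert 0 (?l ` supp w))"
    have M: "?l k \<le> M" if "k \<in> supp w" for k unfolding M_def using s that by (intro Max_ge) auto
    define sh where "sh = (\<lambda>n k. if ?l k = n then w k else 0)"
    have sh: "sh n \<in> GA" for n by (rule GA_I[OF s]) (auto simp: sh_def supp_def)
    have sh_supp: "supp (sh n) = {k \<in> supp w. ?l k = n}" for n by (auto simp: sh_def supp_def)
    have w_sum: "w = (\<lambda>k. \<Sum>n\<in>{0..M}. sh n k)"
    proof
      fix k
      show "w k = (\<Sum>n\<in>{0..M}. sh n k)"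
        using M[of k] by (cases "k \<in> supp w") (auto simp: sh_def supp_def)
    qed
    define b where "b = (\<lambda>n. if n = 0 then C * cmod (w \<one>) else C * real n powr C\<^sub>1 * \<parallel>sh n\<parallel>)"
    have sh0: "\<parallel>sh 0\<parallel> \<le> cmod (w \<one>)"
    proof -
      have "\<parallel>sh 0\<parallel> = sqrt (\<Sum>k\<in>{\<one>}. (cmod (sh 0 k))\<^sup>2)"
      proof (rule ell2_sum_square_finite(2))
        show "sh 0 x = 0" if "x \<notin> {\<one>}" for x
          using word_length_eq_0[OF F, of x] that GA_D(3)[OF w, of x] by (cases "x \<in> carrier G") (auto simp: sh_def)
      qed auto
      then show ?thesis by (simp add: sh_def)
    qed
    have bn: "\<parallel>sh n \<star> u\<parallel> \<le> b n * \<parallel>u\<parallel>" if u: "u \<in> ell2 G" for n u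
    proof -
      have "ell2_opnorm G (left_regular G (sh n)) \<le> b n"
      proof (cases "n = 0")
        case True
        have "ell2_opnorm G (left_regular G (sh 0)) \<le> C * real 1 powr C\<^sub>1 * \<parallel>sh 0\<parallel>"
          using ball[rule_format, of 1 "sh 0"] sh sh_supp[of 0] by auto
        also have "\<dots> \<le> C * cmod (w \<one>)" using sh0 C by simp
        finally show ?thesis using True by (simp add: b_def)
      next
        case False
        then show ?thesis using ball[rule_format, of n "sh n"] sh sh_supp[of n] by (auto simp: b_def)
      qed
      then show ?thesis using opnorm_bound[OF sh u, of n] mult_right_mono[OF _ ell2_norm_nonneg[of u]] order_trans by blast
    qed
    have b0: "b n \<ge> 0" for n using C by (auto simp: b_def)
    have "ell2_opnorm G (left_regular G w) \<le> (\<Sum>n\<in>{0..M}. b n)"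
    proof (rule opnorm_le)
      show "0 \<le> (\<Sum>n\<in>{0..M}. b n)" using b0 by (intro sum_nonneg) auto
      fix u assume u: "u \<in> ell2 G"
      have "w \<star> u = (\<lambda>x. \<Sum>n\<in>{0..M}. (sh n \<star> u) x)"
        by (subst w_sum) (rule conv_sum_left, auto intro: sh)
      then have "\<parallel>w \<star> u\<parallel> \<le> (\<Sum>n\<in>{0..M}. \<parallel>sh n \<star> u\<parallel>)"
        using ell2_sum(2)[of "{0..M}" "\<lambda>n. sh n \<star> u"] conv_ell2(1)[OF sh u] by simp
      also have "\<dots> \<le> (\<Sum>n\<in>{0..M}. b n * \<parallel>u\<parallel>)" by (intro sum_mono bn u)
      finally show "\<parallel>w \<star> u\<parallel> \<le> (\<Sum>n\<in>{0..M}. b n) * \<parallel>u\<parallel>" by (simp add: sum_distrib_right)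
    qed
    also have "(\<Sum>n\<in>{0..M}. b n) = C * cmod (w \<one>) + (\<Sum>n\<in>{1..M}. b n)"
      by (simp add: sum.atLeast_Suc_atMost b_def)
    also have "(\<Sum>n\<in>{1..M}. b n) = C * (\<Sum>n\<in>{1..M}. \<bar>real n powr (C\<^sub>1 - C\<^sub>1' / 2)\<bar> * \<bar>real n powr (C\<^sub>1' / 2) * \<parallel>sh n\<parallel>\<bar>)"
      unfolding sum_distrib_left
    proof (rule sum.cong[OF refl])
      fix n assume n: "n \<in> {1..M}"
      \<comment> \<open>Half of the weight \<open>C\<^sub>1'\<close> goes to either factor; the first one is square-summable as \<open>C\<^sub>1' > 2 C\<^sub>1 + 1\<close>.\<close>
      have "real n powr C\<^sub>1 = real n powr (C\<^sub>1 - C\<^sub>1' / 2) * real n powr (C\<^sub>1' / 2)"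
        by (simp add: powr_add[symmetric])
      then show "b n = C * (\<bar>real n powr (C\<^sub>1 - C\<^sub>1' / 2)\<bar> * \<bar>real n powr (C\<^sub>1' / 2) * \<parallel>sh n\<parallel>\<bar>)"
        using n by (simp add: b_def abs_mult)
    qed
    also have "(\<Sum>n\<in>{1..M}. \<bar>real n powr (C\<^sub>1 - C\<^sub>1' / 2)\<bar> * \<bar>real n powr (C\<^sub>1' / 2) * \<parallel>sh n\<parallel>\<bar>)
        \<le> L2_set (\<lambda>n. real n powr (C\<^sub>1 - C\<^sub>1' / 2)) {1..M} * L2_set (\<lambda>n. real n powr (C\<^sub>1' / 2) * \<parallel>sh n\<parallel>) {1..M}"
      by (rule L2_set_mult_ineq)
    also have "L2_set (\<lambda>n. real n powr (C\<^sub>1 - C\<^sub>1' / 2)) {1..M} \<le> Z"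
    proof -
      have "(\<Sum>n\<in>{1..M}. (real n powr (C\<^sub>1 - C\<^sub>1' / 2))\<^sup>2) = (\<Sum>n\<in>{1..M}. z n)"
        by (rule sum.cong) (simp_all add: z_def power2_eq_square powr_add[symmetric])
      also have "\<dots> \<le> suminf z" by (rule sum_le_suminf[OF zs]) (auto simp: z_def)
      finally show ?thesis unfolding L2_set_def Z_def by simp
    qed
    also have "L2_set (\<lambda>n. real n powr (C\<^sub>1' / 2) * \<parallel>sh n\<parallel>) {1..M} \<le>
        sqrt (\<Sum>k\<in>supp w. (cmod (w k))\<^sup>2 * real (?l k) powr C\<^sub>1')"
      unfolding L2_set_def
    proof (rule real_sqrt_le_mono)
      have "(\<Sum>n\<in>{1..M}. (real n powr (C\<^sub>1' / 2) * \<parallel>sh n\<parallel>)\<^sup>2) \<le> (\<Sum>n\<in>{0..M}. (real n powr (C\<^sub>1' / 2) * \<parallel>sh n\<parallel>)\<^sup>2)"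
        by (rule sum_mono2) auto
      also have "\<dots> = (\<Sum>n\<in>{0..M}. \<Sum>k\<in>{k \<in> supp w. ?l k = n}. (cmod (w k))\<^sup>2 * real (?l k) powr C\<^sub>1')"
      proof (rule sum.cong[OF refl])
        fix n
        have "(real n powr (C\<^sub>1' / 2) * \<parallel>sh n\<parallel>)\<^sup>2 = real n powr C\<^sub>1' * (\<Sum>k\<in>{k \<in> supp w. ?l k = n}. (cmod (sh n k))\<^sup>2)"
          unfolding GA_ell2(2)[OF sh] sh_supp power_mult_distrib
          by (simp add: sum_nonneg power2_eq_square powr_add[symmetric])
        also have "\<dots> = (\<Sum>k\<in>{k \<in> supp w. ?l k = n}. (cmod (w k))\<^sup>2 * real (?l k) powr C\<^sub>1')"
          unfolding sum_distrib_left by (rule sum.cong) (auto simp: sh_def)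
        finally show "(real n powr (C\<^sub>1' / 2) * \<parallel>sh n\<parallel>)\<^sup>2 =
            (\<Sum>k\<in>{k \<in> supp w. ?l k = n}. (cmod (w k))\<^sup>2 * real (?l k) powr C\<^sub>1')" .
      qed
      also have "\<dots> = (\<Sum>k\<in>supp w. (cmod (w k))\<^sup>2 * real (?l k) powr C\<^sub>1')"
        by (rule sum.group) (use s M in auto)
      finally show "(\<Sum>n\<in>{1..M}. (real n powr (C\<^sub>1' / 2) * \<parallel>sh n\<parallel>)\<^sup>2) \<le> (\<Sum>k\<in>supp w. (cmod (w k))\<^sup>2 * real (?l k) powr C\<^sub>1')" .
    qed
    finally have "ell2_opnorm G (left_regular G w) \<le> C * cmod (w \<one>) +
        C * (Z * sqrt (\<Sum>k\<in>supp w. (cmod (w k))\<^sup>2 * real (?l k) powr C\<^sub>1'))"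
      using C Z by (simp add: mult_left_mono mult_right_mono)
    also have "\<dots> \<le> (C * (1 + Z)) * (cmod (w \<one>) + sqrt (\<Sum>k\<in>supp w. (cmod (w k))\<^sup>2 * real (?l k) powr C\<^sub>1'))"
    proof -
      define r where "r = sqrt (\<Sum>k\<in>supp w. (cmod (w k))\<^sup>2 * real (?l k) powr C\<^sub>1')"
      have r: "r \<ge> 0" unfolding r_def by (simp add: sum_nonneg)
      have "cmod (w \<one>) + Z * r \<le> (1 + Z) * (cmod (w \<one>) + r)"
        using r Z by (simp add: algebra_simps)
      then have "C * (cmod (w \<one>) + Z * r) \<le> C * ((1 + Z) * (cmod (w \<one>) + r))" using C by (intro mult_left_mono) auto
      then show ?thesis unfolding r_def[symmetric] by (simp add: algebra_simps)
    qed
    finally show ?thesis .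
  qed
  moreover have "C * (1 + Z) > 0" using C Z by (simp add: add_pos_nonneg)
  ultimately show ?thesis by blast
qed

lemma word_length_conjugate:
  assumes F: "finite_generating_set G F" and t: "t \<in> carrier G" and k: "k \<in> carrier G"
  shows "word_length G F k \<le> (1 + 2 * word_length G F t) * word_length G F (t \<otimes> k \<otimes> inv t)"
proof (cases "t \<otimes> k \<otimes> inv t = \<one>")
  case True
  then have "t \<otimes> k \<otimes> inv t = t \<otimes> \<one> \<otimes> inv t" using t by simp
  then have "k = \<one>" using conjugation_inj[OF t] k by (meson inj_onD one_closed)
  then show ?thesis by (simp add: word_length_one)
next
  case False
  let ?c = "t \<otimes> k \<otimes> inv t"
  have c: "?c \<in> carrier G" using t k by simp
  have pos: "word_length G F ?c \<ge> 1" using word_length_eq_0[OF F c] False by fastforce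
  have "inv t \<otimes> (t \<otimes> (k \<otimes> (inv t \<otimes> t))) = k" using k t by (simp add: m_assoc[symmetric])
  then have "k = inv t \<otimes> ?c \<otimes> t" using k t by (simp add: m_assoc)
  then have "word_length G F k \<le> word_length G F (inv t) + word_length G F ?c + word_length G F t"
    using word_length_mult[OF F _ t, of "inv t \<otimes> ?c"] word_length_mult[OF F inv_closed[OF t] c] c t
    by (smt (verit) add.commute add_le_cancel_left inv_closed m_closed order_trans)
  also have "\<dots> \<le> word_length G F ?c + 2 * word_length G F t"
    using word_length_inv[OF F t] by simp
  also have "\<dots> \<le> word_length G F ?c + 2 * word_length G F t * word_length G F ?c" using pos by simp
  finally show ?thesis by (simp add: algebra_simps)
qed

lemma R4_finite_sums:
  assumes "cond_R4 G F p I\<^sub>0"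
  obtains C\<^sub>1 C\<^sub>1' where "rapid_decay_exponent G C\<^sub>1" "C\<^sub>1' > 2 * C\<^sub>1 + 1"
    "\<forall>\<epsilon>>0. \<forall>\<^sub>F \<eta> in at_right 0. \<forall>E\<in>I\<^sub>0. \<forall>A. finite A \<and> A \<subseteq> carrier G \<longrightarrow>
      (\<Sum>g\<in>A. \<eta>\<^sup>2 * cmod (Im_resolvent G p (Complex E \<eta>) \<one> g) ^ 4 * real (word_length G F g) powr C\<^sub>1') \<le> \<epsilon>"
proof -
  obtain C\<^sub>1 C\<^sub>1' where C: "rapid_decay_exponent G C\<^sub>1" "C\<^sub>1' > 2 * C\<^sub>1 + 1"
    and lim: "((\<lambda>\<eta>. SUP E\<in>I\<^sub>0. \<Sum>\<^sub>\<infinity>g\<in>carrier G.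
            ennreal (\<eta>\<^sup>2 * cmod (Im_resolvent G p (Complex E \<eta>) \<one> g) ^ 4
                     * real (word_length G F g) powr C\<^sub>1')) \<longlongrightarrow> 0) (at_right 0)"
    using assms unfolding cond_R4_def by blast
  have fin: "\<forall>\<^sub>F \<eta> in at_right 0. \<forall>E\<in>I\<^sub>0. \<forall>A. finite A \<and> A \<subseteq> carrier G \<longrightarrow>
      (\<Sum>g\<in>A. \<eta>\<^sup>2 * cmod (Im_resolvent G p (Complex E \<eta>) \<one> g) ^ 4 * real (word_length G F g) powr C\<^sub>1') \<le> \<epsilon>"
    if \<epsilon>: "\<epsilon> > 0" for \<epsilon> :: real
  proof (rule eventually_mono[OF order_tendstoD(2)[OF lim]])
    show "0 < ennreal \<epsilon>" using \<epsilon> by simp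
    fix \<eta> :: real
    let ?f = "\<lambda>E g. \<eta>\<^sup>2 * cmod (Im_resolvent G p (Complex E \<eta>) \<one> g) ^ 4 * real (word_length G F g) powr C\<^sub>1'"
    assume less: "(SUP E\<in>I\<^sub>0. \<Sum>\<^sub>\<infinity>g\<in>carrier G. ennreal (?f E g)) < ennreal \<epsilon>"
    show "\<forall>E\<in>I\<^sub>0. \<forall>A. finite A \<and> A \<subseteq> carrier G \<longrightarrow> (\<Sum>g\<in>A. ?f E g) \<le> \<epsilon>"
    proof (intro ballI allI impI)
      fix E A assume E: "E \<in> I\<^sub>0" and A: "finite A \<and> A \<subseteq> carrier G"
      have "ennreal (\<Sum>g\<in>A. ?f E g) = (\<Sum>g\<in>A. ennreal (?f E g))" by (rule sum_ennreal[symmetric]) simp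
      also have "\<dots> \<le> (\<Sum>\<^sub>\<infinity>g\<in>carrier G. ennreal (?f E g))"
        using A infsum_mono_neutral[of "\<lambda>g. ennreal (?f E g)" A "\<lambda>g. ennreal (?f E g)" "carrier G"]
        by (auto simp: nonneg_summable_on_complete)
      also have "\<dots> \<le> (SUP E\<in>I\<^sub>0. \<Sum>\<^sub>\<infinity>g\<in>carrier G. ennreal (?f E g))" by (rule SUP_upper[OF E])
      also have "\<dots> < ennreal \<epsilon>" by (rule less)
      finally show "(\<Sum>g\<in>A. ?f E g) \<le> \<epsilon>" using \<epsilon> by (simp add: ennreal_less_iff sum_nonneg)
    qed
  qed
  show ?thesis by (rule that[OF C]) (intro allI impI fin)
qed

text \<open>The positivity of \<open>Im R\<close> bounds all its entries by the diagonal one, and the resolvent identity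
  expresses the square sum of a row by a diagonal entry.\<close>

lemma Im_resolvent_bounds:
  assumes p: "p \<in> GA" "p = star G p" and \<eta>: "\<eta> > 0"
    and C: "Re (Im_resolvent G p (Complex E \<eta>) \<one> \<one>) \<le> C"
  shows "h \<in> carrier G \<Longrightarrow> cmod (Im_resolvent G p (Complex E \<eta>) \<one> h) \<le> C"
    "finite A \<Longrightarrow> A \<subseteq> carrier G \<Longrightarrow> (\<Sum>h\<in>A. (cmod (Im_resolvent G p (Complex E \<eta>) \<one> h))\<^sup>2) \<le> C / \<eta>"
proof -
  obtain v where g: "green_like p E \<eta> v" using green_function[OF p \<eta>] by blast
  have v: "v \<in> ell2 G" "\<eta>\<^sup>2 * (\<parallel>v\<parallel>)\<^sup>2 \<le> Re (v \<one>)"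
    and Im: "Im_resolvent G p (Complex E \<eta>) \<one> h = of_real \<eta> * cnj (v h)" "cmod (v h) \<le> Re (v \<one>)" if "h \<in> carrier G" for h
    using g that unfolding green_like_def by auto
  have n: "cmod (Im_resolvent G p (Complex E \<eta>) \<one> h) = \<eta> * cmod (v h)" if "h \<in> carrier G" for h
    unfolding Im(1)[OF that] using \<eta> by (simp add: norm_mult)
  have m: "\<eta> * Re (v \<one>) \<le> C" using C unfolding Im(1)[OF one_closed] by simp
  show "cmod (Im_resolvent G p (Complex E \<eta>) \<one> h) \<le> C" if "h \<in> carrier G"
    unfolding n[OF that] using mult_left_mono[OF Im(2)[OF that], of \<eta>] \<eta> m by linarith
  show "(\<Sum>h\<in>A. (cmod (Im_resolvent G p (Complex E \<eta>) \<one> h))\<^sup>2) \<le> C / \<eta>" if A: "finite A" "A \<subseteq> carrier G"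
  proof -
    have "(\<Sum>h\<in>A. (cmod (Im_resolvent G p (Complex E \<eta>) \<one> h))\<^sup>2) = \<eta>\<^sup>2 * (\<Sum>h\<in>A. (cmod (v h))\<^sup>2)"
      unfolding sum_distrib_left using A n by (intro sum.cong refl) (auto simp: power_mult_distrib)
    also have "\<dots> \<le> \<eta>\<^sup>2 * (\<parallel>v\<parallel>)\<^sup>2"
    proof (rule mult_left_mono)
      have "sqrt (\<Sum>h\<in>A. (cmod (v h))\<^sup>2) \<le> \<parallel>v\<parallel>" using ell2_L2_set_le[OF v(1)[OF one_closed] A] unfolding L2_set_def .
      then show "(\<Sum>h\<in>A. (cmod (v h))\<^sup>2) \<le> (\<parallel>v\<parallel>)\<^sup>2" by (rule sqrt_le_D)
    qed simp
    also have "\<dots> \<le> Re (v \<one>)" by (rule v(2)[OF one_closed])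
    also have "\<dots> \<le> C / \<eta>" using m \<eta> by (simp add: field_simps)
    finally show ?thesis .
  qed
qed

text \<open>Since \<open>2 |w|\<^sup>2\<close> is at most a sum of two fourth powers of entries, (R4) bounds the weighted \<open>\<ell>\<^sup>2\<close> norm
  of \<open>w\<close> by \<open>o(1/\<eta>)\<close>, and rapid decay passes this to the operator norm; the \<open>\<ell>\<^sup>1\<close> norm of \<open>w\<close> would only
  give \<open>O(1/\<eta>)\<close>.\<close>

lemma opnorm_small:
  assumes p: "p \<in> GA" "p = star G p" and F: "finite_generating_set G F"
    and AC: "cond_AC G p I\<^sub>0" and R4: "cond_R4 G F p I\<^sub>0"
    and t: "t \<in> carrier G" and \<epsilon>: "\<epsilon> > 0"
  shows "\<forall>\<^sub>F \<eta> in at_right 0. \<forall>E\<^sub>1\<in>I\<^sub>0. \<forall>E\<^sub>2\<in>I\<^sub>0. \<forall>w\<in>GA. resolvent_dominated p E\<^sub>1 E\<^sub>2 \<eta> t w \<longrightarrow>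
    ell2_opnorm G (left_regular G w) \<le> \<epsilon> / \<eta>"
proof -
  let ?l = "\<lambda>k. real (word_length G F k)" and ?c = "\<lambda>k. t \<otimes> k \<otimes> inv t"
  obtain C\<^sub>0 where C0: "C\<^sub>0 \<ge> 1" and AC': "\<forall>E\<in>I\<^sub>0. \<forall>\<eta>. 0 < \<eta> \<and> \<eta> \<le> 1 \<longrightarrow>
      inverse C\<^sub>0 \<le> Re (Im_resolvent G p (Complex E \<eta>) \<one> \<one>) \<and> Re (Im_resolvent G p (Complex E \<eta>) \<one> \<one>) \<le> C\<^sub>0"
    using AC unfolding cond_AC_def by blast
  obtain C\<^sub>1 \<beta> where RD: "rapid_decay_exponent G C\<^sub>1" and \<beta>: "\<beta> > 2 * C\<^sub>1 + 1"
    and R4': "\<forall>\<epsilon>>0. \<forall>\<^sub>F \<eta> in at_right 0. \<forall>E\<in>I\<^sub>0. \<forall>A. finite A \<and> A \<subseteq> carrier G \<longrightarrow>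
      (\<Sum>g\<in>A. \<eta>\<^sup>2 * cmod (Im_resolvent G p (Complex E \<eta>) \<one> g) ^ 4 * ?l g powr \<beta>) \<le> \<epsilon>"
    by (rule R4_finite_sums[OF R4])
  have \<beta>0: "\<beta> \<ge> 0" using \<beta> RD unfolding rapid_decay_exponent_def by linarith
  obtain C where C: "C > 0" and op: "\<forall>w\<in>GA. ell2_opnorm G (left_regular G w) \<le>
    C * (cmod (w \<one>) + sqrt (\<Sum>k\<in>supp w. (cmod (w k))\<^sup>2 * ?l k powr \<beta>))"
    using rapid_decay_weighted[OF F RD \<beta>] by blast
  define \<kappa> where "\<kappa> = real (1 + 2 * word_length G F t) powr \<beta>"
  have \<kappa>: "\<kappa> \<ge> 0" by (simp add: \<kappa>_def)
  \<comment> \<open>With this bound in (R4) the weighted sum contributes half of \<open>\<epsilon> / \<eta>\<close>; the other half is for the coefficient of the unit.\<close>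
  define \<epsilon>' where "\<epsilon>' = (\<epsilon> / (2 * C))\<^sup>2 / (1 + \<kappa>)"
  have \<epsilon>': "\<epsilon>' > 0" unfolding \<epsilon>'_def using \<epsilon> C \<kappa> by simp
  define r where "r = min 1 (\<epsilon> / (2 * C * C\<^sub>0\<^sup>2))"
  have r: "r > 0" unfolding r_def using \<epsilon> C C0 by simp
  have small: "\<forall>\<^sub>F \<eta> in at_right (0::real). \<eta> \<in> {0<..<r}" by (rule eventually_at_right_real[OF r])
  from R4'[rule_format, OF \<epsilon>'] small show ?thesis
  proof (eventually_elim, intro ballI impI)
    fix \<eta> E\<^sub>1 E\<^sub>2 w
    let ?A1 = "\<lambda>k. cmod (Im_resolvent G p (Complex E\<^sub>1 \<eta>) \<one> k)" and ?A2 = "\<lambda>k. cmod (Im_resolvent G p (Complex E\<^sub>2 \<eta>) \<one> k)"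
    assume R: "\<forall>E\<in>I\<^sub>0. \<forall>A. finite A \<and> A \<subseteq> carrier G \<longrightarrow>
        (\<Sum>g\<in>A. \<eta>\<^sup>2 * cmod (Im_resolvent G p (Complex E \<eta>) \<one> g) ^ 4 * ?l g powr \<beta>) \<le> \<epsilon>'"
      and \<eta>r: "\<eta> \<in> {0<..<r}" and E: "E\<^sub>1 \<in> I\<^sub>0" "E\<^sub>2 \<in> I\<^sub>0" and w: "w \<in> GA"
      and dom: "resolvent_dominated p E\<^sub>1 E\<^sub>2 \<eta> t w"
    have wb: "\<forall>k\<in>carrier G. cmod (w k) \<le> ?A2 (?c k) * ?A1 k" using dom unfolding resolvent_dominated_def .
    have \<eta>: "0 < \<eta>" "\<eta> \<le> 1" "\<eta> \<le> \<epsilon> / (2 * C * C\<^sub>0\<^sup>2)" using \<eta>r unfolding r_def by auto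
    have s: "finite (supp w)" "supp w \<subseteq> carrier G" using GA_D[OF w] by auto
    have A: "?A1 h \<le> C\<^sub>0" "?A2 h \<le> C\<^sub>0" if "h \<in> carrier G" for h
      using Im_resolvent_bounds(1)[OF p \<eta>(1) _ that] AC' E \<eta> by blast+
    have "cmod (w \<one>) \<le> ?A2 (?c \<one>) * ?A1 \<one>" using wb by blast
    also have "\<dots> \<le> C\<^sub>0 * C\<^sub>0" using C0 t by (intro mult_mono A) auto
    finally have w1: "cmod (w \<one>) \<le> C\<^sub>0\<^sup>2" by (simp add: power2_eq_square)
    have "\<eta>\<^sup>2 * (\<Sum>k\<in>supp w. (cmod (w k))\<^sup>2 * ?l k powr \<beta>) \<le>
        (\<Sum>k\<in>supp w. \<kappa> * (\<eta>\<^sup>2 * ?A2 (?c k) ^ 4 * ?l (?c k) powr \<beta>) + \<eta>\<^sup>2 * ?A1 k ^ 4 * ?l k powr \<beta>)"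
      unfolding sum_distrib_left
    proof (rule sum_mono)
      fix k assume "k \<in> supp w"
      then have k: "k \<in> carrier G" using s by auto
      have "(cmod (w k))\<^sup>2 \<le> (?A2 (?c k) * ?A1 k)\<^sup>2" using wb k by (intro power_mono) auto
      also have "\<dots> \<le> ?A2 (?c k) ^ 4 + ?A1 k ^ 4"
      proof -
        have aux: "(x * y)\<^sup>2 \<le> x ^ 4 + y ^ 4" for x y :: real
        proof -
          have "0 \<le> (x\<^sup>2 - y\<^sup>2)\<^sup>2 + (x\<^sup>2)\<^sup>2 + (y\<^sup>2)\<^sup>2" by simp
          then have "2 * (x * y)\<^sup>2 \<le> 2 * (x ^ 4 + y ^ 4)"
            by (simp add: power2_diff power_mult_distrib power_mult[symmetric])
          then show ?thesis by simp
        qed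
        show ?thesis by (rule aux)
      qed
      finally have sq: "(cmod (w k))\<^sup>2 \<le> ?A2 (?c k) ^ 4 + ?A1 k ^ 4" .
      have "?l k powr \<beta> \<le> (real (1 + 2 * word_length G F t) * ?l (?c k)) powr \<beta>"
      proof (rule powr_mono2[OF \<beta>0])
        show "?l k \<le> real (1 + 2 * word_length G F t) * ?l (?c k)"
          using word_length_conjugate[OF F t k] by (metis of_nat_le_iff of_nat_mult)
      qed simp
      also have "\<dots> = \<kappa> * ?l (?c k) powr \<beta>" unfolding \<kappa>_def by (simp add: powr_mult)
      finally have lk: "?l k powr \<beta> \<le> \<kappa> * ?l (?c k) powr \<beta>" .
      have "\<eta>\<^sup>2 * ((cmod (w k))\<^sup>2 * ?l k powr \<beta>) \<le> \<eta>\<^sup>2 * ((?A2 (?c k) ^ 4 + ?A1 k ^ 4) * ?l k powr \<beta>)"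
        using sq by (intro mult_left_mono mult_right_mono) auto
      also have "\<dots> = \<eta>\<^sup>2 * ?A2 (?c k) ^ 4 * ?l k powr \<beta> + \<eta>\<^sup>2 * ?A1 k ^ 4 * ?l k powr \<beta>"
        by (simp only: distrib_left distrib_right mult.assoc)
      also have "\<eta>\<^sup>2 * ?A2 (?c k) ^ 4 * ?l k powr \<beta> \<le> \<eta>\<^sup>2 * ?A2 (?c k) ^ 4 * (\<kappa> * ?l (?c k) powr \<beta>)"
        using lk by (intro mult_left_mono) auto
      finally show "\<eta>\<^sup>2 * ((cmod (w k))\<^sup>2 * ?l k powr \<beta>) \<le>
          \<kappa> * (\<eta>\<^sup>2 * ?A2 (?c k) ^ 4 * ?l (?c k) powr \<beta>) + \<eta>\<^sup>2 * ?A1 k ^ 4 * ?l k powr \<beta>"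
        by (simp only: mult_ac)
    qed
    also have "\<dots> = \<kappa> * (\<Sum>k\<in>supp w. \<eta>\<^sup>2 * ?A2 (?c k) ^ 4 * ?l (?c k) powr \<beta>) + (\<Sum>k\<in>supp w. \<eta>\<^sup>2 * ?A1 k ^ 4 * ?l k powr \<beta>)"
      by (simp only: sum.distrib sum_distrib_left)
    also have "(\<Sum>k\<in>supp w. \<eta>\<^sup>2 * ?A2 (?c k) ^ 4 * ?l (?c k) powr \<beta>) = (\<Sum>g\<in>?c ` supp w. \<eta>\<^sup>2 * ?A2 g ^ 4 * ?l g powr \<beta>)"
      using inj_on_subset[OF conjugation_inj[OF t] s(2)] by (simp add: sum.reindex)
    also have "\<kappa> * \<dots> \<le> \<kappa> * \<epsilon>'"
      by (rule mult_left_mono[OF R[rule_format, OF E(2)] \<kappa>]) (use s t in auto)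
    also have "(\<Sum>k\<in>supp w. \<eta>\<^sup>2 * ?A1 k ^ 4 * ?l k powr \<beta>) \<le> \<epsilon>'"
      by (rule R[rule_format, OF E(1)]) (use s in auto)
    finally have "\<eta>\<^sup>2 * (\<Sum>k\<in>supp w. (cmod (w k))\<^sup>2 * ?l k powr \<beta>) \<le> \<kappa> * \<epsilon>' + \<epsilon>'" by linarith
    also have "\<kappa> * \<epsilon>' + \<epsilon>' = (1 + \<kappa>) * \<epsilon>'" by (simp add: algebra_simps)
    also have "\<dots> = (\<epsilon> / (2 * C))\<^sup>2" unfolding \<epsilon>'_def using \<kappa> by simp
    finally have "(\<Sum>k\<in>supp w. (cmod (w k))\<^sup>2 * ?l k powr \<beta>) \<le> (\<epsilon> / (2 * C))\<^sup>2 / \<eta>\<^sup>2"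
      using \<eta> by (simp add: pos_le_divide_eq mult.commute)
    also have "\<dots> = (\<epsilon> / (2 * C * \<eta>))\<^sup>2" by (simp add: power_divide power_mult_distrib)
    finally have "sqrt (\<Sum>k\<in>supp w. (cmod (w k))\<^sup>2 * ?l k powr \<beta>) \<le> \<epsilon> / (2 * C * \<eta>)"
      using \<epsilon> C \<eta> by (intro real_le_lsqrt) (auto simp: sum_nonneg)
    then have "C * (cmod (w \<one>) + sqrt (\<Sum>k\<in>supp w. (cmod (w k))\<^sup>2 * ?l k powr \<beta>)) \<le> C * (C\<^sub>0\<^sup>2 + \<epsilon> / (2 * C * \<eta>))"
      using w1 C by (intro mult_left_mono add_mono) auto
    also have "\<dots> = C * C\<^sub>0\<^sup>2 + \<epsilon> / (2 * \<eta>)" using C by (simp add: distrib_left)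
    also have "C * C\<^sub>0\<^sup>2 \<le> \<epsilon> / (2 * \<eta>)"
    proof -
      have "\<eta> * (2 * C * C\<^sub>0\<^sup>2) \<le> \<epsilon>" using \<eta>(3) C C0 by (simp add: pos_le_divide_eq)
      then show ?thesis using \<eta>(1) by (simp add: pos_le_divide_eq mult_ac)
    qed
    finally have "C * (cmod (w \<one>) + sqrt (\<Sum>k\<in>supp w. (cmod (w k))\<^sup>2 * ?l k powr \<beta>)) \<le> \<epsilon> / \<eta>" by simp
    then show "ell2_opnorm G (left_regular G w) \<le> \<epsilon> / \<eta>" using op w order_trans by blast
  qed
qed

end

section \<open>Exceptional subspaces of small dimension\<close>

context group
begin

text \<open>The powers \<open>w^(2^j)\<close>, for which the Cauchy-Schwarz inequality relates each power to the next.\<close>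

fun iterated_square where
  "iterated_square w 0 = w"
| "iterated_square w (Suc j) = iterated_square w j \<star> iterated_square w j"

lemma iterated_square_GA: "w \<in> GA \<Longrightarrow> iterated_square w j \<in> GA"
  by (induction j) (auto intro: conv_GA)

lemma iterated_square_norm:
  assumes w: "w \<in> GA" and \<kappa>: "\<kappa> \<ge> 0" and bd: "\<And>u. u \<in> ell2 G \<Longrightarrow> \<parallel>w \<star> u\<parallel> \<le> \<kappa> * \<parallel>u\<parallel>"
  shows "u \<in> ell2 G \<Longrightarrow> \<parallel>iterated_square w j \<star> u\<parallel> \<le> \<kappa> ^ 2 ^ j * \<parallel>u\<parallel>"
proof (induction j arbitrary: u)
  case 0
  then show ?case using bd by simp
next
  case (Suc j)
  let ?S = "iterated_square w j"
  have S: "?S \<in> GA" by (rule iterated_square_GA[OF w])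
  have "\<parallel>iterated_square w (Suc j) \<star> u\<parallel> = \<parallel>?S \<star> (?S \<star> u)\<parallel>" by (simp add: conv_assoc[OF S S])
  also have "\<dots> \<le> \<kappa> ^ 2 ^ j * \<parallel>?S \<star> u\<parallel>" by (rule Suc.IH) (rule conv_ell2(1)[OF S Suc.prems])
  also have "\<dots> \<le> \<kappa> ^ 2 ^ j * (\<kappa> ^ 2 ^ j * \<parallel>u\<parallel>)" using \<kappa> by (intro mult_left_mono Suc) auto
  also have "\<dots> = \<kappa> ^ 2 ^ Suc j * \<parallel>u\<parallel>" by (simp add: power_add[symmetric] mult_2)
  finally show ?case .
qed

lemma iterated_square_l2:
  assumes w: "w \<in> GA" and \<kappa>: "\<kappa> \<ge> 0" and bd: "\<And>u. u \<in> ell2 G \<Longrightarrow> \<parallel>w \<star> u\<parallel> \<le> \<kappa> * \<parallel>u\<parallel>"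
  shows "\<parallel>iterated_square w j\<parallel> \<le> \<kappa> ^ 2 ^ j"
  using iterated_square_norm[OF assms delta_ell2[OF one_closed], of j] conv_delta_right[OF iterated_square_GA[OF w]]
  by (simp add: delta_norm)

end

context permutation_rep
begin

lemma iterated_square_adjoint:
  assumes w: "w \<in> GA" "w = star G w"
  shows "cinner N (mat_vec N (rep_mat \<rho> (iterated_square w j)) a) b = cinner N a (mat_vec N (rep_mat \<rho> (iterated_square w j)) b)"
proof (induction j arbitrary: a b)
  case 0
  then show ?case using rep_adjoint[OF w(1), of a b] w(2) by simp
next
  case (Suc j)
  let ?S = "iterated_square w j" and ?M = "\<lambda>q. mat_vec N (rep_mat \<rho> q)"
  have S: "?S \<in> GA" by (rule iterated_square_GA[OF w(1)])
  have cl: "cinner N (?M (?S \<star> ?S) a) b = cinner N (?M ?S (?M ?S a)) b" for a b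
    unfolding cinner_def by (intro sum.cong refl) (simp only: rep_conv[OF S S])
  have cr: "cinner N a (?M (?S \<star> ?S) b) = cinner N a (?M ?S (?M ?S b))" for a b
    unfolding cinner_def by (intro sum.cong refl) (simp only: rep_conv[OF S S])
  show ?case unfolding iterated_square.simps cl cr by (simp only: Suc.IH)
qed

lemma iterated_square_step:
  assumes w: "w \<in> GA" "w = star G w"
  shows "(vec_sq N (mat_vec N (rep_mat \<rho> (iterated_square w j)) a))\<^sup>2
    \<le> vec_sq N a * vec_sq N (mat_vec N (rep_mat \<rho> (iterated_square w (Suc j))) a)"
proof -
  let ?S = "iterated_square w j" and ?M = "\<lambda>q. mat_vec N (rep_mat \<rho> q)"
  have S: "?S \<in> GA" by (rule iterated_square_GA[OF w(1)])
  have "cinner N (?M ?S a) (?M ?S a) = cinner N a (?M ?S (?M ?S a))"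
    by (rule iterated_square_adjoint[OF w])
  also have "\<dots> = cinner N a (?M (?S \<star> ?S) a)"
    unfolding cinner_def by (intro sum.cong refl) (simp only: rep_conv[OF S S])
  finally have "cmod (complex_of_real (vec_sq N (?M ?S a))) = cmod (cinner N a (?M (?S \<star> ?S) a))"
    by (simp only: cinner_self)
  then have "(vec_sq N (?M ?S a))\<^sup>2 = (cmod (cinner N a (?M (?S \<star> ?S) a)))\<^sup>2" by simp
  also have "\<dots> \<le> vec_sq N a * vec_sq N (?M (?S \<star> ?S) a)" by (rule Cauchy_Schwarz_cinner)
  finally show ?thesis by simp
qed

lemma iterated_square_descend:
  assumes w: "w \<in> GA" "w = star G w" and c: "c \<ge> 0"
    and top: "vec_sq N (mat_vec N (rep_mat \<rho> (iterated_square w j)) a) \<le> (c ^ 2 ^ j)\<^sup>2 * vec_sq N a"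
  shows "vec_sq N (mat_vec N (rep_mat \<rho> w) a) \<le> c\<^sup>2 * vec_sq N a"
  using top
proof (induction j)
  case 0
  then show ?case by simp
next
  case (Suc j)
  let ?v = "\<lambda>j. vec_sq N (mat_vec N (rep_mat \<rho> (iterated_square w j)) a)"
  have "(?v j)\<^sup>2 \<le> vec_sq N a * ?v (Suc j)" by (rule iterated_square_step[OF w])
  also have "\<dots> \<le> vec_sq N a * ((c ^ 2 ^ Suc j)\<^sup>2 * vec_sq N a)" by (rule mult_left_mono[OF Suc.prems]) simp
  also have "\<dots> = ((c ^ 2 ^ j)\<^sup>2 * vec_sq N a)\<^sup>2"
    by (simp add: power2_eq_square power_add mult_2 mult_ac)
  finally have "?v j \<le> (c ^ 2 ^ j)\<^sup>2 * vec_sq N a" by (rule power2_le_imp_le) (simp add: c)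
  then show ?case by (rule Suc.IH)
qed

end

context spectral_sequence
begin

text \<open>The squared Frobenius norm of \<open>S = w^(2^j)\<close> in the representation is \<open>N\<close> times the squared norm of
  \<open>S\<close> in \<open>\<ell>\<^sup>2(\<Gamma>)\<close>, up to \<open>o(N)\<close>, so essentially at most a proportion \<open>2^(1-2^(j+1))\<close> of the directions is stretched by
  \<open>S\<close> by more than \<open>(2\<kappa>)^(2^j)\<close>; on the complement the Cauchy-Schwarz inequality takes the bound
  down to \<open>w\<close>.\<close>

lemma few_bad_directions:
  assumes w: "w \<in> GA" "w = star G w" and \<kappa>: "\<kappa> > 0" and bd: "\<And>u. u \<in> ell2 G \<Longrightarrow> \<parallel>w \<star> u\<parallel> \<le> \<kappa> * \<parallel>u\<parallel>"
    and \<theta>: "\<theta> > 0"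
  shows "\<exists>V. (\<forall>N. finite (V N) \<and> (\<forall>v\<in>V N. \<forall>x. x \<notin> {1..N} \<longrightarrow> v x = 0))
    \<and> (\<forall>\<^sub>F N in along \<N>. real (card (V N)) \<le> \<theta> * real N)
    \<and> (\<forall>N\<in>\<N>. \<forall>a. (\<forall>v\<in>V N. cinner N v a = 0) \<longrightarrow>
         vec_sq N (mat_vec N (rep_mat (\<rho> N) w) a) \<le> (2 * \<kappa>)\<^sup>2 * vec_sq N a)"
proof -
  have "(\<lambda>j. 2 * (1 / 2 :: real) ^ j) \<longlonglongrightarrow> 2 * 0" by (intro tendsto_mult tendsto_const LIMSEQ_realpow_zero) auto
  then have "\<forall>\<^sub>F j in sequentially. 2 * (1 / 2 :: real) ^ j < \<theta>" by (rule order_tendstoD) (use \<theta> in simp)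
  then obtain j :: nat where j: "2 * (1 / 2 :: real) ^ j < \<theta>"
    using eventually_happens'[OF sequentially_bot] by blast
  let ?S = "iterated_square w j"
  define c where "c = ((2 * \<kappa>) ^ 2 ^ j)\<^sup>2"
  have c: "c > 0" unfolding c_def using \<kappa> by simp
  have S: "?S \<in> GA" by (rule iterated_square_GA[OF w(1)])
  \<comment> \<open>The defining properties of the stretched directions of \<open>S\<close>, with threshold \<open>(2\<kappa>)^(2^j)\<close>.\<close>
  define Q where "Q N V \<longleftrightarrow> finite V \<and> (\<forall>v\<in>V. \<forall>x. x \<notin> {1..N} \<longrightarrow> v x = 0)
      \<and> c * real (card V) \<le> frobenius_sq N (rep_mat (\<rho> N) ?S)
      \<and> (\<forall>a. (\<forall>v\<in>V. cinner N v a = 0) \<longrightarrow> vec_sq N (mat_vec N (rep_mat (\<rho> N) ?S) a) \<le> c * vec_sq N a)" for N V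
  have ex: "\<exists>V. Q N V" for N
  proof (rule few_stretched_directions[OF c])
    fix V
    assume "finite V" "\<And>v x. v \<in> V \<Longrightarrow> x \<notin> {1..N} \<Longrightarrow> v x = 0"
      "c * real (card V) \<le> frobenius_sq N (rep_mat (\<rho> N) ?S)"
      "\<And>a. (\<And>v. v \<in> V \<Longrightarrow> cinner N v a = 0) \<Longrightarrow> vec_sq N (mat_vec N (rep_mat (\<rho> N) ?S) a) \<le> c * vec_sq N a"
    then show ?thesis unfolding Q_def by (intro exI[of _ V] conjI ballI allI impI) simp_all
  qed
  then obtain V where VQ: "\<And>N. Q N (V N)" by metis
  have V: "finite (V N)" "\<forall>v\<in>V N. \<forall>x. x \<notin> {1..N} \<longrightarrow> v x = 0" "c * real (card (V N)) \<le> frobenius_sq N (rep_mat (\<rho> N) ?S)"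
      "\<forall>a. (\<forall>v\<in>V N. cinner N v a = 0) \<longrightarrow> vec_sq N (mat_vec N (rep_mat (\<rho> N) ?S) a) \<le> c * vec_sq N a" for N
    using VQ[of N] unfolding Q_def by simp_all
  have "\<forall>\<^sub>F N in along \<N>. real (card (V N)) \<le> \<theta> * real N"
  proof -
    define e where "e = (\<kappa> ^ 2 ^ j)\<^sup>2"
    have e: "e > 0" unfolding e_def using \<kappa> by simp
    have nS: "(\<parallel>?S\<parallel>)\<^sup>2 \<le> e" unfolding e_def
      by (rule power_mono[OF iterated_square_l2[OF w(1) less_imp_le[OF \<kappa>] bd]]) auto
    have ce: "c = (2 ^ 2 ^ j)\<^sup>2 * e" unfolding c_def e_def by (simp add: power_mult_distrib)
    show ?thesis
    proof (rule eventually_mono[OF frobenius_asymptotic[OF S e]])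
      fix N assume N: "frobenius_sq N (rep_mat (\<rho> N) ?S) \<le> ((\<parallel>?S\<parallel>)\<^sup>2 + e) * real N"
      have "c * real (card (V N)) \<le> ((\<parallel>?S\<parallel>)\<^sup>2 + e) * real N" using V(3)[of N] N by linarith
      also have "\<dots> \<le> (2 * e) * real N" using nS by (intro mult_right_mono) auto
      finally have "e * ((2 ^ 2 ^ j)\<^sup>2 * real (card (V N))) \<le> e * (2 * real N)" unfolding ce by (simp add: mult_ac)
      then have b: "(2 ^ 2 ^ j)\<^sup>2 * real (card (V N)) \<le> 2 * real N" using e by simp
      have "(2::real) ^ j \<le> 2 ^ 2 ^ j" by (rule power_increasing) (auto intro: less_imp_le less_exp)
      also have "\<dots> \<le> (2 ^ 2 ^ j)\<^sup>2" by (simp add: power2_eq_square)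
      finally have "2 ^ j * real (card (V N)) \<le> 2 * real N" using b mult_right_mono[of "2 ^ j" "(2 ^ 2 ^ j)\<^sup>2" "real (card (V N))"] by linarith
      then have "real (card (V N)) \<le> 2 * (1 / 2) ^ j * real N" by (simp add: field_simps power_divide)
      also have "\<dots> \<le> \<theta> * real N" using j by (intro mult_right_mono) auto
      finally show "real (card (V N)) \<le> \<theta> * real N" .
    qed
  qed
  moreover have "vec_sq N (mat_vec N (rep_mat (\<rho> N) w) a) \<le> (2 * \<kappa>)\<^sup>2 * vec_sq N a"
    if N: "N \<in> \<N>" and a: "\<forall>v\<in>V N. cinner N v a = 0" for N a
  proof -
    interpret permutation_rep G N "\<rho> N" using rep N by blast
    show ?thesis
      by (rule iterated_square_descend[OF w, of _ j]) (use \<kappa> V(4) a in \<open>auto simp: c_def\<close>)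
  qed
  ultimately show ?thesis using V(1,2) by (intro exI[of _ V]) blast
qed

end

interpretation cvec: vector_space vec_scale
  by (rule vector_space_vec_scale)

lemma span_supported:
  assumes "\<And>v x. v \<in> V \<Longrightarrow> x \<notin> {1..N} \<Longrightarrow> v x = 0"
  shows "is_subspace N (cvec.span V)"
proof -
  have "\<forall>x. x \<notin> {1..N} \<longrightarrow> v x = 0" if "v \<in> cvec.span V" for v
    using that
  proof (induction rule: cvec.span_induct_alt)
    case base
    then show ?case by (simp add: zero_fun_def)
  next
    case (step c x y)
    then show ?case using assms by (simp add: vec_scale_def)
  qed
  then show ?thesis unfolding is_subspace_def by (simp add: cvec.subspace_span)
qed

lemma vec_dim_span_le: "finite V \<Longrightarrow> vec_dim (cvec.span V) \<le> card V"
  unfolding vec_dim_def by (rule cvec.dim_le_card) auto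

context spectral_sequence
begin

text \<open>A diagonal choice: at size \<open>N\<close> the space takes care of the elements up to index \<open>k(N)\<close>, with proportion
  at most \<open>1 / (k(N) + 1)\<close>, where \<open>k(N)\<close> is as large as the dimensions permit.\<close>

lemma exceptional_subspaces:
  fixes w :: "nat \<Rightarrow> 'a \<Rightarrow> complex" and \<kappa> :: "nat \<Rightarrow> real"
  assumes w: "\<And>i. w i \<in> GA" "\<And>i. w i = star G (w i)" and \<kappa>: "\<And>i. \<kappa> i > 0"
    and bd: "\<And>i u. u \<in> ell2 G \<Longrightarrow> \<parallel>w i \<star> u\<parallel> \<le> \<kappa> i * \<parallel>u\<parallel>"
  shows "\<exists>H. (\<forall>N. is_subspace N (H N)) \<and> (\<lambda>N. real (vec_dim (H N))) \<in> o[along \<N>](\<lambda>N. real N)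
    \<and> (\<forall>N. (\<lambda>x. if x \<in> {1..N} then 1 else 0) \<in> H N)
    \<and> (\<forall>i. \<forall>\<^sub>F N in along \<N>. \<forall>a. (\<forall>h\<in>H N. cinner N h a = 0) \<longrightarrow>
         vec_sq N (mat_vec N (rep_mat (\<rho> N) (w i)) a) \<le> (2 * \<kappa> i)\<^sup>2 * vec_sq N a)"
proof -
  let ?one = "\<lambda>N x. if x \<in> {1..N} then (1::complex) else 0"
  define P where "P = (\<lambda>i \<theta> V. (\<forall>N. finite (V N) \<and> (\<forall>v\<in>V N. \<forall>x. x \<notin> {1..N} \<longrightarrow> v x = 0))
    \<and> (\<forall>\<^sub>F N in along \<N>. real (card (V N)) \<le> \<theta> * real N)
    \<and> (\<forall>N\<in>\<N>. \<forall>a. (\<forall>v\<in>V N. cinner N v a = 0) \<longrightarrow>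
         vec_sq N (mat_vec N (rep_mat (\<rho> N) (w i)) a) \<le> (2 * \<kappa> i)\<^sup>2 * vec_sq N a))"
  \<comment> \<open>At stage \<open>k\<close> there are \<open>k + 1\<close> families, whose proportions add up to \<open>1 / (k + 1)\<close>.\<close>
  define th where "th = (\<lambda>k. 1 / (real (Suc k))\<^sup>2)"
  have "\<exists>V. P i (th k) V" for i k
    unfolding P_def by (rule few_bad_directions[OF w \<kappa> bd]) (auto simp: th_def)
  then obtain V where V: "\<And>i k. P i (th k) (V i k)" by metis
  have Vf: "finite (V i k N)" "\<And>v x. v \<in> V i k N \<Longrightarrow> x \<notin> {1..N} \<Longrightarrow> v x = 0"
    and Vc: "\<forall>\<^sub>F N in along \<N>. real (card (V i k N)) \<le> th k * real N"
    and Vb: "\<And>a. N \<in> \<N> \<Longrightarrow> (\<And>v. v \<in> V i k N \<Longrightarrow> cinner N v a = 0) \<Longrightarrow>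
         vec_sq N (mat_vec N (rep_mat (\<rho> N) (w i)) a) \<le> (2 * \<kappa> i)\<^sup>2 * vec_sq N a" for i k N
    using V[of i k] unfolding P_def by blast+
  define U where "U = (\<lambda>k N. \<Union>i\<in>{0..k}. V i k N)"
  have Uf: "finite (U k N)" for k N unfolding U_def using Vf by auto
  have Uc: "\<forall>\<^sub>F N in along \<N>. real (card (U k N)) * real (Suc k) \<le> real N" for k
  proof -
    have "\<forall>\<^sub>F N in along \<N>. \<forall>i\<in>{0..k}. real (card (V i k N)) \<le> th k * real N"
      by (rule eventually_ball_finite) (auto intro: Vc)
    then show ?thesis
    proof (rule eventually_mono)
      fix N assume N: "\<forall>i\<in>{0..k}. real (card (V i k N)) \<le> th k * real N"
      have "real (card (U k N)) \<le> (\<Sum>i\<in>{0..k}. real (card (V i k N)))"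
        unfolding U_def using card_UN_le[of "{0..k}" "\<lambda>i. V i k N"] by (metis finite_atLeastAtMost of_nat_le_iff of_nat_sum)
      also have "\<dots> \<le> (\<Sum>i\<in>{0..k}. th k * real N)" by (rule sum_mono) (use N in blast)
      also have "\<dots> = real N / real (Suc k)" by (simp add: th_def power2_eq_square del: of_nat_Suc)
      finally show "real (card (U k N)) * real (Suc k) \<le> real N" by (simp add: pos_le_divide_eq del: of_nat_Suc)
    qed
  qed
  define Ks where "Ks = (\<lambda>N. {k. k \<le> N \<and> real (card (U k N)) * real (Suc k) \<le> real N})"
  have Ks_fin: "finite (Ks N)" for N unfolding Ks_def by simp
  define B where "B = (\<lambda>N. insert (?one N) (if Ks N = {} then {} else U (Max (Ks N)) N))"
  define H where "H = (\<lambda>N. cvec.span (B N))"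
  have Bf: "finite (B N)" for N unfolding B_def using Uf by simp
  have late: "\<forall>\<^sub>F N in along \<N>. Ks N \<noteq> {} \<and> k \<le> Max (Ks N)" for k
  proof -
    have "\<forall>\<^sub>F N in along \<N>. k \<le> N" unfolding eventually_along using eventually_ge_at_top[of k] by eventually_elim simp
    then show ?thesis using Uc[of k]
    proof eventually_elim
      case (elim N)
      then have "k \<in> Ks N" unfolding Ks_def by simp
      then show ?case using Max_ge[OF Ks_fin] by blast
    qed
  qed
  have "is_subspace N (H N)" for N
    unfolding H_def by (rule span_supported) (auto simp: B_def U_def Vf split: if_splits)
  moreover have "(\<lambda>N. real (vec_dim (H N))) \<in> o[along \<N>](\<lambda>N. real N)"
  proof (rule landau_o.smallI)
    fix c :: real assume c: "c > 0"
    obtain k :: nat where k: "2 / c < real k" using reals_Archimedean2 by blast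
    obtain N0 :: nat where N0: "2 / c < real N0" using reals_Archimedean2 by blast
    have "\<forall>\<^sub>F N in along \<N>. N0 \<le> N" unfolding eventually_along using eventually_ge_at_top[of N0] by eventually_elim simp
    then show "\<forall>\<^sub>F N in along \<N>. norm (real (vec_dim (H N))) \<le> c * norm (real N)"
      using late[of k]
    proof eventually_elim
      case (elim N)
      let ?K = "Max (Ks N)"
      have "?K \<in> Ks N" using elim Ks_fin Max_in by blast
      then have K: "real (card (U ?K N)) * real (Suc ?K) \<le> real N" unfolding Ks_def by simp
      have "real (card (U ?K N)) * (2 / c) \<le> real (card (U ?K N)) * real (Suc ?K)"
        using k elim by (intro mult_left_mono) auto
      then have "real (card (U ?K N)) * (2 / c) \<le> real N" using K by (rule order_trans)
      then have "real (card (U ?K N)) * (2 / c) * (c / 2) \<le> real N * (c / 2)" using c by (intro mult_right_mono) auto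
      then have "real (card (U ?K N)) \<le> c / 2 * real N" using c by (simp add: mult.commute)
      moreover have "1 \<le> c / 2 * real N"
      proof -
        have "2 / c \<le> real N" using N0 elim by simp
        then show ?thesis using c by (simp add: field_simps)
      qed
      moreover have "real (vec_dim (H N)) \<le> 1 + real (card (U ?K N))"
      proof -
        have "vec_dim (H N) \<le> card (B N)" unfolding H_def by (rule vec_dim_span_le[OF Bf])
        also have "\<dots> \<le> Suc (card (U ?K N))" unfolding B_def using elim by (simp add: card_insert_le_m1 Uf card_insert_if)
        finally show ?thesis by simp
      qed
      ultimately show ?case by simp
    qed
  qed
  moreover have "?one N \<in> H N" for N unfolding H_def by (rule cvec.span_base) (simp add: B_def)
  moreover have "\<forall>\<^sub>F N in along \<N>. \<forall>a. (\<forall>h\<in>H N. cinner N h a = 0) \<longrightarrow>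
         vec_sq N (mat_vec N (rep_mat (\<rho> N) (w i)) a) \<le> (2 * \<kappa> i)\<^sup>2 * vec_sq N a" for i
    using late[of i] eventually_along_mem
  proof (eventually_elim, intro allI impI)
    fix N a assume late: "Ks N \<noteq> {} \<and> i \<le> Max (Ks N)" and N: "N \<in> \<N>" and a: "\<forall>h\<in>H N. cinner N h a = 0"
    have sub: "V i (Max (Ks N)) N \<subseteq> H N"
    proof
      fix v assume "v \<in> V i (Max (Ks N)) N"
      then have "v \<in> B N" using late by (auto simp: B_def U_def)
      then show "v \<in> H N" unfolding H_def by (rule cvec.span_base)
    qed
    show "vec_sq N (mat_vec N (rep_mat (\<rho> N) (w i)) a) \<le> (2 * \<kappa> i)\<^sup>2 * vec_sq N a"
      by (rule Vb[OF N]) (use a sub in blast)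
  qed
  ultimately show ?thesis by (intro exI[of _ H]) blast
qed

end

section \<open>From local matrices to functions\<close>

context spectral_sequence
begin

definition dev_sum where
  "dev_sum N K A E\<^sub>1 E\<^sub>2 \<eta> =
     (\<Sum>\<alpha>\<in>spectral_window N (ev N) {E\<^sub>1 - \<eta>..E\<^sub>1 + \<eta>}. \<Sum>\<beta>\<in>spectral_window N (ev N) {E\<^sub>2 - \<eta>..E\<^sub>2 + \<eta>}.
        deviation N K A (\<phi> N \<beta>) (\<phi> N \<alpha>))"

text \<open>The function \<open>a\<close> such that \<open>K\<^sub>N - \<langle>K\<^sub>N\<rangle>\<close> is the sum over \<open>t\<close> of the products \<open>\<rho>\<^sub>N(t) D\<^sub>a\<close>, up to an error
  that comes from coincidences \<open>t.y = t'.y\<close>.\<close>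

definition centered where
  "centered N K t = (\<lambda>x. K (\<rho> N t x) x - vec_mean N (\<lambda>x. K (\<rho> N t x) x))"

lemma deviation_nonneg [simp]: "deviation N K A f h \<ge> 0"
  by (simp add: deviation_def)

lemma centered_bound:
  assumes N: "N \<in> \<N>" and t: "t \<in> carrier G" and K: "\<And>x y. x \<in> {1..N} \<Longrightarrow> y \<in> {1..N} \<Longrightarrow> cmod (K x y) \<le> 1"
    and x: "x \<in> {1..N}"
  shows "cmod (centered N K t x) \<le> 2"
proof -
  interpret permutation_rep G N "\<rho> N" using rep N by blast
  have "cmod (\<Sum>x\<in>{1..N}. K (\<rho> N t x) x) \<le> (\<Sum>x\<in>{1..N}. 1)"
    by (rule order_trans[OF norm_sum sum_mono]) (rule K[OF rep_in[OF t]])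
  then have "cmod (vec_mean N (\<lambda>x. K (\<rho> N t x) x)) \<le> 1"
    unfolding vec_mean_def using N N_pos by (cases "N = 0") (auto simp: norm_divide divide_le_eq)
  moreover have "cmod (K (\<rho> N t x) x) \<le> 1" by (rule K[OF rep_in[OF t x] x])
  ultimately show ?thesis
    unfolding centered_def using norm_triangle_ineq4[of "K (\<rho> N t x) x" "vec_mean N (\<lambda>x. K (\<rho> N t x) x)"] by linarith
qed

text \<open>A pair \<open>(x, y)\<close> with exactly one \<open>t\<close> such that \<open>x = t.y\<close> contributes the same to both sides; the
  others are counted by the fixed points of the quotients \<open>t'\<^sup>-\<^sup>1 t\<close>.\<close>

lemma local_decomposition_error:
  assumes N: "N \<in> \<N>" and T: "finite T" "T \<subseteq> carrier G"
    and K: "\<And>x y. x \<in> {1..N} \<Longrightarrow> y \<in> {1..N} \<Longrightarrow> cmod (K x y) \<le> 1" and loc: "T_local N (\<rho> N) T K"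
  shows "frobenius_sq N (\<lambda>x y. K x y - avg_mat N (\<rho> N) T K x y - (\<Sum>t\<in>T. if x = \<rho> N t y then centered N K t y else 0))
    \<le> (\<Sum>t\<in>T. \<Sum>t'\<in>T - {t}. fixed N (inv t' \<otimes> t))"
proof -
  interpret permutation_rep G N "\<rho> N" using rep N by blast
  let ?e = "\<lambda>x y t. if x = \<rho> N t y then 1 else (0::real)"
  define Err where "Err = (\<lambda>x y. K x y - avg_mat N (\<rho> N) T K x y - (\<Sum>t\<in>T. if x = \<rho> N t y then centered N K t y else 0))"
  have avg: "avg_mat N (\<rho> N) T K x y = (\<Sum>t\<in>T. if x = \<rho> N t y then vec_mean N (\<lambda>x. K (\<rho> N t x) x) else 0)" for x y
  proof -
    let ?k = "avg_coeff N (\<rho> N) T K"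
    have "avg_mat N (\<rho> N) T K x y = (\<Sum>t\<in>T. ?k t * perm_mat (\<rho> N t) x y)"
      unfolding avg_mat_def rep_mat_def using T
      by (intro sum.mono_neutral_left) (auto simp: supp_def avg_coeff_def split: if_splits)
    also have "\<dots> = (\<Sum>t\<in>T. if x = \<rho> N t y then vec_mean N (\<lambda>x. K (\<rho> N t x) x) else 0)"
      by (intro sum.cong refl) (auto simp: perm_mat_def avg_coeff_def vec_mean_def)
    finally show ?thesis .
  qed
  have Err: "Err x y = K x y * of_real (1 - (\<Sum>t\<in>T. ?e x y t))" for x y
  proof -
    have "avg_mat N (\<rho> N) T K x y + (\<Sum>t\<in>T. if x = \<rho> N t y then centered N K t y else 0) = (\<Sum>t\<in>T. K x y * of_real (?e x y t))"
      unfolding avg sum.distrib[symmetric] by (intro sum.cong refl) (auto simp: centered_def)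
    then show ?thesis unfolding Err_def diff_diff_eq by (simp only: sum_distrib_left[symmetric] of_real_sum of_real_diff right_diff_distrib of_real_1 mult_1_right)
  qed
  have pt: "(cmod (Err x y))\<^sup>2 \<le> (\<Sum>t\<in>T. \<Sum>t'\<in>T - {t}. ?e x y t * ?e x y t')" if x: "x \<in> {1..N}" and y: "y \<in> {1..N}" for x y
  proof -
    \<comment> \<open>The number of \<open>t\<close> with \<open>x = t.y\<close>: the error is \<open>K(x, y) (1 - c)\<close>, and \<open>c (c - 1)\<close> counts the pairs.\<close>
    define c where "c = (\<Sum>t\<in>T. ?e x y t)"
    have "(\<Sum>t\<in>T. \<Sum>t'\<in>T - {t}. ?e x y t * ?e x y t') = (\<Sum>t\<in>T. ?e x y t * (c - ?e x y t))"
    proof (rule sum.cong[OF refl])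
      fix t assume t: "t \<in> T"
      have "(\<Sum>t'\<in>T - {t}. ?e x y t') = c - ?e x y t" unfolding c_def using T t by (simp add: sum_diff1)
      then show "(\<Sum>t'\<in>T - {t}. ?e x y t * ?e x y t') = ?e x y t * (c - ?e x y t)"
        by (simp only: sum_distrib_left[symmetric])
    qed
    also have "\<dots> = (\<Sum>t\<in>T. ?e x y t * c - ?e x y t)" by (rule sum.cong) auto
    also have "\<dots> = c * c - c" unfolding sum_subtractf sum_distrib_right[symmetric] c_def ..
    finally have s: "(\<Sum>t\<in>T. \<Sum>t'\<in>T - {t}. ?e x y t * ?e x y t') = c * c - c" .
    have cc: "c = real (card {t \<in> T. x = \<rho> N t y})" unfolding c_def using T by (simp add: sum.If_cases Int_def)
    show ?thesis
    proof (cases "{t \<in> T. x = \<rho> N t y} = {}")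
      case True
      then have "K x y = 0" using loc x y unfolding T_local_def by blast
      moreover have "c = 0" unfolding cc True by simp
      ultimately show ?thesis unfolding s Err by simp
    next
      case False
      then have c1: "c \<ge> 1" unfolding cc using T by (simp add: Suc_le_eq card_gt_0_iff)
      have "(cmod (Err x y))\<^sup>2 = (cmod (K x y))\<^sup>2 * (1 - c)\<^sup>2"
        unfolding Err c_def[symmetric] norm_mult norm_of_real power_mult_distrib by simp
      also have "\<dots> \<le> 1 * (1 - c)\<^sup>2" using K[OF x y] by (intro mult_right_mono) (auto simp: power_le_one)
      also have "\<dots> \<le> c * c - c" using c1 by (simp add: power2_eq_square algebra_simps)
      finally show ?thesis unfolding s .
    qed
  qed
  have "frobenius_sq N Err \<le> (\<Sum>x\<in>{1..N}. \<Sum>y\<in>{1..N}. \<Sum>t\<in>T. \<Sum>t'\<in>T - {t}. ?e x y t * ?e x y t')"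
    unfolding frobenius_sq_def vec_sq_def by (intro sum_mono pt)
  also have "\<dots> = (\<Sum>t\<in>T. \<Sum>t'\<in>T - {t}. \<Sum>y\<in>{1..N}. \<Sum>x\<in>{1..N}. ?e x y t * ?e x y t')"
  proof -
    let ?F = "\<lambda>x y t t'. ?e x y t * ?e x y t'"
    have "(\<Sum>x\<in>{1..N}. \<Sum>y\<in>{1..N}. \<Sum>t\<in>T. \<Sum>t'\<in>T - {t}. ?F x y t t') = (\<Sum>y\<in>{1..N}. \<Sum>x\<in>{1..N}. \<Sum>t\<in>T. \<Sum>t'\<in>T - {t}. ?F x y t t')"
      by (rule sum.swap)
    also have "\<dots> = (\<Sum>y\<in>{1..N}. \<Sum>t\<in>T. \<Sum>x\<in>{1..N}. \<Sum>t'\<in>T - {t}. ?F x y t t')"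
      by (intro sum.cong refl sum.swap)
    also have "\<dots> = (\<Sum>t\<in>T. \<Sum>y\<in>{1..N}. \<Sum>x\<in>{1..N}. \<Sum>t'\<in>T - {t}. ?F x y t t')" by (rule sum.swap)
    also have "\<dots> = (\<Sum>t\<in>T. \<Sum>y\<in>{1..N}. \<Sum>t'\<in>T - {t}. \<Sum>x\<in>{1..N}. ?F x y t t')"
      by (intro sum.cong refl sum.swap)
    also have "\<dots> = (\<Sum>t\<in>T. \<Sum>t'\<in>T - {t}. \<Sum>y\<in>{1..N}. \<Sum>x\<in>{1..N}. ?F x y t t')"
      by (intro sum.cong refl sum.swap)
    finally show ?thesis .
  qed
  also have "\<dots> = (\<Sum>t\<in>T. \<Sum>t'\<in>T - {t}. fixed_count (inv t' \<otimes> t))"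
  proof (intro sum.cong refl)
    fix t t' assume "t \<in> T" "t' \<in> T - {t}"
    then have tt: "t \<in> carrier G" "t' \<in> carrier G" using T by auto
    have "(\<Sum>y\<in>{1..N}. \<Sum>x\<in>{1..N}. ?e x y t * ?e x y t') = (\<Sum>y\<in>{1..N}. if \<rho> N t y = \<rho> N t' y then 1 else 0)"
    proof (intro sum.cong refl)
      fix y assume y: "y \<in> {1..N}"
      have "(\<Sum>x\<in>{1..N}. ?e x y t * ?e x y t') = (\<Sum>x\<in>{1..N}. if x = \<rho> N t y then (if \<rho> N t y = \<rho> N t' y then 1 else 0) else 0)"
        by (intro sum.cong) auto
      then show "(\<Sum>x\<in>{1..N}. ?e x y t * ?e x y t') = (if \<rho> N t y = \<rho> N t' y then 1 else 0)"
        using rep_in[OF tt(1) y] by simp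
    qed
    also have "\<dots> = fixed_count (inv t' \<otimes> t)" by (rule coincidence_count[OF tt])
    finally show "(\<Sum>y\<in>{1..N}. \<Sum>x\<in>{1..N}. ?e x y t * ?e x y t') = fixed_count (inv t' \<otimes> t)" .
  qed
  finally show ?thesis unfolding Err_def .
qed

lemma dev_sum_le:
  assumes N: "N \<in> \<N>" and T: "finite T" "T \<subseteq> carrier G"
    and K: "\<And>x y. x \<in> {1..N} \<Longrightarrow> y \<in> {1..N} \<Longrightarrow> cmod (K x y) \<le> 1" and loc: "T_local N (\<rho> N) T K"
  shows "dev_sum N K (avg_mat N (\<rho> N) T K) E\<^sub>1 E\<^sub>2 \<eta> \<le>
    2 * real (card T) * (\<Sum>t\<in>T. window_energy N E\<^sub>1 E\<^sub>2 \<eta> t (centered N K t))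
    + 2 * (\<Sum>t\<in>T. \<Sum>t'\<in>T - {t}. fixed N (inv t' \<otimes> t))"
proof -
  interpret permutation_rep G N "\<rho> N" using rep N by blast
  let ?W1 = "spectral_window N (ev N) {E\<^sub>1 - \<eta>..E\<^sub>1 + \<eta>}" and ?W2 = "spectral_window N (ev N) {E\<^sub>2 - \<eta>..E\<^sub>2 + \<eta>}"
  let ?A = "avg_mat N (\<rho> N) T K"
  define Err where "Err = (\<lambda>x y. K x y - ?A x y - (\<Sum>t\<in>T. if x = \<rho> N t y then centered N K t y else 0))"
  define X where "X = (\<lambda>t i j. \<Sum>y\<in>{1..N}. cnj (\<phi> N j (\<rho> N t y)) * centered N K t y * \<phi> N i y)"
  define Z where "Z = (\<lambda>i j. cinner N (\<phi> N j) (mat_vec N Err (\<phi> N i)))"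
  have split: "cinner N (\<phi> N j) (mat_vec N K (\<phi> N i)) - cinner N (\<phi> N j) (mat_vec N ?A (\<phi> N i)) = (\<Sum>t\<in>T. X t i j) + Z i j" for i j
  proof -
    let ?M = "\<lambda>x y. \<Sum>t\<in>T. if x = \<rho> N t y then centered N K t y else 0"
    have "cinner N (\<phi> N j) (mat_vec N ?M (\<phi> N i)) =
        (\<Sum>x\<in>{1..N}. \<Sum>y\<in>{1..N}. \<Sum>t\<in>T. if x = \<rho> N t y then cnj (\<phi> N j x) * centered N K t y * \<phi> N i y else 0)"
      unfolding cinner_def mat_vec_def sum_distrib_left sum_distrib_right by (intro sum.cong refl) auto
    also have "\<dots> = (\<Sum>y\<in>{1..N}. \<Sum>t\<in>T. \<Sum>x\<in>{1..N}. if x = \<rho> N t y then cnj (\<phi> N j x) * centered N K t y * \<phi> N i y else 0)"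
    proof -
      have "(\<Sum>x\<in>{1..N}. \<Sum>y\<in>{1..N}. \<Sum>t\<in>T. F x y t) = (\<Sum>y\<in>{1..N}. \<Sum>t\<in>T. \<Sum>x\<in>{1..N}. F x y t)" for F :: "nat \<Rightarrow> nat \<Rightarrow> 'a \<Rightarrow> complex"
        by (subst sum.swap) (intro sum.cong refl sum.swap)
      then show ?thesis .
    qed
    also have "\<dots> = (\<Sum>y\<in>{1..N}. \<Sum>t\<in>T. cnj (\<phi> N j (\<rho> N t y)) * centered N K t y * \<phi> N i y)"
    proof (intro sum.cong refl)
      fix y t assume "y \<in> {1..N}" "t \<in> T"
      then have "\<rho> N t y \<in> {1..N}" using rep_in T by blast
      then show "(\<Sum>x\<in>{1..N}. if x = \<rho> N t y then cnj (\<phi> N j x) * centered N K t y * \<phi> N i y else 0) =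
          cnj (\<phi> N j (\<rho> N t y)) * centered N K t y * \<phi> N i y" by simp
    qed
    also have "\<dots> = (\<Sum>t\<in>T. X t i j)" unfolding X_def by (rule sum.swap)
    finally have M: "cinner N (\<phi> N j) (mat_vec N ?M (\<phi> N i)) = (\<Sum>t\<in>T. X t i j)" .
    have "mat_vec N Err (\<phi> N i) = (\<lambda>x. mat_vec N K (\<phi> N i) x - mat_vec N ?A (\<phi> N i) x - mat_vec N ?M (\<phi> N i) x)"
      unfolding mat_vec_def Err_def by (simp only: left_diff_distrib sum_subtractf)
    then have "Z i j = cinner N (\<phi> N j) (mat_vec N K (\<phi> N i)) - cinner N (\<phi> N j) (mat_vec N ?A (\<phi> N i)) - (\<Sum>t\<in>T. X t i j)"
      unfolding Z_def M[symmetric] by (simp only: cinner_diff_right)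
    then show ?thesis by simp
  qed
  have term_le: "deviation N K ?A (\<phi> N j) (\<phi> N i) \<le> 2 * real (card T) * (\<Sum>t\<in>T. (cmod (X t i j))\<^sup>2) + 2 * (cmod (Z i j))\<^sup>2" for i j
  proof -
    have "cmod ((\<Sum>t\<in>T. X t i j) + Z i j) \<le> (\<Sum>t\<in>T. cmod (X t i j)) + cmod (Z i j)"
      by (rule order_trans[OF norm_triangle_ineq add_right_mono[OF norm_sum]])
    then have "(cmod ((\<Sum>t\<in>T. X t i j) + Z i j))\<^sup>2 \<le> ((\<Sum>t\<in>T. cmod (X t i j)) + cmod (Z i j))\<^sup>2" by (rule power_mono) simp
    also have "\<dots> \<le> 2 * (\<Sum>t\<in>T. cmod (X t i j))\<^sup>2 + 2 * (cmod (Z i j))\<^sup>2"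
    proof -
      have "(x + y)\<^sup>2 \<le> 2 * x\<^sup>2 + 2 * y\<^sup>2" for x y :: real
        using zero_le_power2[of "x - y"] by (simp add: power2_eq_square algebra_simps)
      then show ?thesis .
    qed
    also have "(\<Sum>t\<in>T. cmod (X t i j))\<^sup>2 \<le> (\<Sum>t\<in>T. (cmod (X t i j))\<^sup>2) * real (card T)"
      by (rule sum_squared_le_sum_of_squares)
    finally show ?thesis unfolding deviation_def split by (simp add: mult_ac)
  qed
  have "dev_sum N K ?A E\<^sub>1 E\<^sub>2 \<eta> \<le> (\<Sum>i\<in>?W1. \<Sum>j\<in>?W2. 2 * real (card T) * (\<Sum>t\<in>T. (cmod (X t i j))\<^sup>2) + 2 * (cmod (Z i j))\<^sup>2)"
    unfolding dev_sum_def by (intro sum_mono term_le)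
  also have "\<dots> = 2 * real (card T) * (\<Sum>i\<in>?W1. \<Sum>j\<in>?W2. \<Sum>t\<in>T. (cmod (X t i j))\<^sup>2) + 2 * (\<Sum>i\<in>?W1. \<Sum>j\<in>?W2. (cmod (Z i j))\<^sup>2)"
    by (simp only: sum.distrib sum_distrib_left)
  also have "(\<Sum>i\<in>?W1. \<Sum>j\<in>?W2. \<Sum>t\<in>T. (cmod (X t i j))\<^sup>2) = (\<Sum>t\<in>T. window_energy N E\<^sub>1 E\<^sub>2 \<eta> t (centered N K t))"
  proof -
    have "(\<Sum>i\<in>?W1. \<Sum>j\<in>?W2. \<Sum>t\<in>T. (cmod (X t i j))\<^sup>2) = (\<Sum>i\<in>?W1. \<Sum>t\<in>T. \<Sum>j\<in>?W2. (cmod (X t i j))\<^sup>2)"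
      by (intro sum.cong refl sum.swap)
    also have "\<dots> = (\<Sum>t\<in>T. \<Sum>i\<in>?W1. \<Sum>j\<in>?W2. (cmod (X t i j))\<^sup>2)" by (rule sum.swap)
    finally show ?thesis unfolding window_energy_def X_def .
  qed
  also have "(\<Sum>i\<in>?W1. \<Sum>j\<in>?W2. (cmod (Z i j))\<^sup>2) \<le> (\<Sum>t\<in>T. \<Sum>t'\<in>T - {t}. fixed_count (inv t' \<otimes> t))"
  proof -
    have W: "?W1 \<subseteq> {1..N}" "?W2 \<subseteq> {1..N}" by (auto simp: spectral_window_def)
    have "(\<Sum>i\<in>?W1. \<Sum>j\<in>?W2. (cmod (Z i j))\<^sup>2) \<le> (\<Sum>i\<in>?W1. \<Sum>j\<in>{1..N}. (cmod (Z i j))\<^sup>2)"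
      using W by (intro sum_mono sum_mono2) auto
    also have "\<dots> \<le> (\<Sum>i\<in>{1..N}. \<Sum>j\<in>{1..N}. (cmod (Z i j))\<^sup>2)"
      using W by (intro sum_mono2 sum_nonneg) auto
    also have "\<dots> = frobenius_sq N Err" unfolding Z_def by (rule frobenius_Parseval[OF basis[OF N]]) simp
    also have "\<dots> \<le> (\<Sum>t\<in>T. \<Sum>t'\<in>T - {t}. fixed_count (inv t' \<otimes> t))"
      unfolding Err_def by (rule local_decomposition_error[OF N T K loc])
    finally show ?thesis .
  qed
  finally show ?thesis by simp
qed

lemma coincidences_small:
  assumes T: "finite T" "T \<subseteq> carrier G" and \<delta>: "\<delta> > 0"
  shows "\<forall>\<^sub>F N in along \<N>. (\<Sum>t\<in>T. \<Sum>t'\<in>T - {t}. fixed N (inv t' \<otimes> t)) \<le> \<delta> * real N"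
proof -
  define A where "A = (\<lambda>(t, t'). inv t' \<otimes> t) ` (T \<times> T) - {\<one>}"
  have A: "finite A" "A \<subseteq> carrier G" "\<one> \<notin> A" unfolding A_def using T by auto
  have mem: "inv t' \<otimes> t \<in> A" if "t \<in> T" "t' \<in> T - {t}" for t t'
  proof -
    have "t \<in> carrier G" "t' \<in> carrier G" "t \<noteq> t'" using that T by auto
    then have "inv t' \<otimes> t \<noteq> \<one>" by (metis inv_equality inv_inv inv_closed)
    then show ?thesis unfolding A_def using that by force
  qed
  define L where "L = (real (card T))\<^sup>2 + 1"
  have L: "L > 0" unfolding L_def by (simp add: add_nonneg_pos)
  show ?thesis
  proof (rule eventually_mono[OF fixed_small[OF A divide_pos_pos[OF \<delta> L]]])
    fix N assume few: "\<forall>g\<in>A. fixed N g \<le> \<delta> / L * real N"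
    have "(\<Sum>t\<in>T. \<Sum>t'\<in>T - {t}. fixed N (inv t' \<otimes> t)) \<le> (\<Sum>t\<in>T. \<Sum>t'\<in>T - {t}. \<delta> / L * real N)"
      by (intro sum_mono) (use few mem in blast)
    also have "\<dots> \<le> (\<Sum>t\<in>T. \<Sum>t'\<in>T. \<delta> / L * real N)"
      using T \<delta> L by (intro sum_mono sum_mono2) auto
    also have "\<dots> = (real (card T))\<^sup>2 * (\<delta> / L * real N)" by (simp add: power2_eq_square)
    also have "\<dots> \<le> L * (\<delta> / L * real N)" using \<delta> L by (intro mult_right_mono) (auto simp: L_def)
    also have "\<dots> = \<delta> * real N" using L by simp
    finally show "(\<Sum>t\<in>T. \<Sum>t'\<in>T - {t}. fixed N (inv t' \<otimes> t)) \<le> \<delta> * real N" .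
  qed
qed

section \<open>Quantum ergodicity and mixing from bounds on a net of energies\<close>

lemma dev_sum_mono:
  assumes "{E\<^sub>1 - \<eta>..E\<^sub>1 + \<eta>} \<subseteq> {E\<^sub>1' - \<eta>'..E\<^sub>1' + \<eta>'}" "{E\<^sub>2 - \<eta>..E\<^sub>2 + \<eta>} \<subseteq> {E\<^sub>2' - \<eta>'..E\<^sub>2' + \<eta>'}"
  shows "dev_sum N K A E\<^sub>1 E\<^sub>2 \<eta> \<le> dev_sum N K A E\<^sub>1' E\<^sub>2' \<eta>'"
proof -
  let ?W = "\<lambda>E \<eta>. spectral_window N (ev N) {E - \<eta>..E + \<eta>}"
  have "dev_sum N K A E\<^sub>1 E\<^sub>2 \<eta> \<le> (\<Sum>\<alpha>\<in>?W E\<^sub>1 \<eta>. \<Sum>\<beta>\<in>?W E\<^sub>2' \<eta>'. deviation N K A (\<phi> N \<beta>) (\<phi> N \<alpha>))"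
    unfolding dev_sum_def by (intro sum_mono sum_mono2 window_finite window_mono assms deviation_nonneg)
  also have "\<dots> \<le> dev_sum N K A E\<^sub>1' E\<^sub>2' \<eta>'"
    unfolding dev_sum_def by (intro sum_mono2 window_finite window_mono assms sum_nonneg deviation_nonneg)
  finally show ?thesis .
qed

lemma window_shift:
  fixes E E' \<eta> r :: real
  assumes "\<bar>E - E'\<bar> \<le> r" "\<eta> \<le> r"
  shows "{E - \<eta>..E + \<eta>} \<subseteq> {E' - 2 * r..E' + 2 * r}"
proof -
  have "E' - 2 * r \<le> E - \<eta> \<and> E + \<eta> \<le> E' + 2 * r" using assms by linarith
  then show ?thesis by (simp add: atLeastatMost_subset_iff)
qed

text \<open>Both windows of half-width \<open>\<eta>\<close> are contained in windows of twice the mesh around points of the net, if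
  the mesh is between \<open>\<eta>\<close> and \<open>2\<eta>\<close>. So finitely many pairs of energies at countably many scales
  suffice.\<close>

lemma quantum_mixing_from_net:
  assumes ab: "a < b"
    and cnt: "c > 0" "\<And>\<eta>. 0 < \<eta> \<Longrightarrow> \<eta> \<le> 1 \<Longrightarrow>
      \<forall>\<^sub>F N in along \<N>. \<forall>E\<in>{a..b}. c * \<eta> * real N \<le> real (card (spectral_window N (ev N) {E - \<eta>..E + \<eta>}))"
    and net: "\<And>\<epsilon>. \<epsilon> > 0 \<Longrightarrow> \<forall>\<^sub>F k in sequentially. \<forall>\<^sub>F N in along \<N>. \<forall>E\<^sub>1\<in>net a b k. \<forall>E\<^sub>2\<in>net a b k.
      dev_sum N (K N) (A N) E\<^sub>1 E\<^sub>2 (2 * ((b - a) / real (Suc k))) \<le> \<epsilon> * ((b - a) / real (Suc k)) * real N"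
  shows "quantum_mixing \<N> \<phi> ev {a..b} K A"
proof -
  define Q where "Q = (\<lambda>\<eta>. Limsup (along \<N>) (\<lambda>N. SUP (E\<^sub>1, E\<^sub>2) \<in> interior {a..b} \<times> interior {a..b}.
     ennreal (dev_sum N (K N) (A N) E\<^sub>1 E\<^sub>2 \<eta> / real (card (spectral_window N (ev N) {E\<^sub>1 - \<eta>..E\<^sub>1 + \<eta>})))))"
  have "(Q \<longlongrightarrow> 0) (at_right 0)"
  proof (rule order_tendstoI)
    fix u :: ennreal assume u: "0 < u"
    obtain \<epsilon> :: real where \<epsilon>: "\<epsilon> > 0" "ennreal \<epsilon> < u"
    proof (cases u rule: ennreal_cases)
      case (real r)
      then have "r > 0" using u by (simp add: ennreal_less_zero_iff)
      then have "ennreal (r / 2) < u" unfolding real(2) by (simp add: ennreal_less_iff)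
      then show ?thesis using that[of "r / 2"] \<open>r > 0\<close> by simp
    next
      case top
      then show ?thesis using that[of 1] by simp
    qed
    define e where "e = c * \<epsilon> / 2"
    have e: "e > 0" unfolding e_def using cnt(1) \<epsilon> by simp
    obtain k0 where k0: "\<And>k. k \<ge> k0 \<Longrightarrow> \<forall>\<^sub>F N in along \<N>. \<forall>E\<^sub>1\<in>net a b k. \<forall>E\<^sub>2\<in>net a b k.
      dev_sum N (K N) (A N) E\<^sub>1 E\<^sub>2 (2 * ((b - a) / real (Suc k))) \<le> e * ((b - a) / real (Suc k)) * real N"
      using net[OF e] unfolding eventually_sequentially by blast
    define h where "h = min 1 ((b - a) / real (Suc k0))"
    have h: "h > 0" unfolding h_def using ab by simp
    show "\<forall>\<^sub>F \<eta> in at_right 0. Q \<eta> < u"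
    proof (rule eventually_mono[OF eventually_at_right_real[OF h]])
      fix \<eta> assume "\<eta> \<in> {0<..<h}"
      then have \<eta>: "0 < \<eta>" "\<eta> \<le> 1" "\<eta> \<le> (b - a) / real (Suc k0)" unfolding h_def by auto
      \<comment> \<open>The mesh \<open>(b - a) / q\<close> lies between \<open>\<eta>\<close> and \<open>2\<eta>\<close>.\<close>
      define q where "q = nat \<lfloor>(b - a) / \<eta>\<rfloor>"
      have "real (Suc k0) \<le> (b - a) / \<eta>" using \<eta> by (simp add: pos_le_divide_eq mult.commute del: of_nat_Suc)
      then have q: "Suc k0 \<le> q" "real q \<le> (b - a) / \<eta>" "(b - a) / \<eta> \<le> real q + 1"
        unfolding q_def by linarith+
      define k where "k = q - 1"
      have k: "k \<ge> k0" "Suc k = q" unfolding k_def using q by auto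
      let ?r = "(b - a) / real (Suc k)"
      have qpos: "real q > 0" using q(1) by simp
      have r1: "\<eta> \<le> ?r"
      proof -
        have "real q * \<eta> \<le> b - a" using q(2) \<eta> by (simp add: pos_le_divide_eq)
        then show ?thesis unfolding k(2) using qpos by (simp add: pos_le_divide_eq mult.commute)
      qed
      have r2: "?r \<le> 2 * \<eta>"
      proof -
        have "b - a \<le> (real q + 1) * \<eta>" using q(3) \<eta> by (simp add: pos_divide_le_eq)
        also have "\<dots> \<le> (2 * real q) * \<eta>" using q(1) \<eta> by (intro mult_right_mono) auto
        finally show ?thesis unfolding k(2) using qpos by (simp add: pos_divide_le_eq mult_ac)
      qed
      have "Q \<eta> \<le> ennreal \<epsilon>"
        unfolding Q_def
      proof (rule Limsup_bounded)
        show "\<forall>\<^sub>F N in along \<N>. (SUP (E\<^sub>1, E\<^sub>2) \<in> interior {a..b} \<times> interior {a..b}.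
          ennreal (dev_sum N (K N) (A N) E\<^sub>1 E\<^sub>2 \<eta> / real (card (spectral_window N (ev N) {E\<^sub>1 - \<eta>..E\<^sub>1 + \<eta>})))) \<le> ennreal \<epsilon>"
          using k0[OF k(1)] cnt(2)[OF \<eta>(1,2)] eventually_along_mem
        proof eventually_elim
          case (elim N)
          have N0: "real N > 0" using elim(3) N_pos by (metis gr0I of_nat_0_less_iff)
          show ?case
          proof (rule SUP_least, clarify)
            fix E1 E2 assume E: "E1 \<in> interior {a..b}" "E2 \<in> interior {a..b}"
            then have E': "E1 \<in> {a..b}" "E2 \<in> {a..b}" using interior_subset by blast+
            obtain F1 where F1: "F1 \<in> net a b k" "\<bar>E1 - F1\<bar> \<le> ?r" using net_covers[OF ab E'(1)] by blast
            obtain F2 where F2: "F2 \<in> net a b k" "\<bar>E2 - F2\<bar> \<le> ?r" using net_covers[OF ab E'(2)] by blast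
            let ?n = "real (card (spectral_window N (ev N) {E1 - \<eta>..E1 + \<eta>}))"
            have "dev_sum N (K N) (A N) E1 E2 \<eta> \<le> dev_sum N (K N) (A N) F1 F2 (2 * ?r)"
              by (rule dev_sum_mono) (rule window_shift[OF F1(2) r1], rule window_shift[OF F2(2) r1])
            also have "\<dots> \<le> e * ?r * real N" using elim(1) F1(1) F2(1) by blast
            also have "\<dots> \<le> e * (2 * \<eta>) * real N" using e r2 by (intro mult_right_mono mult_left_mono) auto
            also have "\<dots> = \<epsilon> * (c * \<eta> * real N)" unfolding e_def by simp
            also have "\<dots> \<le> \<epsilon> * ?n" using elim(2) E'(1) \<epsilon> by (intro mult_left_mono) auto
            finally have le: "dev_sum N (K N) (A N) E1 E2 \<eta> \<le> \<epsilon> * ?n" .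
            have "0 < c * \<eta> * real N" using cnt(1) \<eta> N0 by simp
            then have "?n > 0" using elim(2) E'(1) by fastforce
            then have "dev_sum N (K N) (A N) E1 E2 \<eta> / ?n \<le> \<epsilon>" using le by (simp add: pos_divide_le_eq)
            then show "ennreal (dev_sum N (K N) (A N) E1 E2 \<eta> / ?n) \<le> ennreal \<epsilon>" by (rule ennreal_leI)
          qed
        qed
      qed
      also have "\<dots> < u" by (rule \<epsilon>(2))
      finally show "Q \<eta> < u" .
    qed
  qed auto
  then show ?thesis unfolding quantum_mixing_def Q_def dev_sum_def .
qed

text \<open>Ergodicity follows from mixing on the diagonal: the interval is covered by the windows around the
  points of a net, and their number times the mesh is bounded.\<close>

lemma quantum_ergodic_from_net:
  assumes ab: "a < b"
    and cnt: "c > 0" "\<And>\<eta>. 0 < \<eta> \<Longrightarrow> \<eta> \<le> 1 \<Longrightarrow>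
      \<forall>\<^sub>F N in along \<N>. \<forall>E\<in>{a..b}. c * \<eta> * real N \<le> real (card (spectral_window N (ev N) {E - \<eta>..E + \<eta>}))"
    and net: "\<And>\<epsilon>. \<epsilon> > 0 \<Longrightarrow> \<forall>\<^sub>F k in sequentially. \<forall>\<^sub>F N in along \<N>. \<forall>E\<^sub>1\<in>net a b k. \<forall>E\<^sub>2\<in>net a b k.
      dev_sum N (K N) (A N) E\<^sub>1 E\<^sub>2 (2 * ((b - a) / real (Suc k))) \<le> \<epsilon> * ((b - a) / real (Suc k)) * real N"
  shows "quantum_ergodic \<N> \<phi> ev {a..b} K A"
  unfolding quantum_ergodic_def
proof (rule tendstoI)
  fix \<epsilon> :: real assume \<epsilon>: "\<epsilon> > 0"
  define \<eta> where "\<eta> = min 1 ((b - a) / 2)"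
  have \<eta>: "0 < \<eta>" "\<eta> \<le> 1" unfolding \<eta>_def using ab by auto
  have \<eta>2: "\<eta> \<le> (b - a) / 2" unfolding \<eta>_def by (rule min.cobounded2)
  define e where "e = \<epsilon> * (c * \<eta>) / (4 * (b - a))"
  have e: "e > 0" unfolding e_def using \<epsilon> cnt(1) \<eta> ab by simp
  obtain k where k: "\<forall>\<^sub>F N in along \<N>. \<forall>E\<^sub>1\<in>net a b k. \<forall>E\<^sub>2\<in>net a b k.
      dev_sum N (K N) (A N) E\<^sub>1 E\<^sub>2 (2 * ((b - a) / real (Suc k))) \<le> e * ((b - a) / real (Suc k)) * real N"
    using eventually_happens'[OF sequentially_bot net[OF e]] by blast
  let ?r = "(b - a) / real (Suc k)"
  show "\<forall>\<^sub>F N in along \<N>. dist ((\<Sum>\<alpha>\<in>spectral_window N (ev N) {a..b}. deviation N (K N) (A N) (\<phi> N \<alpha>) (\<phi> N \<alpha>))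
           / real (card (spectral_window N (ev N) {a..b}))) 0 < \<epsilon>"
    using k cnt(2)[OF \<eta>(1,2)] eventually_along_mem
  proof eventually_elim
    case (elim N)
    let ?W = "spectral_window N (ev N) {a..b}" and ?V = "\<lambda>E. spectral_window N (ev N) {E - 2 * ?r..E + 2 * ?r}"
    let ?d = "\<lambda>\<alpha> \<beta>. deviation N (K N) (A N) (\<phi> N \<beta>) (\<phi> N \<alpha>)"
    have N0: "real N > 0" using elim(3) N_pos by (metis gr0I of_nat_0_less_iff)
    have r0: "?r > 0" using ab by simp
    have "(\<Sum>\<alpha>\<in>?W. ?d \<alpha> \<alpha>) \<le> (\<Sum>\<alpha>\<in>?W. \<Sum>E\<in>net a b k. if \<alpha> \<in> ?V E then ?d \<alpha> \<alpha> else 0)"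
    proof (rule sum_mono)
      fix \<alpha> assume \<alpha>: "\<alpha> \<in> ?W"
      then have "ev N \<alpha> \<in> {a..b}" by (simp add: spectral_window_def)
      then obtain E where E: "E \<in> net a b k" "\<bar>ev N \<alpha> - E\<bar> \<le> ?r" using net_covers[OF ab] by blast
      have "E - 2 * ?r \<le> ev N \<alpha> \<and> ev N \<alpha> \<le> E + 2 * ?r" using E(2) r0 by linarith
      then have "\<alpha> \<in> ?V E" using \<alpha> by (simp add: spectral_window_def)
      then have "?d \<alpha> \<alpha> = (if \<alpha> \<in> ?V E then ?d \<alpha> \<alpha> else 0)" by (rule if_P[symmetric])
      also have "\<dots> \<le> (\<Sum>E\<in>net a b k. if \<alpha> \<in> ?V E then ?d \<alpha> \<alpha> else 0)"
        by (rule member_le_sum[OF E(1), of "\<lambda>E. if \<alpha> \<in> ?V E then ?d \<alpha> \<alpha> else 0"]) (simp_all add: net_finite)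
      finally show "?d \<alpha> \<alpha> \<le> (\<Sum>E\<in>net a b k. if \<alpha> \<in> ?V E then ?d \<alpha> \<alpha> else 0)" .
    qed
    also have "\<dots> = (\<Sum>E\<in>net a b k. \<Sum>\<alpha>\<in>?W. if \<alpha> \<in> ?V E then ?d \<alpha> \<alpha> else 0)" by (rule sum.swap)
    also have "\<dots> \<le> (\<Sum>E\<in>net a b k. \<Sum>\<alpha>\<in>?V E. ?d \<alpha> \<alpha>)"
    proof (rule sum_mono)
      fix E
      have "(\<Sum>\<alpha>\<in>?W. if \<alpha> \<in> ?V E then ?d \<alpha> \<alpha> else 0) = (\<Sum>\<alpha>\<in>?W \<inter> ?V E. ?d \<alpha> \<alpha>)"
        by (rule sum.inter_restrict[symmetric]) (rule window_finite)
      also have "\<dots> \<le> (\<Sum>\<alpha>\<in>?V E. ?d \<alpha> \<alpha>)" by (rule sum_mono2) (auto simp: window_finite)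
      finally show "(\<Sum>\<alpha>\<in>?W. if \<alpha> \<in> ?V E then ?d \<alpha> \<alpha> else 0) \<le> (\<Sum>\<alpha>\<in>?V E. ?d \<alpha> \<alpha>)" .
    qed
    also have "\<dots> \<le> (\<Sum>E\<in>net a b k. e * ?r * real N)"
    proof (rule sum_mono)
      fix E assume E: "E \<in> net a b k"
      have "(\<Sum>\<alpha>\<in>?V E. ?d \<alpha> \<alpha>) \<le> (\<Sum>\<alpha>\<in>?V E. \<Sum>\<beta>\<in>?V E. ?d \<alpha> \<beta>)"
        by (intro sum_mono member_le_sum) (auto simp: window_finite)
      also have "\<dots> = dev_sum N (K N) (A N) E E (2 * ?r)" by (simp add: dev_sum_def)
      also have "\<dots> \<le> e * ?r * real N" using elim(1) E by blast
      finally show "(\<Sum>\<alpha>\<in>?V E. ?d \<alpha> \<alpha>) \<le> e * ?r * real N" .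
    qed
    also have "\<dots> = real (card (net a b k)) * (e * ?r * real N)" by simp
    also have "\<dots> \<le> (2 * real (Suc k)) * (e * ?r * real N)"
    proof (rule mult_right_mono)
      have "card (net a b k) \<le> 2 * Suc k" using net_finite(2)[of a b k] by simp
      then show "real (card (net a b k)) \<le> 2 * real (Suc k)" by (metis of_nat_le_iff of_nat_mult of_nat_numeral)
    qed (use e ab in simp)
    also have "\<dots> = 2 * e * (b - a) * real N" by (simp del: of_nat_Suc)
    also have "\<dots> = \<epsilon> / 2 * (c * \<eta> * real N)"
    proof -
      have "2 * (x / (4 * d)) * d * y = x / 2 * y" if "d \<noteq> 0" for x y d :: real using that by simp
      from this[of "b - a" "\<epsilon> * (c * \<eta>)" "real N"] show ?thesis unfolding e_def using ab by simp
    qed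
    also have "\<dots> \<le> \<epsilon> / 2 * real (card ?W)"
    proof (rule mult_left_mono)
      let ?m = "(a + b) / 2"
      have "c * \<eta> * real N \<le> real (card (spectral_window N (ev N) {?m - \<eta>..?m + \<eta>}))" using elim(2) ab by simp
      also have "\<dots> \<le> real (card ?W)"
      proof -
        have "a \<le> ?m - \<eta> \<and> ?m + \<eta> \<le> b" using \<eta>2 by (simp add: field_simps)
        then have "{?m - \<eta>..?m + \<eta>} \<subseteq> {a..b}" by (simp only: atLeastatMost_subset_iff) blast
        then show ?thesis using card_mono[OF window_finite window_mono] by simp
      qed
      finally show "c * \<eta> * real N \<le> real (card ?W)" .
    qed (use \<epsilon> in simp)
    finally have le: "(\<Sum>\<alpha>\<in>?W. ?d \<alpha> \<alpha>) \<le> \<epsilon> / 2 * real (card ?W)" .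
    have "(\<Sum>\<alpha>\<in>?W. ?d \<alpha> \<alpha>) / real (card ?W) \<le> \<epsilon> / 2"
    proof (cases "card ?W = 0")
      case False
      then show ?thesis using le by (simp add: pos_divide_le_eq)
    qed (use \<epsilon> in simp)
    moreover have "(\<Sum>\<alpha>\<in>?W. ?d \<alpha> \<alpha>) / real (card ?W) \<ge> 0" by (intro divide_nonneg_nonneg sum_nonneg) auto
    ultimately show ?case using \<epsilon> unfolding dist_real_def diff_zero by linarith
  qed
qed

lemma QE_and_QM_from_energies:
  assumes AC: "cond_AC G p I\<^sub>0" and ab: "a < b" "{a..b} \<subseteq> I\<^sub>0" and T: "finite T" "T \<subseteq> carrier G"
    and K: "\<And>N x y. N \<in> \<N> \<Longrightarrow> x \<in> {1..N} \<Longrightarrow> y \<in> {1..N} \<Longrightarrow> cmod (K N x y) \<le> 1"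
    and loc: "\<And>N. N \<in> \<N> \<Longrightarrow> T_local N (\<rho> N) T (K N)"
    and en: "\<And>\<epsilon> t. \<epsilon> > 0 \<Longrightarrow> t \<in> T \<Longrightarrow> \<forall>\<^sub>F k in sequentially. \<forall>E\<^sub>1\<in>net a b k. \<forall>E\<^sub>2\<in>net a b k. \<forall>\<^sub>F N in along \<N>.
      window_energy N E\<^sub>1 E\<^sub>2 (2 * ((b - a) / real (Suc k))) t (centered N (K N) t) \<le> \<epsilon> * ((b - a) / real (Suc k)) * real N"
  shows "QE_and_QM \<N> \<rho> T \<phi> ev {a..b} K"
proof -
  obtain c where c: "c > 0" "\<And>\<eta>. 0 < \<eta> \<Longrightarrow> \<eta> \<le> 1 \<Longrightarrow>
    \<forall>\<^sub>F N in along \<N>. \<forall>E\<in>{a..b}. c * \<eta> * real N \<le> real (card (spectral_window N (ev N) {E - \<eta>..E + \<eta>}))"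
    using window_count[OF AC ab] by blast
  have net: "\<forall>\<^sub>F k in sequentially. \<forall>\<^sub>F N in along \<N>. \<forall>E\<^sub>1\<in>net a b k. \<forall>E\<^sub>2\<in>net a b k.
      dev_sum N (K N) (avg_mat N (\<rho> N) T (K N)) E\<^sub>1 E\<^sub>2 (2 * ((b - a) / real (Suc k))) \<le> \<epsilon> * ((b - a) / real (Suc k)) * real N"
    if \<epsilon>: "\<epsilon> > 0" for \<epsilon> :: real
  proof -
    define L where "L = 4 * (real (card T) + 1)\<^sup>2"
    have L: "L > 0" unfolding L_def by (simp add: add_nonneg_pos)
    have "\<forall>\<^sub>F k in sequentially. \<forall>t\<in>T. \<forall>E\<^sub>1\<in>net a b k. \<forall>E\<^sub>2\<in>net a b k. \<forall>\<^sub>F N in along \<N>.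
      window_energy N E\<^sub>1 E\<^sub>2 (2 * ((b - a) / real (Suc k))) t (centered N (K N) t) \<le> \<epsilon> / L * ((b - a) / real (Suc k)) * real N"
      by (rule eventually_ball_finite[OF T(1)], rule ballI, rule en) (use \<epsilon> L in auto)
    then show ?thesis
    proof (rule eventually_mono)
      fix k
      let ?r = "(b - a) / real (Suc k)"
      assume k: "\<forall>t\<in>T. \<forall>E\<^sub>1\<in>net a b k. \<forall>E\<^sub>2\<in>net a b k. \<forall>\<^sub>F N in along \<N>.
        window_energy N E\<^sub>1 E\<^sub>2 (2 * ?r) t (centered N (K N) t) \<le> \<epsilon> / L * ?r * real N"
      have r: "?r > 0" using ab by simp
      have 1: "\<forall>\<^sub>F N in along \<N>. \<forall>t\<in>T. \<forall>E\<^sub>1\<in>net a b k. \<forall>E\<^sub>2\<in>net a b k.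
        window_energy N E\<^sub>1 E\<^sub>2 (2 * ?r) t (centered N (K N) t) \<le> \<epsilon> / L * ?r * real N"
        by (intro eventually_ball_finite ballI T(1) net_finite(1)) (use k in blast)
      have "0 < \<epsilon> * ?r / 4" by (intro divide_pos_pos mult_pos_pos \<epsilon> r) simp
      from coincidences_small[OF T this] 1 eventually_along_mem
      show "\<forall>\<^sub>F N in along \<N>. \<forall>E\<^sub>1\<in>net a b k. \<forall>E\<^sub>2\<in>net a b k.
        dev_sum N (K N) (avg_mat N (\<rho> N) T (K N)) E\<^sub>1 E\<^sub>2 (2 * ?r) \<le> \<epsilon> * ?r * real N"
      proof (eventually_elim, intro ballI)
        fix N E1 E2 assume co: "(\<Sum>t\<in>T. \<Sum>t'\<in>T - {t}. fixed N (inv t' \<otimes> t)) \<le> \<epsilon> * ?r / 4 * real N"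
          and w: "\<forall>t\<in>T. \<forall>E\<^sub>1\<in>net a b k. \<forall>E\<^sub>2\<in>net a b k.
            window_energy N E\<^sub>1 E\<^sub>2 (2 * ?r) t (centered N (K N) t) \<le> \<epsilon> / L * ?r * real N"
          and N: "N \<in> \<N>" and E: "E1 \<in> net a b k" "E2 \<in> net a b k"
        have "(\<Sum>t\<in>T. window_energy N E1 E2 (2 * ?r) t (centered N (K N) t)) \<le> (\<Sum>t\<in>T. \<epsilon> / L * ?r * real N)"
          by (rule sum_mono) (use w E in blast)
        also have "\<dots> = real (card T) * (\<epsilon> / L * ?r * real N)" by simp
        finally have "2 * real (card T) * (\<Sum>t\<in>T. window_energy N E1 E2 (2 * ?r) t (centered N (K N) t)) \<le>
            2 * real (card T) * (real (card T) * (\<epsilon> / L * ?r * real N))" by (rule mult_left_mono) simp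
        also have "\<dots> = (2 * (real (card T))\<^sup>2) * (\<epsilon> / L * ?r * real N)" by (simp add: power2_eq_square)
        also have "\<dots> \<le> (L / 2) * (\<epsilon> / L * ?r * real N)"
        proof (rule mult_right_mono)
          have "(real (card T))\<^sup>2 \<le> (real (card T) + 1)\<^sup>2" by (rule power_mono) auto
          then show "2 * (real (card T))\<^sup>2 \<le> L / 2" unfolding L_def by simp
        next
          show "0 \<le> \<epsilon> / L * ?r * real N"
            using \<epsilon> L ab by (intro mult_nonneg_nonneg divide_nonneg_nonneg) auto
        qed
        also have "\<dots> = \<epsilon> * ?r / 2 * real N"
        proof -
          have "(L / 2) * (\<epsilon> / L * x * y) = \<epsilon> * x / 2 * y" for x y using L by simp
          then show ?thesis .
        qed
        finally have en: "2 * real (card T) * (\<Sum>t\<in>T. window_energy N E1 E2 (2 * ?r) t (centered N (K N) t)) \<le> \<epsilon> * ?r / 2 * real N" .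
        have "dev_sum N (K N) (avg_mat N (\<rho> N) T (K N)) E1 E2 (2 * ?r) \<le> \<epsilon> * ?r / 2 * real N + 2 * (\<epsilon> * ?r / 4 * real N)"
          by (rule order_trans[OF dev_sum_le[OF N T K[OF N] loc[OF N]] add_mono[OF en mult_left_mono[OF co]]]) auto
        also have "\<dots> = \<epsilon> * ?r * real N"
        proof -
          have "x / 2 * y + 2 * (x / 4 * y) = x * y" for x y :: real by simp
          then show ?thesis .
        qed
        finally show "dev_sum N (K N) (avg_mat N (\<rho> N) T (K N)) E1 E2 (2 * ?r) \<le> \<epsilon> * ?r * real N" .
      qed
    qed
  qed
  show ?thesis
    unfolding QE_and_QM_def
    using quantum_ergodic_from_net[OF ab(1) c net] quantum_mixing_from_net[OF ab(1) c net] by blast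
qed

end

section \<open>The two classes of observables\<close>

context spectral_sequence
begin

text \<open>The coefficients of the symbol have \<open>\<ell>\<^sup>1\<close> norm \<open>O(1/\<eta>)\<close> and are \<open>O(1)\<close> each. Outside a fixed ball the
  correlations are small, and the ball contributes \<open>O(1)\<close>, which is \<open>o(1/\<eta>)\<close>.\<close>

lemma uncorrelated_energy:
  assumes F: "finite_generating_set G F" and AC: "cond_AC G p I\<^sub>0" and t: "t \<in> carrier G"
    and u: "\<And>N x. N \<in> \<N> \<Longrightarrow> x \<in> {1..N} \<Longrightarrow> cmod (u N x) \<le> 2"
    and dec: "\<And>\<epsilon>. \<epsilon> > 0 \<Longrightarrow> \<exists>L. \<forall>g\<in>carrier G. L \<le> word_length G F g \<longrightarrow>
      (\<forall>\<^sub>F N in along \<N>. cmod (\<Sum>x\<in>{1..N}. cnj (u N x) * u N (\<rho> N g x)) \<le> \<epsilon> * real N)"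
    and \<epsilon>: "\<epsilon> > 0"
  shows "\<forall>\<^sub>F \<eta> in at_right 0. \<forall>E\<^sub>1\<in>I\<^sub>0. \<forall>E\<^sub>2\<in>I\<^sub>0. \<forall>\<^sub>F N in along \<N>.
    window_energy N E\<^sub>1 E\<^sub>2 \<eta> t (u N) \<le> \<epsilon> * \<eta> * real N"
proof -
  let ?c = "\<lambda>k. t \<otimes> k \<otimes> inv t"
  obtain C where C: "C \<ge> 1" and AC': "\<forall>E\<in>I\<^sub>0. \<forall>\<eta>. 0 < \<eta> \<and> \<eta> \<le> 1 \<longrightarrow>
      inverse C \<le> Re (Im_resolvent G p (Complex E \<eta>) \<one> \<one>) \<and> Re (Im_resolvent G p (Complex E \<eta>) \<one> \<one>) \<le> C"
    using AC unfolding cond_AC_def by blast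
  \<comment> \<open>The long elements contribute \<open>16 \<eta>\<^sup>2 e C / \<eta>\<close>, half of \<open>\<epsilon> \<eta>\<close>; the ball and the summand \<open>N\<close> together \<open>16 \<eta>\<^sup>2 D\<close>.\<close>
  define e where "e = \<epsilon> / (32 * C)"
  have e: "e > 0" unfolding e_def using \<epsilon> C by simp
  obtain L where L: "\<forall>g\<in>carrier G. L \<le> word_length G F g \<longrightarrow>
      (\<forall>\<^sub>F N in along \<N>. cmod (\<Sum>x\<in>{1..N}. cnj (u N x) * u N (\<rho> N g x)) \<le> e * real N)"
    using dec[OF e] by blast
  define Ball where "Ball = {g \<in> carrier G. word_length G F g \<le> L}"
  have Ball: "finite Ball" unfolding Ball_def by (rule finite_word_ball[OF F])
  define D where "D = 4 * (real (card Ball) * C\<^sup>2) + 1"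
  have D: "D > 0" unfolding D_def by (simp add: add_nonneg_pos)
  define r where "r = min 1 (\<epsilon> / (32 * D))"
  have r: "r > 0" unfolding r_def using \<epsilon> D by simp
  show ?thesis
  proof (rule eventually_mono[OF eventually_at_right_real[OF r]], intro ballI)
    fix \<eta> E1 E2 assume "\<eta> \<in> {0<..<r}" and E: "E1 \<in> I\<^sub>0" "E2 \<in> I\<^sub>0"
    then have \<eta>: "0 < \<eta>" "\<eta> \<le> 1" and \<eta>D: "\<eta> \<le> \<epsilon> / (32 * D)" unfolding r_def by auto
    let ?A1 = "\<lambda>k. cmod (Im_resolvent G p (Complex E1 \<eta>) \<one> k)" and ?A2 = "\<lambda>k. cmod (Im_resolvent G p (Complex E2 \<eta>) \<one> k)"
    have ac1: "Re (Im_resolvent G p (Complex E1 \<eta>) \<one> \<one>) \<le> C" and ac2: "Re (Im_resolvent G p (Complex E2 \<eta>) \<one> \<one>) \<le> C"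
      using AC' E \<eta> by blast+
    obtain w where sym: "energy_symbol E1 E2 \<eta> t w" using energy_symbol_exists[OF \<eta>(1) t] by blast
    then have w: "w \<in> GA" and wb: "\<forall>k\<in>carrier G. cmod (w k) \<le> ?A2 (?c k) * ?A1 k"
      and we: "\<forall>\<^sub>F N in along \<N>. \<forall>a. (\<forall>x\<in>{1..N}. cmod (a x) \<le> 2) \<longrightarrow>
          window_energy N E1 E2 \<eta> t a \<le> 16 * \<eta>\<^sup>2 * (cmod (cinner N a (mat_vec N (rep_mat (\<rho> N) w) a)) + real N)"
      unfolding energy_symbol_def resolvent_dominated_def by blast+
    have s: "finite (supp w)" "supp w \<subseteq> carrier G" using GA_D[OF w] by auto
    have total: "(\<Sum>k\<in>supp w. cmod (w k)) \<le> C / \<eta>"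
    proof -
      have "(\<Sum>k\<in>supp w. cmod (w k)) \<le> (\<Sum>k\<in>supp w. ((?A2 (?c k))\<^sup>2 + (?A1 k)\<^sup>2) / 2)"
      proof (rule sum_mono)
        fix k assume "k \<in> supp w"
        then have "cmod (w k) \<le> ?A2 (?c k) * ?A1 k" using wb s by blast
        moreover have "x * y \<le> (x\<^sup>2 + y\<^sup>2) / 2" for x y :: real
          using zero_le_power2[of "x - y"] by (simp add: power2_eq_square algebra_simps)
        ultimately show "cmod (w k) \<le> ((?A2 (?c k))\<^sup>2 + (?A1 k)\<^sup>2) / 2" using order_trans by blast
      qed
      also have "\<dots> = ((\<Sum>k\<in>supp w. (?A2 (?c k))\<^sup>2) + (\<Sum>k\<in>supp w. (?A1 k)\<^sup>2)) / 2"
        by (simp only: sum.distrib sum_divide_distrib[symmetric])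
      also have "(\<Sum>k\<in>supp w. (?A2 (?c k))\<^sup>2) = (\<Sum>g\<in>?c ` supp w. (?A2 g)\<^sup>2)"
        using inj_on_subset[OF conjugation_inj[OF t] s(2)] by (simp add: sum.reindex)
      also have "\<dots> \<le> C / \<eta>" by (rule Im_resolvent_bounds(2)[OF p_GA p_star \<eta>(1) ac2]) (use s t in auto)
      also have "(\<Sum>k\<in>supp w. (?A1 k)\<^sup>2) \<le> C / \<eta>" by (rule Im_resolvent_bounds(2)[OF p_GA p_star \<eta>(1) ac1]) (use s in auto)
      finally show ?thesis by simp
    qed
    have near: "(\<Sum>k\<in>supp w \<inter> Ball. cmod (w k)) \<le> real (card Ball) * C\<^sup>2"
    proof -
      have "cmod (w k) \<le> C\<^sup>2" if "k \<in> supp w" for k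
      proof -
        have k: "k \<in> carrier G" "?c k \<in> carrier G" using that s t by auto
        have "cmod (w k) \<le> ?A2 (?c k) * ?A1 k" by (rule wb[rule_format, OF k(1)])
        also have "\<dots> \<le> C * C"
          using C by (intro mult_mono Im_resolvent_bounds(1)[OF p_GA p_star \<eta>(1) ac2 k(2)] Im_resolvent_bounds(1)[OF p_GA p_star \<eta>(1) ac1 k(1)]) auto
        finally show ?thesis by (simp only: power2_eq_square)
      qed
      then have "(\<Sum>k\<in>supp w \<inter> Ball. cmod (w k)) \<le> (\<Sum>k\<in>supp w \<inter> Ball. C\<^sup>2)" by (intro sum_mono) auto
      also have "\<dots> = real (card (supp w \<inter> Ball)) * C\<^sup>2" by simp
      also have "\<dots> \<le> real (card Ball) * C\<^sup>2"
        using Ball by (intro mult_right_mono) (auto intro: card_mono)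
      finally show ?thesis .
    qed
    have far: "\<forall>\<^sub>F N in along \<N>. \<forall>k\<in>supp w. L \<le> word_length G F k \<longrightarrow>
        cmod (\<Sum>x\<in>{1..N}. cnj (u N x) * u N (\<rho> N k x)) \<le> e * real N"
    proof (rule eventually_ball_finite[OF s(1)], rule ballI)
      fix k assume "k \<in> supp w"
      then have "k \<in> carrier G" using s by blast
      then show "\<forall>\<^sub>F N in along \<N>. L \<le> word_length G F k \<longrightarrow> cmod (\<Sum>x\<in>{1..N}. cnj (u N x) * u N (\<rho> N k x)) \<le> e * real N"
        using L by (cases "L \<le> word_length G F k") auto
    qed
    from we far eventually_along_mem
    show "\<forall>\<^sub>F N in along \<N>. window_energy N E1 E2 \<eta> t (u N) \<le> \<epsilon> * \<eta> * real N"
    proof eventually_elim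
      case (elim N)
      interpret permutation_rep G N "\<rho> N" using rep elim(3) by blast
      let ?S = "\<lambda>k. \<Sum>y\<in>{1..N}. cnj (u N (\<rho> N k y)) * u N y"
      have S: "cmod (?S k) = cmod (\<Sum>x\<in>{1..N}. cnj (u N x) * u N (\<rho> N k x))" for k
      proof -
        have "?S k = cnj (\<Sum>x\<in>{1..N}. cnj (u N x) * u N (\<rho> N k x))" by (simp add: mult.commute)
        then show ?thesis by (simp only: complex_mod_cnj)
      qed
      have S4: "cmod (?S k) \<le> 4 * real N" if k: "k \<in> carrier G" for k
      proof -
        have "cmod (?S k) \<le> (\<Sum>y\<in>{1..N}. 4)"
        proof (rule order_trans[OF norm_sum sum_mono])
          fix y assume y: "y \<in> {1..N}"
          have "cmod (u N (\<rho> N k y)) * cmod (u N y) \<le> 2 * 2"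
            by (intro mult_mono u[OF elim(3)] rep_in[OF k] y) auto
          then show "cmod (cnj (u N (\<rho> N k y)) * u N y) \<le> 4" by (simp add: norm_mult)
        qed
        then show ?thesis by simp
      qed
      have "cmod (cinner N (u N) (mat_vec N (rep_mat (\<rho> N) w) (u N))) \<le> (\<Sum>k\<in>supp w. cmod (w k) * (e * real N) + (if k \<in> Ball then cmod (w k) * (4 * real N) else 0))"
        unfolding cinner_rep[OF w]
      proof (rule order_trans[OF norm_sum sum_mono])
        fix k assume k: "k \<in> supp w"
        then have kc: "k \<in> carrier G" using s by blast
        show "cmod (w k * ?S k) \<le> cmod (w k) * (e * real N) + (if k \<in> Ball then cmod (w k) * (4 * real N) else 0)"
        proof (cases "k \<in> Ball")
          case True
          have "cmod (w k * ?S k) \<le> cmod (w k) * (4 * real N)" unfolding norm_mult by (rule mult_left_mono[OF S4[OF kc]]) simp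
          moreover have "0 \<le> cmod (w k) * (e * real N)" using e by simp
          ultimately show ?thesis unfolding if_P[OF True] by linarith
        next
          case False
          then have "L \<le> word_length G F k" using kc unfolding Ball_def by simp
          then have "cmod (?S k) \<le> e * real N" unfolding S using elim(2) k by blast
          then show ?thesis using False by (simp add: norm_mult mult_left_mono)
        qed
      qed
      also have "\<dots> = (\<Sum>k\<in>supp w. cmod (w k)) * (e * real N) + (\<Sum>k\<in>supp w \<inter> Ball. cmod (w k)) * (4 * real N)"
        unfolding sum.distrib sum_distrib_right sum.inter_restrict[OF s(1), of "\<lambda>k. cmod (w k) * (4 * real N)" Ball] ..
      also have "\<dots> \<le> C / \<eta> * (e * real N) + (real (card Ball) * C\<^sup>2) * (4 * real N)"
        using e by (intro add_mono mult_right_mono total near) auto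
      also have "\<dots> = (\<epsilon> / (32 * \<eta>) + (D - 1)) * real N"
        unfolding e_def D_def using C \<eta> by (simp add: algebra_simps)
      finally have Q: "cmod (cinner N (u N) (mat_vec N (rep_mat (\<rho> N) w) (u N))) \<le> (\<epsilon> / (32 * \<eta>) + (D - 1)) * real N" .
      have "window_energy N E1 E2 \<eta> t (u N) \<le> 16 * \<eta>\<^sup>2 * (cmod (cinner N (u N) (mat_vec N (rep_mat (\<rho> N) w) (u N))) + real N)"
        using elim(1) u[OF elim(3)] by blast
      also have "\<dots> \<le> 16 * \<eta>\<^sup>2 * ((\<epsilon> / (32 * \<eta>) + (D - 1)) * real N + real N)"
        using Q by (intro mult_left_mono) auto
      also have "\<dots> = (16 * \<eta>\<^sup>2 * (\<epsilon> / (32 * \<eta>)) + 16 * \<eta> * (\<eta> * D)) * real N"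
        by (simp add: algebra_simps power2_eq_square)
      also have "\<dots> \<le> (\<epsilon> * \<eta> / 2 + 16 * \<eta> * (\<epsilon> / 32)) * real N"
      proof (intro mult_right_mono add_mono mult_left_mono)
        show "16 * \<eta>\<^sup>2 * (\<epsilon> / (32 * \<eta>)) \<le> \<epsilon> * \<eta> / 2" using \<eta> by (simp add: power2_eq_square)
        show "\<eta> * D \<le> \<epsilon> / 32" using \<eta>D D by (simp add: pos_le_divide_eq)
      qed (use \<eta> in auto)
      also have "\<dots> = \<epsilon> * \<eta> * real N" by (simp add: algebra_simps)
      finally show ?case .
    qed
  qed
qed

lemma decorrelation:
  assumes "asymptotically_uncorrelated G F \<N> \<rho> (\<lambda>N x. K N (\<rho> N t x) x)" and \<epsilon>: "\<epsilon> > 0"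
  shows "\<exists>L. \<forall>g\<in>carrier G. L \<le> word_length G F g \<longrightarrow>
      (\<forall>\<^sub>F N in along \<N>. cmod (\<Sum>x\<in>{1..N}. cnj (centered N (K N) t x) * centered N (K N) t (\<rho> N g x)) \<le> \<epsilon> * real N)"
proof -
  let ?a = "\<lambda>N x. K N (\<rho> N t x) x"
  have "\<forall>\<^sub>F g in inf (filtercomap (word_length G F) at_top) (principal (carrier G)). correlation \<N> \<rho> ?a g < ennreal \<epsilon>"
    using assms(1) unfolding asymptotically_uncorrelated_def by (rule order_tendstoD(2)) (use \<epsilon> in simp)
  then obtain L where L: "\<forall>g. L \<le> word_length G F g \<longrightarrow> g \<in> carrier G \<longrightarrow> correlation \<N> \<rho> ?a g < ennreal \<epsilon>"
    unfolding eventually_inf_principal eventually_filtercomap_at_top_linorder by blast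
  have "\<forall>\<^sub>F N in along \<N>. cmod (\<Sum>x\<in>{1..N}. cnj (centered N (K N) t x) * centered N (K N) t (\<rho> N g x)) \<le> \<epsilon> * real N"
    if g: "g \<in> carrier G" "L \<le> word_length G F g" for g
  proof -
    have "correlation \<N> \<rho> ?a g < ennreal \<epsilon>" using L g by blast
    then have "\<forall>\<^sub>F N in along \<N>. ennreal (cmod
       ((\<Sum>x\<in>{1..N}. cnj (?a N x - vec_mean N (?a N)) * (?a N (\<rho> N g x) - vec_mean N (?a N))) / of_nat N)) < ennreal \<epsilon>"
      unfolding correlation_def by (rule Limsup_lessD)
    then show ?thesis using eventually_along_mem
    proof eventually_elim
      case (elim N)
      have N: "real N > 0" using elim(2) N_pos by (metis gr0I of_nat_0_less_iff)
      have "cmod ((\<Sum>x\<in>{1..N}. cnj (centered N (K N) t x) * centered N (K N) t (\<rho> N g x)) / of_nat N) < \<epsilon>"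
        using elim(1) \<epsilon> unfolding centered_def by (simp add: ennreal_less_iff)
      then show ?case using N by (simp add: norm_divide pos_divide_less_eq)
    qed
  qed
  then show ?thesis by blast
qed

lemma net_radius_at_right: "a < b \<Longrightarrow> filterlim (\<lambda>k. 2 * ((b - a) / real (Suc k))) (at_right (0::real)) sequentially"
proof -
  assume ab: "a < b"
  have "(\<lambda>k. 2 * ((b - a) * inverse (real (Suc k)))) \<longlonglongrightarrow> 2 * ((b - a) * 0)"
    by (intro tendsto_mult tendsto_const LIMSEQ_inverse_real_of_nat)
  then have "(\<lambda>k. 2 * ((b - a) / real (Suc k))) \<longlonglongrightarrow> 0"
    by (simp only: divide_inverse mult_zero_right)
  then show ?thesis unfolding filterlim_at using ab by (auto intro!: always_eventually)
qed

lemma uncorrelated_case: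
  assumes F: "finite_generating_set G F" and AC: "cond_AC G p I\<^sub>0" and ab: "a < b" "{a..b} \<subseteq> I\<^sub>0"
    and T: "finite T" "T \<subseteq> carrier G"
    and K: "\<And>N x y. N \<in> \<N> \<Longrightarrow> x \<in> {1..N} \<Longrightarrow> y \<in> {1..N} \<Longrightarrow> cmod (K N x y) \<le> 1"
    and loc: "\<And>N. N \<in> \<N> \<Longrightarrow> T_local N (\<rho> N) T (K N)"
    and unc: "asymptotically_uncorrelated_mat G F \<N> \<rho> T K"
  shows "QE_and_QM \<N> \<rho> T \<phi> ev {a..b} K"
proof (rule QE_and_QM_from_energies[OF AC ab T K loc])
  fix \<epsilon> :: real and t assume \<epsilon>: "\<epsilon> > 0" and t: "t \<in> T"
  have tc: "t \<in> carrier G" using t T by blast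
  have unc': "asymptotically_uncorrelated G F \<N> \<rho> (\<lambda>N x. K N (\<rho> N t x) x)"
    using unc t unfolding asymptotically_uncorrelated_mat_def by blast
  have "\<forall>\<^sub>F \<eta> in at_right 0. \<forall>E\<^sub>1\<in>I\<^sub>0. \<forall>E\<^sub>2\<in>I\<^sub>0. \<forall>\<^sub>F N in along \<N>.
    window_energy N E\<^sub>1 E\<^sub>2 \<eta> t (centered N (K N) t) \<le> \<epsilon> / 2 * \<eta> * real N"
    by (rule uncorrelated_energy[OF F AC tc centered_bound[OF _ tc K] decorrelation[where K = K and t = t and F = F, OF unc']]) (use \<epsilon> in auto)
  from eventually_compose_filterlim[OF this net_radius_at_right[OF ab(1)]]
  show "\<forall>\<^sub>F k in sequentially. \<forall>E\<^sub>1\<in>net a b k. \<forall>E\<^sub>2\<in>net a b k. \<forall>\<^sub>F N in along \<N>.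
      window_energy N E\<^sub>1 E\<^sub>2 (2 * ((b - a) / real (Suc k))) t (centered N (K N) t) \<le> \<epsilon> * ((b - a) / real (Suc k)) * real N"
  proof (rule eventually_mono, intro ballI)
    fix k E1 E2
    let ?r = "(b - a) / real (Suc k)"
    assume en: "\<forall>E\<^sub>1\<in>I\<^sub>0. \<forall>E\<^sub>2\<in>I\<^sub>0. \<forall>\<^sub>F N in along \<N>.
        window_energy N E\<^sub>1 E\<^sub>2 (2 * ?r) t (centered N (K N) t) \<le> \<epsilon> / 2 * (2 * ?r) * real N"
      and E: "E1 \<in> net a b k" "E2 \<in> net a b k"
    have "E1 \<in> I\<^sub>0" "E2 \<in> I\<^sub>0" using E net_subset[of a b k] ab by auto
    then have "\<forall>\<^sub>F N in along \<N>. window_energy N E1 E2 (2 * ?r) t (centered N (K N) t) \<le> \<epsilon> / 2 * (2 * ?r) * real N"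
      using en by blast
    moreover have "\<epsilon> / 2 * (2 * ?r) = \<epsilon> * ?r"
    proof -
      have "\<epsilon> / 2 * (2 * x) = \<epsilon> * x" for x by simp
      then show ?thesis .
    qed
    ultimately show "\<forall>\<^sub>F N in along \<N>. window_energy N E1 E2 (2 * ?r) t (centered N (K N) t) \<le> \<epsilon> * ?r * real N"
      by (simp only:)
  qed
qed

text \<open>The scales are the meshes of the nets, so only countably many symbols are involved, and one sequence
  of exceptional spaces serves for all of them. It contains the constant functions, so orthogonality
  makes the averages vanish.\<close>

lemma orthogonal_case:
  assumes F: "finite_generating_set G F" and AC: "cond_AC G p I\<^sub>0" and R4: "cond_R4 G F p I\<^sub>0"
    and ab: "a < b" "{a..b} \<subseteq> I\<^sub>0" and T: "finite T" "T \<subseteq> carrier G"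
  shows "\<exists>H. (\<forall>N. is_subspace N (H N)) \<and> (\<lambda>N. real (vec_dim (H N))) \<in> o[along \<N>](\<lambda>N. real N) \<and>
    (\<forall>K. (\<forall>N\<in>\<N>. (\<forall>x\<in>{1..N}. \<forall>y\<in>{1..N}. cmod (K N x y) \<le> 1) \<and> T_local N (\<rho> N) T (K N)
            \<and> (\<forall>t\<in>T. \<forall>h\<in>H N. cinner N h (\<lambda>x. K N (\<rho> N t x) x) = 0))
      \<longrightarrow> QE_and_QM \<N> \<rho> T \<phi> ev {a..b} K)"
proof -
  define r where "r k = (b - a) / real (Suc k)" for k
  have r: "r k > 0" for k unfolding r_def using ab by simp
  have Wf: "energy_symbol E1 E2 \<eta> t (SOME w. energy_symbol E1 E2 \<eta> t w)" if "\<eta> > 0" "t \<in> carrier G" for E1 E2 \<eta> t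
    by (rule someI_ex[OF energy_symbol_exists[OF that]])
  \<comment> \<open>The additional index keeps the set non-empty if \<open>T\<close> is empty.\<close>
  define Ix where "Ix = insert (0, a, a, \<one>) (\<Union>k. {k} \<times> net a b k \<times> net a b k \<times> T)"
  have "countable ({k} \<times> net a b k \<times> net a b k \<times> T)" for k
    by (intro countable_finite finite_cartesian_product net_finite(1) T(1)) simp
  then have Ix: "countable Ix" "Ix \<noteq> {}"
    unfolding Ix_def by (intro countable_insert countable_UN countableI_type, simp, blast)
  define w where "w = (\<lambda>i. case from_nat_into Ix i of (k, E1, E2, t) \<Rightarrow> SOME w. energy_symbol E1 E2 (2 * r k) t w)"
  have w: "w i \<in> GA" "w i = star G (w i)" for i
  proof -
    obtain k E1 E2 t where x: "from_nat_into Ix i = (k, E1, E2, t)" by (metis prod_cases4)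
    have "(k, E1, E2, t) \<in> Ix" using from_nat_into[OF Ix(2), of i] unfolding x .
    then have "t \<in> carrier G" unfolding Ix_def using T by auto
    moreover have "2 * r k > 0" using r[of k] by simp
    ultimately have "energy_symbol E1 E2 (2 * r k) t (w i)" unfolding w_def x using Wf by simp
    then show "w i \<in> GA" "w i = star G (w i)" unfolding energy_symbol_def by blast+
  qed
  \<comment> \<open>The summand 1 makes the bound positive; it is negligible against 1/\<open>\<eta>\<close>.\<close>
  define \<kappa> where "\<kappa> = (\<lambda>i. ell2_opnorm G (left_regular G (w i)) + 1)"
  have \<kappa>: "\<kappa> i > 0" for i unfolding \<kappa>_def using opnorm_nonneg[OF w(1)] by (simp add: add_nonneg_pos)
  have bd: "\<parallel>w i \<star> u\<parallel> \<le> \<kappa> i * \<parallel>u\<parallel>" if "u \<in> ell2 G" for i u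
    unfolding \<kappa>_def distrib_right using opnorm_bound[OF w(1) that, of i] ell2_norm_nonneg[of u] by linarith
  have "\<exists>H. (\<forall>N. is_subspace N (H N)) \<and> (\<lambda>N. real (vec_dim (H N))) \<in> o[along \<N>](\<lambda>N. real N)
    \<and> (\<forall>N. (\<lambda>x. if x \<in> {1..N} then 1 else 0) \<in> H N)
    \<and> (\<forall>i. \<forall>\<^sub>F N in along \<N>. \<forall>a. (\<forall>h\<in>H N. cinner N h a = 0) \<longrightarrow>
         vec_sq N (mat_vec N (rep_mat (\<rho> N) (w i)) a) \<le> (2 * \<kappa> i)\<^sup>2 * vec_sq N a)"
    by (rule exceptional_subspaces[of w \<kappa>]) (fact w \<kappa> | rule bd, assumption)+
  then obtain H where H: "\<forall>N. is_subspace N (H N)" "(\<lambda>N. real (vec_dim (H N))) \<in> o[along \<N>](\<lambda>N. real N)"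
    and one: "\<forall>N. (\<lambda>x. if x \<in> {1..N} then 1 else 0) \<in> H N"
    and Hw: "\<forall>i. \<forall>\<^sub>F N in along \<N>. \<forall>a. (\<forall>h\<in>H N. cinner N h a = 0) \<longrightarrow>
         vec_sq N (mat_vec N (rep_mat (\<rho> N) (w i)) a) \<le> (2 * \<kappa> i)\<^sup>2 * vec_sq N a"
    by blast
  have "QE_and_QM \<N> \<rho> T \<phi> ev {a..b} K"
    if K: "\<forall>N\<in>\<N>. (\<forall>x\<in>{1..N}. \<forall>y\<in>{1..N}. cmod (K N x y) \<le> 1) \<and> T_local N (\<rho> N) T (K N)
            \<and> (\<forall>t\<in>T. \<forall>h\<in>H N. cinner N h (\<lambda>x. K N (\<rho> N t x) x) = 0)" for K
  proof (rule QE_and_QM_from_energies[OF AC ab T])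
    show "cmod (K N x y) \<le> 1" if "N \<in> \<N>" "x \<in> {1..N}" "y \<in> {1..N}" for N x y using K that by blast
    then have K1: "cmod (K N x y) \<le> 1" if "N \<in> \<N>" "x \<in> {1..N}" "y \<in> {1..N}" for N x y using that by blast
    show "T_local N (\<rho> N) T (K N)" if "N \<in> \<N>" for N using K that by blast
    have orth: "cinner N h (\<lambda>x. K N (\<rho> N t x) x) = 0" if "N \<in> \<N>" "t \<in> T" "h \<in> H N" for N t h using K that by blast
    fix \<epsilon> :: real and t assume \<epsilon>: "\<epsilon> > 0" and t: "t \<in> T"
    have tc: "t \<in> carrier G" using t T by blast
    have cent: "centered N (K N) t = (\<lambda>x. K N (\<rho> N t x) x)" if N: "N \<in> \<N>" for N
    proof -
      have "(\<Sum>x\<in>{1..N}. K N (\<rho> N t x) x) = cinner N (\<lambda>x. if x \<in> {1..N} then 1 else 0) (\<lambda>x. K N (\<rho> N t x) x)"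
        unfolding cinner_def by (intro sum.cong) auto
      also have "\<dots> = 0" by (rule orth[OF N t]) (use one in blast)
      finally show ?thesis unfolding centered_def vec_mean_def by simp
    qed
    \<comment> \<open>With \<open>\<kappa> \<le> \<epsilon> / (512 \<eta>) + 1\<close> the energy is at most \<open>16 \<eta> (\<epsilon> / 64 + 9 \<eta>) N\<close>, and \<open>\<eta>\<close> is twice the mesh.\<close>
    have \<epsilon>': "\<epsilon> / 512 > 0" using \<epsilon> by simp
    have h: "\<epsilon> / 576 > 0" using \<epsilon> by simp
    have "\<forall>\<^sub>F \<eta> in at_right 0. \<eta> \<in> {0<..<\<epsilon> / 576} \<and> (\<forall>E\<^sub>1\<in>I\<^sub>0. \<forall>E\<^sub>2\<in>I\<^sub>0. \<forall>w\<in>GA. resolvent_dominated p E\<^sub>1 E\<^sub>2 \<eta> t w \<longrightarrow>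
      ell2_opnorm G (left_regular G w) \<le> \<epsilon> / 512 / \<eta>)"
      by (intro eventually_conj eventually_at_right_real[OF h] opnorm_small[OF p_GA p_star F AC R4 tc \<epsilon>'])
    from eventually_compose_filterlim[OF this net_radius_at_right[OF ab(1)]]
    show "\<forall>\<^sub>F k in sequentially. \<forall>E\<^sub>1\<in>net a b k. \<forall>E\<^sub>2\<in>net a b k. \<forall>\<^sub>F N in along \<N>.
      window_energy N E\<^sub>1 E\<^sub>2 (2 * ((b - a) / real (Suc k))) t (centered N (K N) t) \<le> \<epsilon> * ((b - a) / real (Suc k)) * real N"
    proof (rule eventually_mono, fold r_def, intro ballI)
      fix k E1 E2
      let ?\<eta> = "2 * r k"
      assume small: "?\<eta> \<in> {0<..<\<epsilon> / 576} \<and> (\<forall>E\<^sub>1\<in>I\<^sub>0. \<forall>E\<^sub>2\<in>I\<^sub>0. \<forall>w\<in>GA. resolvent_dominated p E\<^sub>1 E\<^sub>2 ?\<eta> t w \<longrightarrow>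
        ell2_opnorm G (left_regular G w) \<le> \<epsilon> / 512 / ?\<eta>)"
        and E: "E1 \<in> net a b k" "E2 \<in> net a b k"
      have EI: "E1 \<in> I\<^sub>0" "E2 \<in> I\<^sub>0" using E net_subset[of a b k] ab by auto
      have \<eta>: "?\<eta> > 0" "?\<eta> \<le> \<epsilon> / 576" using small by auto
      have mem: "(k, E1, E2, t) \<in> Ix" unfolding Ix_def using E t by blast
      define i where "i = to_nat_on Ix (k, E1, E2, t)"
      have i: "from_nat_into Ix i = (k, E1, E2, t)" unfolding i_def by (rule from_nat_into_to_nat_on[OF Ix(1) mem])
      have Pw: "energy_symbol E1 E2 ?\<eta> t (w i)" unfolding w_def i using Wf[OF \<eta>(1) tc] by simp
      have "ell2_opnorm G (left_regular G (w i)) \<le> \<epsilon> / 512 / ?\<eta>"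
        using small EI Pw unfolding energy_symbol_def by blast
      then have \<kappa>i: "\<kappa> i \<le> \<epsilon> / 512 / ?\<eta> + 1" unfolding \<kappa>_def by simp
      have en: "\<forall>\<^sub>F N in along \<N>. \<forall>a. (\<forall>x\<in>{1..N}. cmod (a x) \<le> 2) \<longrightarrow>
          window_energy N E1 E2 ?\<eta> t a \<le> 16 * ?\<eta>\<^sup>2 * (cmod (cinner N a (mat_vec N (rep_mat (\<rho> N) (w i)) a)) + real N)"
        using Pw unfolding energy_symbol_def by blast
      from en spec[OF Hw, of i] eventually_along_mem
      show "\<forall>\<^sub>F N in along \<N>. window_energy N E1 E2 ?\<eta> t (centered N (K N) t) \<le> \<epsilon> * r k * real N"
      proof eventually_elim
        case (elim N)
        let ?u = "centered N (K N) t" and ?M = "mat_vec N (rep_mat (\<rho> N) (w i))"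
        have u2: "\<forall>x\<in>{1..N}. cmod (?u x) \<le> 2"
          by (rule ballI, rule centered_bound[OF elim(3) tc], erule (1) K1[OF elim(3)])
        have "vec_sq N ?u \<le> (\<Sum>x\<in>{1..N}. 2\<^sup>2)"
          unfolding vec_sq_def by (intro sum_mono power_mono) (use u2 in auto)
        then have v4: "vec_sq N ?u \<le> 4 * real N" by simp
        have "vec_sq N (?M ?u) \<le> (2 * \<kappa> i)\<^sup>2 * vec_sq N ?u"
          using elim(2) orth[OF elim(3) t] unfolding cent[OF elim(3)] by blast
        then have "(cmod (cinner N ?u (?M ?u)))\<^sup>2 \<le> vec_sq N ?u * ((2 * \<kappa> i)\<^sup>2 * vec_sq N ?u)"
          using Cauchy_Schwarz_cinner[of N ?u "?M ?u"] mult_left_mono[OF _ vec_sq_nonneg[of N ?u]] order_trans by blast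
        also have "\<dots> = (2 * \<kappa> i * vec_sq N ?u)\<^sup>2" by (simp add: power2_eq_square)
        finally have "cmod (cinner N ?u (?M ?u)) \<le> 2 * \<kappa> i * vec_sq N ?u"
          by (rule power2_le_imp_le) (use \<kappa>[of i] in simp)
        also have "\<dots> \<le> 2 * \<kappa> i * (4 * real N)" using v4 \<kappa>[of i] by (intro mult_left_mono) auto
        also have "\<dots> \<le> 2 * (\<epsilon> / 512 / ?\<eta> + 1) * (4 * real N)" using \<kappa>i by (intro mult_right_mono mult_left_mono) auto
        finally have q: "cmod (cinner N ?u (?M ?u)) \<le> 2 * (\<epsilon> / 512 / ?\<eta> + 1) * (4 * real N)" .
        have "window_energy N E1 E2 ?\<eta> t ?u \<le> 16 * ?\<eta>\<^sup>2 * (cmod (cinner N ?u (?M ?u)) + real N)"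
          using elim(1) u2 by blast
        also have "\<dots> \<le> 16 * ?\<eta>\<^sup>2 * (2 * (\<epsilon> / 512 / ?\<eta> + 1) * (4 * real N) + real N)"
          using q by (intro mult_left_mono) auto
        also have "\<dots> = (16 * ?\<eta> * (\<epsilon> / 64 + 9 * ?\<eta>)) * real N"
          using \<eta>(1) by (simp add: field_simps power2_eq_square)
        also have "\<dots> \<le> (16 * ?\<eta> * (\<epsilon> / 64 + \<epsilon> / 64)) * real N"
          using \<eta> by (intro mult_right_mono mult_left_mono) auto
        also have "\<dots> = \<epsilon> * r k * real N" by simp
        finally show ?case .
      qed
    qed
  qed
  then show ?thesis using H by blast
qed

end

section \<open>Free products\<close>

lemma (in group) real_symmetric_element:
  fixes c d :: real
  assumes A: "finite A" "A \<subseteq> carrier G" "\<And>g. g \<in> A \<Longrightarrow> inv g \<in> A"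
    and B: "finite B" "B \<subseteq> carrier G" "\<And>g. g \<in> B \<Longrightarrow> inv g \<in> B"
  defines "q \<equiv> \<lambda>g. complex_of_real c * indicator A g + complex_of_real d * indicator B g"
  shows "q \<in> GA" "q = star G q"
proof -
  show "q \<in> GA" by (rule GA_I[of "A \<union> B"]) (use A B in \<open>auto simp: q_def\<close>)
  have iff: "inv g \<in> A \<longleftrightarrow> g \<in> A" "inv g \<in> B \<longleftrightarrow> g \<in> B" if "g \<in> carrier G" for g
    using A(3) B(3) that by (metis inv_inv)+
  show "q = star G q"
  proof
    fix g
    show "q g = star G q g"
      using A(2) B(2) iff[of g] by (auto simp: q_def star_def indicator_def)
  qed
qed

lemma factor_embedding_symmetric:
  assumes grp: "\<And>i. i \<in> I \<Longrightarrow> group (G i)" and i: "i \<in> I" and fin: "finite (carrier (G i))"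
  defines "A \<equiv> factor_embedding G i ` (carrier (G i) - {\<one>\<^bsub>G i\<^esub>})"
  shows "finite A" "A \<subseteq> carrier (free_product I G)" "\<And>g. g \<in> A \<Longrightarrow> inv\<^bsub>free_product I G\<^esub> g \<in> A"
proof -
  interpret Gi: group "G i" using grp i by blast
  interpret fp: group "free_product I G" by (rule free_product_group) (rule grp)
  have hom: "factor_embedding G i \<in> hom (G i) (free_product I G)"
    by (rule factor_embedding_hom) (use grp i in auto)
  interpret h: group_hom "G i" "free_product I G" "factor_embedding G i"
    by unfold_locales (rule hom)
  show "finite A" unfolding A_def using fin by simp
  show "A \<subseteq> carrier (free_product I G)" unfolding A_def using h.hom_closed by blast
  fix g assume "g \<in> A"
  then obtain s where s: "s \<in> carrier (G i)" "s \<noteq> \<one>\<^bsub>G i\<^esub>" "g = factor_embedding G i s" unfolding A_def by blast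
  have "inv\<^bsub>G i\<^esub> s \<in> carrier (G i) - {\<one>\<^bsub>G i\<^esub>}" using s by simp
  moreover have "inv\<^bsub>free_product I G\<^esub> g = factor_embedding G i (inv\<^bsub>G i\<^esub> s)" using s by simp
  ultimately show "inv\<^bsub>free_product I G\<^esub> g \<in> A" unfolding A_def by blast
qed

lemma free_product_settings:
  assumes "setting_a m G S p \<or> setting_b m G S p"
  shows "group (free_product {1..m} G)" "p \<in> group_algebra (free_product {1..m} G)"
    "p = star (free_product {1..m} G) p"
proof -
  have grp: "group (G i)" if "i \<in> {1..m}" for i
    using assms that by (auto simp: setting_a_def setting_b_def)
  show g: "group (free_product {1..m} G)" by (rule free_product_group) (rule grp)
  interpret group "free_product {1..m} G" by (rule g)
  have "p \<in> group_algebra (free_product {1..m} G) \<and> p = star (free_product {1..m} G) p"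
  proof (cases "setting_a m G S p")
    case True
    then show ?thesis unfolding setting_a_def by blast
  next
    case False
    then have b: "setting_b m G S p" using assms by blast
    then have m: "m = 2" and fin: "\<And>i. i \<in> {1..2} \<Longrightarrow> finite (carrier (G i)) \<and> S i = carrier (G i) - {\<one>\<^bsub>G i\<^esub>}"
      unfolding setting_b_def by blast+
    obtain c d :: real where p: "p = (\<lambda>g. complex_of_real c * indicator (factor_embedding G 1 ` S 1) g
        + complex_of_real d * indicator (factor_embedding G 2 ` S 2) g)"
      using b unfolding setting_b_def by blast
    have mem: "1 \<in> {1..m}" "2 \<in> {1..m}" using m by auto
    have S: "S 1 = carrier (G 1) - {\<one>\<^bsub>G 1\<^esub>}" "S 2 = carrier (G 2) - {\<one>\<^bsub>G 2\<^esub>}"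
      and f: "finite (carrier (G 1))" "finite (carrier (G 2))" using fin[of 1] fin[of 2] by auto
    note A = factor_embedding_symmetric[where G = G and I = "{1..m}" and i = 1, OF grp mem(1) f(1)]
      and B = factor_embedding_symmetric[where G = G and I = "{1..m}" and i = 2, OF grp mem(2) f(2)]
    show ?thesis unfolding p S using real_symmetric_element[OF A B] by blast
  qed
  then show "p \<in> group_algebra (free_product {1..m} G)" "p = star (free_product {1..m} G) p" by blast+
qed

lemma mat_norm_1_inf_entry:
  assumes "mat_norm_1_inf N K \<le> 1" "x \<in> {1..N}" "y \<in> {1..N}"
  shows "cmod (K x y) \<le> 1"
proof -
  have "{cmod (K x y) | x y. x \<in> {1..N} \<and> y \<in> {1..N}} = (\<lambda>(x, y). cmod (K x y)) ` ({1..N} \<times> {1..N})" by force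
  then have "finite {cmod (K x y) | x y. x \<in> {1..N} \<and> y \<in> {1..N}}" by simp
  then have "cmod (K x y) \<le> mat_norm_1_inf N K" unfolding mat_norm_1_inf_def by (rule Max_ge) (use assms in blast)
  then show ?thesis using assms(1) by linarith
qed

theorem theorem6p2:
  fixes m :: nat
    and G :: "nat \<Rightarrow> 'a monoid"
    and S :: "nat \<Rightarrow> 'a set"
    and \<Gamma> :: "(nat \<times> 'a) list monoid"
    and p :: "(nat \<times> 'a) list \<Rightarrow> complex"
    and F T :: "(nat \<times> 'a) list set"
    and a\<^sub>0 b\<^sub>0 a b :: real
    and \<N> :: "nat set"
    and \<rho> :: "nat \<Rightarrow> (nat \<times> 'a) list \<Rightarrow> nat \<Rightarrow> nat"
    and \<phi> :: "nat \<Rightarrow> nat \<Rightarrow> nat \<Rightarrow> complex"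
    and ev :: "nat \<Rightarrow> nat \<Rightarrow> real"
  assumes "setting_a m G S p \<or> setting_b m G S p"
    and "\<Gamma> = free_product {1..m} G"
    and "finite_generating_set \<Gamma> F"
    and "a\<^sub>0 < b\<^sub>0"
    and "cond_AC \<Gamma> p {a\<^sub>0..b\<^sub>0}"
    and "cond_R4 \<Gamma> F p {a\<^sub>0..b\<^sub>0}"
    and "infinite \<N>" and "0 \<notin> \<N>"
    and "\<And>N. N \<in> \<N> \<Longrightarrow> \<rho> N \<in> hom \<Gamma> (sym_group N)"
    and "converges_in_distribution \<Gamma> \<N> \<rho>"
    and "a < b" and "{a..b} \<subseteq> interior {a\<^sub>0..b\<^sub>0}"
    and "\<And>N. N \<in> \<N> \<Longrightarrow> orthonormal_eigenbasis N (rep_mat (\<rho> N) p) (\<phi> N) (ev N)"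
    and "finite T" and "T \<subseteq> carrier \<Gamma>"
  shows
    "(\<forall>K. (\<forall>N\<in>\<N>. T_local N (\<rho> N) T (K N) \<and> mat_norm_1_inf N (K N) \<le> 1) \<and>
          asymptotically_uncorrelated_mat \<Gamma> F \<N> \<rho> T K
        \<longrightarrow> QE_and_QM \<N> \<rho> T \<phi> ev {a..b} K)
     \<and>
     (\<exists>H. (\<forall>N\<in>\<N>. is_subspace N (H N)) \<and>
          (\<lambda>N. real (vec_dim (H N))) \<in> o[along \<N>](\<lambda>N. real N) \<and>
          (\<forall>K. (\<forall>N\<in>\<N>. T_local N (\<rho> N) T (K N) \<and> mat_norm_1_inf N (K N) \<le> 1) \<and>
               (\<forall>N\<in>\<N>. \<forall>t\<in>T. \<forall>h\<in>H N. cinner N h (\<lambda>x. K N (\<rho> N t x) x) = 0)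
             \<longrightarrow> QE_and_QM \<N> \<rho> T \<phi> ev {a..b} K))"
proof -
  have setting: "group \<Gamma>" "p \<in> group_algebra \<Gamma>" "p = star \<Gamma> p"
    using free_product_settings[OF assms(1)] unfolding assms(2)[symmetric] by auto
  interpret group \<Gamma> by (rule setting(1))
  interpret spectral_sequence \<Gamma> p \<N> \<rho> \<phi> ev
    by unfold_locales (rule setting(2,3) assms(8) assms(9) assms(10) assms(13); assumption?)+
  have sub: "{a..b} \<subseteq> {a\<^sub>0..b\<^sub>0}" using assms(12) interior_subset by blast
  show ?thesis
  proof (intro conjI allI impI)
    fix K :: "nat \<Rightarrow> nat \<Rightarrow> nat \<Rightarrow> complex"
    assume K: "(\<forall>N\<in>\<N>. T_local N (\<rho> N) T (K N) \<and> mat_norm_1_inf N (K N) \<le> 1) \<and> asymptotically_uncorrelated_mat \<Gamma> F \<N> \<rho> T K"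
    show "QE_and_QM \<N> \<rho> T \<phi> ev {a..b} K"
    proof (rule uncorrelated_case[OF assms(3,5,11) sub assms(14,15)])
      show "cmod (K N x y) \<le> 1" if "N \<in> \<N>" "x \<in> {1..N}" "y \<in> {1..N}" for N x y
        using mat_norm_1_inf_entry[OF _ that(2,3)] K that(1) by blast
    qed (use K in auto)
  next
    obtain H where H: "\<forall>N. is_subspace N (H N)" "(\<lambda>N. real (vec_dim (H N))) \<in> o[along \<N>](\<lambda>N. real N)"
      and HK: "\<forall>K. (\<forall>N\<in>\<N>. (\<forall>x\<in>{1..N}. \<forall>y\<in>{1..N}. cmod (K N x y) \<le> 1) \<and> T_local N (\<rho> N) T (K N)
            \<and> (\<forall>t\<in>T. \<forall>h\<in>H N. cinner N h (\<lambda>x. K N (\<rho> N t x) x) = 0))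
          \<longrightarrow> QE_and_QM \<N> \<rho> T \<phi> ev {a..b} K"
      using orthogonal_case[OF assms(3,5,6,11) sub assms(14,15)] by blast
    have "QE_and_QM \<N> \<rho> T \<phi> ev {a..b} K"
      if K: "(\<forall>N\<in>\<N>. T_local N (\<rho> N) T (K N) \<and> mat_norm_1_inf N (K N) \<le> 1) \<and>
               (\<forall>N\<in>\<N>. \<forall>t\<in>T. \<forall>h\<in>H N. cinner N h (\<lambda>x. K N (\<rho> N t x) x) = 0)" for K
      by (rule HK[rule_format]) (use K mat_norm_1_inf_entry in blast)
    then show "\<exists>H. (\<forall>N\<in>\<N>. is_subspace N (H N)) \<and>
          (\<lambda>N. real (vec_dim (H N))) \<in> o[along \<N>](\<lambda>N. real N) \<and>
          (\<forall>K. (\<forall>N\<in>\<N>. T_local N (\<rho> N) T (K N) \<and> mat_norm_1_inf N (K N) \<le> 1) \<and>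
               (\<forall>N\<in>\<N>. \<forall>t\<in>T. \<forall>h\<in>H N. cinner N h (\<lambda>x. K N (\<rho> N t x) x) = 0)
             \<longrightarrow> QE_and_QM \<N> \<rho> T \<phi> ev {a..b} K)"
      using H by (intro exI[of _ H]) blast
  qed
qed

end
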